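(* For an open and dense set of $C^\infty$ vector fields on $M$ that satisfy (H1)–(H4) (listed in the context) and one of the conditions (Case 3) $a_{21}>0,\ k>0,\ b_{22}<0$ and $\delta_P\delta_2>1$, (Case 4) $a_{21}>0,\ k<0,\ b_{22}>0$ and $\delta<1$, (Case 5) $a_{21}>0,\ k>0,\ b_{22}>0$ and $\delta>1$, there exists a sequence of compact sets within the cross section $R_P^{\rm in}$ on which the first return map $R$ to $R_P^{\rm in}$ is uniformly hyperbolic and conjugate to a full shift over a finite number of symbols. This sequence of compact sets accumulates on the cycle $\Gamma$.
   Context: **Setting.** $M$ is a compact boundaryless three-dimensional manifold; $\mathcal X^\infty(M)$ is the space of $C^\infty$ vector fields on $M$ with the $C^\infty$ Whitney topology. $\dot x=f(x,\alpha,\beta)$ is a two-parameter family in $\mathcal X^\infty(M)$ with flow $\varphi(t,\cdot)$, and $f_0=f(\cdot,0,0)$. Hypotheses on $f_0$: (H1) $E$ is a hyperbolic equilibrium whose linearization has real eigenvalues $\mu,-\lambda_1,-\lambda_2$ with $-\lambda_2<-\lambda_1<0<\mu$ and $\lambda_1<\mu$. (H2) $P$ is a hyperbolic periodic solution with positive Floquet multipliers $0<e^{-\eta_c}<1<e^{\eta_e}$, $\eta_e,\eta_c>0$, and $(-\eta_c,\eta_e)\in\mathcal D$, where $\mathcal D\subset\mathbb R^2$ is the residual set (Sternberg-type non-resonance conditions, due to Takens) for which the first return map to a section at $P$ is $C^2$-conjugate to its linear part. (H3) There is a heteroclinic connection $[P\to E]_t\subset W^u(P)\cap W^s(E)$ given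 through a quadratic tangency. (H4) There is a heteroclinic connection $[E\to P]\subset W^u(E)\cap W^s(P)$. The cycle $\Gamma$ is $E\cup P\cup[E\to P]\cup[P\to E]_t$. **Local maps.** Near $E$ there are $C^2$ local coordinates $(x,y,z)$ on a cubic neighbourhood $V_E$ in which the linear part is $\mathrm{diag}(-\lambda_1,-\lambda_2,\mu)$ and $W^s_{\rm loc}(E)=\{z=0\}$; $[E\to P]$ leaves $E$ in the positive $z$-direction, $[P\to E]_t$ reaches $E$ along the $x$-axis. Sections: $\Sigma_E^{\rm in}\subset\{x=1\}$ with coordinates $(y,z)$, and $\Sigma_E^{\rm out}\subset\{z=1\}$ with coordinates $(x,y)$; $\Sigma_E^{{\rm in}(\pm)}=\{\pm z>0\}$. Up to higher order terms, $\Pi_E:\Sigma_E^{{\rm in}(+)}\to\Sigma_E^{\rm out}$ is $\Pi_E(y,z)=(z^{\delta_1},yz^{\delta_2})$, $\delta_1=\lambda_1/\mu<1$, $\delta_2=\lambda_2/\mu$. Near $P$ (period normalized to $2\pi$) there are coordinates $(\psi,\rho,z)$, $\psi\in\mathbb R\pmod{2\pi}$, $|\rho|,|z|\le1$, on a neighbourhood $V_P$, in which the flow is $C^2$-orbitally equivalent to $\dot\psi=1,\ \dot\rho=-\eta_c\rho,\ \dot z=\eta_e z$. Sections: $\Sigma_P^{\rm in}=\{\rho=1\}$ with coordinates $(\psi,z)$, $\Sigma_P^{\rm out}=\{z=1\}$ with coordinates $(\psi,\rho)$; $\Sigma_P^{{\rm in}(\pm)}=\{\pm z>0\}$; $W^s_{\rm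 loc}(P)=\{z=0\}$, $W^u_{\rm loc}(P)=\{\rho=0\}$. $\Pi_P:\Sigma_P^{{\rm in}(+)}\to\Sigma_P^{\rm out}$ is $\Pi_P(\psi,z)=(\psi-\frac1{\eta_e}\ln z \bmod 2\pi,\ z^{\delta_P})$, $\delta_P=\eta_c/\eta_e$. Put $\delta=\delta_1\delta_P$. **Transition maps** (lowest order terms): $\Psi_{EP}:\Sigma_E^{\rm out}\to\Sigma_P^{\rm in}$, $(x,y)\mapsto(\psi,z)=(a_{11}x+a_{12}y+\alpha\xi_1,\ a_{21}x+a_{22}y+\alpha)$ with $a_{11}a_{22}-a_{12}a_{21}\ne0$, $a_{21}\neq0$, $\xi_1\in\mathbb R$ and, without loss of generality, $a_{11}>0$; $\Psi_{PE}:\Sigma_P^{\rm out}\to\Sigma_E^{\rm in}$, $(\psi,\rho)\mapsto(y,z)=(b_{11}\psi+b_{12}\rho+\beta\xi_2,\ b_{22}\rho+k\psi^2+\beta(1+\nu\psi))$ with $b_{22}\ne0$, $k\neq0$, $\xi_2\in\mathbb R$, $\nu>0$. For this statement $\alpha=\beta=0$, so connections meet each section at $(0,0)$. Points with negative $z$-component in $\Sigma_P^{\rm in}$ and $\Sigma_E^{\rm in}$ do not follow the cycle and are disregarded. **Return map.** $R_P^{\rm in}\subset\Sigma_P^{\rm in}$ and $R_P^{\rm out}\subset\Sigma_P^{\rm out}$ are the squares $[-\tau,\tau]\times[-\tau,\tau]$, $\tau>0$ small. For $n\ge n_0$, $H_n=\{(\psi,z):\psi\in[-\tau,\tau],\ e^{a_n(\psi)}\le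 z\le e^{b_n(\psi)}\}$ with $a_n(\psi)=\eta_e(-\tau-2n\pi+\psi)$, $b_n(\psi)=\eta_e(\tau-2n\pi+\psi)$. $R=\Psi_{EP}\circ\Pi_E\circ\Psi_{PE}\circ\Pi_P$ is defined on the subset of $\bigcup_{n\ge n_0}H_n$ that returns to $R_P^{\rm in}$. *)

theory Defs
  imports "HOL-Analysis.Analysis"
begin

section \<open>Differentiability classes\<close>

text \<open>Class \<open>C\<^sup>k\<close> on a set, used for open sets of finite-dimensional spaces only.\<close>

primrec Ck :: "nat \<Rightarrow> 'a::real_normed_vector set \<Rightarrow> ('a \<Rightarrow> 'b::real_normed_vector) \<Rightarrow> bool" where
  "Ck 0 S f \<longleftrightarrow> continuous_on S f"
| "Ck (Suc k) S f \<longleftrightarrow> (\<forall>x\<in>S. f differentiable (at x)) \<and>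
      (\<forall>v. Ck k S (\<lambda>x. frechet_derivative f (at x) v))"

definition smooth :: "'a::real_normed_vector set \<Rightarrow> ('a \<Rightarrow> 'b::real_normed_vector) \<Rightarrow> bool" where
  "smooth S f \<longleftrightarrow> (\<forall>k. Ck k S f)"

primrec dird :: "'a list \<Rightarrow> ('a::real_normed_vector \<Rightarrow> 'b::real_normed_vector) \<Rightarrow> 'a \<Rightarrow> 'b" where
  "dird [] f = f"
| "dird (v # vs) f = (\<lambda>x. frechet_derivative (dird vs f) (at x) v)"

section \<open>Compact three-dimensional manifolds and the space of smooth vector fields\<close>

text \<open>The manifold is a whole type \<open>'m\<close>; a chart is a pair of its domain and its coordinate map.
  Charts have open image in \<open>\<real>\<^sup>3\<close>, so there is no boundary.\<close>

type_synonym 'm chart = "'m set \<times> ('m \<Rightarrow> real^3)"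

abbreviation chart_inv :: "'m chart \<Rightarrow> real^3 \<Rightarrow> 'm" where
  "chart_inv c \<equiv> inv_into (fst c) (snd c)"

definition compact_3manifold :: "'m::t2_space chart set \<Rightarrow> bool" where
  "compact_3manifold A \<longleftrightarrow>
     compact (UNIV :: 'm set) \<and>
     (\<Union>c\<in>A. fst c) = UNIV \<and>
     (\<forall>c\<in>A. open (fst c) \<and> open (snd c ` fst c) \<and>
        homeomorphism (fst c) (snd c ` fst c) (snd c) (chart_inv c)) \<and>
     (\<forall>c\<in>A. \<forall>c'\<in>A. smooth (snd c ` (fst c \<inter> fst c')) (snd c' \<circ> chart_inv c))"

text \<open>A tangent vector at \<open>p\<close> is given by its components in the charts around \<open>p\<close>;
  a vector field \<open>f\<close> has components \<open>f c p\<close>.\<close>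

type_synonym 'm vfield = "'m chart \<Rightarrow> 'm \<Rightarrow> real^3"

definition vfield_in :: "'m vfield \<Rightarrow> 'm chart \<Rightarrow> real^3 \<Rightarrow> real^3" where
  "vfield_in f c = f c \<circ> chart_inv c"

definition smooth_vfields :: "'m::t2_space chart set \<Rightarrow> 'm vfield set" where
  "smooth_vfields A = {f.
     (\<forall>c\<in>A. smooth (snd c ` fst c) (vfield_in f c)) \<and>
     (\<forall>c\<in>A. \<forall>c'\<in>A. \<forall>p\<in>fst c \<inter> fst c'.
        f c' p = frechet_derivative (snd c' \<circ> chart_inv c) (at (snd c p)) (f c p)) \<and>
     (\<forall>c p. c \<notin> A \<or> p \<notin> fst c \<longrightarrow> f c p = 0)}"

definition Cinf_ball ::
  "'m::t2_space chart set \<Rightarrow> 'm vfield \<Rightarrow> 'm chart \<Rightarrow> 'm set \<Rightarrow> nat \<Rightarrow> real \<Rightarrow> 'm vfield set" where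
  "Cinf_ball A f c K k \<epsilon> = {g \<in> smooth_vfields A.
     \<forall>p\<in>K. \<forall>vs. length vs \<le> k \<and> set vs \<subseteq> Basis \<longrightarrow>
       norm (dird vs (vfield_in f c) (snd c p) - dird vs (vfield_in g c) (snd c p)) < \<epsilon>}"

text \<open>As the manifold is compact, uniform convergence of all derivatives on compact subsets of
  chart domains is the Whitney topology.\<close>

definition Cinf_topology :: "'m::t2_space chart set \<Rightarrow> 'm vfield topology" where
  "Cinf_topology A = topology_generated_by
     {Cinf_ball A f c K k \<epsilon> | f c K k \<epsilon>.
        f \<in> smooth_vfields A \<and> c \<in> A \<and> compact K \<and> K \<subseteq> fst c \<and> 0 < \<epsilon>}"

section \<open>Flow, invariant sets, local coordinates\<close>

definition is_flow :: "'m::t2_space chart set \<Rightarrow> 'm vfield \<Rightarrow> (real \<Rightarrow> 'm \<Rightarrow> 'm) \<Rightarrow> bool" where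
  "is_flow A f \<phi> \<longleftrightarrow> (\<forall>p. \<phi> 0 p = p \<and> continuous_on UNIV (\<lambda>t. \<phi> t p) \<and>
     (\<forall>t. \<forall>c\<in>A. \<phi> t p \<in> fst c \<longrightarrow>
        ((\<lambda>s. snd c (\<phi> s p)) has_vector_derivative f c (\<phi> t p)) (at t)))"

definition flow :: "'m::t2_space chart set \<Rightarrow> 'm vfield \<Rightarrow> real \<Rightarrow> 'm \<Rightarrow> 'm" where
  "flow A f = (THE \<phi>. is_flow A f \<phi>)"

definition orbit :: "(real \<Rightarrow> 'm \<Rightarrow> 'm) \<Rightarrow> 'm \<Rightarrow> 'm set" where
  "orbit \<phi> p = range (\<lambda>t. \<phi> t p)"

definition stable_set :: "(real \<Rightarrow> 'm::t2_space \<Rightarrow> 'm) \<Rightarrow> 'm set \<Rightarrow> 'm set" where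
  "stable_set \<phi> S = {p. \<forall>U. open U \<and> S \<subseteq> U \<longrightarrow> (\<forall>\<^sub>F t in at_top. \<phi> t p \<in> U)}"

definition unstable_set :: "(real \<Rightarrow> 'm::t2_space \<Rightarrow> 'm) \<Rightarrow> 'm set \<Rightarrow> 'm set" where
  "unstable_set \<phi> S = {p. \<forall>U. open U \<and> S \<subseteq> U \<longrightarrow> (\<forall>\<^sub>F t in at_bot. \<phi> t p \<in> U)}"

definition eigenvalue_of :: "(real^3 \<Rightarrow> real^3) \<Rightarrow> real \<Rightarrow> bool" where
  "eigenvalue_of L l \<longleftrightarrow> (\<exists>v. v \<noteq> 0 \<and> L v = l *\<^sub>R v)"

text \<open>Coordinates are given by parametrizations of subsets of the manifold.\<close>

definition local_Ck_diffeo :: "nat \<Rightarrow> 'm::t2_space chart set \<Rightarrow> (real^3) set \<Rightarrow> (real^3 \<Rightarrow> 'm) \<Rightarrow> bool" where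
  "local_Ck_diffeo k A W \<kappa> \<longleftrightarrow> open W \<and>
     (\<forall>c\<in>A. open (W \<inter> \<kappa> -` fst c) \<and> Ck k (W \<inter> \<kappa> -` fst c) (snd c \<circ> \<kappa>) \<and>
        (\<forall>w\<in>W \<inter> \<kappa> -` fst c. inj (frechet_derivative (snd c \<circ> \<kappa>) (at w))))"

text \<open>In the coordinates \<open>\<kappa>\<close>, the vector field \<open>f\<close> has the value \<open>v\<close> at \<open>w\<close>.\<close>

definition represents :: "'m::t2_space chart set \<Rightarrow> 'm vfield \<Rightarrow> (real^3 \<Rightarrow> 'm) \<Rightarrow> real^3 \<Rightarrow> real^3 \<Rightarrow> bool" where
  "represents A f \<kappa> w v \<longleftrightarrow>
     (\<forall>c\<in>A. \<kappa> w \<in> fst c \<longrightarrow> f c (\<kappa> w) = frechet_derivative (snd c \<circ> \<kappa>) (at w) v)"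

abbreviation vec3 :: "real \<Rightarrow> real \<Rightarrow> real \<Rightarrow> real^3" where
  "vec3 x y z \<equiv> vector [x, y, z]"

definition cube :: "(real^3) set" where
  "cube = {w. \<forall>i. \<bar>w $ i\<bar> \<le> 1}"

definition tube :: "(real^3) set" where
  "tube = {w. \<bar>w $ 2\<bar> \<le> 1 \<and> \<bar>w $ 3\<bar> \<le> 1}"

section \<open>Hypotheses on the vector field\<close>

definition hyperbolic_saddle :: "'m::t2_space chart set \<Rightarrow> 'm vfield \<Rightarrow> 'm \<Rightarrow> real \<Rightarrow> real \<Rightarrow> real \<Rightarrow> bool" where
  "hyperbolic_saddle A f E l1 l2 \<mu> \<longleftrightarrow>
     - l2 < - l1 \<and> - l1 < 0 \<and> 0 < \<mu> \<and> l1 < \<mu> \<and>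
     (\<forall>c\<in>A. E \<in> fst c \<longrightarrow> f c E = 0 \<and>
        (\<forall>l\<in>{\<mu>, - l1, - l2}. eigenvalue_of (frechet_derivative (vfield_in f c) (at (snd c E))) l))"

text \<open>The pairs \<open>(a, b)\<close> for which every planar germ of a smooth map fixing the origin
  with linear part \<open>diag(e\<^sup>a, e\<^sup>b)\<close> is \<open>C\<^sup>2\<close>-conjugate to its linear part.\<close>

definition Takens_set :: "(real \<times> real) set" where
  "Takens_set = {(a, b). \<forall>G :: real \<times> real \<Rightarrow> real \<times> real.
     (\<exists>r>0. smooth (ball 0 r) G) \<and> G 0 = 0 \<and>
     (G has_derivative (\<lambda>(u, v). (exp a * u, exp b * v))) (at 0) \<longrightarrow>
     (\<exists>(h :: real \<times> real \<Rightarrow> real \<times> real) V. open V \<and> 0 \<in> V \<and> Ck 2 V h \<and> h 0 = 0 \<and>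
        inj (frechet_derivative h (at 0)) \<and>
        (\<forall>w\<in>V. G w \<in> V \<longrightarrow> h (G w) = (exp a * fst (h w), exp b * snd (h w))))}"

text \<open>Throughout, \<open>\<eta>c\<close> and \<open>\<eta>e\<close> are the rates of the linear flow near \<open>P\<close> in the
  coordinates in which the period is normalized to \<open>2\<pi>\<close>. Hence the logarithms of the
  nontrivial Floquet multipliers are \<open>-2\<pi>\<eta>c\<close> and \<open>2\<pi>\<eta>e\<close>.\<close>

definition hyperbolic_periodic :: "'m::t2_space chart set \<Rightarrow> 'm vfield \<Rightarrow> 'm \<Rightarrow> real \<Rightarrow> real \<Rightarrow> bool" where
  "hyperbolic_periodic A f p \<eta>c \<eta>e \<longleftrightarrow> 0 < \<eta>c \<and> 0 < \<eta>e \<and>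
     (- (2 * pi * \<eta>c), 2 * pi * \<eta>e) \<in> Takens_set \<and>
     (\<exists>T>0. flow A f T p = p \<and> (\<forall>s. 0 < s \<and> s < T \<longrightarrow> flow A f s p \<noteq> p) \<and>
        (\<forall>c\<in>A. p \<in> fst c \<longrightarrow> f c p \<noteq> 0 \<and>
           (\<forall>l\<in>{exp (- (2 * pi * \<eta>c)), exp (2 * pi * \<eta>e)}.
              eigenvalue_of (frechet_derivative (snd c \<circ> flow A f T \<circ> chart_inv c) (at (snd c p))) l)))"

text \<open>Two surfaces through \<open>q\<close>, contained in \<open>S\<^sub>1\<close> and \<open>S\<^sub>2\<close>, have the same tangent plane at \<open>q\<close>
  and a contact of order exactly two: in smooth coordinates in which the first is the plane
  \<open>w\<^sub>3 = 0\<close>, the second is the graph of a function with a critical point but nonzero Hessian.\<close>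

definition quadratic_tangency :: "'m::t2_space chart set \<Rightarrow> 'm set \<Rightarrow> 'm set \<Rightarrow> 'm \<Rightarrow> bool" where
  "quadratic_tangency A S1 S2 q \<longleftrightarrow>
     (\<exists>W \<kappa> (g :: real \<times> real \<Rightarrow> real).
        0 \<in> W \<and> (\<forall>k. local_Ck_diffeo k A W \<kappa>) \<and> inj_on \<kappa> W \<and> \<kappa> 0 = q \<and>
        smooth UNIV g \<and> g 0 = 0 \<and> (g has_derivative (\<lambda>_. 0)) (at 0) \<and>
        (\<exists>u. dird [u, u] g 0 \<noteq> 0) \<and>
        \<kappa> ` {w \<in> W. w $ 3 = 0} \<subseteq> S1 \<and>
        \<kappa> ` {w \<in> W. w $ 3 = g (w $ 1, w $ 2)} \<subseteq> S2)"

text \<open>A cycle with its local data. \<open>per_pt\<close> is a point of \<open>P\<close>; \<open>pt_PE\<close> and \<open>pt_EP\<close> are points of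
  the two connections. Coordinates near \<open>E\<close> are \<open>(x,y,z)\<close>, those near \<open>P\<close> are \<open>(\<psi>,\<rho>,z)\<close>.\<close>

record 'm cycle =
  equil :: 'm
  per_pt :: 'm
  pt_PE :: 'm
  pt_EP :: 'm
  lam1 :: real
  lam2 :: real
  mu :: real
  etac :: real
  etae :: real
  coordE :: "real^3 \<Rightarrow> 'm"
  coordP :: "real^3 \<Rightarrow> 'm"
  PsiEP :: "real \<times> real \<Rightarrow> real \<times> real"
  PsiPE :: "real \<times> real \<Rightarrow> real \<times> real"
  a11 :: real
  a12 :: real
  a21 :: real
  a22 :: real
  b11 :: real
  b12 :: real
  b22 :: real
  kq :: real

definition delta1 :: "'m cycle \<Rightarrow> real" where "delta1 d = lam1 d / mu d"
definition delta2 :: "'m cycle \<Rightarrow> real" where "delta2 d = lam2 d / mu d"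
definition deltaP :: "'m cycle \<Rightarrow> real" where "deltaP d = etac d / etae d"
definition delta :: "'m cycle \<Rightarrow> real" where "delta d = delta1 d * deltaP d"

definition perP :: "'m::t2_space chart set \<Rightarrow> 'm vfield \<Rightarrow> 'm cycle \<Rightarrow> 'm set" where
  "perP A f d = orbit (flow A f) (per_pt d)"

definition H1 :: "'m::t2_space chart set \<Rightarrow> 'm vfield \<Rightarrow> 'm cycle \<Rightarrow> bool" where
  "H1 A f d \<longleftrightarrow> hyperbolic_saddle A f (equil d) (lam1 d) (lam2 d) (mu d)"

definition H2 :: "'m::t2_space chart set \<Rightarrow> 'm vfield \<Rightarrow> 'm cycle \<Rightarrow> bool" where
  "H2 A f d \<longleftrightarrow> hyperbolic_periodic A f (per_pt d) (etac d) (etae d)"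

definition H3 :: "'m::t2_space chart set \<Rightarrow> 'm vfield \<Rightarrow> 'm cycle \<Rightarrow> bool" where
  "H3 A f d \<longleftrightarrow>
     pt_PE d \<in> unstable_set (flow A f) (perP A f d) \<inter> stable_set (flow A f) {equil d} \<and>
     quadratic_tangency A (stable_set (flow A f) {equil d})
       (unstable_set (flow A f) (perP A f d)) (pt_PE d)"

definition H4 :: "'m::t2_space chart set \<Rightarrow> 'm vfield \<Rightarrow> 'm cycle \<Rightarrow> bool" where
  "H4 A f d \<longleftrightarrow>
     pt_EP d \<in> unstable_set (flow A f) {equil d} \<inter> stable_set (flow A f) (perP A f d)"

definition Gamma :: "'m::t2_space chart set \<Rightarrow> 'm vfield \<Rightarrow> 'm cycle \<Rightarrow> 'm set" where
  "Gamma A f d = {equil d} \<union> perP A f d \<union> orbit (flow A f) (pt_EP d) \<union> orbit (flow A f) (pt_PE d)"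

section \<open>Sections, local maps and transition maps\<close>

fun secEin :: "'m cycle \<Rightarrow> real \<times> real \<Rightarrow> 'm" where
  "secEin d (y, z) = coordE d (vec3 1 y z)"

fun secEout :: "'m cycle \<Rightarrow> real \<times> real \<Rightarrow> 'm" where
  "secEout d (x, y) = coordE d (vec3 x y 1)"

fun secPin :: "'m cycle \<Rightarrow> real \<times> real \<Rightarrow> 'm" where
  "secPin d (\<psi>, z) = coordP d (vec3 \<psi> 1 z)"

fun secPout :: "'m cycle \<Rightarrow> real \<times> real \<Rightarrow> 'm" where
  "secPout d (\<psi>, \<rho>) = coordP d (vec3 \<psi> \<rho> 1)"

abbreviation sq1 :: "(real \<times> real) set" where
  "sq1 \<equiv> {-1..1} \<times> {-1..1}"

text \<open>The orbit through \<open>w\<close> in the section \<open>x = 1\<close> stays in the cube until it hits the section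
  \<open>z = 1\<close> in \<open>w'\<close>.\<close>

definition passesE :: "'m::t2_space chart set \<Rightarrow> 'm vfield \<Rightarrow> 'm cycle \<Rightarrow> real \<times> real \<Rightarrow> real \<times> real \<Rightarrow> bool" where
  "passesE A f d w w' \<longleftrightarrow> w \<in> sq1 \<and> w' \<in> sq1 \<and>
     (\<exists>t>0. flow A f t (secEin d w) = secEout d w' \<and>
        (\<forall>s\<in>{0..t}. flow A f s (secEin d w) \<in> coordE d ` cube))"

definition PiE :: "'m::t2_space chart set \<Rightarrow> 'm vfield \<Rightarrow> 'm cycle \<Rightarrow> real \<times> real \<Rightarrow> real \<times> real" where
  "PiE A f d w = (THE w'. passesE A f d w w')"

text \<open>The angle is reduced modulo \<open>2\<pi>\<close> to the representative in \<open>[-\<pi>,\<pi>)\<close>.\<close>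

fun PiP :: "'m cycle \<Rightarrow> real \<times> real \<Rightarrow> real \<times> real" where
  "PiP d (\<psi>, z) =
     (let \<theta> = \<psi> - ln z / etae d in (\<theta> - 2 * pi * of_int (round (\<theta> / (2 * pi))), z powr deltaP d))"

text \<open>\<open>\<Pi>\<^sub>E(y,z) = (z\<^bsup>\<delta>1\<^esup>, y z\<^bsup>\<delta>2\<^esup>)\<close> up to terms that are of higher order than the leading term
  \<open>z\<^bsup>\<delta>1\<^esup>\<close> (and its \<open>z\<close>-derivative); the term \<open>y z\<^bsup>\<delta>2\<^esup>\<close> is the leading one in the
  \<open>y\<close>-derivative. Bounding the value of the remainder by a power larger than \<open>\<delta>2\<close> instead is
  impossible in general: if the linearizing coordinate of the incoming connection at \<open>x = 1\<close>
  is \<open>y\<^sub>0 \<noteq> 0\<close>, there is a remainder \<open>y\<^sub>0 z\<^bsup>\<delta>2\<^esup>\<close>.\<close>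

definition PiE_asymptotics :: "'m::t2_space chart set \<Rightarrow> 'm vfield \<Rightarrow> 'm cycle \<Rightarrow> bool" where
  "PiE_asymptotics A f d \<longleftrightarrow>
     (\<exists>\<sigma>>0. \<exists>C. \<exists>\<epsilon>>0. \<exists>r :: real \<times> real \<Rightarrow> real \<times> real.
        \<forall>y z. \<bar>y\<bar> < \<epsilon> \<and> 0 < z \<and> z < \<epsilon> \<longrightarrow>
          (\<exists>!w'. passesE A f d (y, z) w') \<and>
          PiE A f d (y, z) = (z powr delta1 d, y * z powr delta2 d) + r (y, z) \<and>
          r differentiable (at (y, z)) \<and>
          norm (r (y, z)) \<le> C * z powr (delta1 d + \<sigma>) \<and>
          norm (frechet_derivative r (at (y, z)) (0, 1)) \<le> C * z powr (delta1 d - 1 + \<sigma>) \<and>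
          norm (frechet_derivative r (at (y, z)) (1, 0)) \<le> C * z powr (delta2 d + \<sigma>))"

text \<open>The condition on \<open>sgn\<close> says that the incoming connection reaches \<open>E\<close> tangentially to the
  positive \<open>x\<close>-axis; it cannot be the axis itself in general, as for \<open>\<lambda>2 < 2\<lambda>1\<close> its closure
  is usually not a \<open>C\<^sup>2\<close> curve.\<close>

definition adapted_E :: "'m::t2_space chart set \<Rightarrow> 'm vfield \<Rightarrow> 'm cycle \<Rightarrow> bool" where
  "adapted_E A f d \<longleftrightarrow>
     (\<exists>W g. cube \<subseteq> W \<and> local_Ck_diffeo 2 A W (coordE d) \<and> inj_on (coordE d) W \<and>
        coordE d 0 = equil d \<and>
        (\<forall>w\<in>W. represents A f (coordE d) w (g w)) \<and>
        (g has_derivative (\<lambda>v. vec3 (- lam1 d * v $ 1) (- lam2 d * v $ 2) (mu d * v $ 3))) (at 0)) \<and>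
     {p. \<forall>t\<ge>0. flow A f t p \<in> coordE d ` cube} = coordE d ` {w \<in> cube. w $ 3 = 0} \<and>
     (\<forall>s\<in>{0<..1}. coordE d (vec3 0 0 s) \<in> orbit (flow A f) (pt_EP d)) \<and>
     secEin d (0, 0) \<in> orbit (flow A f) (pt_PE d) \<and>
     ((\<lambda>t. sgn (inv_into cube (coordE d) (flow A f t (secEin d (0, 0))))) \<longlongrightarrow> vec3 1 0 0) at_top \<and>
     PiE_asymptotics A f d"

definition adapted_P :: "'m::t2_space chart set \<Rightarrow> 'm vfield \<Rightarrow> 'm cycle \<Rightarrow> bool" where
  "adapted_P A f d \<longleftrightarrow>
     (\<exists>W h. tube \<subseteq> W \<and> local_Ck_diffeo 2 A W (coordP d) \<and>
        (\<forall>w\<in>W. 0 < h w \<and>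
           represents A f (coordP d) w (h w *\<^sub>R vec3 1 (- etac d * w $ 2) (etae d * w $ 3)))) \<and>
     (\<forall>w\<in>tube. \<forall>w'\<in>tube. coordP d w = coordP d w' \<longleftrightarrow>
        (\<exists>j::int. w' = w + vec3 (2 * pi * of_int j) 0 0)) \<and>
     perP A f d = range (\<lambda>\<psi>. coordP d (vec3 \<psi> 0 0)) \<and>
     secPin d (0, 0) \<in> orbit (flow A f) (pt_EP d) \<and>
     secPout d (0, 0) \<in> orbit (flow A f) (pt_PE d)"

text \<open>\<open>\<Psi>\<close> is, near the origin, the map that follows the flow between the sections \<open>s\<close> and \<open>s'\<close> along
  the connection through their origins.\<close>

definition transition_map ::
  "(real \<Rightarrow> 'm \<Rightarrow> 'm) \<Rightarrow> (real \<times> real \<Rightarrow> 'm) \<Rightarrow> (real \<times> real \<Rightarrow> 'm) \<Rightarrow> (real \<times> real \<Rightarrow> real \<times> real) \<Rightarrow> bool" where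
  "transition_map \<phi> s s' \<Psi> \<longleftrightarrow>
     (\<exists>r>0. \<exists>T. Ck 2 (ball 0 r) \<Psi> \<and> continuous_on (ball 0 r) T \<and> \<Psi> 0 = 0 \<and> T 0 > 0 \<and>
        (\<forall>w\<in>ball 0 r. \<phi> (T w) (s w) = s' (\<Psi> w)))"

definition transitions :: "'m::t2_space chart set \<Rightarrow> 'm vfield \<Rightarrow> 'm cycle \<Rightarrow> bool" where
  "transitions A f d \<longleftrightarrow>
     transition_map (flow A f) (secEout d) (secPin d) (PsiEP d) \<and>
     transition_map (flow A f) (secPout d) (secEin d) (PsiPE d) \<and>
     (PsiEP d has_derivative (\<lambda>(x, y). (a11 d * x + a12 d * y, a21 d * x + a22 d * y))) (at 0) \<and>
     a11 d * a22 d - a12 d * a21 d \<noteq> 0 \<and> a21 d \<noteq> 0 \<and> a11 d > 0 \<and>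
     (PsiPE d has_derivative (\<lambda>(\<psi>, \<rho>). (b11 d * \<psi> + b12 d * \<rho>, b22 d * \<rho>))) (at 0) \<and>
     dird [(1, 0), (1, 0)] (\<lambda>w. snd (PsiPE d w)) 0 = 2 * kq d \<and>
     b22 d \<noteq> 0 \<and> kq d \<noteq> 0"

definition tangency_cycle :: "'m::t2_space chart set \<Rightarrow> 'm vfield \<Rightarrow> 'm cycle \<Rightarrow> bool" where
  "tangency_cycle A f d \<longleftrightarrow> H1 A f d \<and> H2 A f d \<and> H3 A f d \<and> H4 A f d \<and>
     adapted_E A f d \<and> adapted_P A f d \<and> transitions A f d"

definition case3 :: "'m cycle \<Rightarrow> bool" where
  "case3 d \<longleftrightarrow> a21 d > 0 \<and> kq d > 0 \<and> b22 d < 0 \<and> deltaP d * delta2 d > 1"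

definition case4 :: "'m cycle \<Rightarrow> bool" where
  "case4 d \<longleftrightarrow> a21 d > 0 \<and> kq d < 0 \<and> b22 d > 0 \<and> delta d < 1"

definition case5 :: "'m cycle \<Rightarrow> bool" where
  "case5 d \<longleftrightarrow> a21 d > 0 \<and> kq d > 0 \<and> b22 d > 0 \<and> delta d > 1"

section \<open>Return map and horseshoes\<close>

definition RP :: "real \<Rightarrow> (real \<times> real) set" where
  "RP \<tau> = {-\<tau>..\<tau>} \<times> {-\<tau>..\<tau>}"

definition Hstrip :: "'m cycle \<Rightarrow> real \<Rightarrow> nat \<Rightarrow> (real \<times> real) set" where
  "Hstrip d \<tau> n = {(\<psi>, z). \<psi> \<in> {-\<tau>..\<tau>} \<and>
     exp (etae d * (- \<tau> - 2 * real n * pi + \<psi>)) \<le> z \<and>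
     z \<le> exp (etae d * (\<tau> - 2 * real n * pi + \<psi>))}"

definition Rmap :: "'m::t2_space chart set \<Rightarrow> 'm vfield \<Rightarrow> 'm cycle \<Rightarrow> real \<times> real \<Rightarrow> real \<times> real" where
  "Rmap A f d = PsiEP d \<circ> PiE A f d \<circ> PsiPE d \<circ> PiP d"

definition Rdom :: "'m::t2_space chart set \<Rightarrow> 'm vfield \<Rightarrow> 'm cycle \<Rightarrow> real \<Rightarrow> nat \<Rightarrow> (real \<times> real) set" where
  "Rdom A f d \<tau> n0 = {p \<in> (\<Union>n\<in>{n0..}. Hstrip d \<tau> n).
     PiP d p \<in> RP \<tau> \<and>
     snd (PsiPE d (PiP d p)) > 0 \<and>
     (\<exists>!w'. passesE A f d (PsiPE d (PiP d p)) w') \<and>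
     Rmap A f d p \<in> RP \<tau>}"

definition uniformly_hyperbolic :: "('a::euclidean_space \<Rightarrow> 'a) \<Rightarrow> 'a set \<Rightarrow> bool" where
  "uniformly_hyperbolic R K \<longleftrightarrow>
     (\<exists>Es Eu C \<theta>. 0 < C \<and> 0 < \<theta> \<and> \<theta> < 1 \<and>
        (\<forall>p\<in>K. R differentiable (at p) \<and>
           subspace (Es p) \<and> subspace (Eu p) \<and> Es p \<inter> Eu p = {0} \<and>
           (\<forall>v. \<exists>s\<in>Es p. \<exists>u\<in>Eu p. v = s + u) \<and>
           frechet_derivative R (at p) ` Es p = Es (R p) \<and>
           frechet_derivative R (at p) ` Eu p = Eu (R p) \<and>
           (\<forall>n. (\<forall>v\<in>Es p. norm (frechet_derivative (R ^^ n) (at p) v) \<le> C * \<theta> ^ n * norm v) \<and>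
                (\<forall>v\<in>Eu p. norm v \<le> C * \<theta> ^ n * norm (frechet_derivative (R ^^ n) (at p) v)))))"

definition full_shift_space :: "nat \<Rightarrow> (int \<Rightarrow> nat) topology" where
  "full_shift_space N = product_topology (\<lambda>_. discrete_topology {..<N}) UNIV"

text \<open>At least two symbols: the shift over one symbol is a single fixed point.\<close>

definition conjugate_to_full_shift :: "('a::topological_space \<Rightarrow> 'a) \<Rightarrow> 'a set \<Rightarrow> bool" where
  "conjugate_to_full_shift R K \<longleftrightarrow>
     (\<exists>N\<ge>2. \<exists>h. homeomorphic_map (top_of_set K) (full_shift_space N) h \<and>
        (\<forall>p\<in>K. h (R p) = (\<lambda>i. h p (i + 1))))"

definition saturation :: "'m::t2_space chart set \<Rightarrow> 'm vfield \<Rightarrow> 'm cycle \<Rightarrow> (real \<times> real) set \<Rightarrow> 'm set" where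
  "saturation A f d K = (\<Union>p\<in>K. orbit (flow A f) (secPin d p))"

text \<open>The sets of orbits through the \<open>K m\<close> converge to \<open>G\<close>, in the sense of Hausdorff.\<close>

definition accumulates_on ::
  "'m::t2_space chart set \<Rightarrow> 'm vfield \<Rightarrow> 'm cycle \<Rightarrow> (nat \<Rightarrow> (real \<times> real) set) \<Rightarrow> 'm set \<Rightarrow> bool" where
  "accumulates_on A f d K G \<longleftrightarrow>
     (\<forall>U. open U \<and> G \<subseteq> U \<longrightarrow> (\<forall>\<^sub>F m in sequentially. saturation A f d (K m) \<subseteq> U)) \<and>
     (\<forall>U. open U \<and> G \<inter> U \<noteq> {} \<longrightarrow> (\<forall>\<^sub>F m in sequentially. saturation A f d (K m) \<inter> U \<noteq> {}))"

text \<open>The number \<open>n0\<close> is only required to be so large that the strips lie in the square.\<close>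

definition horseshoe_sequence :: "'m::t2_space chart set \<Rightarrow> 'm vfield \<Rightarrow> 'm cycle \<Rightarrow> bool" where
  "horseshoe_sequence A f d \<longleftrightarrow>
     (\<exists>\<tau>0>0. \<forall>\<tau>. 0 < \<tau> \<and> \<tau> < \<tau>0 \<longrightarrow>
        (\<forall>n0. (\<forall>n\<ge>n0. Hstrip d \<tau> n \<subseteq> RP \<tau>) \<longrightarrow>
           (\<exists>K :: nat \<Rightarrow> (real \<times> real) set.
              (\<forall>m. compact (K m) \<and> K m \<subseteq> Rdom A f d \<tau> n0 \<and> Rmap A f d ` K m = K m \<and>
                 uniformly_hyperbolic (Rmap A f d) (K m) \<and>
                 conjugate_to_full_shift (Rmap A f d) (K m)) \<and>
              accumulates_on A f d K (Gamma A f d))))"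

definition case_vfields :: "'m::t2_space chart set \<Rightarrow> 'm vfield set" where
  "case_vfields A = {f \<in> smooth_vfields A.
     \<exists>d. tangency_cycle A f d \<and> (case3 d \<or> case4 d \<or> case5 d)}"

end

theory Submission imports Defs
begin

text \<open>The open and dense set is the whole class. An orbit of the return map
 in a strip is described by the entry angle \<open>\<psi>\<close> at \<open>P\<close>, the exit angle \<open>s\<close> at \<open>P\<close> and the height \<open>z\<close> at \<open>E\<close>; the
 difference \<open>\<psi>' - s'\<close> of the next point determines \<open>z\<close>, the height \<open>z\<close> determines \<open>s\<close> up to the sign, through
 the tangency, and the present point determines \<open>\<psi>'\<close>. After rescaling about the values \<open>s\<close> with
 \<open>k s\<^sup>2 = Z - b22 \<rho>\<close>, where \<open>Z\<close> and \<open>\<rho>\<close> are the typical values of \<open>z\<close> and \<open>\<rho>\<close> in the strip, these three relations define a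
 contraction on bounded bi-infinite sequences for each sequence of signs. The fixed points are the
 horseshoe, a full shift over two symbols. In each of the three cases \<open>(Z - b22 \<rho>) / k\<close> is positive and at least of
 the order of \<open>Z\<close> and \<open>\<rho>\<close> in all late strips, which is what the contraction needs. The same estimates for differences of orbits
 give the crossed inequalities from which hyperbolicity follows.

 The orbits near \<open>P\<close> are explicit. An orbit that passes \<open>E\<close> leaves a small neighbourhood of \<open>E\<close> close to a point whose backward
 orbit stays there, hence close to the outgoing connection; so all orbits through the horseshoes stay close to
 the cycle.\<close>

section \<open>Uniform hyperbolicity from crossed contraction\<close>

text \<open>Two obstacles shape the argument. The derivative of the passage of \<open>E\<close> has
  entries of the different orders \<open>Z powr d1\<close> and \<open>Z powr d2\<close>, and the
  error is small only relative to the first, so cone conditions cannot be checked on the matrix of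
  \<open>R\<close> itself. Written as equations between entry angle, exit angle and height, with the
  next point among the unknowns, the dynamics involve only the leading order; each equation is
  treated by a Newton step with frozen derivative. The smaller order \<open>Z powr d2\<close> enters
  only qualitatively, to make \<open>R\<close> and its derivative injective. Secondly, this
  injectivity requires the transition from \<open>P\<close> to \<open>E\<close> to be invertible,
  hence \<open>b11\<close> nonzero, which is not among the data but forced by the flow. The
  constants are chosen in the order \<open>kp\<close> (radius of the rescaled cube),
  \<open>c\<close> (scale of the entry angle), \<open>\<eta>\<close> (error), strip number
  \<open>n\<close>. The sign of \<open>Z - b22*\<rho>\<close> is that of \<open>k\<close> for a
  different reason in each case: the two terms have the same sign, or \<open>\<rho>\<close>
  dominates \<open>Z\<close>, or \<open>Z\<close> dominates \<open>\<rho>\<close>.\<close>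

locale cross_cocycle =
 fixes K :: "'a set" and R :: "'a => 'a" and D :: "'a => real \<times> real => real \<times> real"
  and a b :: "'a => real \<times> real => real" and \<theta> C :: real
 assumes R_in: "q \<in> K ==> R q \<in> K"
  and D_lin: "q \<in> K ==> linear (D q)" and D_inj: "q \<in> K ==> inj (D q)"
  and a_lin: "q \<in> K ==> linear (a q)" and b_lin: "q \<in> K ==> linear (b q)"
  and th: "0 < \<theta>" "\<theta> < 1"
  and cross_b: "q \<in> K ==> abs (b q v) <= \<theta>*max (abs (a q v)) (abs (b (R q) (D q v)))"
  and cross_a: "q \<in> K ==> abs (a (R q) (D q v)) <= \<theta>*max (abs (a q v)) (abs (b (R q) (D q v)))"
  and norm_le: "q \<in> K ==> norm v <= C*max (abs (a q v)) (abs (b q v))"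
  and le_norm: "q \<in> K ==> max (abs (a q v)) (abs (b q v)) <= C*norm v"
begin

primrec Dn :: "nat => 'a => real \<times> real => real \<times> real" where
 "Dn 0 q v = v"
| "Dn (Suc n) q v = D ((R ^^ n) q) (Dn n q v)"

lemma Rn_in: "q \<in> K ==> (R ^^ n) q \<in> K"
 by (induction n) (auto intro: R_in)

lemma Dn_shift: "Dn (Suc n) q v = Dn n (R q) (D q v)"
 by (induction n) (simp_all add: funpow_swap1)

lemma Dn_linear: "q \<in> K ==> linear (Dn n q)"
proof (induction n)
 case 0 show ?case by (simp add: linear_iff)
next
 case (Suc n)
 have "linear (D ((R ^^ n) q) \<circ> Dn n q)"
  by (intro linear_compose Suc D_lin Rn_in)
 then show ?case by (simp add: o_def)
qed

lemma Dn_inj: "q \<in> K ==> inj (Dn n q)"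
proof (induction n)
 case 0 show ?case by (simp add: inj_def)
next
 case (Suc n)
 have "inj (D ((R ^^ n) q) \<circ> Dn n q)"
  by (intro inj_compose Suc D_inj Rn_in)
 then show ?case by (simp add: o_def)
qed

text \<open>The crossed hypotheses bound the old \<open>b\<close> and the new \<open>a\<close> by
  the old \<open>a\<close> and the new \<open>b\<close>: the form typical of \<open>a\<close>
  contracted and \<open>b\<close> expanded. If \<open>b\<close> dominates at \<open>q\<close>, the
  maximum may be taken over the old and the new \<open>b\<close>, and the old one cannot win since
  \<open>abs (b q v) <= \<theta>*abs (b q v)\<close> forces zero.\<close>

lemma unstable_cone:
 assumes "q \<in> K" "abs (a q v) <= abs (b q v)"
 shows "abs (b q v) <= \<theta>*abs (b (R q) (D q v))" "abs (a (R q) (D q v)) <= abs (b (R q) (D q v))"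
proof -
 have 1: "abs (b q v) <= \<theta>*max (abs (b q v)) (abs (b (R q) (D q v)))"
  using order_trans[OF cross_b[OF assms(1), of v] mult_left_mono[of "max (abs (a q v)) (abs (b (R q) (D q v)))" "max (abs (b q v)) (abs (b (R q) (D q v)))" \<theta>]]
   assms(2) th(1) by (simp add: max.coboundedI1 max.mono)
 show 2: "abs (b q v) <= \<theta>*abs (b (R q) (D q v))"
 proof (cases "abs (b q v) <= abs (b (R q) (D q v))")
  case True then show ?thesis using 1 by (simp add: max_def split: if_splits)
 next
  case False
  then have "abs (b q v) <= \<theta>*abs (b q v)" using 1 by simp
  then have "(1 - \<theta>)*abs (b q v) <= 0" by (simp add: algebra_simps)
  then have "abs (b q v) <= 0" using th by (simp add: mult_le_0_iff)
  then show ?thesis using False by simp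
 qed
 have "\<theta>*abs (b (R q) (D q v)) <= 1*abs (b (R q) (D q v))"
  using th by (intro mult_right_mono) auto
 then have "abs (a q v) <= abs (b (R q) (D q v))" using 2 assms(2) by linarith
 then have "abs (a (R q) (D q v)) <= \<theta>*abs (b (R q) (D q v))" using cross_a[OF assms(1), of v] by simp
 also have "... <= 1*abs (b (R q) (D q v))" using th by (intro mult_right_mono) auto
 finally show "abs (a (R q) (D q v)) <= abs (b (R q) (D q v))" by simp
qed

text \<open>The cone condition is placed at the image point: the cone around the \<open>a\<close>
  direction is invariant under pulling back, not under pushing forward.\<close>

lemma stable_cone:
 assumes "q \<in> K" "abs (b (R q) (D q v)) <= abs (a (R q) (D q v))"
 shows "abs (a (R q) (D q v)) <= \<theta>*abs (a q v)" "abs (b q v) <= \<theta>*abs (a q v)"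
proof -
 have 1: "abs (a (R q) (D q v)) <= \<theta>*max (abs (a q v)) (abs (a (R q) (D q v)))"
  using order_trans[OF cross_a[OF assms(1), of v] mult_left_mono[of "max (abs (a q v)) (abs (b (R q) (D q v)))" "max (abs (a q v)) (abs (a (R q) (D q v)))" \<theta>]]
   assms(2) th(1) by (simp add: max.coboundedI1 max.mono)
 show 2: "abs (a (R q) (D q v)) <= \<theta>*abs (a q v)"
 proof (cases "abs (a (R q) (D q v)) <= abs (a q v)")
  case True then show ?thesis using 1 by (simp add: max_def split: if_splits)
 next
  case False
  then have "abs (a (R q) (D q v)) <= \<theta>*abs (a (R q) (D q v))" using 1 by simp
  then have "(1 - \<theta>)*abs (a (R q) (D q v)) <= 0" by (simp add: algebra_simps)
  then have "abs (a (R q) (D q v)) <= 0" using th by (simp add: mult_le_0_iff)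
  then show ?thesis using False by simp
 qed
 have "\<theta>*abs (a q v) <= 1*abs (a q v)" using th by (intro mult_right_mono) auto
 then have "max (abs (a q v)) (abs (b (R q) (D q v))) = abs (a q v)" using 2 assms(2) by simp
 then show "abs (b q v) <= \<theta>*abs (a q v)" using cross_b[OF assms(1), of v] by simp
qed

text \<open>The stable space as the set of vectors whose images all stay in the cone around the
  \<open>a\<close> direction; that it is linear is not visible in this form.\<close>

definition Es :: "'a => (real \<times> real) set" where
 "Es q = {v. \<forall>n. abs (b ((R ^^ n) q) (Dn n q v)) <= abs (a ((R ^^ n) q) (Dn n q v))}"

lemma Es_decay:
 assumes "q \<in> K" "v \<in> Es q"
 shows "abs (a ((R ^^ n) q) (Dn n q v)) <= \<theta> ^ n*abs (a q v)"
proof (induction n)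
 case (Suc n)
 have "abs (a ((R ^^ Suc n) q) (Dn (Suc n) q v)) <= \<theta>*abs (a ((R ^^ n) q) (Dn n q v))"
  using stable_cone(1)[OF Rn_in[OF assms(1)], of n "Dn n q v"] assms(2)[unfolded Es_def mem_Collect_eq, rule_format, of "Suc n"]
  by simp
 also have "... <= \<theta>*(\<theta> ^ n*abs (a q v))" using Suc th by (intro mult_left_mono) auto
 finally show ?case by simp
qed simp

lemma Es_strict:
 assumes "q \<in> K" "v \<in> Es q"
 shows "abs (b q v) <= \<theta>*abs (a q v)"
 using stable_cone(2)[OF assms(1), of v] assms(2)[unfolded Es_def mem_Collect_eq, rule_format, of "Suc 0"]
 by simp

text \<open>A vector that leaves the cone once stays in the opposite cone, where \<open>b\<close>
  grows at the rate \<open>1/\<theta>\<close>. So staying in the cone amounts to boundedness of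
  \<open>b\<close>, a condition that is visibly linear and invariant; the next two lemmas rest on
  it.\<close>

lemma Es_bounded:
 assumes "q \<in> K"
 shows "v \<in> Es q \<longleftrightarrow> (\<exists>B. \<forall>n. abs (b ((R ^^ n) q) (Dn n q v)) <= B)"
proof
 assume v: "v \<in> Es q"
 show "\<exists>B. \<forall>n. abs (b ((R ^^ n) q) (Dn n q v)) <= B"
 proof (intro exI allI)
  fix n
  have "abs (b ((R ^^ n) q) (Dn n q v)) <= abs (a ((R ^^ n) q) (Dn n q v))" using v by (simp add: Es_def)
  also have "... <= \<theta> ^ n*abs (a q v)" by (rule Es_decay[OF assms v])
  also have "... <= 1*abs (a q v)" using th by (intro mult_right_mono power_le_one) auto
  finally show "abs (b ((R ^^ n) q) (Dn n q v)) <= abs (a q v)" by simp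
 qed
next
 assume "\<exists>B. \<forall>n. abs (b ((R ^^ n) q) (Dn n q v)) <= B"
 then obtain B where B: "!!n. abs (b ((R ^^ n) q) (Dn n q v)) <= B" by blast
 show "v \<in> Es q"
 proof (rule ccontr)
  assume "v \<notin> Es q"
  then obtain m where m: "abs (a ((R ^^ m) q) (Dn m q v)) < abs (b ((R ^^ m) q) (Dn m q v))"
   by (auto simp: Es_def not_le)
  have grow: "abs (a ((R ^^ (m+k)) q) (Dn (m+k) q v)) <= abs (b ((R ^^ (m+k)) q) (Dn (m+k) q v)) &
    abs (b ((R ^^ m) q) (Dn m q v)) <= \<theta> ^ k*abs (b ((R ^^ (m+k)) q) (Dn (m+k) q v))" for k
  proof (induction k)
   case 0 then show ?case using m by simp
  next
   case (Suc k)
   note u = unstable_cone[OF Rn_in[OF assms], of "m+k" "Dn (m+k) q v"]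
   have "abs (b ((R ^^ m) q) (Dn m q v)) <= \<theta> ^ k*abs (b ((R ^^ (m+k)) q) (Dn (m+k) q v))" using Suc by simp
   also have "... <= \<theta> ^ k*(\<theta>*abs (b ((R ^^ (m+Suc k)) q) (Dn (m+Suc k) q v)))"
    using u(1) Suc th by (intro mult_left_mono) auto
   finally show ?case using u(2) Suc by (simp add: mult_ac)
  qed
  have "abs (b ((R ^^ m) q) (Dn m q v)) <= \<theta> ^ k*B" for k
  proof -
   have "\<theta> ^ k*abs (b ((R ^^ (m+k)) q) (Dn (m+k) q v)) <= \<theta> ^ k*B"
    using B th by (intro mult_left_mono) auto
   then show ?thesis using grow[of k] by linarith
  qed
  moreover have "(%k. \<theta> ^ k*B) \<longlonglongrightarrow> 0*B"
   using th by (intro tendsto_intros LIMSEQ_power_zero) auto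
  ultimately have "abs (b ((R ^^ m) q) (Dn m q v)) <= 0*B"
   by (intro LIMSEQ_le_const) auto
  then show False using m by simp
 qed
qed

lemma Es_subspace: assumes "q \<in> K" shows "subspace (Es q)"
proof -
 have lin: "linear (%v. b ((R ^^ n) q) (Dn n q v))" for n
  using linear_compose[OF Dn_linear[OF assms] b_lin[OF Rn_in[OF assms]], of n n] by (simp add: o_def)
 show ?thesis
 proof (rule subspaceI)
  show "0 \<in> Es q"
   unfolding Es_bounded[OF assms] using linear_0[OF lin] by (intro exI[of _ 0]) simp
 next
  fix x y assume "x \<in> Es q" "y \<in> Es q"
  then obtain B1 B2 where "!!n. abs (b ((R ^^ n) q) (Dn n q x)) <= B1" "!!n. abs (b ((R ^^ n) q) (Dn n q y)) <= B2"
   unfolding Es_bounded[OF assms] by blast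
  then show "x + y \<in> Es q"
   unfolding Es_bounded[OF assms] using linear_add[OF lin]
   by (intro exI[of _ "B1 + B2"]) (auto intro: order_trans[OF abs_triangle_ineq] add_mono)
 next
  fix c x assume "x \<in> Es q"
  then obtain B1 where "!!n. abs (b ((R ^^ n) q) (Dn n q x)) <= B1"
   unfolding Es_bounded[OF assms] by blast
  then show "c *\<^sub>R x \<in> Es q"
   unfolding Es_bounded[OF assms] using linear_scale[OF lin]
   by (intro exI[of _ "abs c*B1"]) (auto simp: abs_mult intro!: mult_left_mono)
 qed
qed

lemma Es_invariant: assumes "q \<in> K" shows "D q ` Es q = Es (R q)"
proof (intro equalityI subsetI)
 fix w assume "w \<in> D q ` Es q"
 then obtain v where "w = D q v" "v \<in> Es q" by blast
 then obtain B where v: "w = D q v" "!!n. abs (b ((R ^^ n) q) (Dn n q v)) <= B"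
  unfolding Es_bounded[OF assms] by blast
 show "w \<in> Es (R q)"
  unfolding Es_bounded[OF R_in[OF assms]]
  using v(2)[of "Suc _"] unfolding v(1) Dn_shift by (auto simp: funpow_swap1)
next
 fix w assume w: "w \<in> Es (R q)"
 have "surj (D q)"
  using linear_injective_imp_surjective D_lin[OF assms] D_inj[OF assms] by blast
 then obtain v where v: "w = D q v" by blast
 obtain B where B: "!!n. abs (b ((R ^^ n) (R q)) (Dn n (R q) w)) <= B"
  using w unfolding Es_bounded[OF R_in[OF assms]] by blast
 have "abs (b ((R ^^ n) q) (Dn n q v)) <= max B (abs (b q v))" for n
 proof (cases n)
  case (Suc m)
  have "(R ^^ Suc m) q = (R ^^ m) (R q)" by (simp add: funpow_swap1)
  then show ?thesis using B[of m] unfolding Suc Dn_shift v by (simp add: le_max_iff_disj)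
 qed simp
 then have "v \<in> Es q" unfolding Es_bounded[OF assms] by blast
 then show "w \<in> D q ` Es q" using v by blast
qed

text \<open>A unit vector whose \<open>n\<close>-th image is annihilated by \<open>b\<close> has all
  images up to time \<open>n\<close> in the cone, by pull-back invariance. A limit of such vectors
  for growing \<open>n\<close> exists by compactness of the circle and satisfies all cone
  conditions.\<close>

lemma Es_nontrivial: assumes "q \<in> K" shows "\<exists>v\<in>Es q. v ~= 0"
proof -
 have "\<exists>v. norm v = 1 & b ((R ^^ n) q) (Dn n q v) = 0" for n
 proof -
  let ?f = "b ((R ^^ n) q)"
  have lf: "linear ?f" by (rule b_lin[OF Rn_in[OF assms]])
  obtain u :: "real \<times> real" where u: "u ~= 0" "?f u = 0"
  proof (cases "?f (1, 0) = 0")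
   case True show ?thesis by (rule that[of "(1,0)"]) (use True in \<open>auto simp: zero_prod_def\<close>)
  next
   case False
   have "?f (- ?f (0,1) *\<^sub>R (1,0) + ?f (1,0) *\<^sub>R (0,1)) = 0"
    unfolding linear_add[OF lf] linear_scale[OF lf] by simp
   moreover have "- ?f (0,1) *\<^sub>R (1,0) + ?f (1,0) *\<^sub>R (0,1) ~= (0 :: real \<times> real)"
    using False by (simp add: zero_prod_def)
   ultimately show ?thesis using that by blast
  qed
  have "surj (Dn n q)"
   using linear_injective_imp_surjective Dn_linear[OF assms] Dn_inj[OF assms] by blast
  then obtain v where v: "u = Dn n q v" by blast
  have l0: "linear (Dn n q)" by (rule Dn_linear[OF assms])
  have v0: "v ~= 0" using u v linear_0[OF l0] by auto
  have "?f (Dn n q ((1/norm v) *\<^sub>R v)) = 0"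
   using linear_scale[OF l0] linear_scale[OF lf] u v by simp
  then show ?thesis using v0 by (intro exI[of _ "(1/norm v) *\<^sub>R v"]) simp
 qed
 then obtain V where V: "!!n. norm (V n) = 1" "!!n. b ((R ^^ n) q) (Dn n q (V n)) = 0" by metis
 have cone: "k <= n ==> abs (b ((R ^^ k) q) (Dn k q (V n))) <= abs (a ((R ^^ k) q) (Dn k q (V n)))" for k n
 proof (induction k rule: inc_induct)
  case base then show ?case using V(2)[of n] by simp
 next
  case (step k)
  have "abs (b ((R ^^ k) q) (Dn k q (V n))) <= \<theta>*abs (a ((R ^^ k) q) (Dn k q (V n)))"
   using stable_cone(2)[OF Rn_in[OF assms], of k "Dn k q (V n)"] step by simp
  also have "... <= 1*abs (a ((R ^^ k) q) (Dn k q (V n)))" using th by (intro mult_right_mono) auto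
  finally show ?case by simp
 qed
 have "compact (sphere (0::real \<times> real) 1)" by simp
 then obtain l r where lr: "l \<in> sphere 0 1" "strict_mono r" "(V \<circ> r) \<longlonglongrightarrow> l"
  using V(1) unfolding compact_def by (metis mem_sphere dist_0_norm)
 have "abs (b ((R ^^ k) q) (Dn k q l)) <= abs (a ((R ^^ k) q) (Dn k q l))" for k
 proof (rule LIMSEQ_le)
  have cb: "continuous_on UNIV (%v. b ((R ^^ k) q) (Dn k q v))"
   using linear_compose[OF Dn_linear[OF assms] b_lin[OF Rn_in[OF assms]], of k k]
   by (simp add: o_def linear_continuous_on linear_linear)
  have ca: "continuous_on UNIV (%v. a ((R ^^ k) q) (Dn k q v))"
   using linear_compose[OF Dn_linear[OF assms] a_lin[OF Rn_in[OF assms]], of k k]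
   by (simp add: o_def linear_continuous_on linear_linear)
  show "(%i. abs (b ((R ^^ k) q) (Dn k q ((V \<circ> r) i)))) \<longlonglongrightarrow> (abs (b ((R ^^ k) q) (Dn k q l)))"
   by (intro tendsto_rabs continuous_on_tendsto_compose[OF cb lr(3)]) auto
  show "(%i. abs (a ((R ^^ k) q) (Dn k q ((V \<circ> r) i)))) \<longlonglongrightarrow> (abs (a ((R ^^ k) q) (Dn k q l)))"
   by (intro tendsto_rabs continuous_on_tendsto_compose[OF ca lr(3)]) auto
  show "\<exists>N. \<forall>n\<ge>N. abs (b ((R ^^ k) q) (Dn k q ((V \<circ> r) n))) <= abs (a ((R ^^ k) q) (Dn k q ((V \<circ> r) n)))"
   using cone order_trans[OF _ seq_suble[OF lr(2)]] by (intro exI[of _ k]) auto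
 qed
 then have "l \<in> Es q" by (simp add: Es_def)
 moreover have "l ~= 0" using lr(1) by auto
 ultimately show ?thesis by blast
qed

lemma Es_norm_decay:
 assumes "q \<in> K" "v \<in> Es q"
 shows "norm (Dn n q v) <= C*C*\<theta> ^ n*norm v"
proof -
 have "0 <= max (abs (a q (1,0))) (abs (b q (1,0)))" by simp
 then have C: "0 <= C" using le_norm[OF assms(1), of "(1,0)"] by auto
 have "norm (Dn n q v) <= C*max (abs (a ((R ^^ n) q) (Dn n q v))) (abs (b ((R ^^ n) q) (Dn n q v)))"
  by (rule norm_le[OF Rn_in[OF assms(1)]])
 also have "... = C*abs (a ((R ^^ n) q) (Dn n q v))" using assms(2) by (simp add: Es_def max_absorb1)
 also have "... <= C*(\<theta> ^ n*abs (a q v))" using Es_decay[OF assms] C by (intro mult_left_mono)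
 also have "... <= C*(\<theta> ^ n*(C*norm v))"
  using le_norm[OF assms(1), of v] C th by (intro mult_left_mono) auto
 finally show ?thesis by (simp add: mult_ac)
qed

end


text \<open>The hypotheses of \<open>cross_cocycle\<close> are symmetric under time reversal with
  \<open>a\<close> and \<open>b\<close> exchanged. So the unstable bundle is obtained as the stable
  bundle of the inverse cocycle, by a second interpretation of the same locale.\<close>

lemma uniformly_hyperbolicI:
 fixes K :: "(real \<times> real) set"
 assumes cc: "cross_cocycle K R D a b \<theta> C"
  and RK: "R ` K = K" and inj: "inj_on R K"
  and der: "!!q. q \<in> K ==> (R has_derivative D q) (at q)"
 shows "uniformly_hyperbolic R K"
proof -
 interpret cross_cocycle K R D a b \<theta> C by (rule cc)
 define S where "S = inv_into K R"
 have S_in: "S q \<in> K" and RS: "R (S q) = q" if "q \<in> K" for q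
  using that RK unfolding S_def by (metis inv_into_into, metis f_inv_into_f)
 have SR: "S (R q) = q" if "q \<in> K" for q
  using that inj unfolding S_def by simp
 define Di where "Di q = inv (D (S q))" for q
 have D_surj: "surj (D q)" if "q \<in> K" for q
  using linear_injective_imp_surjective D_lin[OF that] D_inj[OF that] by blast
 have DDi: "D (S q) (Di q v) = v" if "q \<in> K" for q v
  unfolding Di_def by (rule surj_f_inv_f[OF D_surj[OF S_in[OF that]]])
 have DiD: "Di (R q) (D q v) = v" if "q \<in> K" for q v
  unfolding Di_def SR[OF that] by (rule inv_f_f[OF D_inj[OF that]])
 interpret B: cross_cocycle K S Di b a \<theta> C
 proof (rule cross_cocycle.intro)
  fix q assume q: "q \<in> K"
  show "S q \<in> K" by (rule S_in[OF q])
  have Dq: "linear (D (S q))" "inj (D (S q))" using D_lin D_inj S_in[OF q] by blast+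
  show "linear (Di q)" unfolding Di_def
   by (rule inj_linear_imp_inv_linear[OF Dq])
  show "inj (Di q)" unfolding Di_def by (rule surj_imp_inj_inv[OF D_surj[OF S_in[OF q]]])
  show "linear (b q)" "linear (a q)" using a_lin b_lin q by blast+
  fix v
  show "abs (a q v) <= \<theta>*max (abs (b q v)) (abs (a (S q) (Di q v)))"
   using cross_a[OF S_in[OF q], of "Di q v"] by (simp add: RS[OF q] DDi[OF q] max.commute)
  show "abs (b (S q) (Di q v)) <= \<theta>*max (abs (b q v)) (abs (a (S q) (Di q v)))"
   using cross_b[OF S_in[OF q], of "Di q v"] by (simp add: RS[OF q] DDi[OF q] max.commute)
  show "norm v <= C*max (abs (b q v)) (abs (a q v))" "max (abs (b q v)) (abs (a q v)) <= C*norm v"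
   using norm_le[OF q, of v] le_norm[OF q, of v] by (simp_all add: max.commute)
 qed (use th in auto)
 have Dn_der: "((R ^^ n) has_derivative Dn n q) (at q)" if q: "q \<in> K" for n q
 proof (induction n)
  case 0 then show ?case by (simp add: id_def)
 next
  case (Suc n)
  have "(R \<circ> (R ^^ n) has_derivative D ((R ^^ n) q) \<circ> Dn n q) (at q)"
   by (rule diff_chain_at[OF Suc der[OF Rn_in[OF q]]])
  then show ?case by (simp add: o_def)
 qed
 have frD: "frechet_derivative (R ^^ n) (at q) = Dn n q" if "q \<in> K" for n q
  using frechet_derivative_at[OF Dn_der[OF that]] by simp
 have frD1: "frechet_derivative R (at q) = D q" if "q \<in> K" for q
  using frechet_derivative_at[OF der[OF that]] by simp
 have Eu_fwd: "D q ` B.Es q = B.Es (R q)" if q: "q \<in> K" for q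
 proof -
  have "Di (R q) ` B.Es (R q) = B.Es q"
   using B.Es_invariant[OF R_in[OF q]] SR[OF q] by simp
  then have "D q ` B.Es q = D q ` Di (R q) ` B.Es (R q)" by simp
  also have "... = (%v. v) ` B.Es (R q)"
   unfolding image_image using DDi[OF R_in[OF q]] SR[OF q] by simp
  finally show ?thesis by simp
 qed
 \<comment> \<open>The inverse cocycle undoes the forward one; this turns decay under
   \<open>B.Dn\<close> into expansion under \<open>Dn\<close>.\<close>
 have ret: "(S ^^ n) ((R ^^ n) q) = q & B.Dn n ((R ^^ n) q) (Dn n q v) = v" if q: "q \<in> K" for n q v
 proof (induction n)
  case (Suc n)
  have 1: "S ((R ^^ Suc n) q) = (R ^^ n) q" using SR[OF Rn_in[OF q]] by simp
  have 2: "Di ((R ^^ Suc n) q) (Dn (Suc n) q v) = Dn n q v"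
   using DiD[OF Rn_in[OF q], of n "Dn n q v"] by simp
  show ?case unfolding B.Dn_shift 1 2 using Suc 1 by (simp add: funpow_swap1)
 qed simp
 have Dn_Eu: "Dn n q v \<in> B.Es ((R ^^ n) q)" if q: "q \<in> K" and v: "v \<in> B.Es q" for n q v
 proof (induction n)
  case (Suc n) then show ?case using Eu_fwd[OF Rn_in[OF q], of n] by auto
 qed (use v in simp)
 have "0 <= C" if "q \<in> K" for q
 proof -
  have "0 <= max (abs (a q (1,0))) (abs (b q (1,0)))" by simp
  then show "0 <= C" using le_norm[OF that, of "(1,0)"] by auto
 qed
 \<comment> \<open>The definition asks for a positive constant even if \<open>K\<close> is empty,
   where nothing is known of \<open>C\<close>; hence the summand 1.\<close>
 then have C: "C*C <= 1 + C*C" "0 < 1 + C*C" by (auto simp: add_pos_nonneg)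
 have split: "Es q \<inter> B.Es q = {0} & (\<forall>v. \<exists>s\<in>Es q. \<exists>u\<in>B.Es q. v = s + u)" if q: "q \<in> K" for q
 proof -
  have sub: "subspace (Es q)" "subspace (B.Es q)" using Es_subspace[OF q] B.Es_subspace[OF q] by auto
  \<comment> \<open>On the intersection each of \<open>a\<close> and \<open>b\<close> is at most
    \<open>\<theta>\<close> times the other, so both vanish.\<close>
  have int: "v = 0" if v: "v \<in> Es q" "v \<in> B.Es q" for v
  proof -
   have ab: "abs (b q v) <= \<theta>*abs (a q v)" "abs (a q v) <= \<theta>*abs (b q v)"
    using Es_strict[OF q v(1)] B.Es_strict[OF q v(2)] by auto
   have "(1 - \<theta>)*(abs (a q v) + abs (b q v)) <= 0" using ab by (simp add: algebra_simps)
   then have "abs (a q v) + abs (b q v) <= 0" using th by (simp add: mult_le_0_iff)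
   then have "abs (a q v) = 0" "abs (b q v) = 0" by auto
   then show "v = 0" using norm_le[OF q, of v] by simp
  qed
  obtain s u where su: "s \<in> Es q" "s ~= 0" "u \<in> B.Es q" "u ~= 0"
   using Es_nontrivial[OF q] B.Es_nontrivial[OF q] by blast
  have nonpar: "fst s * snd u - snd s*fst u ~= 0"
  proof
   assume "fst s * snd u - snd s*fst u = 0"
   then have e: "fst s * snd u = snd s*fst u" by simp
   have "\<exists>c. u = c *\<^sub>R s"
   proof (cases "fst s = 0")
    case True
    then have "snd s ~= 0" using su(2) by (simp add: prod_eq_iff)
    then show ?thesis using True e by (intro exI[of _ "snd u/snd s"]) (auto simp: prod_eq_iff)
   next
    case False
    then show ?thesis using e by (intro exI[of _ "fst u/fst s"]) (auto simp: prod_eq_iff field_simps)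
   qed
   then have "u \<in> Es q" using su(1) sub(1) by (auto intro: subspace_scale)
   then show False using int su by blast
  qed
  have "\<exists>s'\<in>Es q. \<exists>u'\<in>B.Es q. v = s' + u'" for v
  proof -
   \<comment> \<open>Cramer's rule for the decomposition along the two independent vectors
     \<open>s\<close> and \<open>u\<close>.\<close>
   let ?d = "fst s * snd u - snd s*fst u"
   let ?x = "(fst v * snd u - snd v * fst u) / ?d" and ?y = "(fst s * snd v - snd s*fst v) / ?d"
   have "?x*fst s + ?y*fst u = fst v * ?d / ?d" unfolding times_divide_eq_left add_divide_distrib[symmetric]
    by (rule arg_cong[of _ _ "%x. x / ?d"]) algebra
   moreover have "?x * snd s + ?y * snd u = snd v * ?d / ?d" unfolding times_divide_eq_left add_divide_distrib[symmetric]
    by (rule arg_cong[of _ _ "%x. x / ?d"]) algebra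
   ultimately have "v = ?x *\<^sub>R s + ?y *\<^sub>R u" using nonpar by (simp add: prod_eq_iff)
   then show ?thesis using su sub by (blast intro: subspace_scale)
  qed
  then show ?thesis using int sub by (auto dest: subspace_0)
 qed
 show ?thesis
  unfolding uniformly_hyperbolic_def
 proof (rule exI[of _ Es], rule exI[of _ B.Es], rule exI[of _ "1 + C*C"], rule exI[of _ \<theta>],
   intro conjI ballI allI impI)
  fix q assume q: "q \<in> K"
  show "R differentiable (at q)" using der[OF q] by (auto simp: differentiable_def)
  show "subspace (Es q)" "subspace (B.Es q)" using Es_subspace[OF q] B.Es_subspace[OF q] by auto
  show "Es q \<inter> B.Es q = {0}" using split[OF q] by blast
  show "\<exists>s\<in>Es q. \<exists>u\<in>B.Es q. v = s + u" for v using split[OF q] by blast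
  show "frechet_derivative R (at q) ` Es q = Es (R q)" "frechet_derivative R (at q) ` B.Es q = B.Es (R q)"
   unfolding frD1[OF q] by (rule Es_invariant[OF q], rule Eu_fwd[OF q])
  fix n v
  show "norm (frechet_derivative (R ^^ n) (at q) v) <= (1 + C*C)*\<theta> ^ n*norm v" if "v \<in> Es q"
   unfolding frD[OF q] using Es_norm_decay[OF q that, of n] C th
   by (elim order_trans) (intro mult_right_mono, auto)
  show "norm v <= (1 + C*C)*\<theta> ^ n*norm (frechet_derivative (R ^^ n) (at q) v)" if "v \<in> B.Es q"
  proof -
   have "norm v <= C*C*\<theta> ^ n*norm (Dn n q v)"
    using B.Es_norm_decay[OF Rn_in[OF q] Dn_Eu[OF q that], of n n] ret[OF q] by simp
   then show ?thesis unfolding frD[OF q] using C th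
    by (elim order_trans) (intro mult_right_mono, auto)
  qed
 qed (use th C in auto)
qed

section \<open>Orbits coded by symbol sequences\<close>

text \<open>The iterates of 0 converge in every coordinate at the common rate
  \<open>\<theta> ^ n*kp\<close>. It is this uniformity over the index that allows the limit to be
  inserted into \<open>F\<close>, which may look at all coordinates.\<close>

lemma sup_contraction_fixpoint:
 fixes F :: "('i => real) => 'i => real"
 assumes th: "0 <= \<theta>" "\<theta> < 1"
  and self: "!!u i. (!!i. abs (u i) <= kp) ==> abs (F u i) <= kp"
  and lip: "!!u v c i. (!!i. abs (u i) <= kp) ==> (!!i. abs (v i) <= kp) ==> (!!i. abs (u i - v i) <= c) ==>
    abs (F u i - F v i) <= \<theta>*c"
  and k: "0 <= kp"
 shows "\<exists>u. (\<forall>i. abs (u i) <= kp) & F u = u"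
proof -
 define x where "x n = (F ^^ n) (%_. 0)" for n
 have xb: "abs (x n i) <= kp" for n i
  by (induction n arbitrary: i) (auto simp: x_def k intro: self)
 have d: "abs (x n i - x (n + m) i) <= \<theta> ^ n*kp" for n m i
 proof (induction n arbitrary: i)
  case 0 show ?case using xb[of m i] by (simp add: x_def)
 next
  case (Suc n)
  have "abs (F (x n) i - F (x (n + m)) i) <= \<theta>*(\<theta> ^ n*kp)"
   by (rule lip[OF xb xb Suc])
  then show ?case by (simp add: x_def)
 qed
 have lim0: "(%n. \<theta> ^ n*kp) \<longlonglongrightarrow> 0"
  using tendsto_mult_left_zero[OF LIMSEQ_power_zero[of \<theta>]] th by simp
 have "Cauchy (%n. x n i)" for i
 proof (rule metric_CauchyI)
  fix e :: real assume "0 < e"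
  then obtain M where M: "!!n. n \<ge> M ==> \<theta> ^ n*kp < e"
   using order_tendstoD(2)[OF lim0, of e] by (auto simp: eventually_sequentially)
  have "abs (x m i - x n i) < e" if "M <= m" "m <= n" for m n
   using d[of m i "n - m"] M[of m] that by simp
  then show "\<exists>M. \<forall>m\<ge>M. \<forall>n\<ge>M. dist (x m i) (x n i) < e"
   unfolding dist_real_def by (metis abs_minus_commute linear)
 qed
 then have "\<exists>l. (%n. x n i) \<longlonglongrightarrow> l" for i by (simp add: Cauchy_convergent_iff convergent_def)
 then obtain u where u: "!!i. (%n. x n i) \<longlonglongrightarrow> u i" by metis
 have ub: "abs (u i) <= kp" for i
  by (rule LIMSEQ_le_const2[OF tendsto_rabs[OF u]]) (use xb in auto)
 have du: "abs (x n i - u i) <= \<theta> ^ n*kp" for n i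
 proof (rule LIMSEQ_le_const2)
  show "(%m. abs (x n i - x (m + n) i)) \<longlonglongrightarrow> (abs (x n i - u i))"
   by (intro tendsto_intros LIMSEQ_ignore_initial_segment[OF u])
  show "\<exists>N. \<forall>m\<ge>N. abs (x n i - x (m + n) i) <= \<theta> ^ n*kp"
   using d[of n i] by (simp add: add.commute)
 qed
 have "F u i = u i" for i
 proof -
  have e: "abs (x (Suc n) i - F u i) <= \<theta>*(\<theta> ^ n*kp)" for n
   using lip[OF xb ub du[of n]] by (simp add: x_def)
  have "(%n. x (Suc n) i - F u i) \<longlonglongrightarrow> 0"
   by (rule tendsto_0_le[OF tendsto_mult_right_zero[OF lim0, of \<theta>], of _ 1])
    (use e in \<open>auto simp: abs_mult k th\<close>)
  then have "(%n. x (Suc n) i) \<longlonglongrightarrow> F u i" by (simp add: LIM_zero_iff)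
  then show ?thesis using LIMSEQ_unique[OF _ LIMSEQ_Suc[OF u]] by blast
 qed
 then show ?thesis using ub by blast
qed

text \<open>The unknowns are the rescaled entry angle \<open>p\<close>, exit angle \<open>s\<close>
  and height \<open>z\<close>; only \<open>Fz\<close> also sees the next \<open>p'\<close> and
  \<open>s'\<close>. The strict bounds keep solutions off the boundary of the cube, so that they can
  later be compared with all nearby points. The common bound \<open>c\<close> in the Lipschitz
  conditions stands for a sup norm over whole sequences.\<close>

locale cross_form =
 fixes Fp Fs :: "nat => real => real => real => real"
  and Fz :: "nat => nat => real => real => real => real => real => real" and kp \<theta> :: real
 assumes th: "0 < \<theta>" "\<theta> < 1" and kappa: "0 < kp"
  and p_le: "!!b p s z. b < 2 ==> abs p <= kp ==> abs s <= kp ==> abs z <= kp ==> abs (Fp b p s z) < kp"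
  and s_le: "!!b p s z. b < 2 ==> abs p <= kp ==> abs s <= kp ==> abs z <= kp ==> abs (Fs b p s z) < kp"
  and z_le: "!!b b' p s z p' s'. b < 2 ==> b' < 2 ==> abs p <= kp ==> abs s <= kp ==> abs z <= kp ==> abs p' <= kp ==> abs s' <= kp ==>
    abs (Fz b b' p s z p' s') < kp"
  and p_lip: "!!b p s z q t w c. b < 2 ==> abs p <= kp ==> abs s <= kp ==> abs z <= kp ==> abs q <= kp ==> abs t <= kp ==> abs w <= kp ==>
    abs (p - q) <= c ==> abs (s - t) <= c ==> abs (z - w) <= c ==> abs (Fp b p s z - Fp b q t w) <= \<theta>*c"
  and s_lip: "!!b p s z q t w c. b < 2 ==> abs p <= kp ==> abs s <= kp ==> abs z <= kp ==> abs q <= kp ==> abs t <= kp ==> abs w <= kp ==>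
    abs (p - q) <= c ==> abs (s - t) <= c ==> abs (z - w) <= c ==> abs (Fs b p s z - Fs b q t w) <= \<theta>*c"
  and z_lip: "!!b b' p s z p' s' q t w q' t' c. b < 2 ==> b' < 2 ==> abs p <= kp ==> abs s <= kp ==> abs z <= kp ==> abs p' <= kp ==> abs s' <= kp ==>
    abs q <= kp ==> abs t <= kp ==> abs w <= kp ==> abs q' <= kp ==> abs t' <= kp ==>
    abs (p - q) <= c ==> abs (s - t) <= c ==> abs (z - w) <= c ==> abs (p' - q') <= c ==> abs (s' - t') <= c ==>
    abs (Fz b b' p s z p' s' - Fz b b' q t w q' t') <= \<theta>*c"
begin

definition step :: "nat => real => real => real => nat => real => real => bool" where
 "step b p s z b' p' s' \<longleftrightarrow> p' = Fp b p s z & s = Fs b p s z & z = Fz b b' p s z p' s'"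

definition sol :: "(int => nat) => (int => real) => (int => real) => (int => real) => bool" where
 "sol \<omega> p s z \<longleftrightarrow> (\<forall>j. \<omega> j < 2 & abs (p j) < kp & abs (s j) < kp & abs (z j) < kp &
   step (\<omega> j) (p j) (s j) (z j) (\<omega> (j + 1)) (p (j + 1)) (s (j + 1)))"

lemma sol_exists:
 assumes om: "!!j. \<omega> j < 2"
 shows "\<exists>p s z. sol \<omega> p s z"
proof -
 \<comment> \<open>Three sequences become one family: second index 0 for \<open>p\<close>, 1 for
   \<open>s\<close>, every other one for \<open>z\<close>. As \<open>p\<close> is produced by the
   preceding point, its formula is shifted by one.\<close>
 define F :: "(int \<times> nat => real) => int \<times> nat => real" where
  "F u = (%(j, k). if k = 0 then Fp (\<omega> (j - 1)) (u (j - 1, 0)) (u (j - 1, 1)) (u (j - 1, 2))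
    else if k = 1 then Fs (\<omega> j) (u (j, 0)) (u (j, 1)) (u (j, 2))
    else Fz (\<omega> j) (\<omega> (j + 1)) (u (j, 0)) (u (j, 1)) (u (j, 2)) (u (j + 1, 0)) (u (j + 1, 1)))" for u
 have "\<exists>u. (\<forall>i. abs (u i) <= kp) & F u = u"
 proof (rule sup_contraction_fixpoint[where \<theta> = \<theta>])
  fix u :: "int \<times> nat => real" and i assume "!!i. abs (u i) <= kp"
  then show "abs (F u i) <= kp"
   unfolding F_def by (auto simp: om split: prod.splits intro!: p_le[THEN less_imp_le] s_le[THEN less_imp_le] z_le[THEN less_imp_le])
 next
  fix u v :: "int \<times> nat => real" and c i assume "!!i. abs (u i) <= kp" "!!i. abs (v i) <= kp" "!!i. abs (u i - v i) <= c"
  then show "abs (F u i - F v i) <= \<theta>*c"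
   unfolding F_def by (auto simp: om split: prod.splits intro!: p_lip s_lip z_lip)
 qed (use th kappa in auto)
 then obtain u where u: "!!i. abs (u i) <= kp" "F u = u" by blast
 have e: "u (j + 1, 0) = Fp (\<omega> j) (u (j, 0)) (u (j, 1)) (u (j, 2))"
  "u (j, 1) = Fs (\<omega> j) (u (j, 0)) (u (j, 1)) (u (j, 2))"
  "u (j, 2) = Fz (\<omega> j) (\<omega> (j + 1)) (u (j, 0)) (u (j, 1)) (u (j, 2)) (u (j + 1, 0)) (u (j + 1, 1))" for j
  using fun_cong[OF u(2), of "(j + 1, 0)"] fun_cong[OF u(2), of "(j, 1)"] fun_cong[OF u(2), of "(j, 2)"]
  by (simp_all add: F_def)
 have "abs (u (j + 1, 0)) < kp" "abs (u (j, 1)) < kp" "abs (u (j, 2)) < kp" for j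
  by (subst e; intro p_le s_le z_le om u(1))+
 from this(1)[of "_ - 1"] this(2,3) have "sol \<omega> (%j. u (j, 0)) (%j. u (j, 1)) (%j. u (j, 2))"
  unfolding sol_def step_def using om e by simp
 then show ?thesis by blast
qed

text \<open>Each use of the three equations reaches at most one index to either side and gains a
  factor \<open>\<theta>\<close>, so \<open>N\<close> common symbols on each side are worth
  \<open>\<theta> ^ N\<close>. Uniqueness and continuity in the product topology both follow from
  this.\<close>

lemma sol_agree:
 assumes "sol \<omega> p s z" "sol \<omega>' p' s' z'" "!!j. abs (j - i) <= int N ==> \<omega> j = \<omega>' j"
 shows "abs (p i - p' i) <= \<theta> ^ N*(2*kp) & abs (s i - s' i) <= \<theta> ^ N*(2*kp) & abs (z i - z' i) <= \<theta> ^ N*(2*kp)"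
 using assms(3)
proof (induction N arbitrary: i)
 case 0
 have "abs (p i) < kp & abs (s i) < kp & abs (z i) < kp & abs (p' i) < kp & abs (s' i) < kp & abs (z' i) < kp"
  using assms(1,2) unfolding sol_def by auto
 then show ?case
  using abs_triangle_ineq4[of "p i" "p' i"] abs_triangle_ineq4[of "s i" "s' i"] abs_triangle_ineq4[of "z i" "z' i"]
  unfolding power_0 mult_1 by (auto simp only: abs_triangle_ineq4 intro: order_trans add_mono less_imp_le)
next
 case (Suc N)
 have B: "abs (p j) <= kp" "abs (s j) <= kp" "abs (z j) <= kp" "abs (p' j) <= kp" "abs (s' j) <= kp" "abs (z' j) <= kp" for j
  using assms(1,2) unfolding sol_def by (auto intro: less_imp_le)
 have I0: "abs (p i - p' i) <= \<theta> ^ N*(2*kp) & abs (s i - s' i) <= \<theta> ^ N*(2*kp) & abs (z i - z' i) <= \<theta> ^ N*(2*kp)"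
  by (rule Suc.IH) (auto intro: Suc.prems)
 have I1: "abs (p (i+1) - p' (i+1)) <= \<theta> ^ N*(2*kp) & abs (s (i+1) - s' (i+1)) <= \<theta> ^ N*(2*kp) & abs (z (i+1) - z' (i+1)) <= \<theta> ^ N*(2*kp)"
  by (rule Suc.IH) (auto intro: Suc.prems)
 have I2: "abs (p (i-1) - p' (i-1)) <= \<theta> ^ N*(2*kp) & abs (s (i-1) - s' (i-1)) <= \<theta> ^ N*(2*kp) & abs (z (i-1) - z' (i-1)) <= \<theta> ^ N*(2*kp)"
  by (rule Suc.IH) (auto intro: Suc.prems)
 have o: "\<omega>' i = \<omega> i" "\<omega>' (i + 1) = \<omega> (i + 1)" "\<omega>' (i - 1) = \<omega> (i - 1)" using Suc.prems by auto
 have st: "step (\<omega> j) (p j) (s j) (z j) (\<omega> (j + 1)) (p (j + 1)) (s (j + 1))"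
   "step (\<omega>' j) (p' j) (s' j) (z' j) (\<omega>' (j + 1)) (p' (j + 1)) (s' (j + 1))" "\<omega> j < 2" for j
  using assms(1,2) unfolding sol_def by auto
 have "p i = Fp (\<omega> (i-1)) (p (i-1)) (s (i-1)) (z (i-1))" "p' i = Fp (\<omega> (i-1)) (p' (i-1)) (s' (i-1)) (z' (i-1))"
  using st(1,2)[of "i - 1"] o by (auto simp: step_def)
 then have 1: "abs (p i - p' i) <= \<theta>*(\<theta> ^ N*(2*kp))"
  using p_lip[of "\<omega> (i-1)" "p (i-1)" "s (i-1)" "z (i-1)" "p' (i-1)" "s' (i-1)" "z' (i-1)"] I2 st(3) B by simp
 have "s i = Fs (\<omega> i) (p i) (s i) (z i)" "s' i = Fs (\<omega> i) (p' i) (s' i) (z' i)"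
  using st(1,2)[of i] o by (auto simp: step_def)
 then have 2: "abs (s i - s' i) <= \<theta>*(\<theta> ^ N*(2*kp))"
  using s_lip[of "\<omega> i" "p i" "s i" "z i" "p' i" "s' i" "z' i"] I0 st(3) B by metis
 have "z i = Fz (\<omega> i) (\<omega> (i+1)) (p i) (s i) (z i) (p (i+1)) (s (i+1))"
    "z' i = Fz (\<omega> i) (\<omega> (i+1)) (p' i) (s' i) (z' i) (p' (i+1)) (s' (i+1))"
  using st(1,2)[of i] o by (auto simp: step_def)
 then have 3: "abs (z i - z' i) <= \<theta>*(\<theta> ^ N*(2*kp))"
  using z_lip[of "\<omega> i" "\<omega> (i+1)" "p i" "s i" "z i" "p (i+1)" "s (i+1)" "p' i" "s' i" "z' i" "p' (i+1)" "s' (i+1)"]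
   I0 I1 st(3) B by metis
 show ?case using 1 2 3 by (simp add: mult.assoc)
qed

lemma sol_unique:
 assumes "sol \<omega> p s z" "sol \<omega> p' s' z'"
 shows "p = p'" "s = s'" "z = z'"
proof -
 have lim: "(%N. \<theta> ^ N*(2*kp)) \<longlonglongrightarrow> 0"
  using tendsto_mult_left_zero[OF LIMSEQ_power_zero[of \<theta>]] th by simp
 note a = sol_agree[OF assms]
 have "abs (p i - p' i) <= 0 & abs (s i - s' i) <= 0 & abs (z i - z' i) <= 0" for i
  by (intro conjI LIMSEQ_le_const[OF lim]) (use a in blast)+
 then show "p = p'" "s = s'" "z = z'" by auto
qed

lemma sol_shift: "sol \<omega> p s z ==> sol (%j. \<omega> (j + i)) (%j. p (j + i)) (%j. s (j + i)) (%j. z (j + i))"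
 unfolding sol_def by (intro allI, drule spec[of _ "_ + i"]) (simp add: add.assoc add.commute[of 1])

definition points :: "(nat => real => real => 'a) => 'a set" where
 "points Pt = {Pt (\<omega> 0) (p 0) (s 0) | \<omega> p s z. sol \<omega> p s z}"

text \<open>The coding runs from sequences to points. A point determines its symbol at 0 by
  \<open>symb\<close> and the other symbols through its orbit, backwards by injectivity of
  \<open>R\<close>. Continuity comes from \<open>sol_agree\<close>, and a continuous bijection from
  a compact space onto a Hausdorff space is a homeomorphism.\<close>

lemma full_shift_conjugacy:
 fixes Pt :: "nat => real => real => 'a::metric_space"
 assumes cont: "!!b. b < 2 ==> continuous_on ({-kp<..<kp} \<times> {-kp<..<kp}) (%(p, s). Pt b p s)"
  and symb: "!!b b' p s p' s'. b < 2 ==> b' < 2 ==> abs p < kp ==> abs s < kp ==> abs p' < kp ==> abs s' < kp ==> Pt b p s = Pt b' p' s' ==> b = b'"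
  and R: "!!b b' p s z p' s'. b < 2 ==> b' < 2 ==> abs p < kp ==> abs s < kp ==> abs z < kp ==> abs p' < kp ==> abs s' < kp ==>
    step b p s z b' p' s' ==> R (Pt b p s) = Pt b' p' s'"
  and inj: "inj_on R (points Pt)"
 shows "compact (points Pt)" "R ` points Pt = points Pt" "conjugate_to_full_shift R (points Pt)"
proof -
 let ?X = "full_shift_space 2"
 have topX: "topspace ?X = {\<omega>. \<forall>j. \<omega> j < 2}"
  by (auto simp: full_shift_space_def PiE_def Pi_def)
 have "\<forall>\<omega>. \<exists>p s z. (\<forall>j. \<omega> j < 2) --> sol \<omega> p s z" using sol_exists by blast
 then obtain p s z where psz: "!!\<omega>. \<forall>j. \<omega> j < 2 ==> sol \<omega> (p \<omega>) (s \<omega>) (z \<omega>)" by metis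
 have sol2: "\<forall>j. \<omega> j < 2" if "sol \<omega> p s z" for \<omega> p s z using that by (auto simp: sol_def)
 define P where "P \<omega> = Pt (\<omega> 0) (p \<omega> 0) (s \<omega> 0)" for \<omega>
 have P_eq: "Pt (\<omega> 0) (p' 0) (s' 0) = P \<omega>" if "sol \<omega> p' s' z'" for \<omega> p' s' z'
  using sol_unique[OF that psz[OF sol2[OF that]]] by (simp add: P_def)
 have image: "P ` topspace ?X = points Pt"
  unfolding topX points_def using P_eq psz sol2 by (auto simp: image_iff P_def) blast
 have RP: "R (P \<omega>) = P (%j. \<omega> (j + 1))" if "\<forall>j. \<omega> j < 2" for \<omega>
 proof -
  note so = psz[OF that]
  have "R (P \<omega>) = Pt (\<omega> 1) (p \<omega> 1) (s \<omega> 1)"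
   unfolding P_def
   by (rule R[of "\<omega> 0" "\<omega> 1" "p \<omega> 0" "s \<omega> 0" "z \<omega> 0" "p \<omega> 1" "s \<omega> 1"])
    (use so[unfolded sol_def, rule_format, of 0] so[unfolded sol_def, rule_format, of 1] in auto)
  also have "... = P (%j. \<omega> (j + 1))" using P_eq[OF sol_shift[OF so, of 1]] by simp
  finally show ?thesis .
 qed
 have Pex: "\<exists>\<omega>. (\<forall>j. \<omega> j < 2) & x = P \<omega>" if "x \<in> points Pt" for x
  using that unfolding image[symmetric] topX by blast
 have Pin: "P \<omega> \<in> points Pt" if "\<forall>j. \<omega> j < 2" for \<omega> using image topX that by blast
 show RK: "R ` points Pt = points Pt"
 proof (intro equalityI subsetI)
  fix x assume "x \<in> R ` points Pt"
  then obtain \<omega> where "\<forall>j. \<omega> j < 2" "x = R (P \<omega>)" using Pex by blast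
  then show "x \<in> points Pt" using RP Pin by simp
 next
  fix x assume "x \<in> points Pt"
  then obtain \<omega> where o: "\<forall>j. \<omega> j < 2" "x = P \<omega>" using Pex by blast
  then have "x = R (P (%j. \<omega> (j - 1)))" using RP[of "%j. \<omega> (j - 1)"] by simp
  then show "x \<in> R ` points Pt" using Pin[of "%j. \<omega> (j - 1)"] o by blast
 qed
 have injP: "\<omega> = \<omega>'" if om: "\<forall>j. \<omega> j < 2" "\<forall>j. \<omega>' j < 2" "P \<omega> = P \<omega>'" for \<omega> \<omega>'
 proof -
  have A: "P (%j. \<omega> (j + i)) = P (%j. \<omega>' (j + i))" for i
  proof (induction i rule: int_induct[where k = 0])
   case base then show ?case using om by simp
  next
   case (step1 i)
   then show ?case using RP[of "%j. \<omega> (j + i)"] RP[of "%j. \<omega>' (j + i)"] om by (simp add: ac_simps)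
  next
   case (step2 i)
   have "R (P (%j. \<omega> (j + (i - 1)))) = R (P (%j. \<omega>' (j + (i - 1))))"
    using RP[of "%j. \<omega> (j + (i - 1))"] RP[of "%j. \<omega>' (j + (i - 1))"] om step2 by simp
   then show ?case using inj om by (auto dest!: inj_onD intro!: Pin)
  qed
  have B: "\<omega> 0 = \<omega>' 0" if om: "\<forall>j. \<omega> j < 2" "\<forall>j. \<omega>' j < 2" "P \<omega> = P \<omega>'" for \<omega> \<omega>'
   using that psz[OF om(1)] psz[OF om(2)] unfolding P_def sol_def
   by (intro symb[of "\<omega> 0" "\<omega>' 0" "p \<omega> 0" "s \<omega> 0" "p \<omega>' 0" "s \<omega>' 0"]) auto
  have "\<omega> i = \<omega>' i" for i
   using B[of "%j. \<omega> (j + i)" "%j. \<omega>' (j + i)"] A[of i] om(1,2) by simp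
  then show ?thesis by auto
 qed
 have compX: "compact_space ?X"
  unfolding full_shift_space_def by (intro compact_space_product_topology[THEN iffD2] disjI2 ballI)
   (simp add: compact_space_discrete_topology)
 have lim: "(%N. \<theta> ^ N*(2*kp)) \<longlonglongrightarrow> 0"
  using tendsto_mult_left_zero[OF LIMSEQ_power_zero[of \<theta>]] th by simp
 have contP: "continuous_map ?X euclidean P"
  unfolding continuous_map_eq_topcontinuous_at topcontinuous_at_def
 proof (intro ballI conjI allI impI)
  fix \<omega> V assume om: "\<omega> \<in> topspace ?X" and V: "openin euclidean V & P \<omega> \<in> V"
  then have om2: "\<forall>j. \<omega> j < 2" using topX by auto
  have in0: "(p \<omega> 0, s \<omega> 0) \<in> {-kp<..<kp} \<times> {-kp<..<kp}"
   using psz[OF om2] by (auto simp: sol_def abs_less_iff dest: spec[of _ 0])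
  have "isCont (%(p, s). Pt (\<omega> 0) p s) (p \<omega> 0, s \<omega> 0)"
   using cont[of "\<omega> 0"] om2 in0 by (simp add: continuous_on_eq_continuous_at open_Times)
  moreover have "(%(p, s). Pt (\<omega> 0) p s) (p \<omega> 0, s \<omega> 0) \<in> V" using V by (simp add: P_def)
  ultimately have "\<forall>\<^sub>F x in nhds (p \<omega> 0, s \<omega> 0). (%(p, s). Pt (\<omega> 0) p s) x \<in> V"
   using V unfolding isCont_def tendsto_def by (auto simp: eventually_at_filter elim: eventually_mono)
  then obtain e where e: "e > 0" "!!x. dist x (p \<omega> 0, s \<omega> 0) < e ==> (%(p, s). Pt (\<omega> 0) p s) x \<in> V"
   unfolding eventually_nhds_metric by blast
  obtain N where N: "\<theta> ^ N*(2*kp) < e/2"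
   using order_tendstoD(2)[OF lim, of "e/2"] e(1) by (auto simp: eventually_sequentially)
  \<comment> \<open>The cylinder that fixes the symbols up to distance \<open>N\<close>; each of the
    two coordinates then moves by less than \<open>e/2\<close>.\<close>
  define U where "U = (\<Pi>\<^sub>E j\<in>UNIV. if abs j <= int N then {\<omega> j} else {..<2::nat})"
  have "openin ?X U" unfolding full_shift_space_def U_def
  proof (rule product_topology_basis)
   show "openin (discrete_topology {..<2}) (if abs j <= int N then {\<omega> j} else {..<2})" for j
    using om2 by auto
   have "{j. (if abs j <= int N then {\<omega> j} else {..<2}) ~= topspace (discrete_topology {..<2::nat})} \<subseteq> {- int N..int N}"
    by (auto split: if_splits)
   then show "finite {j. (if abs j <= int N then {\<omega> j} else {..<2}) ~= topspace (discrete_topology {..<2::nat})}"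
    by (rule finite_subset) simp
  qed
  moreover have "\<omega> \<in> U" using om2 by (auto simp: U_def)
  moreover have "P \<omega>' \<in> V" if w: "\<omega>' \<in> U" for \<omega>'
  proof -
   have mem: "\<omega>' j \<in> (if abs j <= int N then {\<omega> j} else {..<2})" for j
    using w unfolding U_def by (rule PiE_mem) simp
   have ag: "\<omega>' j = \<omega> j" if "abs j <= int N" for j
    using mem[of j] that by simp
   have om': "\<omega>' j < 2" for j using mem[of j] om2 by (auto split: if_splits)
   have "abs (p \<omega>' 0 - p \<omega> 0) <= \<theta> ^ N*(2*kp) & abs (s \<omega>' 0 - s \<omega> 0) <= \<theta> ^ N*(2*kp)"
    using sol_agree[OF psz psz, of \<omega>' \<omega> 0 N] om' om2 ag by auto
   then have "norm ((p \<omega>' 0, s \<omega>' 0) - (p \<omega> 0, s \<omega> 0)) < e"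
    using norm_Pair_le[of "p \<omega>' 0 - p \<omega> 0" "s \<omega>' 0 - s \<omega> 0"] N by simp
   then show ?thesis using e(2)[of "(p \<omega>' 0, s \<omega>' 0)"] ag[of 0] by (simp add: P_def dist_norm)
  qed
  ultimately show "\<exists>U. openin ?X U & \<omega> \<in> U & (\<forall>y\<in>U. P y \<in> V)" by blast
 qed auto
 show "compact (points Pt)"
  using image_compactin[OF _ contP, of "topspace ?X"] compX image by (simp add: compact_space_def)
 have "homeomorphic_map ?X (top_of_set (points Pt)) P"
 proof (rule continuous_imp_homeomorphic_map)
  show "continuous_map ?X (top_of_set (points Pt)) P"
   using contP image by (auto simp: continuous_map_in_subtopology)
  show "inj_on P (topspace ?X)" using injP topX by (auto simp: inj_on_def)
  show "Hausdorff_space (top_of_set (points Pt))"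
   by (intro Hausdorff_space_subtopology Hausdorff_space_euclidean)
 qed (use compX image in auto)
 then obtain h where h: "homeomorphic_maps ?X (top_of_set (points Pt)) P h"
  by (auto simp: homeomorphic_map_maps)
 have "h (R x) = (%i. h x (i + 1))" if x: "x \<in> points Pt" for x
 proof -
  obtain \<omega> where o: "\<forall>j. \<omega> j < 2" "x = P \<omega>" using Pex x by blast
  have hP: "h (P \<omega>) = \<omega>" if "\<forall>j. \<omega> j < 2" for \<omega>
   using h that topX by (auto simp: homeomorphic_maps_def)
  show ?thesis using o RP[OF o(1)] hP[of "%j. \<omega> (j + 1)"] hP[OF o(1)] by simp
 qed
 then show "conjugate_to_full_shift R (points Pt)"
  unfolding conjugate_to_full_shift_def
  using homeomorphic_maps_map[THEN iffD1, OF homeomorphic_maps_sym[THEN iffD1, OF h]]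
  by (intro exI[of _ 2] conjI exI[of _ h]) auto
qed

end

section \<open>The horseshoe of one strip\<close>

lemma exp_diff_le:
 fixes x y :: real
 assumes "abs x <= 1" "abs y <= 1"
 shows "abs (exp x - exp y) <= 3*abs (x - y)"
proof -
 have "norm (exp x - exp y) <= 3*norm (x - y)"
 proof (rule field_differentiable_bound[of "{-1..1::real}" exp exp])
  fix z :: real assume "z \<in> {-1..1}"
  then have "exp z <= exp 1" by simp
  also have "... <= 3" by (rule exp_le)
  finally show "norm (exp z) <= 3" by simp
 qed (use assms in \<open>auto intro!: derivative_eq_intros\<close>)
 then show ?thesis by simp
qed

lemma abs4_le:
 fixes x y u v :: real
 assumes "abs x <= X" "abs y/abs D <= Y" "abs u/abs D <= U" "abs v/abs D <= V"
 shows "abs (- x - y/D - u/D + v/D) <= X + Y + U + V"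
 using assms unfolding abs_divide[symmetric] by linarith

lemma exp_le3: "abs x <= 1 ==> exp x <= (3::real)"
 using exp_le exp_le_cancel_iff[of x 1] by linarith

text \<open>\<open>g\<close> is the map from \<open>P\<close> to \<open>E\<close>; \<open>E\<close>
  is the passage of the equilibrium followed by the transition to \<open>P\<close>. \<open>Z\<close>
  and \<open>\<rho>s\<close> are the typical height at \<open>E\<close> and the typical
  \<open>\<rho>\<close>: \<open>aZ\<close> says that height \<open>Z\<close> leads back to the
  height \<open>\<epsilon>\<close> of the strip, and \<open>kss\<close> that the exit angles
  \<open>ss\<close> and \<open>- ss\<close> lead to height \<open>Z\<close>, both to leading order.
  Of the numerical conditions, \<open>num_s\<close>, \<open>num_z\<close>, \<open>num_p\<close>
  bound Lipschitz constants, and \<open>num_s0\<close>, \<open>num_z0\<close>, \<open>num_p0\<close>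
  bound values at the origin of the rescaled cube.\<close>

locale strip =
 fixes g E :: "real \<times> real => real \<times> real"
  and etc ete d1 A1 A2 k b22 y0 kp c \<epsilon> Z \<rho>s ss \<eta> B Cg Cl :: real
 assumes pos: "0 < etc" "0 < ete" "0 < d1" "0 < A2" "k ~= 0" "0 < y0" "0 < kp" "kp <= 1/16" "0 < c" "0 < \<epsilon>" "0 < Z"
   "0 < \<rho>s" "0 < ss" "0 <= \<eta>" "0 <= B" "0 <= Cg" "0 <= Cl"
  and kss: "k * ss\<^sup>2 = Z - b22*\<rho>s" and aZ: "A2*Z powr d1 = \<epsilon>"
  and ZK: "Z <= (11/10)*(abs k * ss\<^sup>2)" and rB: "\<rho>s <= B * ss\<^sup>2"
  and G_lip: "!!s s' r r'. abs s <= 2* ss ==> abs s' <= 2* ss ==> 0 <= r ==> r <= 3*\<rho>s ==> 0 <= r' ==> r' <= 3*\<rho>s ==>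
   abs ((snd (g (s, r)) - k * s\<^sup>2 - b22*r) - (snd (g (s', r')) - k * s'\<^sup>2 - b22*r'))
    <= (2*\<eta>* ss + 3*Cg*\<rho>s)*abs (s - s') + \<eta>*abs (r - r')"
  and g0: "g (0, 0) = (0, 0)"
  and Y_lip: "!!s s' r r'. abs s <= 2* ss ==> abs s' <= 2* ss ==> 0 <= r ==> r <= 3*\<rho>s ==> 0 <= r' ==> r' <= 3*\<rho>s ==>
   abs (fst (g (s, r)) - fst (g (s', r'))) <= Cl*(abs (s - s') + abs (r - r'))"
  and E_lip: "!!y z y' z'. abs y <= y0 ==> abs y' <= y0 ==> abs z <= 1/2 ==> abs z' <= 1/2 ==>
   norm ((E (y, Z*(1 + z)) - (Z*(1 + z)) powr d1 *\<^sub>R (A1, A2)) - (E (y', Z*(1 + z')) - (Z*(1 + z')) powr d1 *\<^sub>R (A1, A2)))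
    <= \<eta>*Z powr d1*(abs (y - y') + abs (z - z'))"
  and E_0: "norm (E (0, Z) - Z powr d1 *\<^sub>R (A1, A2)) <= \<eta>*Z powr d1"
  and kap: "!!x y. abs x <= kp ==> abs y <= kp ==> abs ((x - (1 + x) powr d1/d1) - (y - (1 + y) powr d1/d1)) <= (1/16)*abs (x - y)"
  and num_s: "3*abs b22*etc*(c+ss)*B/(2*abs k) + (2*\<eta> + 3*Cg*B* ss + 3*\<eta>*etc*(c+ss)*B)/(2*abs k) <= 1/8"
  and num_s0: "3*abs b22*etc* ss*B/(2*abs k) + (2*\<eta> + 3*Cg*B* ss + 3*\<eta>*B)/(2*abs k) <= kp/8"
  and num_z: "2*\<eta>/(A2*d1) + 3*ete*(c+ss)/d1 <= 1/2"
  and num_z0: "2*\<eta>/(A2*d1) + 3*ete* ss/d1 <= kp/8"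
  and num_p: "(2*abs A1*d1 + 2*\<eta>)*Z powr d1/c <= 3/4"
  and num_p0: "(abs A1 + 2*\<eta>)*Z powr d1/c <= kp/8"
  and num_t: "etc*(c+2* ss) <= 1" "ete*(c+2* ss) <= 1"
  and num_y: "Cl*(2* ss + 3*etc*(c+ss)*\<rho>s + 3*\<rho>s) <= min 1 y0"
begin

text \<open>The two symbols stand for the two sides of the fold made by the tangency.\<close>

definition sb :: "nat => real" where "sb b = (if b = 0 then - ss else ss)"
definition "sF b s = sb b*(1 + s)"
text \<open>In terms of entry angle, exit angle and the full turns \<open>\<tau>\<close>, the entry
  height is \<open>exp (ete*(\<psi> - s - \<tau>))\<close>; its power \<open>etc/ete\<close> is
  \<open>\<rho>s*exp (etc*(\<psi> - s))\<close>.\<close>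

definition "rF b p s = \<rho>s*exp (etc*(c*p - sF b s))"
definition "yF b p s = fst (g (sF b s, rF b p s))"
definition "Fp b p s z = fst (E (yF b p s, Z*(1 + z)))/c"
text \<open>A Newton step for reaching height \<open>Z*(1 + z)\<close>, with the derivative frozen:
  the leading term \<open>k*(sF b s)\<^sup>2\<close> has slope \<open>2*k * ss\<^sup>2\<close> at
  \<open>s = 0\<close>.\<close>

definition "Fs b p s z = s - (snd (g (sF b s, rF b p s)) - Z*(1 + z))/(2*k * ss\<^sup>2)"
text \<open>Again a frozen Newton step, now for the return height prescribed by the next point: to
  leading order the quotient by \<open>\<epsilon>\<close> is \<open>(1 + z) powr d1\<close>, with
  slope \<open>d1\<close> at \<open>z = 0\<close>.\<close>

definition "Fz b b' p s z p' s' = z - (snd (E (yF b p s, Z*(1 + z)))/\<epsilon> - exp (ete*(c*p' - sF b' s')))/d1"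
 for b b' :: nat

lemma sb_abs: "abs (sb b) = ss" "(sb b)\<^sup>2 = ss\<^sup>2" using pos by (auto simp: sb_def)

lemma sF_diff: "abs (sF b s - sF b t) = ss*abs (s - t)"
 by (simp add: sF_def right_diff_distrib[symmetric] abs_mult sb_abs)

lemma sF_le: "abs s <= kp ==> abs (sF b s) <= 2 * ss"
proof -
 assume "abs s <= kp"
 then have "abs (1 + s) <= 2" using pos by auto
 then show ?thesis using pos mult_left_mono[of "abs (1 + s)" 2 ss] by (simp add: sF_def abs_mult sb_abs mult.commute)
qed

lemma arg_le:
 assumes "abs p <= kp" "abs s <= kp" "0 < h" "h*(c + 2 * ss) <= 1"
 shows "abs (h*(c*p - sF b s)) <= 1"
proof -
 have "abs (c*p) <= c*1" using pos assms(1) unfolding abs_mult by (intro mult_mono) auto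
 then have "abs (c*p - sF b s) <= c + 2 * ss" using sF_le[OF assms(2), of b] by linarith
 then have "h*abs (c*p - sF b s) <= h*(c + 2 * ss)" using assms(3) by (intro mult_left_mono) auto
 from order_trans[OF this assms(4)] show ?thesis using assms(3) by (simp add: abs_mult)
qed

lemma arg_diff:
 assumes "abs (p - q) <= e" "abs (s - t) <= e" "0 < h"
 shows "abs (h*(c*p - sF b s) - h*(c*q - sF b t)) <= h*(c + ss)*e"
proof -
 have "abs (c*p - c*q) <= c*e" using assms pos unfolding right_diff_distrib[symmetric] abs_mult by simp
 moreover have "abs (sF b s - sF b t) <= ss*e" unfolding sF_diff using assms pos by simp
 ultimately have "abs ((c*p - sF b s) - (c*q - sF b t)) <= (c + ss)*e" by (simp add: algebra_simps)
 then have "h*abs ((c*p - sF b s) - (c*q - sF b t)) <= h*((c + ss)*e)" using assms by (intro mult_left_mono) auto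
 then show ?thesis using assms(3) unfolding right_diff_distrib[symmetric] abs_mult by (simp add: mult.assoc)
qed

lemma rF_range: "abs p <= kp ==> abs s <= kp ==> 0 <= rF b p s & rF b p s <= 3*\<rho>s"
 using exp_le3[OF arg_le[OF _ _ pos(1) num_t(1)], of p s b] pos by (simp add: rF_def mult.commute)

lemma rF_diff:
 assumes "abs p <= kp" "abs s <= kp" "abs q <= kp" "abs t <= kp" "abs (p - q) <= e" "abs (s - t) <= e"
 shows "abs (rF b p s - rF b q t) <= 3*etc*(c + ss)*\<rho>s*e"
proof -
 have "abs (exp (etc*(c*p - sF b s)) - exp (etc*(c*q - sF b t))) <= 3*(etc*(c + ss)*e)"
  using order_trans[OF exp_diff_le[OF arg_le[OF assms(1,2) pos(1) num_t(1)] arg_le[OF assms(3,4) pos(1) num_t(1)]]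
    mult_left_mono[OF arg_diff[OF assms(5,6) pos(1)], of 3]] by simp
 then have "\<rho>s*abs (exp (etc*(c*p - sF b s)) - exp (etc*(c*q - sF b t))) <= \<rho>s*(3*(etc*(c + ss)*e))"
  using pos by (intro mult_left_mono) auto
 then show ?thesis using pos unfolding rF_def right_diff_distrib[symmetric] abs_mult by (simp add: ac_simps)
qed

lemma yF_diff:
 assumes "abs p <= kp" "abs s <= kp" "abs q <= kp" "abs t <= kp" "abs (p - q) <= e" "abs (s - t) <= e"
 shows "abs (yF b p s - yF b q t) <= e"
proof -
 have e: "0 <= e" using assms(5) by linarith
 have "abs (yF b p s - yF b q t) <= Cl*(abs (sF b s - sF b t) + abs (rF b p s - rF b q t))"
  unfolding yF_def using rF_range[OF assms(1,2), of b] rF_range[OF assms(3,4), of b]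
  by (intro Y_lip sF_le assms(2,4)) simp_all
 also have "... <= Cl*(ss*e + 3*etc*(c + ss)*\<rho>s*e)"
  using pos rF_diff[OF assms] assms(6) sF_diff[of b s t] by (intro mult_left_mono add_mono) simp_all
 also have "... <= Cl*(2* ss + 3*etc*(c+ss)*\<rho>s + 3*\<rho>s)*e"
 proof -
  have "ss*e + 3*etc*(c + ss)*\<rho>s*e <= (2* ss + 3*etc*(c+ss)*\<rho>s + 3*\<rho>s)*e"
   unfolding distrib_right[symmetric] using pos e by (intro mult_right_mono) auto
  then show ?thesis unfolding mult.assoc[of Cl] using pos by (intro mult_left_mono) auto
 qed
 also have "... <= 1*e" using num_y e by (intro mult_right_mono) auto
 finally show ?thesis by simp
qed

lemma yF_le:
 assumes "abs p <= kp" "abs s <= kp"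
 shows "abs (yF b p s) <= min 1 y0"
proof -
 have "abs (fst (g (sF b s, rF b p s)) - fst (g (0, 0))) <= Cl*(abs (sF b s - 0) + abs (rF b p s - 0))"
  using rF_range[OF assms, of b] pos by (intro Y_lip sF_le assms) simp_all
 also have "... <= Cl*(2 * ss + 3*\<rho>s)"
  using pos sF_le[OF assms(2)] rF_range[OF assms] by (intro mult_left_mono add_mono) simp_all
 also have "... <= Cl*(2* ss + 3*etc*(c+ss)*\<rho>s + 3*\<rho>s)" using pos by (intro mult_left_mono) auto
 finally show ?thesis using num_y by (simp add: yF_def g0)
qed

lemma Zz: "abs z <= kp ==> (Z*(1 + z)) powr d1 = Z powr d1*(1 + z) powr d1"
 by (simp add: powr_mult)

lemma powr_lip:
 assumes "abs x <= kp" "abs y <= kp"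
 shows "abs ((1 + x) powr d1 - (1 + y) powr d1) <= 2*d1*abs (x - y)"
proof -
 have "abs ((1 + x) powr d1/d1 - (1 + y) powr d1/d1) <= (1/16)*abs (x - y) + abs (x - y)"
  using kap[OF assms] by linarith
 then have "abs ((1 + x) powr d1/d1 - (1 + y) powr d1/d1) <= 2*abs (x - y)"
  by (rule order_trans) simp
 then have "d1*abs ((1 + x) powr d1/d1 - (1 + y) powr d1/d1) <= d1*(2*abs (x - y))"
  using pos by (intro mult_left_mono) auto
 moreover have "d1*abs ((1 + x) powr d1/d1 - (1 + y) powr d1/d1) = abs ((1 + x) powr d1 - (1 + y) powr d1)"
  using pos by (simp add: diff_divide_distrib[symmetric] abs_divide)
 ultimately show ?thesis by simp
qed

text \<open>Expanding the square: the linear part of \<open>(1 + s)\<^sup>2/2\<close> cancels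
  \<open>s\<close>, which leaves \<open>- s\<^sup>2/2\<close> and the contributions of
  \<open>\<rho>\<close>, of the remainder and of the height.\<close>

lemma Fs_form: "Fs b p s z = - 1/2 - s\<^sup>2/2 - (b22*rF b p s + (snd (g (sF b s, rF b p s)) - k*(sF b s)\<^sup>2 - b22*rF b p s) - Z*(1 + z))/(2*k * ss\<^sup>2)"
proof -
 have "k*(sF b s)\<^sup>2/(2*k * ss\<^sup>2) = (1 + s)\<^sup>2/2"
  using pos by (simp add: sF_def power_mult_distrib sb_abs)
 moreover have "s - X = - 1/2 - s\<^sup>2/2 - (X - (1 + s)\<^sup>2/2)" for X
  by (simp add: power2_eq_square field_simps)
 moreover have "b22*rF b p s + (snd (g (sF b s, rF b p s)) - k*(sF b s)\<^sup>2 - b22*rF b p s) - Z*(1 + z)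
   = (snd (g (sF b s, rF b p s)) - Z*(1 + z)) - k*(sF b s)\<^sup>2" by simp
 ultimately show ?thesis unfolding Fs_def by (simp only: diff_divide_distrib[of _ "k*(sF b s)\<^sup>2"])
qed

lemma kss_abs: "abs (2*k * ss\<^sup>2) = 2*abs k * ss\<^sup>2" using pos by (simp add: abs_mult)

lemma kss_pos: "0 < 2*abs k * ss\<^sup>2" using pos by simp

lemma Fs_lip:
 assumes "abs p <= kp" "abs s <= kp" "abs z <= kp" "abs q <= kp" "abs t <= kp" "abs w <= kp"
  "abs (p - q) <= e" "abs (s - t) <= e" "abs (z - w) <= e"
 shows "abs (Fs b p s z - Fs b q t w) <= 3/4*e"
proof -
 let ?r = "rF b p s" and ?r' = "rF b q t"
 let ?G = "snd (g (sF b s, rF b p s)) - k*(sF b s)\<^sup>2 - b22*rF b p s"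
 let ?G' = "snd (g (sF b t, rF b q t)) - k*(sF b t)\<^sup>2 - b22*rF b q t"
 let ?D = "2*k * ss\<^sup>2" and ?Da = "2*abs k * ss\<^sup>2"
 have e: "0 <= e" using assms(7) by linarith
 have r: "abs (?r - ?r') <= 3*etc*(c + ss)*\<rho>s*e" by (rule rF_diff[OF assms(1,2,4,5,7,8)])
 have "\<rho>s <= B * ss\<^sup>2" by (rule rB)
 then have rB1: "3*etc*(c + ss)*\<rho>s*e <= 3*etc*(c + ss)*(B * ss\<^sup>2)*e"
  using pos e by (intro mult_right_mono mult_left_mono) auto
 have T1: "abs (s\<^sup>2/2 - t\<^sup>2/2) <= 1/16*e"
 proof -
  have "abs (s + t) <= 2*(1/16)" using assms(2,5) pos(8) by linarith
  then have "abs (s - t)*abs (s + t) <= e*(2*(1/16))" using assms(8) e by (intro mult_mono) simp_all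
  then have b: "abs (s - t)*abs (s + t)*abs (1/2) <= 1/16*e" by simp
  have "s\<^sup>2/2 - t\<^sup>2/2 = (s - t)*(s + t)*(1/2)" by (simp add: power2_eq_square algebra_simps)
  then show ?thesis using b by (simp only: abs_mult)
 qed
 have T2: "abs (b22 * ?r - b22 * ?r') / ?Da <= 3*abs b22*etc*(c+ss)*B/(2*abs k)*e"
 proof -
  have "abs (b22 * ?r - b22 * ?r') <= abs b22*(3*etc*(c + ss)*(B * ss\<^sup>2)*e)"
   unfolding right_diff_distrib[symmetric] abs_mult using r rB1 by (intro mult_left_mono) auto
  then have "abs (b22 * ?r - b22 * ?r') / ?Da <= abs b22*(3*etc*(c + ss)*(B * ss\<^sup>2)*e) / ?Da"
   using kss_pos by (intro divide_right_mono) auto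
  also have "... = 3*abs b22*etc*(c+ss)*B/(2*abs k)*e" using pos by (simp add: field_simps)
  finally show ?thesis .
 qed
 have T3: "abs (?G - ?G') / ?Da <= (2*\<eta> + 3*Cg*B* ss + 3*\<eta>*etc*(c+ss)*B)/(2*abs k)*e"
 proof -
  have "abs (?G - ?G') <= (2*\<eta>* ss + 3*Cg*\<rho>s)*abs (sF b s - sF b t) + \<eta>*abs (?r - ?r')"
   using rF_range[OF assms(1,2), of b] rF_range[OF assms(4,5), of b]
   by (intro G_lip sF_le assms(2,5)) simp_all
  also have "... <= (2*\<eta>* ss + 3*Cg*(B * ss\<^sup>2))*(ss*e) + \<eta>*(3*etc*(c + ss)*(B * ss\<^sup>2)*e)"
   unfolding sF_diff using order_trans[OF r rB1] pos(13-16) e rB assms(8)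
   by (intro add_mono[OF mult_mono[OF add_left_mono mult_left_mono] mult_left_mono] mult_left_mono)
    (simp_all only: add_nonneg_nonneg mult_nonneg_nonneg less_imp_le zero_le_numeral zero_le_power2 abs_ge_zero)
  also have "... = (2*\<eta> + 3*Cg*B* ss + 3*\<eta>*etc*(c+ss)*B)*e * ss\<^sup>2" by (simp add: algebra_simps power2_eq_square)
  finally have "abs (?G - ?G') / ?Da <= (2*\<eta> + 3*Cg*B* ss + 3*\<eta>*etc*(c+ss)*B)*e * ss\<^sup>2 / ?Da"
   using kss_pos by (intro divide_right_mono) auto
  also have "... = (2*\<eta> + 3*Cg*B* ss + 3*\<eta>*etc*(c+ss)*B)/(2*abs k)*e" using pos by (simp add: field_simps)
  finally show ?thesis .
 qed
 have T4: "abs (Z*(1 + z) - Z*(1 + w)) / ?Da <= 11/20*e"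
 proof -
  have "abs (Z*(1 + z) - Z*(1 + w)) <= (11/10)*(abs k * ss\<^sup>2)*e"
   unfolding right_diff_distrib[symmetric] abs_mult using assms(9) pos ZK by (intro mult_mono) simp_all
  then have "abs (Z*(1 + z) - Z*(1 + w)) / ?Da <= (11/10)*(abs k * ss\<^sup>2)*e / ?Da"
   using kss_pos by (intro divide_right_mono) auto
  also have "... = 11/20*e" using pos by (simp add: field_simps)
  finally show ?thesis .
 qed
 have eq: "Fs b p s z - Fs b q t w = - (s\<^sup>2/2 - t\<^sup>2/2) - (b22 * ?r - b22 * ?r') / ?D - (?G - ?G') / ?D + (Z*(1 + z) - Z*(1 + w)) / ?D"
  unfolding Fs_form by (simp add: add_divide_distrib diff_divide_distrib)
 have "abs (Fs b p s z - Fs b q t w) <= 1/16*e + 3*abs b22*etc*(c+ss)*B/(2*abs k)*e + (2*\<eta> + 3*Cg*B* ss + 3*\<eta>*etc*(c+ss)*B)/(2*abs k)*e + 11/20*e"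
  unfolding eq by (rule abs4_le[OF T1 T2[folded kss_abs] T3[folded kss_abs] T4[folded kss_abs]])
 also have "... = (1/16 + (3*abs b22*etc*(c+ss)*B/(2*abs k) + (2*\<eta> + 3*Cg*B* ss + 3*\<eta>*etc*(c+ss)*B)/(2*abs k)) + 11/20)*e"
  by (simp only: distrib_right[of _ _ e] add.assoc)
 \<comment> \<open>The quadratic term contributes \<open>1/16\<close>, the terms from
   \<open>\<rho>\<close> and from the tangency remainder together \<open>1/8\<close>, the height
   \<open>11/20\<close>, which is half of the factor \<open>11/10\<close> in \<open>ZK\<close>. The
   sum is just below \<open>3/4\<close>.\<close>
 also have "... <= (1/16 + 1/8 + 11/20)*e" by (intro mult_right_mono add_mono num_s order_refl e)
 also have "... <= 3/4*e" using e by simp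
 finally show ?thesis .
qed

text \<open>By \<open>kss\<close> the leading terms cancel exactly at the origin; the deviation of
  \<open>\<rho>\<close> from \<open>\<rho>s\<close> and the tangency remainder are left.\<close>

lemma Fs_0: "abs (Fs b 0 0 0) <= kp/8"
proof -
 let ?r = "rF b 0 0"
 let ?G = "snd (g (sF b 0, ?r)) - k*(sF b 0)\<^sup>2 - b22 * ?r"
 let ?D = "2*k * ss\<^sup>2" and ?Da = "2*abs k * ss\<^sup>2"
 have k0: "abs 0 <= kp" using pos by simp
 have r0: "abs (?r - \<rho>s) <= 3*etc * ss*\<rho>s"
 proof -
  have "abs (exp (etc*(c*0 - sF b 0)) - exp 0) <= 3*abs (etc*(c*0 - sF b 0) - 0)"
   using arg_le[OF k0 k0 pos(1) num_t(1), of b] by (intro exp_diff_le) auto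
  then have "\<rho>s*abs (exp (etc*(c*0 - sF b 0)) - 1) <= \<rho>s*(3*(etc * ss))"
   using pos by (intro mult_left_mono) (auto simp: sF_def abs_mult sb_abs)
  moreover have "?r - \<rho>s = \<rho>s*(exp (etc*(c*0 - sF b 0)) - 1)"
   by (simp add: rF_def algebra_simps)
  then have "abs (?r - \<rho>s) = \<rho>s*abs (exp (etc*(c*0 - sF b 0)) - 1)"
   using pos(12) by (simp add: abs_mult)
  ultimately show ?thesis by (simp add: ac_simps)
 qed
 have rB1: "3*etc * ss*\<rho>s <= 3*etc * ss*(B * ss\<^sup>2)"
  using pos rB by (intro mult_left_mono) auto
 have T2: "abs (b22 * ?r - b22*\<rho>s) / ?Da <= 3*abs b22*etc* ss*B/(2*abs k)"
 proof -
  have "abs (b22 * ?r - b22*\<rho>s) <= abs b22*(3*etc * ss*(B * ss\<^sup>2))"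
   unfolding right_diff_distrib[symmetric] abs_mult using r0 rB1 by (intro mult_left_mono) auto
  then have "abs (b22 * ?r - b22*\<rho>s) / ?Da <= abs b22*(3*etc * ss*(B * ss\<^sup>2)) / ?Da"
   using kss_pos by (intro divide_right_mono) auto
  also have "... = 3*abs b22*etc* ss*B/(2*abs k)" using pos by (simp add: field_simps)
  finally show ?thesis .
 qed
 have T3: "abs (?G) / ?Da <= (2*\<eta> + 3*Cg*B* ss + 3*\<eta>*B)/(2*abs k)"
 proof -
  \<comment> \<open>The remainder vanishes at \<open>(0, 0)\<close>, so its Lipschitz bound also
    bounds its size.\<close>
  have "abs (?G - (snd (g (0, 0)) - k*0\<^sup>2 - b22*0)) <= (2*\<eta>* ss + 3*Cg*\<rho>s)*abs (sF b 0 - 0) + \<eta>*abs (?r - 0)"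
   using rF_range[OF k0 k0] sF_le[OF k0] pos by (intro G_lip) auto
  also have "... <= (2*\<eta>* ss + 3*Cg*(B* ss\<^sup>2)) * ss + \<eta>*(3*(B* ss\<^sup>2))"
   using rF_range[OF k0 k0, of b] pos rB by (intro add_mono mult_mono mult_left_mono) (auto simp: sF_def sb_abs)
  also have "... = (2*\<eta> + 3*Cg*B* ss + 3*\<eta>*B) * ss\<^sup>2" by (simp add: algebra_simps power2_eq_square)
  finally have "abs (?G) / ?Da <= (2*\<eta> + 3*Cg*B* ss + 3*\<eta>*B) * ss\<^sup>2 / ?Da"
   using kss_pos by (intro divide_right_mono) (auto simp: g0)
  also have "... = (2*\<eta> + 3*Cg*B* ss + 3*\<eta>*B)/(2*abs k)" using pos by (simp add: field_simps)
  finally show ?thesis .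
 qed
 have "Fs b 0 0 0 = - 1/2 - (b22 * ?r + ?G - Z) / ?D" unfolding Fs_form by simp
 also have "... = - 1/2 - (b22 * ?r - b22*\<rho>s) / ?D - ?G / ?D + (Z - b22*\<rho>s) / ?D"
  by (simp add: add_divide_distrib diff_divide_distrib)
 also have "(Z - b22*\<rho>s) / ?D = 1/2" unfolding kss[symmetric] using pos by simp
 finally have "Fs b 0 0 0 = - ((b22 * ?r - b22*\<rho>s) / ?D) - ?G / ?D" by simp
 then have "abs (Fs b 0 0 0) <= abs (b22 * ?r - b22*\<rho>s) / ?Da + abs (?G) / ?Da"
  unfolding kss_abs[symmetric] abs_divide[symmetric] by linarith
 then show ?thesis using T2 T3 num_s0 by linarith
qed

abbreviation "Rest y z \<equiv> E (y, Z*(1 + z)) - (Z*(1 + z)) powr d1 *\<^sub>R (A1, A2)"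

lemma Rest_diff:
 assumes "abs p <= kp" "abs s <= kp" "abs z <= kp" "abs q <= kp" "abs t <= kp" "abs w <= kp"
  "abs (p - q) <= e" "abs (s - t) <= e" "abs (z - w) <= e"
 shows "norm (Rest (yF b p s) z - Rest (yF b q t) w) <= 2*\<eta>*Z powr d1*e"
proof -
 have "norm (Rest (yF b p s) z - Rest (yF b q t) w) <= \<eta>*Z powr d1*(abs (yF b p s - yF b q t) + abs (z - w))"
  using yF_le[OF assms(1,2), of b] yF_le[OF assms(4,5), of b] assms(3,6) pos(8)
  by (intro E_lip) linarith+
 also have "... <= \<eta>*Z powr d1*(e + e)"
  using yF_diff[OF assms(1,2,4,5,7,8), of b] assms(9) pos(14) by (intro mult_left_mono add_mono) simp_all
 finally show ?thesis by (simp add: algebra_simps)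
qed

lemma Rest_le:
 assumes "abs p <= kp" "abs s <= kp"
 shows "norm (Rest (yF b p s) 0) <= 2*\<eta>*Z powr d1"
proof -
 have "norm (Rest (yF b p s) 0 - Rest 0 0) <= \<eta>*Z powr d1*(abs (yF b p s - 0) + abs (0 - 0))"
  using yF_le[OF assms, of b] pos by (intro E_lip) auto
 also have "... <= \<eta>*Z powr d1*1" using yF_le[OF assms, of b] pos by (intro mult_left_mono) auto
 finally have "norm (Rest (yF b p s) 0 - Rest 0 0) <= \<eta>*Z powr d1" by simp
 moreover have "norm (Rest 0 0) <= \<eta>*Z powr d1" using E_0 by simp
 moreover have "norm (Rest (yF b p s) 0) <= norm (Rest (yF b p s) 0 - Rest 0 0) + norm (Rest 0 0)"
  using norm_triangle_ineq[of "Rest (yF b p s) 0 - Rest 0 0" "Rest 0 0"] by (simp only: diff_add_cancel)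
 ultimately show ?thesis by linarith
qed

lemma fst_le: "abs (fst x) <= norm x" and snd_le: "abs (snd x) <= norm x" for x :: "real \<times> real"
 using norm_fst_le[of "fst x" "snd x"] norm_snd_le[of "snd x" "fst x"] by auto

lemma Fp_form: "abs z <= kp ==> Fp b p s z = (A1*Z powr d1*(1 + z) powr d1 + fst (Rest (yF b p s) z))/c"
 by (simp add: Fp_def Zz)

lemma Fp_lip:
 assumes "abs p <= kp" "abs s <= kp" "abs z <= kp" "abs q <= kp" "abs t <= kp" "abs w <= kp"
  "abs (p - q) <= e" "abs (s - t) <= e" "abs (z - w) <= e"
 shows "abs (Fp b p s z - Fp b q t w) <= 3/4*e"
proof -
 have e: "0 <= e" using assms(7) by linarith
 have 1: "abs (A1*Z powr d1*(1 + z) powr d1 - A1*Z powr d1*(1 + w) powr d1) <= abs A1*Z powr d1*(2*d1*e)"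
 proof -
  have "abs ((1 + z) powr d1 - (1 + w) powr d1) <= 2*d1*e"
   using order_trans[OF powr_lip[OF assms(3,6)] mult_left_mono[OF assms(9), of "2*d1"]] pos by simp
  then show ?thesis unfolding right_diff_distrib[symmetric] abs_mult by (intro mult_mono) auto
 qed
 have 2: "abs (fst (Rest (yF b p s) z) - fst (Rest (yF b q t) w)) <= 2*\<eta>*Z powr d1*e"
  using fst_le[of "Rest (yF b p s) z - Rest (yF b q t) w"] Rest_diff[OF assms, of b] by simp
 have "Fp b p s z - Fp b q t w = ((A1*Z powr d1*(1 + z) powr d1 - A1*Z powr d1*(1 + w) powr d1) + (fst (Rest (yF b p s) z) - fst (Rest (yF b q t) w)))/c"
  unfolding Fp_form[OF assms(3)] Fp_form[OF assms(6)] by (simp add: diff_divide_distrib add_divide_distrib)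
 then have "abs (Fp b p s z - Fp b q t w) <= (abs A1*Z powr d1*(2*d1*e) + 2*\<eta>*Z powr d1*e)/c"
  using pos 1 2 by (simp only: abs_divide) (intro frac_le, auto)
 also have "... = (2*abs A1*d1 + 2*\<eta>)*Z powr d1/c*e" by (simp add: algebra_simps add_divide_distrib)
 also have "... <= 3/4*e" using num_p e by (intro mult_right_mono) auto
 finally show ?thesis .
qed

lemma Fp_0: "abs (Fp b 0 0 0) <= kp/8"
proof -
 have k0: "abs 0 <= kp" using pos by simp
 have "abs (Fp b 0 0 0) <= (abs A1*Z powr d1 + 2*\<eta>*Z powr d1)/c"
  unfolding Fp_form[OF k0] abs_divide using pos Rest_le[OF k0 k0, of b] fst_le[of "Rest (yF b 0 0) 0"]
  by (intro frac_le order_trans[OF abs_triangle_ineq] add_mono) (auto simp: abs_mult)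
 then show ?thesis using num_p0 unfolding distrib_right[symmetric] by (rule order_trans)
qed

text \<open>The first summand has derivative 0 at \<open>z = 0\<close>, which \<open>kap\<close>
  exploits. Dividing the remainder by \<open>\<epsilon>\<close> is harmless because the remainder is
  small relative to \<open>Z powr d1\<close>, which is \<open>\<epsilon>/A2\<close>.\<close>

lemma Fz_form: "abs z <= kp ==> Fz b b' p s z p' s' = (z - (1 + z) powr d1/d1) - snd (Rest (yF b p s) z)/(\<epsilon>*d1) + exp (ete*(c*p' - sF b' s'))/d1"
proof -
 assume z: "abs z <= kp"
 have "snd (E (yF b p s, Z*(1 + z))) = \<epsilon>*(1 + z) powr d1 + snd (Rest (yF b p s) z)"
  unfolding aZ[symmetric] by (simp add: Zz[OF z])
 then show ?thesis unfolding Fz_def using pos(3,10) by (simp add: field_simps)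
qed

lemma Fz_lip:
 assumes "abs p <= kp" "abs s <= kp" "abs z <= kp" "abs q <= kp" "abs t <= kp" "abs w <= kp"
  "abs (p - q) <= e" "abs (s - t) <= e" "abs (z - w) <= e"
  "abs p' <= kp" "abs s' <= kp" "abs q' <= kp" "abs t' <= kp" "abs (p' - q') <= e" "abs (s' - t') <= e"
 shows "abs (Fz b b' p s z p' s' - Fz b b' q t w q' t') <= 3/4*e"
proof -
 have e: "0 <= e" using assms(7) by linarith
 have 1: "abs ((z - (1 + z) powr d1/d1) - (w - (1 + w) powr d1/d1)) <= 1/16*e"
  by (rule order_trans[OF kap[OF assms(3,6)]]) (use assms(9) in simp)
 have 2: "abs (snd (Rest (yF b p s) z)/(\<epsilon>*d1) - snd (Rest (yF b q t) w)/(\<epsilon>*d1)) <= 2*\<eta>/(A2*d1)*e"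
 proof -
  have "abs (snd (Rest (yF b p s) z) - snd (Rest (yF b q t) w)) <= 2*\<eta>*Z powr d1*e"
   using snd_le[of "Rest (yF b p s) z - Rest (yF b q t) w"] Rest_diff[OF assms(1-9), of b] by simp
  then have "abs (snd (Rest (yF b p s) z) - snd (Rest (yF b q t) w))/(\<epsilon>*d1) <= 2*\<eta>*Z powr d1*e/(\<epsilon>*d1)"
   using pos by (intro divide_right_mono) auto
  moreover have "2*\<eta>*Z powr d1*e/(\<epsilon>*d1) = 2*\<eta>/(A2*d1)*e"
   unfolding aZ[symmetric] using pos by (simp add: field_simps)
  moreover have "abs (snd (Rest (yF b p s) z)/(\<epsilon>*d1) - snd (Rest (yF b q t) w)/(\<epsilon>*d1)) = abs (snd (Rest (yF b p s) z) - snd (Rest (yF b q t) w))/(\<epsilon>*d1)"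
   unfolding diff_divide_distrib[symmetric] abs_divide using pos by simp
  ultimately show ?thesis by simp
 qed
 have 3: "abs (exp (ete*(c*p' - sF b' s'))/d1 - exp (ete*(c*q' - sF b' t'))/d1) <= 3*ete*(c+ss)/d1*e"
 proof -
  have "abs (exp (ete*(c*p' - sF b' s')) - exp (ete*(c*q' - sF b' t'))) <= 3*(ete*(c + ss)*e)"
   using order_trans[OF exp_diff_le[OF arg_le[OF assms(10,11) pos(2) num_t(2)] arg_le[OF assms(12,13) pos(2) num_t(2)]]
    mult_left_mono[OF arg_diff[OF assms(14,15) pos(2)], of 3]] by simp
  then have "abs (exp (ete*(c*p' - sF b' s')) - exp (ete*(c*q' - sF b' t')))/d1 <= 3*(ete*(c + ss)*e)/d1"
   using pos by (intro divide_right_mono) auto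
  moreover have "abs (exp (ete*(c*p' - sF b' s'))/d1 - exp (ete*(c*q' - sF b' t'))/d1) = abs (exp (ete*(c*p' - sF b' s')) - exp (ete*(c*q' - sF b' t')))/d1"
   unfolding diff_divide_distrib[symmetric] abs_divide using pos by simp
  ultimately show ?thesis by (simp add: mult.assoc)
 qed
 have "abs (Fz b b' p s z p' s' - Fz b b' q t w q' t') <= 1/16*e + 2*\<eta>/(A2*d1)*e + 3*ete*(c+ss)/d1*e"
  unfolding Fz_form[OF assms(3)] Fz_form[OF assms(6)] using 1 2 3 by linarith
 also have "... = (1/16 + (2*\<eta>/(A2*d1) + 3*ete*(c+ss)/d1))*e" by (simp only: distrib_right[of _ _ e] add.assoc)
 also have "... <= 3/4*e" using num_z e by (intro mult_right_mono) auto
 finally show ?thesis .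
qed

lemma Fz_0: "abs (Fz b b' 0 0 0 0 0) <= kp/8"
proof -
 have k0: "abs 0 <= kp" using pos by simp
 have 2: "abs (snd (Rest (yF b 0 0) 0)/(\<epsilon>*d1)) <= 2*\<eta>/(A2*d1)"
 proof -
  have "abs (snd (Rest (yF b 0 0) 0))/(\<epsilon>*d1) <= 2*\<eta>*Z powr d1/(\<epsilon>*d1)"
   using pos order_trans[OF snd_le Rest_le[OF k0 k0, of b]] by (intro divide_right_mono) auto
  moreover have "2*\<eta>*Z powr d1/(\<epsilon>*d1) = 2*\<eta>/(A2*d1)"
   unfolding aZ[symmetric] using pos by (simp add: field_simps)
  ultimately show ?thesis unfolding abs_divide using pos by simp
 qed
 have "abs (exp (ete*(c*0 - sF b' 0)) - exp 0) <= 3*abs (ete*(c*0 - sF b' 0) - 0)"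
  using arg_le[OF k0 k0 pos(2) num_t(2), of b'] by (intro exp_diff_le) auto
 then have "abs (exp (ete*(c*0 - sF b' 0)) - 1) <= 3*(ete * ss)"
  using pos by (simp add: sF_def abs_mult sb_abs)
 then have "abs (exp (ete*(c*0 - sF b' 0)) - 1)/d1 <= 3*(ete * ss)/d1" using pos by (intro divide_right_mono) auto
 then have 3: "abs (exp (ete*(c*0 - sF b' 0))/d1 - 1/d1) <= 3*ete * ss/d1"
  unfolding diff_divide_distrib[symmetric] abs_divide using pos by (simp add: mult.assoc)
 have "Fz b b' 0 0 0 0 0 = - 1/d1 - snd (Rest (yF b 0 0) 0)/(\<epsilon>*d1) + exp (ete*(c*0 - sF b' 0))/d1"
  unfolding Fz_form[OF k0] by simp
 then show ?thesis using 2 3 num_z0 by linarith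
qed

text \<open>The value at the origin is at most \<open>kp/8\<close>, and the distance from it at most
  \<open>3/4*kp\<close>; the sum is strictly below \<open>kp\<close>.\<close>

lemma F_range:
 assumes *: "abs p <= kp" "abs s <= kp" "abs z <= kp"
 shows "abs (Fp b p s z) < kp" "abs (Fs b p s z) < kp"
  "abs p' <= kp ==> abs s' <= kp ==> abs (Fz b b' p s z p' s') < kp"
proof -
 have k0: "abs 0 <= kp" using pos(7) by simp
 show "abs (Fp b p s z) < kp"
  using Fp_lip[OF * k0 k0 k0, of kp b] Fp_0[of b] * pos(7) unfolding diff_0_right by linarith
 show "abs (Fs b p s z) < kp"
  using Fs_lip[OF * k0 k0 k0, of kp b] Fs_0[of b] * pos(7) unfolding diff_0_right by linarith
 assume **: "abs p' <= kp" "abs s' <= kp"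
 show "abs (Fz b b' p s z p' s') < kp"
  using Fz_lip[OF * k0 k0 k0 _ _ _ ** k0 k0, of kp b b'] Fz_0[of b b'] * ** pos(7)
  unfolding diff_0_right by linarith
qed

sublocale cf: cross_form Fp Fs Fz kp "3/4"
proof (rule cross_form.intro, goal_cases)
 case 3 show ?case by (rule pos)
next
 case 4 show ?case by (rule F_range(1)[OF 4(2-4)])
next
 case 5 show ?case by (rule F_range(2)[OF 5(2-4)])
next
 case 6 show ?case by (rule F_range(3)[OF 6(3-7)])
next
 case 7 show ?case by (rule Fp_lip[OF 7(2-10)])
next
 case 8 show ?case by (rule Fs_lip[OF 8(2-10)])
next
 case 9 show ?case by (rule Fz_lip[OF 9(3-5) 9(8-10) 9(13-15) 9(6,7) 9(11,12) 9(16,17)])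
qed simp_all

end

section \<open>From difference estimates to derivatives\<close>

lemma has_vector_derivative_quotient:
 fixes g :: "real => 'b::real_normed_vector"
 assumes "(g has_vector_derivative d) (at 0)"
 shows "((%t. (g t - g 0) /\<^sub>R t) \<longlongrightarrow> d) (at 0)"
proof -
 have "((%h. norm (g (0 + h) - g 0 - h *\<^sub>R d)/norm h) \<longlongrightarrow> 0) (at 0)"
  using assms unfolding has_vector_derivative_def has_derivative_at by blast
 moreover have "\<forall>\<^sub>F h in at 0. norm (g (0 + h) - g 0 - h *\<^sub>R d)/norm h = norm ((g h - g 0) /\<^sub>R h - d)"
 proof (rule eventually_at_filter[THEN iffD2], intro always_eventually allI impI)
  fix h :: real assume h: "h ~= 0"
  have "(g h - g 0) /\<^sub>R h - d = (g (0 + h) - g 0 - h *\<^sub>R d) /\<^sub>R h"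
   using h by (simp add: scaleR_diff_right)
  then show "norm (g (0 + h) - g 0 - h *\<^sub>R d)/norm h = norm ((g h - g 0) /\<^sub>R h - d)"
   by (simp add: divide_inverse mult.commute)
 qed
 ultimately have "((%h. norm ((g h - g 0) /\<^sub>R h - d)) \<longlongrightarrow> 0) (at 0)"
  by (subst (asm) tendsto_cong) auto
 then show ?thesis by (simp add: tendsto_norm_zero_iff LIM_zero_iff)
qed

lemma has_derivative_line:
 assumes "(f has_derivative f') (at x)"
 shows "((%t. f (x + t *\<^sub>R v)) has_vector_derivative f' v) (at 0)"
proof -
 have "((%t. x + t *\<^sub>R v) has_derivative (%t. t *\<^sub>R v)) (at 0)"
  by (auto intro!: derivative_eq_intros)
 then have "((%t. f (x + t *\<^sub>R v)) has_derivative (%t. f' (t *\<^sub>R v))) (at 0)"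
  by (rule has_derivative_compose) (use assms in simp)
 moreover have "f' (t *\<^sub>R v) = t *\<^sub>R f' v" for t
  by (rule linear_scale[OF has_derivative_linear[OF assms]])
 ultimately show ?thesis unfolding has_vector_derivative_def by simp
qed

text \<open>Difference quotients along a line inherit the lower Lipschitz bound, and so does their
  limit. In this way injectivity of derivatives is obtained later without computing them.\<close>

lemma has_derivative_lower_bound:
 fixes f :: "'a::real_normed_vector => 'b::real_normed_vector"
 assumes f: "(f has_derivative f') (at x)" and lb: "\<forall>\<^sub>F y in nhds x. norm (y - x) <= M*norm (f y - f x)"
 shows "norm v <= M*norm (f' v)"
proof -
 have lim: "((%t. M*norm ((f (x + t *\<^sub>R v) - f x) /\<^sub>R t)) \<longlongrightarrow> M*norm (f' v)) (at 0)"
  using has_vector_derivative_quotient[OF has_derivative_line[OF f]]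
  by (intro tendsto_intros) simp
 have "((%t. x + t *\<^sub>R v) \<longlongrightarrow> x + 0 *\<^sub>R v) (at 0)" by (intro tendsto_intros)
 then have "filterlim (%t. x + t *\<^sub>R v) (nhds x) (at 0)" by simp
 then have "\<forall>\<^sub>F t in at 0. norm (x + t *\<^sub>R v - x) <= M*norm (f (x + t *\<^sub>R v) - f x)"
  using lb by (rule eventually_compose_filterlim[rotated])
 moreover have "\<forall>\<^sub>F t in at (0::real). t ~= 0" by (simp add: eventually_at_filter)
 ultimately have "\<forall>\<^sub>F t in at 0. norm v <= M*norm ((f (x + t *\<^sub>R v) - f x) /\<^sub>R t)"
 proof eventually_elim
  case (elim t)
  then have "abs t*norm v <= M*norm (f (x + t *\<^sub>R v) - f x)" by simp
  then have "inverse (abs t)*(abs t*norm v) <= inverse (abs t)*(M*norm (f (x + t *\<^sub>R v) - f x))"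
   by (rule mult_left_mono) simp
  moreover have "inverse (abs t)*(abs t*norm v) = norm v" using elim(2) by simp
  moreover have "inverse (abs t)*(M*norm (f (x + t *\<^sub>R v) - f x)) = M*norm ((f (x + t *\<^sub>R v) - f x) /\<^sub>R t)"
   by simp
  ultimately show ?case by (simp only:)
 qed
 then show ?thesis by (rule tendsto_lowerbound[OF lim]) simp
qed

text \<open>Division by \<open>abs t\<close> commutes with the maximum, so a crossed inequality
  between differences survives the limit of the difference quotients.\<close>

lemma derivative_cross_le:
 fixes X Y X' :: "real => real"
 assumes "(X has_vector_derivative dX) (at 0)" "(Y has_vector_derivative dY) (at 0)" "(U has_vector_derivative dU) (at 0)"
  and le: "\<forall>\<^sub>F t in at 0. abs (U t - U 0) <= \<theta>*max (abs (X t - X 0)) (abs (Y t - Y 0))"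
 shows "abs dU <= \<theta>*max (abs dX) (abs dY)"
proof -
 note l = assms(1-3)[THEN has_vector_derivative_quotient]
 have "((%t. \<theta>*max (abs ((X t - X 0) /\<^sub>R t)) (abs ((Y t - Y 0) /\<^sub>R t))) \<longlongrightarrow> \<theta>*max (abs dX) (abs dY)) (at 0)"
  by (intro tendsto_intros l)
 moreover have "((%t. abs ((U t - U 0) /\<^sub>R t)) \<longlongrightarrow> (abs dU)) (at 0)" by (intro tendsto_intros l)
 moreover have "\<forall>\<^sub>F t in at (0::real). t ~= 0" by (simp add: eventually_at_filter)
 then have "\<forall>\<^sub>F t in at 0. abs ((U t - U 0) /\<^sub>R t) <= \<theta>*max (abs ((X t - X 0) /\<^sub>R t)) (abs ((Y t - Y 0) /\<^sub>R t))"
  using le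
 proof eventually_elim
  case (elim t)
  then have "inverse (abs t)*abs (U t - U 0) <= inverse (abs t)*(\<theta>*max (abs (X t - X 0)) (abs (Y t - Y 0)))"
   by (intro mult_left_mono) auto
  also have "... = \<theta>*(inverse (abs t)*max (abs (X t - X 0)) (abs (Y t - Y 0)))" by (simp add: ac_simps)
  also have "inverse (abs t)*max (abs (X t - X 0)) (abs (Y t - Y 0)) = max (inverse (abs t)*abs (X t - X 0)) (inverse (abs t)*abs (Y t - Y 0))"
   by (rule max_mult_distrib_left[THEN trans]) auto
  finally show ?case by (simp add: abs_mult)
 qed
 ultimately show ?thesis by (intro tendsto_le[of "at 0"]) auto
qed

context cross_form begin

text \<open>The equations determine \<open>s\<close>, \<open>z\<close> and \<open>p'\<close>, while
  \<open>p\<close> and \<open>s'\<close> are free. With \<open>c\<close> the largest of the five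
  differences, the determined ones are at most \<open>\<theta>*c\<close>, so \<open>c\<close> is
  attained by a free one. The height thereby drops out, and the crossed inequalities of
  \<open>cross_cocycle\<close> appear.\<close>

lemma cross_contraction:
 assumes "b < 2" "b' < 2" "step b p s z b' p' s'" "step b q t w b' q' t'"
  and "abs p <= kp" "abs s <= kp" "abs z <= kp" "abs p' <= kp" "abs s' <= kp"
  "abs q <= kp" "abs t <= kp" "abs w <= kp" "abs q' <= kp" "abs t' <= kp"
 shows "abs (s - t) <= \<theta>*max (abs (p - q)) (abs (s' - t'))" "abs (p' - q') <= \<theta>*max (abs (p - q)) (abs (s' - t'))"
proof -
 define m where "m = max (abs (p - q)) (abs (s' - t'))"
 define M where "M = max (max (abs (s - t)) (abs (z - w))) (abs (p' - q'))"
 define c where "c = max m M"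
 have cs: "abs (p - q) <= c" "abs (s' - t') <= c" "abs (s - t) <= c" "abs (z - w) <= c" "abs (p' - q') <= c"
  unfolding c_def m_def M_def by (simp_all only: le_max_iff_disj order_refl simp_thms)
 have "abs (p' - q') <= \<theta>*c"
  using p_lip[OF assms(1,5,6,7,10,11,12) cs(1,3,4)] assms(3,4) by (simp only: step_def)
 moreover have "abs (s - t) <= \<theta>*c"
  using s_lip[OF assms(1,5,6,7,10,11,12) cs(1,3,4)] assms(3,4) unfolding step_def by metis
 moreover have "abs (z - w) <= \<theta>*c"
  using z_lip[OF assms(1,2,5-9) assms(10-14) cs(1,3,4,5,2)] assms(3,4) unfolding step_def by metis
 ultimately have M: "M <= \<theta>*c" unfolding M_def by (simp only: max.bounded_iff)
 have c0: "0 <= c" using cs(1) abs_ge_zero order_trans by blast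
 have "c = m"
 proof (rule ccontr)
  assume "c ~= m"
  then have "c = M" "m < c" unfolding c_def by (auto simp: max_def split: if_splits)
  then have "(1 - \<theta>)*c <= 0" using M by (simp add: algebra_simps)
  then have "c <= 0" using th by (simp add: mult_le_0_iff)
  moreover have "0 <= m" by (simp add: m_def le_max_iff_disj)
  ultimately show False using \<open>m < c\<close> by simp
 qed
 then show "abs (s - t) <= \<theta>*max (abs (p - q)) (abs (s' - t'))" "abs (p' - q') <= \<theta>*max (abs (p - q)) (abs (s' - t'))"
  using M unfolding m_def[symmetric] M_def by (simp_all only: max.bounded_iff)
qed

end

text \<open>The abstract step is connected with the actual maps: \<open>P\<close> is the local map
  near the periodic orbit, \<open>\<tau>\<close> accounts for the full turns, and \<open>M\<close>
  is a lower Lipschitz constant that may depend on the strip. The bound 2 lies below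
  \<open>pi\<close>, so that reduction modulo \<open>2*pi\<close> just subtracts the full
  turns.\<close>

locale strip_map = strip +
 fixes P R :: "real \<times> real => real \<times> real" and \<tau> M r0 :: real
 assumes eps: "\<epsilon> = exp (- (ete*\<tau>))" and rhos: "\<rho>s = exp (- (etc*\<tau>))"
  and P: "!!\<psi> z. 0 < z ==> abs (\<psi> - ln z/ete - \<tau>) < 2 ==> P (\<psi>, z) = (\<psi> - ln z/ete - \<tau>, z powr (etc/ete))"
  and R: "!!q. R q = E (g (P q))"
  and ss1: "ss < 1"
  and g_inj: "!!w w'. w \<in> ball 0 r0 ==> w' \<in> ball 0 r0 ==> norm (w - w') <= M*norm (g w - g w')"
  and g_diff: "!!w. w \<in> ball 0 r0 ==> g differentiable (at w)"
  and E_inj: "!!y z y' z'. abs y < y0 ==> abs y' < y0 ==> abs z < 1/2 ==> abs z' < 1/2 ==>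
   norm ((y, Z*(1 + z)) - (y', Z*(1 + z'))) <= M*norm (E (y, Z*(1 + z)) - E (y', Z*(1 + z')))"
  and E_diff: "!!y z. abs y < y0 ==> abs z < 1/2 ==> E differentiable (at (y, Z*(1 + z)))"
  and num_y': "Cl*(2* ss + 3*etc*(c+ss)*\<rho>s + 3*\<rho>s) < y0"
  and num_r: "2* ss + 3*\<rho>s < r0"
begin

text \<open>The height is the one for which the exit angle equals \<open>sF b s\<close>; see
  \<open>P_Pt\<close>.\<close>

definition Pt :: "nat => real => real => real \<times> real" where
 "Pt b p s = (c*p, exp (ete*(c*p - sF b s - \<tau>)))"

lemma P_Pt: "abs s <= kp ==> P (Pt b p s) = (sF b s, rF b p s)"
proof -
 assume s: "abs s <= kp"
 have e: "c*p - ln (exp (ete*(c*p - sF b s - \<tau>)))/ete - \<tau> = sF b s" using pos(2) by simp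
 have "abs (sF b s) < 2" using sF_le[OF s, of b] ss1 by linarith
 then have "P (Pt b p s) = (sF b s, exp (ete*(c*p - sF b s - \<tau>)) powr (etc/ete))"
  unfolding Pt_def using P[of "exp (ete*(c*p - sF b s - \<tau>))" "c*p"] unfolding e by simp
 also have "exp (ete*(c*p - sF b s - \<tau>)) powr (etc/ete) = exp (etc*(c*p - sF b s - \<tau>))"
  using pos(2) by (simp add: powr_def)
 also have "... = rF b p s" by (subst rF_def, subst rhos) (simp add: exp_add[symmetric] algebra_simps)
 finally show ?thesis .
qed

text \<open>A fixed point of a frozen Newton step is a zero of the underlying equation, so
  \<open>cf.step\<close> is the relation between consecutive points of an orbit, together with the
  choice of \<open>z\<close> as the rescaled height at \<open>E\<close>.\<close>

lemma step_iff:
 assumes "abs s <= kp"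
 shows "cf.step b p s z b' p' s' \<longleftrightarrow> snd (g (sF b s, rF b p s)) = Z*(1 + z) & R (Pt b p s) = Pt b' p' s'"
proof -
 have 1: "s = Fs b p s z \<longleftrightarrow> snd (g (sF b s, rF b p s)) = Z*(1 + z)"
  unfolding Fs_def using pos(5,13) by simp
 have 2: "p' = Fp b p s z \<longleftrightarrow> fst (E (yF b p s, Z*(1 + z))) = c*p'"
  unfolding Fp_def using pos(9) by (auto simp: field_simps)
 have 3: "z = Fz b b' p s z p' s' \<longleftrightarrow> snd (E (yF b p s, Z*(1 + z))) = \<epsilon>*exp (ete*(c*p' - sF b' s'))"
  unfolding Fz_def using pos(3,10) by (auto simp: field_simps)
 have 4: "\<epsilon>*exp (ete*(c*p' - sF b' s')) = exp (ete*(c*p' - sF b' s' - \<tau>))"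
  unfolding eps exp_add[symmetric] by (simp add: algebra_simps)
 have 5: "R (Pt b p s) = E (yF b p s, snd (g (sF b s, rF b p s)))"
  unfolding R P_Pt[OF assms] yF_def by simp
 show ?thesis unfolding cf.step_def 2 3 4 5 using 1 by (auto simp: Pt_def prod_eq_iff)
qed

definition "pc q = fst q/c"
definition "sc b q = (fst q - ln (snd q)/ete - \<tau>)/sb b - 1" for b :: nat

lemma sb_nz: "sb b ~= 0" using pos(13) by (simp add: sb_def)

lemma Pt_pc_sc: "0 < snd q ==> Pt b (pc q) (sc b q) = q"
proof -
 assume q: "0 < snd q"
 have "sF b (sc b q) = fst q - ln (snd q)/ete - \<tau>" using sb_nz[of b] by (simp add: sF_def sc_def)
 then show ?thesis using pos(2,9) q by (simp add: Pt_def pc_def prod_eq_iff)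
qed

lemma pc_sc_Pt: "pc (Pt b p s) = p" "sc b (Pt b p s) = s" "0 < snd (Pt b p s)"
 using pos(2,9) sb_nz[of b] by (simp_all add: pc_def sc_def Pt_def sF_def)

text \<open>As \<open>kp < 1\<close>, the factor \<open>1 + s\<close> is positive; hence the symbol
  is the sign of the exit angle and can be read off from the point.\<close>

lemma sF_sign: "b < 2 ==> abs s < kp ==> (0 < sF b s \<longleftrightarrow> b = 1)"
 using pos(7,8,13) by (auto simp: sF_def sb_def zero_less_mult_iff)

lemma Pt_inj:
 assumes "b < 2" "b' < 2" "abs s < kp" "abs s' < kp" "Pt b p s = Pt b' p' s'"
 shows "b = b' & p = p' & s = s'"
proof -
 have "c*p = c*p'" "c*p - sF b s - \<tau> = c*p' - sF b' s' - \<tau>" using assms(5) pos(2) by (auto simp: Pt_def)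
 then have *: "p = p'" "sF b s = sF b' s'" using pos(9) by auto
 then have "b = b'" using sF_sign[OF assms(1,3)] sF_sign[OF assms(2,4)] assms(1,2) by auto
 then show ?thesis using * sb_nz[of b] by (simp add: sF_def)
qed

abbreviation "K \<equiv> cf.points Pt"

lemma K_cases:
 assumes "q \<in> K"
 obtains b b' p s z p' s' where "b < 2" "b' < 2" "abs p < kp" "abs s < kp" "abs z < kp" "abs p' < kp" "abs s' < kp"
  "q = Pt b p s" "R q = Pt b' p' s'" "snd (g (sF b s, rF b p s)) = Z*(1 + z)"
  "\<exists>b'' p'' s'' z''. b'' < 2 & abs p'' < kp & abs s'' < kp & abs z'' < kp & p = Fp b'' p'' s'' z''"
proof -
 obtain \<omega> p s z where q: "q = Pt (\<omega> 0) (p 0) (s 0)" and sol: "cf.sol \<omega> p s z"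
  using assms unfolding cf.points_def by blast
 have S: "\<omega> j < 2" "abs (p j) < kp" "abs (s j) < kp" "abs (z j) < kp" "cf.step (\<omega> j) (p j) (s j) (z j) (\<omega> (j+1)) (p (j+1)) (s (j+1))" for j
  using sol unfolding cf.sol_def by blast+
 have st: "snd (g (sF (\<omega> 0) (s 0), rF (\<omega> 0) (p 0) (s 0))) = Z*(1 + z 0)" "R q = Pt (\<omega> 1) (p 1) (s 1)"
  using S(5)[of 0] step_iff[OF less_imp_le[OF S(3)[of 0]]] q by auto
 \<comment> \<open>The predecessor is kept because smallness of the entry angle is a property of
   values of \<open>Fp\<close>; \<open>K_bounds\<close> relies on it.\<close>
 have "p 0 = Fp (\<omega> (-1)) (p (-1)) (s (-1)) (z (-1))" using S(5)[of "-1"] by (simp add: cf.step_def)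
 then show ?thesis
  using that[OF S(1)[of 0] S(1)[of 1] S(2-4)[of 0] S(2,3)[of 1] q st(2,1)] S(1-4)[of "-1"] by blast
qed

lemma Pt_g_range: "abs p <= kp ==> abs s <= kp ==> (sF b s, rF b p s) \<in> ball 0 r0"
 using sF_le[of s b] rF_range[of p s b] num_r norm_Pair_le[of "sF b s" "rF b p s"] by simp

lemma yF_less: "abs p <= kp ==> abs s <= kp ==> abs (yF b p s) < y0"
proof -
 assume assms: "abs p <= kp" "abs s <= kp"
 have "abs (fst (g (sF b s, rF b p s)) - fst (g (0, 0))) <= Cl*(abs (sF b s - 0) + abs (rF b p s - 0))"
  using rF_range[OF assms, of b] pos by (intro Y_lip sF_le assms) simp_all
 also have "... <= Cl*(2 * ss + 3*\<rho>s)"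
  using pos sF_le[OF assms(2)] rF_range[OF assms] by (intro mult_left_mono add_mono) simp_all
 also have "... <= Cl*(2* ss + 3*etc*(c+ss)*\<rho>s + 3*\<rho>s)" using pos by (intro mult_left_mono) auto
 finally show ?thesis using num_y' by (simp add: yF_def g0)
qed

text \<open>Points of \<open>K\<close> pass through the regions where \<open>g\<close> and
  \<open>E\<close> have lower Lipschitz bounds, so equal images have equal values under
  \<open>P\<close>; exit angle and \<open>\<rho>\<close> together determine entry angle and
  height.\<close>

lemma R_inj_on: "inj_on R K"
proof (rule inj_onI)
 fix q q' assume "q \<in> K" "q' \<in> K" and eq: "R q = R q'"
 from K_cases[OF \<open>q \<in> K\<close>] obtain b p s z where q: "b < 2" "abs p < kp" "abs s < kp" "abs z < kp" "q = Pt b p s" "snd (g (sF b s, rF b p s)) = Z*(1 + z)" by metis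
 from K_cases[OF \<open>q' \<in> K\<close>] obtain b' p' s' z' where q': "b' < 2" "abs p' < kp" "abs s' < kp" "abs z' < kp" "q' = Pt b' p' s'" "snd (g (sF b' s', rF b' p' s')) = Z*(1 + z')" by metis
 have gq: "g (P q) = (yF b p s, Z*(1 + z))" "g (P q') = (yF b' p' s', Z*(1 + z'))"
  unfolding q(5) q'(5) P_Pt[OF less_imp_le[OF q(3)]] P_Pt[OF less_imp_le[OF q'(3)]] yF_def
  by (simp_all add: prod_eq_iff q(6) q'(6))
 have zz: "abs z < 1/2" "abs z' < 1/2" using q(4) q'(4) pos(8) by linarith+
 have "norm (g (P q) - g (P q')) <= M*norm (E (g (P q)) - E (g (P q')))"
  unfolding gq using q(2,3) q'(2,3) zz by (intro E_inj yF_less) simp_all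
 then have "g (P q) = g (P q')" using eq by (simp add: R)
 moreover have "norm (P q - P q') <= M*norm (g (P q) - g (P q'))"
  unfolding q(5) q'(5) P_Pt[OF less_imp_le[OF q(3)]] P_Pt[OF less_imp_le[OF q'(3)]]
  using q(2,3) q'(2,3) by (intro g_inj Pt_g_range) simp_all
 ultimately have "P q = P q'" by simp
 then have "sF b s = sF b' s'" "rF b p s = rF b' p' s'"
  unfolding q(5) q'(5) P_Pt[OF less_imp_le[OF q(3)]] P_Pt[OF less_imp_le[OF q'(3)]] by auto
 then show "q = q'" unfolding q(5) q'(5) Pt_def using pos(1,9,12) by (simp add: rF_def)
qed

lemma K_horseshoe: "compact K" "R ` K = K" "conjugate_to_full_shift R K"
proof -
 have c: "continuous_on ({-kp<..<kp} \<times> {-kp<..<kp}) (%(p, s). Pt b p s)" for b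
  unfolding Pt_def sF_def case_prod_unfold by (intro continuous_intros)
 have RR: "R (Pt b p s) = Pt b' p' s'" if "abs s < kp" "cf.step b p s z b' p' s'" for b b' p s z p' s'
  using that step_iff[OF less_imp_le[OF that(1)]] by blast
 note h = cf.full_shift_conjugacy[OF c _ RR R_inj_on]
 show "compact K" "R ` K = K" "conjugate_to_full_shift R K"
  by (rule h; (use Pt_inj in blast)?)+
qed


lemma P_has_derivative:
 assumes "0 < snd q" "abs (fst q - ln (snd q)/ete - \<tau>) < 2"
 shows "(P has_derivative (%v. (fst v - snd v/(ete * snd q), etc/ete * snd q powr (etc/ete - 1) * snd v))) (at q)"
proof -
 let ?S = "{q :: real \<times> real. 0 < snd q} \<inter> {q. 0 < snd q & abs (fst q - ln (snd q)/ete - \<tau>) < 2}"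
 have op: "open ?S"
 proof -
  have o: "open {q :: real \<times> real. 0 < snd q}"
   by (intro open_Collect_less continuous_intros)
  have "continuous_on {q :: real \<times> real. 0 < snd q} (%q. abs (fst q - ln (snd q)/ete - \<tau>))"
   using pos(2) by (intro continuous_intros) auto
  then have "open ({q. 0 < snd q} \<inter> (%q. abs (fst q - ln (snd q)/ete - \<tau>)) -` {..<2})"
   by (rule continuous_open_preimage[OF _ o]) simp
  then show ?thesis by (rule back_subst[of "open"]) auto
 qed
 have "((%q. (fst q - ln (snd q)/ete - \<tau>, snd q powr (etc/ete))) has_derivative
   (%v. (fst v - snd v/(ete * snd q), etc/ete * snd q powr (etc/ete - 1) * snd v))) (at q)"
 proof -
  have s: "(snd has_derivative snd) (at q)" by (rule has_derivative_snd[OF has_derivative_ident])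
  have "((%q. ln (snd q)) has_derivative (%v. snd v * inverse (snd q))) (at q)"
   using has_derivative_compose[OF s DERIV_ln[OF assms(1), THEN has_field_derivative_imp_has_derivative]]
   by (simp add: mult.commute)
  then have l: "((%q. ln (snd q)/ete) has_derivative (%v. (snd v * inverse (snd q))/ete)) (at q)"
   by (rule bounded_linear.has_derivative[OF bounded_linear_divide])
  have p: "((%q. snd q powr (etc/ete)) has_derivative (%v. etc/ete * snd q powr (etc/ete - 1) * snd v)) (at q)"
   using has_derivative_compose[OF s has_real_derivative_powr[OF assms(1), of "etc/ete", THEN has_field_derivative_imp_has_derivative]]
   by simp
  have "((%q. (fst q - ln (snd q)/ete - \<tau>, snd q powr (etc/ete))) has_derivative
   (%v. (fst v - (snd v * inverse (snd q))/ete - 0, etc/ete * snd q powr (etc/ete - 1) * snd v))) (at q)"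
   by (intro has_derivative_Pair has_derivative_diff l p has_derivative_const has_derivative_fst has_derivative_ident)
  then show ?thesis by (simp add: field_simps)
 qed
 then show ?thesis
  by (rule has_derivative_transform_within_open[OF _ op]) (use assms P in \<open>auto simp: prod_eq_iff\<close>)
qed

end

section \<open>Derivative of the return map and hyperbolicity\<close>

context strip_map begin

text \<open>\<open>La\<close> and \<open>Lb\<close> are the differentials of the coordinates
  \<open>pc\<close> and \<open>sc\<close>, the latter up to sign: dividing by \<open>ss\<close>
  instead of \<open>sb b\<close> makes the functional independent of the symbol.\<close>

definition "La q v = fst v/c" for q v :: "real \<times> real"
definition "Lb q v = (fst v - snd v/(ete * snd q))/ss" for q v :: "real \<times> real"

lemma pc_derivative: "(pc has_derivative La q) (at q)"
 unfolding pc_def[abs_def] La_def[abs_def]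
 by (rule bounded_linear.has_derivative[OF bounded_linear_divide has_derivative_fst[OF has_derivative_ident]])

lemma sc_derivative:
 assumes "0 < snd q"
 shows "(sc b has_derivative (%v. (ss/sb b)*Lb q v)) (at q)"
proof -
 have s: "(snd has_derivative snd) (at q)" by (rule has_derivative_snd[OF has_derivative_ident])
 have "((%q. ln (snd q)) has_derivative (%v. snd v * inverse (snd q))) (at q)"
  using has_derivative_compose[OF s DERIV_ln[OF assms, THEN has_field_derivative_imp_has_derivative]]
  by (simp add: mult.commute)
 then have l: "((%q. ln (snd q)/ete) has_derivative (%v. (snd v * inverse (snd q))/ete)) (at q)"
  by (rule bounded_linear.has_derivative[OF bounded_linear_divide])
 have "((%q. fst q - ln (snd q)/ete - \<tau>) has_derivative (%v. fst v - (snd v * inverse (snd q))/ete - 0)) (at q)"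
  by (intro has_derivative_diff l has_derivative_const has_derivative_fst has_derivative_ident)
 then have "((%q. (fst q - ln (snd q)/ete - \<tau>)/sb b - 1) has_derivative
   (%v. (fst v - (snd v * inverse (snd q))/ete - 0)/sb b - 0)) (at q)"
  by (rule has_derivative_diff[OF bounded_linear.has_derivative[OF bounded_linear_divide] has_derivative_const])
 moreover have "(%v. (fst v - (snd v * inverse (snd q))/ete - 0)/sb b - 0) = (%v. (ss/sb b)*Lb q v)"
 proof
  fix v :: "real \<times> real"
  have "(ss/sb b)*(x/ss) = x/sb b" for x using pos(13) by simp
  moreover have "(snd v * inverse (snd q))/ete = snd v/(ete * snd q)" by (simp add: divide_inverse mult_ac)
  ultimately show "(fst v - (snd v * inverse (snd q))/ete - 0)/sb b - 0 = (ss/sb b)*Lb q v"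
   unfolding Lb_def by simp
 qed
 ultimately show ?thesis unfolding sc_def[abs_def] by simp
qed

lemma abs_branch: "abs ((ss/sb b)*x) = abs x"
 using pos(13) by (simp add: abs_mult sb_abs)

definition "DR q = frechet_derivative R (at q)"

text \<open>The derivative of \<open>P\<close> is injective by its triangular formula, those of
  \<open>g\<close> and \<open>E\<close> by their lower Lipschitz bounds.\<close>

lemma R_derivative:
 assumes "q \<in> K"
 shows "(R has_derivative DR q) (at q)" "inj (DR q)"
proof -
 from K_cases[OF assms] obtain b p s z where q: "b < 2" "abs p < kp" "abs s < kp" "abs z < kp" "q = Pt b p s" "snd (g (sF b s, rF b p s)) = Z*(1 + z)" by metis
 note le = q(2-4)[THEN less_imp_le]
 let ?w = "(sF b s, rF b p s)" and ?y = "(yF b p s, Z*(1 + z))"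
 have Pq: "P q = ?w" unfolding q(5) by (rule P_Pt[OF le(2)])
 have gw: "g ?w = ?y" unfolding yF_def by (simp add: prod_eq_iff q(6))
 have w: "?w \<in> ball 0 r0" by (rule Pt_g_range[OF le(1,2)])
 have sq: "0 < snd q" unfolding q(5) by (rule pc_sc_Pt)
 have arg: "abs (fst q - ln (snd q)/ete - \<tau>) < 2"
 proof -
  have "fst q - ln (snd q)/ete - \<tau> = sF b s" unfolding q(5) Pt_def using pos(2) by simp
  then show ?thesis using sF_le[OF le(2), of b] ss1 by linarith
 qed
 define DP where "DP = (%v :: real \<times> real. (fst v - snd v/(ete * snd q), etc/ete * snd q powr (etc/ete - 1) * snd v))"
 define Dg where "Dg = frechet_derivative g (at ?w)"
 define DE where "DE = frechet_derivative E (at ?y)"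
 have dP: "(P has_derivative DP) (at q)" unfolding DP_def by (rule P_has_derivative[OF sq arg])
 have dg: "(g has_derivative Dg) (at (P q))"
  unfolding Pq Dg_def by (rule frechet_derivative_works[THEN iffD1, OF g_diff[OF w]])
 have z2: "abs z < 1/2" using q(4) pos(8) by linarith
 have dE: "(E has_derivative DE) (at (g (P q)))"
  unfolding Pq gw DE_def by (rule frechet_derivative_works[THEN iffD1, OF E_diff[OF yF_less[OF le(1,2)] z2]])
 have "((%x. E (g (P x))) has_derivative (%v. DE (Dg (DP v)))) (at q)"
  by (rule has_derivative_compose[OF has_derivative_compose[OF dP dg] dE])
 then have R': "(R has_derivative (%v. DE (Dg (DP v)))) (at q)" unfolding R[abs_def, symmetric] by (simp add: R[abs_def])
 then show der: "(R has_derivative DR q) (at q)"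
  unfolding DR_def using frechet_derivative_at[OF R'] by simp
 have DReq: "DR q = (%v. DE (Dg (DP v)))" unfolding DR_def using frechet_derivative_at[OF R'] by simp
 have DP0: "v = 0" if "DP v = 0" for v
 proof -
  have "etc/ete * snd q powr (etc/ete - 1) * snd v = 0" "fst v - snd v/(ete * snd q) = 0"
   using that by (auto simp: DP_def zero_prod_def)
  then show ?thesis using pos(1,2) sq by (simp add: prod_eq_iff)
 qed
 have Dg0: "norm v <= M*norm (Dg v)" for v
 proof (rule has_derivative_lower_bound[OF dg])
  have "\<forall>\<^sub>F y in nhds (P q). y \<in> ball 0 r0" unfolding Pq
   by (rule eventually_nhds_in_open[OF open_ball w])
  then show "\<forall>\<^sub>F y in nhds (P q). norm (y - P q) <= M*norm (g y - g (P q))"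
   by eventually_elim (use g_inj w Pq in simp)
 qed
 have DE0: "norm v <= M*norm (DE v)" for v
 proof (rule has_derivative_lower_bound[OF dE])
  let ?U = "{-y0<..<y0} \<times> {Z*(1/2)<..<Z*(3/2)}"
  have yU: "abs (fst y) < y0 & (\<exists>x. abs x < 1/2 & snd y = Z*(1 + x))" if "y \<in> ?U" for y
  proof -
   have "1/2 < snd y/Z" "snd y/Z < 3/2" "snd y = Z*(1 + (snd y/Z - 1))"
    using that pos(11) by (auto simp: field_simps)
   then have "abs (snd y/Z - 1) < 1/2" "snd y = Z*(1 + (snd y/Z - 1))"
    by (simp only: abs_less_iff, linarith) (use pos(11) in simp)
   then show ?thesis using that by (auto simp: abs_less_iff)
  qed
  have "Z*(1/2) < Z*(1 + z)" "Z*(1 + z) < Z*(3/2)" using z2 pos(11) by (intro mult_strict_left_mono; linarith)+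
  then have "?y \<in> ?U" using yF_less[OF le(1,2), of b] by (simp add: abs_less_iff; linarith)
  then have "\<forall>\<^sub>F y in nhds (g (P q)). y \<in> ?U" unfolding Pq gw
   by (intro eventually_nhds_in_open open_Times) auto
  then show "\<forall>\<^sub>F y in nhds (g (P q)). norm (y - g (P q)) <= M*norm (E y - E (g (P q)))"
  proof eventually_elim
   case (elim y)
   then obtain x where x: "abs (fst y) < y0" "abs x < 1/2" "y = (fst y, Z*(1 + x))"
    using yU[of y] by (metis prod.collapse)
   show ?case unfolding Pq gw using E_inj[OF x(1) yF_less[OF le(1,2)] x(2) z2] unfolding x(3)[symmetric] .
  qed
 qed
 have "v = 0" if "DR q v = 0" for v
 proof -
  have "DE (Dg (DP v)) = 0" using that DReq by simp
  then have "Dg (DP v) = 0" using DE0[of "Dg (DP v)"] by simp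
  then have "DP v = 0" using Dg0[of "DP v"] by simp
  then show ?thesis by (rule DP0)
 qed
 then show "inj (DR q)"
  using linear_injective_0[OF has_derivative_linear[OF der]] by blast
qed

text \<open>Since \<open>Lb\<close> divides by the height, this makes the comparison of the norm
  with \<open>La\<close> and \<open>Lb\<close> uniform over \<open>K\<close>.\<close>

lemma snd_range:
 assumes "q \<in> K"
 shows "\<epsilon>/3 <= snd q" "snd q <= 3*\<epsilon>"
proof -
 from K_cases[OF assms] obtain b p s where q: "abs p < kp" "abs s < kp" "q = Pt b p s" by metis
 let ?t = "ete*(c*p - sF b s)"
 have t: "abs (?t) <= 1" using arg_le[OF less_imp_le[OF q(1)] less_imp_le[OF q(2)] pos(2) num_t(2)] .
 have e: "snd q = \<epsilon>*exp ?t" unfolding q(3) Pt_def snd_conv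
  by (subst eps) (simp add: exp_add[symmetric] algebra_simps)
 have "\<epsilon>*exp ?t <= \<epsilon>*3" using exp_le3[OF t] pos(10) by (intro mult_left_mono) auto
 then show "snd q <= 3*\<epsilon>" unfolding e by simp
 have "1/exp ?t <= 3" using exp_le3[of "- ?t"] t by (simp add: exp_minus inverse_eq_divide)
 then have "1/3 <= exp ?t" by (simp add: field_simps)
 then have "\<epsilon>*(1/3) <= \<epsilon>*exp ?t" using pos(10) by (intro mult_left_mono) auto
 then show "\<epsilon>/3 <= snd q" unfolding e by simp
qed

text \<open>\<open>cf.step\<close> speaks of one step only, so it holds for all points near
  \<open>q\<close>, whether or not their orbits continue. Hence \<open>cf.cross_contraction\<close>
  applies to \<open>q\<close> and \<open>q + t *\<^sub>R v\<close> for small \<open>t\<close>, and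
  the limit gives the statement for derivatives.\<close>

lemma cross_linear:
 assumes "q \<in> K"
 shows "abs (Lb q v) <= 3/4*max (abs (La q v)) (abs (Lb (R q) (DR q v)))"
  "abs (La (R q) (DR q v)) <= 3/4*max (abs (La q v)) (abs (Lb (R q) (DR q v)))"
proof -
 from K_cases[OF assms] obtain b b' p s z p' s' where q: "b < 2" "b' < 2" "abs p < kp" "abs s < kp" "abs z < kp" "abs p' < kp" "abs s' < kp"
  "q = Pt b p s" "R q = Pt b' p' s'" "snd (g (sF b s, rF b p s)) = Z*(1 + z)" by metis
 note le = q(3-7)[THEN less_imp_le]
 define l where "l t = q + t *\<^sub>R v" for t
 define X where "X t = pc (l t)" for t
 define U where "U t = sc b (l t)" for t
 define W where "W t = pc (R (l t))" for t
 define Y where "Y t = sc b' (R (l t))" for t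
 \<comment> \<open>The rescaled height of the moving point is read off from \<open>g\<close>, so the
   height equation of \<open>cf.step\<close> holds by definition.\<close>
 define z' where "z' t = snd (g (P (l t)))/Z - 1" for t
 have sq: "0 < snd q" "0 < snd (R q)" unfolding q(9) unfolding q(8) by (rule pc_sc_Pt)+
 have Rder: "(R has_derivative DR q) (at q)" by (rule R_derivative[OF assms])
 have dX: "(X has_vector_derivative La q v) (at 0)"
  unfolding X_def[abs_def] l_def by (rule has_derivative_line[OF pc_derivative])
 have dU: "(U has_vector_derivative (ss/sb b)*Lb q v) (at 0)"
  unfolding U_def[abs_def] l_def by (rule has_derivative_line[OF sc_derivative[OF sq(1)]])
 have dW: "(W has_vector_derivative La (R q) (DR q v)) (at 0)"
  unfolding W_def[abs_def] l_def by (rule has_derivative_line[OF has_derivative_compose[OF Rder pc_derivative]])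
 have dY: "(Y has_vector_derivative (ss/sb b')*Lb (R q) (DR q v)) (at 0)"
  unfolding Y_def[abs_def] l_def by (rule has_derivative_line[OF has_derivative_compose[OF Rder sc_derivative[OF sq(2)]]])
 have l0: "l 0 = q" by (simp add: l_def)
 have X0: "X 0 = p" "U 0 = s" "W 0 = p'" "Y 0 = s'" "z' 0 = z"
 proof -
  show "X 0 = p" "U 0 = s" unfolding X_def U_def l0 unfolding q(8) by (rule pc_sc_Pt)+
  show "W 0 = p'" "Y 0 = s'" unfolding W_def Y_def l0 unfolding q(9) by (rule pc_sc_Pt)+
  show "z' 0 = z" unfolding z'_def l0 unfolding q(8) P_Pt[OF le(2)] q(10) using pos(11) by simp
 qed
 have contl: "(l \<longlongrightarrow> q) (at 0)"
 proof -
  have "((%t. q + t *\<^sub>R v) \<longlongrightarrow> q + 0 *\<^sub>R v) (at 0)" by (intro tendsto_intros)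
  then show ?thesis by (simp add: l_def[abs_def])
 qed
 have limz: "(z' \<longlongrightarrow> z) (at 0)"
 proof -
  have Pq: "P q = (sF b s, rF b p s)" unfolding q(8) by (rule P_Pt[OF le(2)])
  have "fst q - ln (snd q)/ete - \<tau> = sF b s" unfolding q(8) Pt_def using pos(2) by simp
  then have "abs (fst q - ln (snd q)/ete - \<tau>) < 2" using sF_le[OF le(2), of b] ss1 by linarith
  then have "isCont P q" using has_derivative_continuous[OF P_has_derivative[OF sq(1)]] by simp
  moreover have "isCont g (P q)" unfolding Pq
   by (rule differentiable_imp_continuous_within[OF g_diff[OF Pt_g_range[OF le(1,2)]]])
  ultimately have "((%t. g (P (l t))) \<longlongrightarrow> g (P q)) (at 0)"
   using contl by (intro isCont_tendsto_compose[of _ g] isCont_tendsto_compose[of _ P])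
  then have "((%t. snd (g (P (l t)))/Z - 1) \<longlongrightarrow> snd (g (P q))/Z - 1) (at 0)"
   using pos(11) by (intro tendsto_intros) auto
  then show ?thesis using X0(5) by (simp add: z'_def[abs_def] l0)
 qed
 have limR: "((%t. R (l t)) \<longlongrightarrow> R q) (at 0)"
  using has_derivative_continuous[OF Rder] contl by (intro isCont_tendsto_compose[of _ R]) auto
 have near: "\<forall>\<^sub>F t in at 0. abs (f t) < kp" if "(f has_vector_derivative d) (at 0)" "abs (f 0) < kp" for f d
  using order_tendstoD(2)[OF tendsto_rabs that(2), of f] has_vector_derivative_continuous[OF that(1)]
  by (auto simp: isCont_def)
 have "\<forall>\<^sub>F t in at 0. abs (X t) < kp" "\<forall>\<^sub>F t in at 0. abs (U t) < kp" "\<forall>\<^sub>F t in at 0. abs (W t) < kp" "\<forall>\<^sub>F t in at 0. abs (Y t) < kp"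
  using near[OF dX] near[OF dU] near[OF dW] near[OF dY] X0 q by auto
 moreover have "\<forall>\<^sub>F t in at 0. abs (z' t) < kp"
  using order_tendstoD(2)[OF tendsto_rabs[OF limz] q(5)] .
 moreover have "\<forall>\<^sub>F t in at 0. 0 < snd (l t)"
  using order_tendstoD(1)[OF tendsto_snd[OF contl] sq(1)] .
 moreover have "\<forall>\<^sub>F t in at 0. 0 < snd (R (l t))"
  using order_tendstoD(1)[OF tendsto_snd[OF limR] sq(2)] .
 ultimately have ev: "\<forall>\<^sub>F t in at 0. abs (U t - U 0) <= 3/4*max (abs (X t - X 0)) (abs (Y t - Y 0)) & abs (W t - W 0) <= 3/4*max (abs (X t - X 0)) (abs (Y t - Y 0))"
 proof eventually_elim
  case (elim t)
  have lt: "Pt b (X t) (U t) = l t" unfolding X_def U_def by (rule Pt_pc_sc[OF elim(6)])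
  have Rlt: "Pt b' (W t) (Y t) = R (l t)" unfolding W_def Y_def by (rule Pt_pc_sc[OF elim(7)])
  have "P (l t) = (sF b (U t), rF b (X t) (U t))" unfolding lt[symmetric] by (rule P_Pt[OF less_imp_le[OF elim(2)]])
  then have "snd (g (sF b (U t), rF b (X t) (U t))) = Z*(1 + z' t)" unfolding z'_def using pos(11) by simp
  then have st: "cf.step b (X t) (U t) (z' t) b' (W t) (Y t)"
   unfolding step_iff[OF less_imp_le[OF elim(2)]] lt Rlt by simp
  have st0: "cf.step b p s z b' p' s'"
   unfolding step_iff[OF le(2)] using q(8,9,10) by simp
  show ?case unfolding X0
   using cf.cross_contraction[OF q(1,2) st st0] elim(1-5)[THEN less_imp_le] le by blast
 qed
 show "abs (Lb q v) <= 3/4*max (abs (La q v)) (abs (Lb (R q) (DR q v)))"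
  using derivative_cross_le[OF dX dY dU eventually_mono[OF ev]] unfolding abs_branch by blast
 show "abs (La (R q) (DR q v)) <= 3/4*max (abs (La q v)) (abs (Lb (R q) (DR q v)))"
  using derivative_cross_le[OF dX dY dW eventually_mono[OF ev]] unfolding abs_branch by blast
qed

lemma K_hyperbolic: "uniformly_hyperbolic R K"
proof (rule uniformly_hyperbolicI[where D = DR and a = La and b = Lb and \<theta> = "3/4"])
 \<comment> \<open>The sum of the three constants that arise when \<open>norm v\<close> is compared
   with \<open>La\<close> and \<open>Lb\<close>, in both directions.\<close>
 define C where "C = (c + 3*ete*\<epsilon>*(c + ss)) + 1/c + (1 + 3/(ete*\<epsilon>))/ss"
 show "cross_cocycle K R DR La Lb (3/4) C"
 proof (rule cross_cocycle.intro)
  fix q v assume q: "q \<in> K"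
  have sq: "0 < snd q" using snd_range[OF q] pos(10) by linarith
  show "R q \<in> K" using K_horseshoe(2) q by blast
  show "linear (DR q)" using R_derivative[OF q] by (rule_tac has_derivative_linear)
  show "inj (DR q)" using R_derivative[OF q] by blast
  show "linear (La q)" by (rule has_derivative_linear[OF pc_derivative])
  show "linear (Lb q)" unfolding Lb_def[abs_def]
   by (intro linearI) (simp_all add: add_divide_distrib diff_divide_distrib right_diff_distrib)
  show "abs (Lb q v) <= 3/4*max (abs (La q v)) (abs (Lb (R q) (DR q v)))"
   "abs (La (R q) (DR q v)) <= 3/4*max (abs (La q v)) (abs (Lb (R q) (DR q v)))"
   by (rule cross_linear[OF q])+
  let ?m = "max (abs (La q v)) (abs (Lb q v))"
  have m: "abs (La q v) <= ?m" "abs (Lb q v) <= ?m" "0 <= ?m" by (auto simp: le_max_iff_disj)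
  have v1: "abs (fst v) <= c * ?m"
  proof -
   have "fst v = c*La q v" using pos(9) by (simp add: La_def)
   then show ?thesis using pos(9) m(1) by (simp add: abs_mult)
  qed
  have v2: "abs (snd v) <= 3*ete*\<epsilon>*(c + ss) * ?m"
  proof -
   have "snd v = (ete * snd q)*(fst v - ss*Lb q v)" using pos(2,13) sq by (simp add: Lb_def)
   then have "abs (snd v) = (ete * snd q)*abs (fst v - ss*Lb q v)" using pos(2) sq by (simp add: abs_mult)
   also have "... <= (ete*(3*\<epsilon>))*(c * ?m + ss * ?m)"
   proof (intro mult_mono mult_left_mono snd_range[OF q])
    have "abs (ss*Lb q v) <= ss * ?m" using pos(13) m(2) by (simp add: abs_mult)
    then show "abs (fst v - ss*Lb q v) <= c * ?m + ss * ?m" using v1 by linarith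
   qed (use pos sq in auto)
   finally show ?thesis by (simp add: algebra_simps)
  qed
  have C1: "c + 3*ete*\<epsilon>*(c + ss) <= C" "1/c <= C" "(1 + 3/(ete*\<epsilon>))/ss <= C"
   unfolding C_def using pos(2,9,10,13) by simp_all
  have "norm v <= abs (fst v) + abs (snd v)" using norm_Pair_le[of "fst v" "snd v"] by simp
  also have "... <= (c + 3*ete*\<epsilon>*(c + ss)) * ?m" using v1 v2 by (simp add: distrib_right)
  also have "... <= C * ?m" using C1(1) m(3) by (rule mult_right_mono)
  finally show "norm v <= C * ?m" .
  have "abs (La q v) <= (1/c)*norm v"
   unfolding La_def using pos(9) fst_le[of v] by (simp add: divide_right_mono)
  also have "... <= C*norm v" using C1(2) by (rule mult_right_mono) simp
  finally have a: "abs (La q v) <= C*norm v" .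
  have "abs (snd v/(ete * snd q)) <= norm v * (3/(ete*\<epsilon>))"
  proof -
   have "abs (snd v/(ete * snd q)) = abs (snd v)/(ete * snd q)" using pos(2) sq by simp
   also have "... <= norm v/(ete*(\<epsilon>/3))"
    using snd_le[of v] snd_range(1)[OF q] pos(2,10) by (intro frac_le mult_left_mono) auto
   finally show ?thesis by simp
  qed
  then have "abs (fst v - snd v/(ete * snd q)) <= norm v * (1 + 3/(ete*\<epsilon>))"
   using fst_le[of v] unfolding distrib_left by linarith
  then have "abs (Lb q v) <= norm v * (1 + 3/(ete*\<epsilon>))/ss"
   unfolding Lb_def abs_divide using pos(13) by (simp add: divide_right_mono)
  also have "... = ((1 + 3/(ete*\<epsilon>))/ss)*norm v" by simp
  also have "... <= C*norm v" using C1(3) by (rule mult_right_mono) simp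
  finally show "?m <= C*norm v" using a by simp
 qed auto
qed (use K_horseshoe(2) R_inj_on R_derivative in blast)+

lemma Fp_le:
 assumes "abs p <= kp" "abs s <= kp" "abs z <= kp"
 shows "abs (c*Fp b p s z) <= (abs A1*(1 + 2*d1) + 4*\<eta>)*Z powr d1"
proof -
 have k0: "abs 0 <= kp" using pos(7) by simp
 have "abs ((1 + z) powr d1 - (1 + 0) powr d1) <= 2*d1*abs (z - 0)" by (rule powr_lip[OF assms(3) k0])
 also have "... <= 2*d1*1" using assms(3) pos(3,8) by (intro mult_left_mono) auto
 finally have 1: "(1 + z) powr d1 <= 1 + 2*d1" by simp
 have "norm (Rest (yF b p s) z - Rest (yF b p s) 0) <= 2*\<eta>*Z powr d1*1"
  using assms(3) pos(8) by (intro Rest_diff assms k0) auto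
 then have "norm (Rest (yF b p s) z) <= 4*\<eta>*Z powr d1"
  using Rest_le[OF assms(1,2), of b] norm_triangle_ineq2[of "Rest (yF b p s) z" "Rest (yF b p s) 0"] by linarith
 then have 2: "abs (fst (Rest (yF b p s) z)) <= 4*\<eta>*Z powr d1" by (rule order_trans[OF fst_le])
 have "c*Fp b p s z = A1*Z powr d1*(1 + z) powr d1 + fst (Rest (yF b p s) z)"
  using Fp_form[OF assms(3), of b p s] pos(9) by simp
 then have "abs (c*Fp b p s z) <= abs A1*Z powr d1*(1 + z) powr d1 + abs (fst (Rest (yF b p s) z))"
  using abs_triangle_ineq[of "A1*Z powr d1*(1 + z) powr d1" "fst (Rest (yF b p s) z)"] by (simp add: abs_mult)
 also have "... <= abs A1*Z powr d1*(1 + 2*d1) + 4*\<eta>*Z powr d1"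
  using 1 2 by (intro add_mono mult_left_mono) auto
 finally show ?thesis by (simp add: algebra_simps)
qed

text \<open>All bounds are quantities that tend to 0 as the strip number grows; this is what brings
  the horseshoes close to the cycle. The entry angle is small because the point is itself a
  return.\<close>

lemma K_bounds:
 assumes "(\<psi>, z) \<in> K"
 shows "\<exists>s \<rho> y \<zeta>. abs \<psi> <= (abs A1*(1 + 2*d1) + 4*\<eta>)*Z powr d1 & z = exp (ete*(\<psi> - s - \<tau>)) & abs s <= 2 * ss &
  P (\<psi>, z) = (s, \<rho>) & 0 < \<rho> & \<rho> <= 3*\<rho>s & g (s, \<rho>) = (y, \<zeta>) &
  abs y <= Cl*(2* ss + 3*etc*(c+ss)*\<rho>s + 3*\<rho>s) & 0 < \<zeta> & \<zeta> <= 2*Z"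
proof -
 obtain b p s z0 b'' p'' s'' z'' where q: "abs p < kp" "abs s < kp" "abs z0 < kp" "(\<psi>, z) = Pt b p s" "snd (g (sF b s, rF b p s)) = Z*(1 + z0)"
   "abs p'' < kp" "abs s'' < kp" "abs z'' < kp" "p = Fp b'' p'' s'' z''"
  using assms by (rule K_cases) blast
 note le = q(1-3)[THEN less_imp_le]
 have \<psi>: "\<psi> = c*p" "z = exp (ete*(\<psi> - sF b s - \<tau>))" using q(4) by (auto simp: Pt_def)
 have "0 < Z*(1 + z0)" "Z*(1 + z0) <= 2*Z" using q(3) pos(8,11) by (auto simp: zero_less_mult_iff)
 moreover have "abs \<psi> <= (abs A1*(1 + 2*d1) + 4*\<eta>)*Z powr d1"
  unfolding \<psi>(1) q(9) by (rule Fp_le[OF less_imp_le[OF q(6)] less_imp_le[OF q(7)] less_imp_le[OF q(8)]])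
 moreover have "0 < rF b p s" using pos(12) by (simp add: rF_def)
 moreover have "abs (yF b p s) <= Cl*(2* ss + 3*etc*(c+ss)*\<rho>s + 3*\<rho>s)"
 proof -
  have "abs (fst (g (sF b s, rF b p s)) - fst (g (0, 0))) <= Cl*(abs (sF b s - 0) + abs (rF b p s - 0))"
   using rF_range[OF le(1,2), of b] pos by (intro Y_lip sF_le le) simp_all
  also have "... <= Cl*(2 * ss + 3*\<rho>s)"
   using pos sF_le[OF le(2)] rF_range[OF le(1,2)] by (intro mult_left_mono add_mono) simp_all
  also have "... <= Cl*(2* ss + 3*etc*(c+ss)*\<rho>s + 3*\<rho>s)" using pos by (intro mult_left_mono) auto
  finally show ?thesis by (simp add: yF_def g0)
 qed
 moreover have "g (sF b s, rF b p s) = (yF b p s, Z*(1 + z0))"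
  unfolding yF_def by (simp add: prod_eq_iff q(5))
 moreover have "P (\<psi>, z) = (sF b s, rF b p s)" unfolding q(4) by (rule P_Pt[OF le(2)])
 ultimately show ?thesis
  using \<psi>(2) sF_le[OF le(2), of b] rF_range[OF le(1,2), of b] by blast
qed

end

section \<open>Calculus of \<open>C\<^sup>k\<close> maps\<close>

lemma Ck_continuous: "Ck k S f ==> continuous_on S f"
proof (cases k)
 case (Suc m)
 assume "Ck k S f"
 then have "\<forall>x\<in>S. f differentiable (at x)" using Suc by simp
 then show ?thesis by (auto intro!: continuous_at_imp_continuous_on differentiable_imp_continuous_within)
qed simp

lemma Ck_SucD: "Ck (Suc k) S f ==> Ck k S f"
proof (induction k arbitrary: f)
 case 0 then show ?case using Ck_continuous[of "Suc 0" S f] by simp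
next
 case (Suc k)
 then show ?case by (metis Ck.simps(2))
qed

lemma Ck_le: "m <= k ==> Ck k S f ==> Ck m S f"
 by (induction rule: inc_induct) (blast intro: Ck_SucD)+

lemma linear_norm_le_Basis:
 fixes f :: "'a::euclidean_space => 'b::real_normed_vector"
 assumes "linear f" "!!i. i \<in> Basis ==> norm (f i) <= B"
 shows "norm (f v) <= real DIM('a)*B*norm v"
proof -
 have "f v = (\<Sum>i\<in>Basis. (v \<bullet> i) *\<^sub>R f i)"
  using linear_sum[OF assms(1), of "%i. (v \<bullet> i) *\<^sub>R i" Basis] linear_scale[OF assms(1)]
  by (simp add: euclidean_representation)
 then have "norm (f v) <= (\<Sum>i\<in>(Basis::'a set). norm ((v \<bullet> i) *\<^sub>R f i))" by (simp only: norm_sum)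
 also have "... <= (\<Sum>i\<in>(Basis::'a set). norm v * B)"
  using assms(2) by (intro sum_mono) (auto intro!: mult_mono Basis_le_norm simp: )
 finally show ?thesis by (simp add: mult_ac)
qed

text \<open>\<open>Ck\<close> yields continuity of the derivative vector by vector. Control on the
  finitely many basis vectors, with \<open>e\<close> divided by twice the dimension, controls the
  operator norm, and the mean value inequality for \<open>f\<close> minus its linear part
  finishes.\<close>

lemma Ck_strict:
 fixes f :: "'a::euclidean_space => 'b::real_normed_vector"
 assumes f: "Ck (Suc 0) S f" and S: "open S" "x \<in> S" and e: "0 < e"
 obtains d where "0 < d" "ball x d \<subseteq> S"
  "!!u v. u \<in> ball x d ==> v \<in> ball x d ==> norm (f u - f v - frechet_derivative f (at x) (u - v)) <= e*norm (u - v)"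
proof -
 let ?D = "%y. frechet_derivative f (at y)"
 let ?e = "e/(2*real DIM('a))"
 have e': "0 < ?e" using e by simp
 have D: "(f has_derivative ?D y) (at y)" if "y \<in> S" for y
  using f that frechet_derivative_works by auto
 have "\<forall>\<^sub>F y in nhds x. \<forall>i\<in>Basis. norm (?D y i - ?D x i) < ?e"
 proof (rule eventually_ball_finite[OF finite_Basis], rule ballI)
  fix i :: 'a assume "i \<in> Basis"
  have "isCont (%y. ?D y i) x"
   using f S by (simp add: continuous_on_eq_continuous_at)
  then have "((%y. ?D y i) \<longlongrightarrow> ?D x i) (nhds x)" by (simp add: isCont_def tendsto_nhds_iff)
  then show "\<forall>\<^sub>F y in nhds x. norm (?D y i - ?D x i) < ?e"
   using e' by (auto simp: tendsto_iff dist_norm)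
 qed
 moreover have "\<forall>\<^sub>F y in nhds x. y \<in> S" by (rule eventually_nhds_in_open[OF S])
 ultimately have "\<forall>\<^sub>F y in nhds x. y \<in> S & (\<forall>i\<in>Basis. norm (?D y i - ?D x i) < ?e)"
  by eventually_elim auto
 then obtain d where d: "0 < d" "!!y. dist y x < d ==> y \<in> S & (\<forall>i\<in>Basis. norm (?D y i - ?D x i) < ?e)"
  unfolding eventually_nhds_metric by blast
 show ?thesis
 proof (rule that[OF d(1)])
  show "ball x d \<subseteq> S" using d(2) by (auto simp: dist_commute)
  fix u v assume uv: "u \<in> ball x d" "v \<in> ball x d"
  have xS: "x \<in> S" by (rule S)
  have "norm ((f u - ?D x u) - (f v - ?D x v)) <= e*norm (u - v)"
  proof (rule differentiable_bound[of "ball x d"])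
   fix y assume y: "y \<in> ball x d"
   then have y': "y \<in> S" "\<forall>i\<in>Basis. norm (?D y i - ?D x i) < ?e" using d(2)[of y] by (auto simp: dist_commute)
   show "((%u. f u - ?D x u) has_derivative (%v. ?D y v - ?D x v)) (at y within ball x d)"
    by (intro has_derivative_diff has_derivative_at_withinI[OF D[OF y'(1)]]
      bounded_linear_imp_has_derivative has_derivative_bounded_linear[OF D[OF xS]])
   show "onorm (%v. ?D y v - ?D x v) <= e"
   proof (rule onorm_le)
    fix v
    have "linear (%v. ?D y v - ?D x v)"
     by (intro linear_compose_sub has_derivative_linear[OF D] y' xS)
    then have "norm (?D y v - ?D x v) <= real DIM('a) * ?e*norm v"
     using y'(2) by (intro linear_norm_le_Basis) (auto intro: less_imp_le)
    also have "... <= e*norm v" using e by (intro mult_right_mono) auto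
    finally show "norm (?D y v - ?D x v) <= e*norm v" .
   qed
  qed (use uv in auto)
  moreover have "f u - f v - ?D x (u - v) = (f u - ?D x u) - (f v - ?D x v)"
   unfolding linear_diff[OF has_derivative_linear[OF D[OF xS]]] by simp
  ultimately show "norm (f u - f v - ?D x (u - v)) <= e*norm (u - v)" by (simp only:)
 qed
qed

text \<open>The mean value inequality along a segment, with the two coordinate directions kept
  apart: near the tangency and near \<open>E\<close> the two partial derivatives have different
  orders.\<close>

lemma partial_derivative_bound:
 fixes f :: "real \<times> real => 'b::real_normed_vector"
 assumes "convex S" "u \<in> S" "v \<in> S" "!!w. w \<in> S ==> (f has_derivative f' w) (at w)"
  "!!w. w \<in> S ==> norm (f' w (1, 0)) <= A" "!!w. w \<in> S ==> norm (f' w (0, 1)) <= B"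
 shows "norm (f u - f v) <= A*abs (fst u - fst v) + B*abs (snd u - snd v)"
proof -
 let ?g = "%t. f (v + t *\<^sub>R (u - v))"
 have inS: "v + t *\<^sub>R (u - v) \<in> S" if "t \<in> {0..1}" for t
  using convexD_alt[OF assms(1,3,2), of t] that by (simp add: algebra_simps)
 have "norm (?g 1 - ?g 0) <= (A*abs (fst u - fst v) + B*abs (snd u - snd v))*norm (1 - 0 :: real)"
 proof (rule differentiable_bound[of "{0..1}"])
  fix t :: real assume t: "t \<in> {0..1}"
  let ?w = "v + t *\<^sub>R (u - v)"
  have "((%t. v + t *\<^sub>R (u - v)) has_derivative (%h. h *\<^sub>R (u - v))) (at t within {0..1})"
   by (auto intro!: derivative_eq_intros)
  then show "(?g has_derivative (%h. f' ?w (h *\<^sub>R (u - v)))) (at t within {0..1})"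
   by (rule has_derivative_compose) (rule assms(4)[OF inS[OF t]])
  have lin: "linear (f' ?w)" by (rule has_derivative_linear[OF assms(4)[OF inS[OF t]]])
  show "onorm (%h. f' ?w (h *\<^sub>R (u - v))) <= A*abs (fst u - fst v) + B*abs (snd u - snd v)"
  proof (rule onorm_le)
   fix h :: real
   have e: "u - v = (fst u - fst v) *\<^sub>R (1, 0) + (snd u - snd v) *\<^sub>R (0, 1)" by (simp add: prod_eq_iff)
   have "f' ?w (u - v) = (fst u - fst v) *\<^sub>R f' ?w (1, 0) + (snd u - snd v) *\<^sub>R f' ?w (0, 1)"
    by (subst e) (simp only: linear_add[OF lin] linear_scale[OF lin])
   then have "norm (f' ?w (u - v)) <= abs (fst u - fst v)*norm (f' ?w (1, 0)) + abs (snd u - snd v)*norm (f' ?w (0, 1))"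
    using norm_triangle_ineq[of "(fst u - fst v) *\<^sub>R f' ?w (1, 0)" "(snd u - snd v) *\<^sub>R f' ?w (0, 1)"] by simp
   also have "... <= abs (fst u - fst v)*A + abs (snd u - snd v)*B"
    using assms(5,6)[OF inS[OF t]] by (intro add_mono mult_left_mono) auto
   finally have "norm (f' ?w (u - v)) <= A*abs (fst u - fst v) + B*abs (snd u - snd v)" by (simp add: mult.commute)
   then have "abs h*norm (f' ?w (u - v)) <= abs h*(A*abs (fst u - fst v) + B*abs (snd u - snd v))"
    by (rule mult_left_mono) simp
   then show "norm (f' ?w (h *\<^sub>R (u - v))) <= (A*abs (fst u - fst v) + B*abs (snd u - snd v))*norm h"
    by (simp add: linear_scale[OF lin] mult.commute)
  qed
 qed auto
 then show ?thesis by simp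
qed

text \<open>Strict differentiability with error half of the lower bound \<open>B\<close> of the
  injective derivative gives both Lipschitz estimates.\<close>

lemma Ck_lower_bound:
 fixes f :: "'a::euclidean_space => 'b::euclidean_space"
 assumes f: "Ck (Suc 0) S f" and S: "open S" "x \<in> S" and inj: "inj (frechet_derivative f (at x))"
 obtains d M where "0 < d" "0 < M" "ball x d \<subseteq> S"
  "!!u v. u \<in> ball x d ==> v \<in> ball x d ==> norm (u - v) <= M*norm (f u - f v)"
  "!!u v. u \<in> ball x d ==> v \<in> ball x d ==> norm (f u - f v) <= M*norm (u - v)"
proof -
 let ?D = "frechet_derivative f (at x)"
 have D: "(f has_derivative ?D) (at x)" using f S(2) frechet_derivative_works by auto
 have bl: "bounded_linear ?D" by (rule has_derivative_bounded_linear[OF D])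
 obtain B where B: "B > 0" "!!v. norm v * B <= norm (?D v)"
  using linear_inj_bounded_below_pos[OF bounded_linear.linear[OF bl] inj] by (auto simp: mult.commute)
 obtain d where d: "0 < d" "ball x d \<subseteq> S"
  "!!u v. u \<in> ball x d ==> v \<in> ball x d ==> norm (f u - f v - ?D (u - v)) <= B/2*norm (u - v)"
  using Ck_strict[OF f S, of "B/2"] B(1) by auto
 obtain C where C: "C > 0" "!!v. norm (?D v) <= norm v * C" using bounded_linear.pos_bounded[OF bl] by blast
 let ?M = "2/B + (B/2 + C)"
 show ?thesis
 proof (rule that[OF d(1) _ d(2)])
  show "0 < ?M" using B(1) C(1) by (simp add: add_pos_pos)
  fix u v assume uv: "u \<in> ball x d" "v \<in> ball x d"
  have "norm (?D (u - v)) <= norm (f u - f v) + norm (f u - f v - ?D (u - v))"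
   using norm_triangle_ineq4[of "f u - f v" "f u - f v - ?D (u - v)"] by simp
  then have "norm (u - v)*B <= norm (f u - f v) + B/2*norm (u - v)"
   using B(2)[of "u - v"] d(3)[OF uv] by linarith
  then have "B/2*norm (u - v) <= norm (f u - f v)" by (simp add: field_simps)
  then have "norm (u - v) <= 2/B*norm (f u - f v)" using B(1) by (simp add: field_simps)
  also have "... <= ?M*norm (f u - f v)" using B(1) C(1) by (intro mult_right_mono) auto
  finally show "norm (u - v) <= ?M*norm (f u - f v)" .
  have "norm (f u - f v) <= norm (f u - f v - ?D (u - v)) + norm (?D (u - v))"
   using norm_triangle_ineq[of "f u - f v - ?D (u - v)" "?D (u - v)"] by simp
  also have "... <= B/2*norm (u - v) + norm (u - v)*C" by (intro add_mono d(3)[OF uv] C(2))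
  also have "... <= ?M*norm (u - v)" using B(1) by (simp add: algebra_simps)
  finally show "norm (f u - f v) <= ?M*norm (u - v)" .
 qed
qed

text \<open>After \<open>k * s\<^sup>2\<close> and \<open>c22*\<rho>\<close> are subtracted, the
  derivative in \<open>s\<close> is the mixed second derivative times \<open>\<rho>\<close>, up to
  an error small relative to \<open>norm w\<close>, because the first partial derivative is
  differentiable at 0. The derivative in \<open>\<rho>\<close> is small by continuity. So only
  \<open>\<rho>m\<close> carries a fixed factor, and \<open>Cg\<close> can be chosen before
  \<open>\<eta>\<close>.\<close>

lemma tangency_map_estimate:
 fixes g :: "real \<times> real => real \<times> real"
 assumes g: "Ck 2 (ball 0 r) g" "0 < r"
  and dg: "(g has_derivative (%(\<psi>, \<rho>). (c11*\<psi> + c12*\<rho>, c22*\<rho>))) (at 0)"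
  and k: "dird [(1, 0), (1, 0)] (%w. snd (g w)) 0 = 2*k"
 shows "\<exists>Cg\<ge>0. \<forall>\<eta>>0. \<exists>r'>0. \<forall>S \<rho>m s s' \<rho> \<rho>'. S <= r' & \<rho>m <= r' & abs s <= S & abs s' <= S & 0 <= \<rho> & \<rho> <= \<rho>m & 0 <= \<rho>' & \<rho>' <= \<rho>m -->
   abs ((snd (g (s, \<rho>)) - k * s\<^sup>2 - c22*\<rho>) - (snd (g (s', \<rho>')) - k * s'\<^sup>2 - c22*\<rho>')) <= (\<eta>*S + Cg*\<rho>m)*abs (s - s') + \<eta>*abs (\<rho> - \<rho>')"
proof -
 let ?D = "%w. frechet_derivative g (at w)"
 have D: "(g has_derivative ?D w) (at w)" if "w \<in> ball 0 r" for w
  by (rule frechet_derivative_works[THEN iffD1]) (use g(1) that in \<open>simp add: numeral_2_eq_2\<close>)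
 have D0: "?D 0 = (%(\<psi>, \<rho>). (c11*\<psi> + c12*\<rho>, c22*\<rho>))"
  using frechet_derivative_at[OF dg] by simp
 have b0: "0 \<in> ball (0::real \<times> real) r" using g(2) by simp
 have Fr: "frechet_derivative (%w. snd (g w)) (at w) v = snd (?D w v)" if "w \<in> ball 0 r" for w v
  using frechet_derivative_at[OF has_derivative_snd[OF D[OF that]]] by (metis (no_types))
 define Fs where "Fs w = snd (?D w (1, 0))" for w
 define Fr' where "Fr' w = snd (?D w (0, 1))" for w
 have diffD: "(%w. ?D w v) differentiable (at 0)" for v
 proof -
  have "\<forall>v. Ck (Suc 0) (ball 0 r) (%w. ?D w v)" using g(1) unfolding numeral_2_eq_2 Ck.simps by blast
  then show ?thesis using b0 unfolding Ck.simps by blast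
 qed
 have "(Fs has_derivative (%v. snd (frechet_derivative (%w. ?D w (1, 0)) (at 0) v))) (at 0)"
  unfolding Fs_def by (rule has_derivative_snd[OF diffD[THEN frechet_derivative_works[THEN iffD1]]])
 then obtain L where L: "(Fs has_derivative L) (at 0)" by blast
 have "((%w. frechet_derivative (%w. snd (g w)) (at w) (1, 0)) has_derivative L) (at 0)"
  by (rule has_derivative_transform_within_open[OF L open_ball b0]) (simp add: Fs_def Fr)
 then have L1: "L (1, 0) = 2*k" using frechet_derivative_at k by force
 have linL: "linear L" by (rule has_derivative_linear[OF L])
 define q where "q = L (0, 1)"
 have Lform: "L (s, \<rho>) = s*(2*k) + \<rho>*q" for s \<rho>
 proof -
  have "L (s *\<^sub>R (1, 0) + \<rho> *\<^sub>R (0, 1)) = s *\<^sub>R L (1, 0) + \<rho> *\<^sub>R L (0, 1)"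
   by (simp only: linear_add[OF linL] linear_scale[OF linL])
  then show ?thesis by (simp add: L1 q_def)
 qed
 have Fs0: "Fs 0 = 0" by (simp add: Fs_def D0)
 show ?thesis
 proof (rule exI[of _ "abs q + 1"], intro conjI allI impI)
  fix \<eta> :: real assume eta: "0 < \<eta>"
  \<comment> \<open>The cap 1 lets the part of the error proportional to \<open>\<rho>m\<close> be
    absorbed by the summand 1 in \<open>abs q + 1\<close>.\<close>
  define \<eta>' where "\<eta>' = min \<eta> 1"
  have e': "0 < \<eta>'" "\<eta>' <= 1" "\<eta>' <= \<eta>" using eta by (auto simp: \<eta>'_def)
  obtain d1 where d1: "0 < d1" "!!w. norm w < d1 ==> norm (Fs w - L w) <= \<eta>'*norm w"
   using L[unfolded has_derivative_at_alt, THEN conjunct2, rule_format, OF e'(1)] by (auto simp: Fs0)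
  have "isCont Fr' 0" unfolding Fr'_def
   using differentiable_imp_continuous_within[OF diffD] by (intro continuous_intros)
  then obtain d2 where d2: "0 < d2" "!!w. norm w < d2 ==> abs (Fr' w - c22) < \<eta>"
   using eta unfolding continuous_at_eps_delta by (auto simp: dist_norm Fr'_def D0)
  define d where "d = min r (min d1 d2)"
  have d: "0 < d" using g(2) d1(1) d2(1) by (simp add: d_def)
  show "\<exists>r'>0. \<forall>S \<rho>m s s' \<rho> \<rho>'. S <= r' & \<rho>m <= r' & abs s <= S & abs s' <= S & 0 <= \<rho> & \<rho> <= \<rho>m & 0 <= \<rho>' & \<rho>' <= \<rho>m -->
   abs ((snd (g (s, \<rho>)) - k * s\<^sup>2 - c22*\<rho>) - (snd (g (s', \<rho>')) - k * s'\<^sup>2 - c22*\<rho>')) <= (\<eta>*S + (abs q + 1)*\<rho>m)*abs (s - s') + \<eta>*abs (\<rho> - \<rho>')"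
  proof (rule exI[of _ "d/3"], intro conjI allI impI)
   show "0 < d/3" using d by simp
   fix S \<rho>m s s' \<rho> \<rho>' assume A: "S <= d/3 & \<rho>m <= d/3 & abs s <= S & abs s' <= S & 0 <= \<rho> & \<rho> <= \<rho>m & 0 <= \<rho>' & \<rho>' <= \<rho>m"
   let ?B = "{-S..S} \<times> {0..\<rho>m}"
   let ?G = "%w. snd (g w) - k*(fst w)\<^sup>2 - c22 * snd w"
   have small: "norm w < d" if "w \<in> ?B" for w
    using that A d norm_Pair_le[of "fst w" "snd w"] by (auto simp: abs_le_iff)
   have "norm (?G (s, \<rho>) - ?G (s', \<rho>')) <= (\<eta>*S + (abs q + 1)*\<rho>m)*abs (fst (s, \<rho>) - fst (s', \<rho>')) + \<eta>*abs (snd (s, \<rho>) - snd (s', \<rho>'))"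
   proof (rule partial_derivative_bound[where S = ?B and f' = "%w v. snd (?D w v) - k*(2*fst w*fst v) - c22 * snd v"])
    show "convex ?B" by (intro convex_Times) auto
    show "(s, \<rho>) \<in> ?B" "(s', \<rho>') \<in> ?B" using A by (auto simp: abs_le_iff)
    fix w assume w: "w \<in> ?B"
    have wr: "w \<in> ball 0 r" "norm w < d1" "norm w < d2" using small[OF w] by (auto simp: d_def)
    have fd: "(fst has_derivative fst) (at w)" by (rule has_derivative_fst[OF has_derivative_ident])
    have sd: "(snd has_derivative snd) (at w)" by (rule has_derivative_snd[OF has_derivative_ident])
    have "((%w. (fst w)\<^sup>2) has_derivative (%v. 2*fst w*fst v)) (at w)"
     using has_derivative_mult[OF fd fd] by (simp add: power2_eq_square algebra_simps)
    then show "(?G has_derivative (%v. snd (?D w v) - k*(2*fst w*fst v) - c22 * snd v)) (at w)"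
     by (intro has_derivative_diff has_derivative_snd[OF D[OF wr(1)]] has_derivative_mult_right sd)
    have "abs (Fs w - L w) <= \<eta>'*norm w" using d1(2)[OF wr(2)] by simp
    also have "... <= \<eta>'*(S + \<rho>m)"
     using w e' norm_Pair_le[of "fst w" "snd w"] by (intro mult_left_mono) (auto simp: abs_le_iff)
    also have "... <= \<eta>*S + 1*\<rho>m" unfolding distrib_left using A e' by (intro add_mono mult_right_mono) auto
    finally have 1: "abs (Fs w - L w) <= \<eta>*S + \<rho>m" by simp
    have 2: "abs (snd w*q) <= abs q*\<rho>m" using w unfolding abs_mult mult.commute[of "abs (snd w)"]
     by (intro mult_left_mono) (auto simp: mem_Times_iff)
    have "Fs w - k*(2*fst w*1) - c22*0 = (Fs w - L w) + snd w*q"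
     using Lform[of "fst w" "snd w"] by simp
    then show "norm (snd (?D w (1, 0)) - k*(2*fst w*fst (1::real, 0::real)) - c22 * snd (1::real, 0::real)) <= \<eta>*S + (abs q + 1)*\<rho>m"
     using 1 2 unfolding Fs_def by (simp add: distrib_right)
    show "norm (snd (?D w (0, 1)) - k*(2*fst w*fst (0::real, 1::real)) - c22 * snd (0::real, 1::real)) <= \<eta>"
     using d2(2)[OF wr(3)] by (simp add: Fr'_def)
   qed
   then show "abs ((snd (g (s, \<rho>)) - k * s\<^sup>2 - c22*\<rho>) - (snd (g (s', \<rho>')) - k * s'\<^sup>2 - c22*\<rho>')) <= (\<eta>*S + (abs q + 1)*\<rho>m)*abs (s - s') + \<eta>*abs (\<rho> - \<rho>')"
    by simp
  qed
 qed simp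
qed

section \<open>The map from the incoming section at \<open>E\<close> to \<open>P\<close>\<close>

lemma powr_le_on:
 assumes "1/2 <= x" "x <= (3/2::real)"
 shows "x powr p <= 2 powr (abs p)"
proof (cases "0 <= p")
 case True
 then have "x powr p <= 2 powr p" using assms by (intro powr_mono2) auto
 then show ?thesis using True by simp
next
 case False
 then have "x powr p <= (1/2) powr p" using assms by (intro powr_mono2') auto
 also have "(1/2::real) powr p = 2 powr (-p)" by (simp add: powr_minus_divide powr_divide)
 finally show ?thesis using False by simp
qed

lemma powr_bilipschitz:
 assumes "0 < (d::real)"
 shows "\<exists>m>0. \<exists>M>0. \<forall>x\<in>{1/2..3/2}. \<forall>y\<in>{1/2..3/2}. m*abs (x - y) <= abs (x powr d - y powr d) & abs (x powr d - y powr d) <= M*abs (x - y)"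
proof -
 define m where "m = d*inverse (2 powr (abs (1 - d)))"
 define M where "M = d*2 powr (abs (d - 1))"
 have bnd: "m <= d*z powr (d - 1)" "d*z powr (d - 1) <= M" if "1/2 <= z" "z <= 3/2" for z
 proof -
  show "d*z powr (d - 1) <= M" unfolding M_def using powr_le_on[OF that] assms by (intro mult_left_mono) auto
  have "inverse (2 powr (abs (1 - d))) <= inverse (z powr (1 - d))"
   using powr_le_on[OF that, of "1 - d"] that by (intro le_imp_inverse_le) auto
  also have "... = z powr (d - 1)" by (simp add: powr_minus[symmetric])
  finally show "m <= d*z powr (d - 1)" unfolding m_def using assms by (intro mult_left_mono) auto
 qed
 have main: "m*(y - x) <= y powr d - x powr d & y powr d - x powr d <= M*(y - x)" if "1/2 <= x" "x < y" "y <= 3/2" for x y :: real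
 proof -
  have "\<exists>z. x < z & z < y & y powr d - x powr d = (y - x)*(d*z powr (d - 1))"
   by (rule MVT2[OF that(2)]) (use that in \<open>auto intro!: has_real_derivative_powr\<close>)
  then obtain z where z: "x < z" "z < y" "y powr d - x powr d = (y - x)*(d*z powr (d - 1))" by blast
  have "(y - x)*m <= (y - x)*(d*z powr (d - 1))" "(y - x)*(d*z powr (d - 1)) <= (y - x)*M"
   using bnd[of z] z that by (intro mult_left_mono; simp)+
  then show ?thesis using z(3) by (simp add: mult.commute)
 qed
 have pos: "0 < m" "0 < M" using assms by (auto simp: m_def M_def)
 have "m*abs (x - y) <= abs (x powr d - y powr d) & abs (x powr d - y powr d) <= M*abs (x - y)"
  if "x \<in> {1/2..3/2}" "y \<in> {1/2..3/2}" for x y :: real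
 proof -
  have *: "m*abs (x - y) <= abs (x powr d - y powr d) & abs (x powr d - y powr d) <= M*abs (x - y)"
   if xy: "1/2 <= x" "x < y" "y <= 3/2" for x y :: real
  proof -
   have "0 < m*(y - x)" using pos xy by simp
   then show ?thesis using main[OF xy] xy by (simp add: abs_minus_commute[of x y] abs_minus_commute[of "x powr d"])
  qed
  show ?thesis
   using *[of x y] *[of y x] that by (cases x y rule: linorder_cases) (auto simp: abs_minus_commute)
 qed
 then show ?thesis using pos by blast
qed

text \<open>Substituting each inequality into the other leaves on the right the fraction
  \<open>\<gamma>*\<delta>/(\<alpha>*\<beta>)\<close> of \<open>a\<close> and of \<open>b\<close>,
  which is at most one half and can be moved to the left.\<close>

lemma two_by_two:
 fixes a b p \<alpha> \<beta> \<gamma> \<delta> :: real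
 assumes pos: "0 < \<alpha>" "0 < \<beta>" "0 <= \<gamma>" "0 <= \<delta>" "0 <= a" "0 <= b" "0 <= p"
  and b: "\<alpha>*b <= 2*p + \<gamma>*a" and a: "\<beta>*a <= 2*p + \<delta>*b" and gd: "2*(\<gamma>*\<delta>) <= \<alpha>*\<beta>"
 shows "a + b <= 4*(\<alpha> + \<beta> + \<gamma> + \<delta>)/(\<alpha>*\<beta>)*p"
proof -
 have 1: "\<delta>*(\<alpha>*b) <= \<delta>*(2*p + \<gamma>*a)" "\<alpha>*(\<beta>*a) <= \<alpha>*(2*p + \<delta>*b)"
  "\<gamma>*(\<beta>*a) <= \<gamma>*(2*p + \<delta>*b)" "\<beta>*(\<alpha>*b) <= \<beta>*(2*p + \<gamma>*a)"
  "2*(\<gamma>*\<delta>)*a <= \<alpha>*\<beta>*a" "2*(\<gamma>*\<delta>)*b <= \<alpha>*\<beta>*b"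
  using assms by (auto intro!: mult_left_mono mult_right_mono)
 then have "(a + b)*(\<alpha>*\<beta>) <= 4*(\<alpha> + \<beta> + \<gamma> + \<delta>)*p"
  by (simp add: algebra_simps)
 then show ?thesis using pos by (simp add: pos_le_divide_eq)
qed

text \<open>\<open>F\<close> is the passage of \<open>E\<close> with remainder \<open>r\<close>, and
  \<open>Psi\<close> the transition to \<open>P\<close>. \<open>A1\<close> and \<open>A2\<close>
  form the first column of the derivative of \<open>Psi\<close>, the image of the dominant direction
  \<open>x\<close>; \<open>A3\<close> and \<open>A4\<close> form the second.\<close>

locale transit =
 fixes Psi F r :: "real \<times> real => real \<times> real" and rr d1 d2 \<sigma> C \<epsilon> A1 A2 A3 A4 :: real
 assumes Psi: "Ck 2 (ball 0 rr) Psi" "0 < rr" "Psi 0 = 0"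
  and dPsi: "(Psi has_derivative (%(x, y). (A1*x + A3*y, A2*x + A4*y))) (at 0)"
  and det: "A1*A4 - A3*A2 ~= 0"
  and d: "0 < d1" "d1 < d2" and sg: "0 < \<sigma>" and eps: "0 < \<epsilon>" and C: "0 <= C"
  and F: "!!y z. abs y < \<epsilon> ==> 0 < z ==> z < \<epsilon> ==> F (y, z) = (z powr d1, y*z powr d2) + r (y, z)"
  and r_diff: "!!y z. abs y < \<epsilon> ==> 0 < z ==> z < \<epsilon> ==> r differentiable (at (y, z))"
  and r_le: "!!y z. abs y < \<epsilon> ==> 0 < z ==> z < \<epsilon> ==> norm (r (y, z)) <= C*z powr (d1 + \<sigma>)"
  and r_z: "!!y z. abs y < \<epsilon> ==> 0 < z ==> z < \<epsilon> ==> norm (frechet_derivative r (at (y, z)) (0, 1)) <= C*z powr (d1 - 1 + \<sigma>)"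
  and r_y: "!!y z. abs y < \<epsilon> ==> 0 < z ==> z < \<epsilon> ==> norm (frechet_derivative r (at (y, z)) (1, 0)) <= C*z powr (d2 + \<sigma>)"
begin

definition "y0 = min (\<epsilon>/2) 1"

lemma y0: "0 < y0" "y0 < \<epsilon>" "y0 <= 1" using eps by (auto simp: y0_def)

definition "rect = {-y0..y0} \<times> {-1/2..1/2::real}"

text \<open>Heights are measured relative to \<open>Z\<close>, so that one rectangle
  \<open>rect\<close> serves for all strips.\<close>

definition "zt Z w = (fst w, Z*(1 + snd w))" for Z :: real and w :: "real \<times> real"

lemma Zx:
 assumes "0 < Z" "Z < \<epsilon>/2" "w \<in> rect"
 shows "abs (fst w) < \<epsilon>" "0 < Z*(1 + snd w)" "Z*(1 + snd w) < \<epsilon>" "1/2 <= 1 + snd w" "1 + snd w <= 3/2"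
proof -
 show "abs (fst w) < \<epsilon>" using assms(3) y0 by (auto simp: rect_def)
 show x: "1/2 <= 1 + snd w" "1 + snd w <= 3/2" using assms(3) by (auto simp: rect_def)
 show "0 < Z*(1 + snd w)" using assms x by simp
 have "Z*(1 + snd w) <= Z*2" using assms x by (intro mult_left_mono) auto
 also have "... < \<epsilon>" using assms by simp
 finally show "Z*(1 + snd w) < \<epsilon>" .
qed

lemma zpow:
 assumes "0 < Z" "w \<in> rect"
 shows "(Z*(1 + snd w)) powr p <= 2 powr (abs p)*Z powr p"
proof -
 have "(Z*(1 + snd w)) powr p = Z powr p*(1 + snd w) powr p" by (simp add: powr_mult)
 also have "... <= Z powr p*2 powr (abs p)"
  using assms(2) by (intro mult_left_mono powr_le_on) (auto simp: rect_def)
 finally show ?thesis by (simp add: mult.commute)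
qed

text \<open>Differentiation in the relative height produces a factor \<open>Z\<close>, which turns
  the exponent \<open>d1 - 1 + \<sigma>\<close> into \<open>d1 + \<sigma>\<close>.\<close>

lemma r_lip:
 "\<exists>Cr\<ge>0. \<forall>Z u v. 0 < Z & Z < \<epsilon>/2 & u \<in> rect & v \<in> rect -->
  norm (r (zt Z u) - r (zt Z v)) <= Cr*Z powr (d2 + \<sigma>)*abs (fst u - fst v) + Cr*Z powr (d1 + \<sigma>)*abs (snd u - snd v)"
proof -
 define Cr where "Cr = C*2 powr (abs (d2 + \<sigma>)) + C*2 powr (abs (d1 - 1 + \<sigma>))"
 have Cr0: "0 <= Cr" using C by (simp add: Cr_def)
 have "norm (r (zt Z u) - r (zt Z v)) <= Cr*Z powr (d2 + \<sigma>)*abs (fst u - fst v) + Cr*Z powr (d1 + \<sigma>)*abs (snd u - snd v)"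
  if Z: "0 < Z" "Z < \<epsilon>/2" and uv: "u \<in> rect" "v \<in> rect" for Z u v
 proof (rule partial_derivative_bound[where S = rect and f' = "%w h. frechet_derivative r (at (zt Z w)) (fst h, Z * snd h)"])
  show "convex rect" unfolding rect_def by (intro convex_Times) auto
  show "u \<in> rect" "v \<in> rect" by fact+
  fix w assume w: "w \<in> rect"
  note zx = Zx[OF Z w]
  have D: "(r has_derivative frechet_derivative r (at (zt Z w))) (at (zt Z w))"
   unfolding zt_def using r_diff[OF zx(1-3)] by (rule frechet_derivative_works[THEN iffD1])
  have "(zt Z has_derivative (%h. (fst h, Z*(0 + snd h)))) (at w)"
   unfolding zt_def[abs_def]
   by (intro has_derivative_Pair has_derivative_fst has_derivative_ident has_derivative_mult_right has_derivative_add has_derivative_const has_derivative_snd)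
  then have "(zt Z has_derivative (%h. (fst h, Z * snd h))) (at w)" by simp
  then show "((%w. r (zt Z w)) has_derivative (%h. frechet_derivative r (at (zt Z w)) (fst h, Z * snd h))) (at w)"
   by (rule has_derivative_compose) (rule D)
  have lin: "linear (frechet_derivative r (at (zt Z w)))" by (rule has_derivative_linear[OF D])
  have "norm (frechet_derivative r (at (zt Z w)) (1, 0)) <= C*(2 powr (abs (d2 + \<sigma>))*Z powr (d2 + \<sigma>))"
   unfolding zt_def using r_y[OF zx(1-3)] zpow[OF Z(1) w, of "d2 + \<sigma>"] C
   by (auto elim!: order_trans intro!: mult_left_mono)
  also have "... <= Cr*Z powr (d2 + \<sigma>)"
   unfolding Cr_def using C by (simp add: distrib_right)
  finally show "norm (frechet_derivative r (at (zt Z w)) (fst (1::real, 0::real), Z * snd (1::real, 0::real))) <= Cr*Z powr (d2 + \<sigma>)" by simp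
  have "(0, Z*1) = Z *\<^sub>R (0 :: real, 1 :: real)" by simp
  then have "norm (frechet_derivative r (at (zt Z w)) (0, Z*1)) = Z*norm (frechet_derivative r (at (zt Z w)) (0, 1))"
   using Z by (simp only: linear_scale[OF lin]) simp
  also have "... <= Z*(C*(2 powr (abs (d1 - 1 + \<sigma>))*Z powr (d1 - 1 + \<sigma>)))"
   unfolding zt_def using r_z[OF zx(1-3)] zpow[OF Z(1) w, of "d1 - 1 + \<sigma>"] C Z
   by (intro mult_left_mono) (auto elim!: order_trans intro!: mult_left_mono)
  also have "... = (C*2 powr (abs (d1 - 1 + \<sigma>)))*(Z powr 1*Z powr (d1 - 1 + \<sigma>))" using Z by simp
  also have "Z powr 1*Z powr (d1 - 1 + \<sigma>) = Z powr (d1 + \<sigma>)" unfolding powr_add[symmetric] by simp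
  also have "(C*2 powr (abs (d1 - 1 + \<sigma>)))*Z powr (d1 + \<sigma>) <= Cr*Z powr (d1 + \<sigma>)"
   unfolding Cr_def using C by (simp add: distrib_right)
  finally show "norm (frechet_derivative r (at (zt Z w)) (fst (0::real, 1::real), Z * snd (0::real, 1::real))) <= Cr*Z powr (d1 + \<sigma>)" by simp
 qed
 then show ?thesis using Cr0 by blast
qed

definition "X Z w = (Z*(1 + snd w)) powr d1" for Z :: real and w :: "real \<times> real"
definition "V Z w = (0, fst w*(Z*(1 + snd w)) powr d2) + r (zt Z w)"

lemma F_zt: "0 < Z ==> Z < \<epsilon>/2 ==> w \<in> rect ==> F (zt Z w) = (X Z w, 0) + V Z w"
 using Zx[of Z w] F[of "fst w" "Z*(1 + snd w)"] by (simp add: zt_def X_def V_def)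

abbreviation "dl u v \<equiv> abs (fst u - fst v) + abs (snd u - snd (v :: real \<times> real) :: real)"

lemma X_bilip: "\<exists>m>0. \<exists>M>0. \<forall>Z u v. 0 < Z & u \<in> rect & v \<in> rect -->
  m*Z powr d1*abs (snd u - snd v) <= abs (X Z u - X Z v) & abs (X Z u - X Z v) <= M*Z powr d1*abs (snd u - snd v)"
proof -
 obtain m M where mM: "0 < m" "0 < M" "!!x y. x \<in> {1/2..3/2} ==> y \<in> {1/2..3/2} ==>
   m*abs (x - y) <= abs (x powr d1 - y powr d1) & abs (x powr d1 - y powr d1) <= M*abs (x - y)"
  using powr_bilipschitz[OF d(1)] by blast
 have "m*Z powr d1*abs (snd u - snd v) <= abs (X Z u - X Z v) & abs (X Z u - X Z v) <= M*Z powr d1*abs (snd u - snd v)"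
  if Z: "0 < Z" and uv: "u \<in> rect" "v \<in> rect" for Z u v
 proof -
  have "X Z u - X Z v = Z powr d1*((1 + snd u) powr d1 - (1 + snd v) powr d1)"
   unfolding X_def powr_mult by (simp add: right_diff_distrib)
  then have e: "abs (X Z u - X Z v) = Z powr d1*abs ((1 + snd u) powr d1 - (1 + snd v) powr d1)" by (simp add: abs_mult)
  have "m*abs ((1 + snd u) - (1 + snd v)) <= abs ((1 + snd u) powr d1 - (1 + snd v) powr d1)"
    "abs ((1 + snd u) powr d1 - (1 + snd v) powr d1) <= M*abs ((1 + snd u) - (1 + snd v))"
   using mM(3)[of "1 + snd u" "1 + snd v"] uv by (auto simp: rect_def)
  then have "Z powr d1*(m*abs (snd u - snd v)) <= abs (X Z u - X Z v)" "abs (X Z u - X Z v) <= Z powr d1*(M*abs (snd u - snd v))"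
   unfolding e by (intro mult_left_mono; simp)+
  then show ?thesis by (simp add: mult_ac)
 qed
 then show ?thesis using mM(1,2) by blast
qed

text \<open>By the product rule a change of height also changes this component; therefore the lower
  estimate in \<open>y\<close> carries an error term in the height.\<close>

lemma Y_lip: "\<exists>M>0. \<forall>Z u v. 0 < Z & u \<in> rect & v \<in> rect -->
  abs (fst u*(Z*(1 + snd u)) powr d2 - fst v * (Z*(1 + snd v)) powr d2) <= M*Z powr d2*dl u v &
  inverse M*Z powr d2*abs (fst u - fst v) <= abs (fst u*(Z*(1 + snd u)) powr d2 - fst v * (Z*(1 + snd v)) powr d2) + M*Z powr d2*abs (snd u - snd v)"
proof -
 have d2: "0 < d2" using d by simp
 obtain M where M: "0 < M" "!!x y. x \<in> {1/2..3/2} ==> y \<in> {1/2..3/2} ==> abs (x powr d2 - y powr d2) <= M*abs (x - y)"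
  using powr_bilipschitz[OF d2] by blast
 define M' where "M' = M + 2 powr (abs d2) + 2 powr (abs (- d2))"
 have M': "0 < M'" using M(1) by (simp add: M'_def add_pos_pos)
 have "abs (fst u*(Z*(1 + snd u)) powr d2 - fst v * (Z*(1 + snd v)) powr d2) <= M'*Z powr d2*dl u v &
  inverse M'*Z powr d2*abs (fst u - fst v) <= abs (fst u*(Z*(1 + snd u)) powr d2 - fst v * (Z*(1 + snd v)) powr d2) + M'*Z powr d2*abs (snd u - snd v)"
  if Z: "0 < Z" and uv: "u \<in> rect" "v \<in> rect" for Z u v
 proof -
  let ?xu = "(1 + snd u) powr d2" and ?xv = "(1 + snd v) powr d2"
  have e: "fst u*(Z*(1 + snd u)) powr d2 - fst v * (Z*(1 + snd v)) powr d2 = Z powr d2*((fst u - fst v) * ?xu + fst v * (?xu - ?xv))"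
   unfolding powr_mult by (simp add: right_diff_distrib left_diff_distrib distrib_left mult_ac)
  have xr: "1 + snd u \<in> {1/2..3/2}" "1 + snd v \<in> {1/2..3/2}" using uv by (auto simp: rect_def)
  have "abs (?xu - ?xv) <= M*abs (snd u - snd v)" using M(2)[OF xr] by simp
  then have "abs (fst v)*abs (?xu - ?xv) <= 1*(M*abs (snd u - snd v))"
   using uv y0 by (intro mult_mono) (auto simp: rect_def)
  also have "... <= M'*abs (snd u - snd v)" unfolding mult_1 by (intro mult_right_mono) (auto simp: M'_def)
  finally have 1: "abs (fst v * (?xu - ?xv)) <= M'*abs (snd u - snd v)" by (simp add: abs_mult)
  have P: "0 < (2::real) powr (abs d2)" by simp
  have xu1: "?xu <= 2 powr (abs d2)" using xr by (intro powr_le_on) auto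
  have xu: "?xu <= M'" using xu1 P M(1) unfolding M'_def abs_minus_cancel by linarith
  have "inverse M' <= ?xu"
  proof -
   have "(1 + snd u) powr (- d2) <= 2 powr (abs (- d2))" using xr by (intro powr_le_on) auto
   then have "(1 + snd u) powr (- d2) <= M'" using P M(1) unfolding M'_def abs_minus_cancel by linarith
   then have "inverse M' <= inverse ((1 + snd u) powr (- d2))" using xr by (intro le_imp_inverse_le) auto
   then show ?thesis by (simp add: powr_minus)
  qed
  then have 2: "inverse M'*abs (fst u - fst v) <= abs ((fst u - fst v) * ?xu)" "abs ((fst u - fst v) * ?xu) <= M'*abs (fst u - fst v)"
   using xu mult_right_mono[of "inverse M'" ?xu "abs (fst u - fst v)"] mult_right_mono[of ?xu M' "abs (fst u - fst v)"]
   by (simp_all add: abs_mult mult.commute)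
  have "abs ((fst u - fst v) * ?xu + fst v * (?xu - ?xv)) <= M'*dl u v"
   unfolding distrib_left using 1 2 by linarith
  then have "Z powr d2*abs ((fst u - fst v) * ?xu + fst v * (?xu - ?xv)) <= Z powr d2*(M'*dl u v)"
   by (intro mult_left_mono) auto
  moreover have "inverse M'*abs (fst u - fst v) <= abs ((fst u - fst v) * ?xu + fst v * (?xu - ?xv)) + M'*abs (snd u - snd v)"
   using 1 2 by linarith
  then have "Z powr d2*(inverse M'*abs (fst u - fst v)) <= Z powr d2*(abs ((fst u - fst v) * ?xu + fst v * (?xu - ?xv)) + M'*abs (snd u - snd v))"
   by (intro mult_left_mono) auto
  ultimately show ?thesis unfolding e abs_mult by (simp add: algebra_simps)
 qed
 then show ?thesis using M' by blast
qed


lemma small_powers: "0 < p ==> 0 < e ==> \<exists>Z0>0. \<forall>Z. 0 < Z & Z < Z0 --> Z powr p < (e :: real)"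
proof -
 assume p: "0 < p" "0 < e"
 have "Z powr p < e" if "0 < Z" "Z < e powr (1/p)" for Z
 proof -
  have "Z powr p < (e powr (1/p)) powr p" using that p by (intro powr_less_mono2) auto
  then show ?thesis using p by (simp add: powr_powr)
 qed
 then show ?thesis using p by (intro exI[of _ "e powr (1/p)"]) auto
qed

definition "L w = (A1*fst w + A3 * snd w, A2*fst w + A4 * snd w)" for w :: "real \<times> real"

lemma L_le: "norm (L w) <= (abs A1 + abs A2 + abs A3 + abs A4)*norm w"
proof -
 have "norm (L w) <= abs (A1*fst w + A3 * snd w) + abs (A2*fst w + A4 * snd w)"
  unfolding L_def by (rule order_trans[OF norm_Pair_le]) simp
 also have "... <= (abs A1*abs (fst w) + abs A3*abs (snd w)) + (abs A2*abs (fst w) + abs A4*abs (snd w))"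
  by (intro add_mono order_trans[OF abs_triangle_ineq]) (simp_all add: abs_mult)
 also have "... <= (abs A1*norm w + abs A3*norm w) + (abs A2*norm w + abs A4*norm w)"
  using norm_fst_le[of "fst w" "snd w"] norm_snd_le[of "snd w" "fst w"] by (intro add_mono mult_left_mono) auto
 finally show ?thesis by (simp add: algebra_simps)
qed

lemma frPsi: "frechet_derivative Psi (at 0) = L"
proof -
 have "(%(x, y). (A1*x + A3*y, A2*x + A4*y)) = L" by (auto simp: L_def fun_eq_iff)
 then show ?thesis using frechet_derivative_at[OF dPsi] by simp
qed

lemma inj_L: "inj L"
proof -
 have "linear L" using has_derivative_linear[OF dPsi] frechet_derivative_at[OF dPsi] frPsi by metis
 moreover have "w = 0" if "L w = 0" for w
 proof -
  have e: "A1*fst w + A3 * snd w = 0" "A2*fst w + A4 * snd w = 0" using that by (auto simp: L_def zero_prod_def)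
  have "(A1*A4 - A3*A2)*fst w = A4*(A1*fst w + A3 * snd w) - A3*(A2*fst w + A4 * snd w)"
   "(A1*A4 - A3*A2) * snd w = A1*(A2*fst w + A4 * snd w) - A2*(A1*fst w + A3 * snd w)" by algebra+
  then have "(A1*A4 - A3*A2)*fst w = 0" "(A1*A4 - A3*A2) * snd w = 0" using e by simp_all
  then show ?thesis using det by (simp add: prod_eq_iff)
 qed
 ultimately show ?thesis by (simp add: linear_injective_0)
qed

lemma Psi_strict:
 assumes "0 < e"
 obtains \<delta> where "0 < \<delta>" "!!u v. norm u < \<delta> ==> norm v < \<delta> ==> norm (Psi u - Psi v - L (u - v)) <= e*norm (u - v)"
proof -
 have P1: "Ck (Suc 0) (ball 0 rr) Psi" using Ck_le[OF _ Psi(1), of "Suc 0"] by simp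
 show ?thesis
  using Ck_strict[OF P1 open_ball _ assms, of 0] Psi(2) that unfolding frPsi by (metis centre_in_ball mem_ball_0)
qed

lemma Psi_lower:
 obtains \<delta> M where "0 < \<delta>" "0 < M" "!!u v. norm u < \<delta> ==> norm v < \<delta> ==> norm (u - v) <= M*norm (Psi u - Psi v)"
  "!!u. norm u < \<delta> ==> Psi differentiable (at u)"
proof -
 have P1: "Ck (Suc 0) (ball 0 rr) Psi" using Ck_le[OF _ Psi(1), of "Suc 0"] by simp
 obtain d M where dM: "0 < d" "0 < M" "ball (0 :: real \<times> real) d \<subseteq> ball 0 rr" "!!u v. u \<in> ball 0 d ==> v \<in> ball 0 d ==> norm (u - v) <= M*norm (Psi u - Psi v)"
 proof -
  have "0 \<in> ball (0 :: real \<times> real) rr" "inj (frechet_derivative Psi (at 0))" using Psi(2) inj_L by (simp_all add: frPsi)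
  then show thesis
  proof (rule Ck_lower_bound[OF P1 open_ball])
   fix d M assume a: "0 < d" "0 < M" "ball 0 d \<subseteq> ball (0 :: real \<times> real) rr"
    "!!u v. u \<in> ball 0 d ==> v \<in> ball 0 d ==> norm (u - v) <= M*norm (Psi u - Psi v)"
   show thesis by (rule that[OF a(1-3)]) (rule a(4))
  qed
 qed
 show ?thesis
  by (rule that[OF dM(1,2)]) (use dM P1 in auto)
qed

definition "E w = Psi (F w)"

text \<open>The size of \<open>V\<close> relative to the leading term \<open>X\<close>: the first
  summand comes from the component with \<open>Z powr d2\<close>, the second from the remainder
  \<open>r\<close>.\<close>

definition "om Z = Z powr (d2 - d1) + Z powr \<sigma>" for Z :: real

lemma om_small: "0 < e ==> \<exists>Z0>0. \<forall>Z. 0 < Z & Z < Z0 --> om Z < e"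
proof -
 assume e: "0 < e"
 obtain Z1 Z2 where Z: "0 < Z1" "!!Z. 0 < Z ==> Z < Z1 ==> Z powr (d2 - d1) < e/2"
   "0 < Z2" "!!Z. 0 < Z ==> Z < Z2 ==> Z powr \<sigma> < e/2"
  using small_powers[of "d2 - d1" "e/2"] small_powers[of \<sigma> "e/2"] d sg e by auto
 have "om Z < e" if "0 < Z" "Z < min Z1 Z2" for Z using Z(2)[of Z] Z(4)[of Z] that by (simp add: om_def)
 then show ?thesis using Z(1,3) by (intro exI[of _ "min Z1 Z2"]) auto
qed

lemma powr_om: "Z powr d2 + Z powr (d1 + \<sigma>) = Z powr d1 * om Z"
 by (simp add: om_def distrib_left powr_add[symmetric])

lemma powr_om_le: "Z powr d2 <= Z powr d1 * om Z" "Z powr (d1 + \<sigma>) <= Z powr d1 * om Z"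
 using powr_om[of Z] powr_ge_zero[of Z d2] powr_ge_zero[of Z "d1 + \<sigma>"] by linarith+

lemma zero_rect: "(0, 0) \<in> rect" using y0 by (simp add: rect_def)

lemma V_lip: "\<exists>Cv>0. \<forall>Z u v. 0 < Z & Z < \<epsilon>/2 & Z < 1 & u \<in> rect & v \<in> rect -->
  norm (V Z u - V Z v) <= Cv * (Z powr d1 * om Z)*dl u v & norm (V Z (0, 0)) <= Cv * (Z powr d1 * om Z)"
proof -
 obtain Cr where Cr: "0 <= Cr" "!!Z u v. 0 < Z ==> Z < \<epsilon>/2 ==> u \<in> rect ==> v \<in> rect ==>
  norm (r (zt Z u) - r (zt Z v)) <= Cr*Z powr (d2 + \<sigma>)*abs (fst u - fst v) + Cr*Z powr (d1 + \<sigma>)*abs (snd u - snd v)"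
  using r_lip by blast
 obtain M where M: "0 < M" "!!Z u v. 0 < Z ==> u \<in> rect ==> v \<in> rect ==>
  abs (fst u*(Z*(1 + snd u)) powr d2 - fst v * (Z*(1 + snd v)) powr d2) <= M*Z powr d2*dl u v"
  using Y_lip by blast
 define Cv where "Cv = M + Cr + C"
 have Cv: "0 < Cv" using M(1) Cr(1) C by (simp add: Cv_def)
 have "norm (V Z u - V Z v) <= Cv * (Z powr d1 * om Z)*dl u v & norm (V Z (0, 0)) <= Cv * (Z powr d1 * om Z)"
  if Z: "0 < Z" "Z < \<epsilon>/2" "Z < 1" and uv: "u \<in> rect" "v \<in> rect" for Z u v
 proof
  let ?W = "Z powr d1 * om Z"
  have W: "0 <= ?W" by (simp add: om_def)
  let ?y = "fst u*(Z*(1 + snd u)) powr d2 - fst v * (Z*(1 + snd v)) powr d2"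
  have "V Z u - V Z v = (0, ?y) + (r (zt Z u) - r (zt Z v))" by (simp add: V_def)
  then have "norm (V Z u - V Z v) <= abs (?y) + norm (r (zt Z u) - r (zt Z v))"
   using norm_triangle_ineq[of "(0, ?y)" "r (zt Z u) - r (zt Z v)"] by simp
  also have "abs (?y) <= M * ?W*dl u v"
   by (rule order_trans[OF M(2)[OF Z(1) uv] mult_right_mono[OF mult_left_mono[OF powr_om_le(1)[of Z]]]])
    (use M(1) in auto)
  also have "norm (r (zt Z u) - r (zt Z v)) <= Cr * ?W*dl u v"
  proof -
   have "Z powr (d2 + \<sigma>) <= Z powr d2" using Z sg by (intro powr_mono') auto
   then have "Z powr (d2 + \<sigma>) <= ?W" using powr_om_le(1)[of Z] by linarith
   then have "Cr*Z powr (d2 + \<sigma>)*abs (fst u - fst v) <= Cr * ?W*abs (fst u - fst v)"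
    "Cr*Z powr (d1 + \<sigma>)*abs (snd u - snd v) <= Cr * ?W*abs (snd u - snd v)"
    using Cr(1) powr_om_le(2)[of Z] by (intro mult_right_mono mult_left_mono; simp)+
   then show ?thesis using Cr(2)[OF Z(1,2) uv] unfolding distrib_left by linarith
  qed
  finally have "norm (V Z u - V Z v) <= M * ?W*dl u v + Cr * ?W*dl u v" by simp
  also have "... <= Cv * ?W*dl u v"
   unfolding Cv_def distrib_right using C W by simp
  finally show "norm (V Z u - V Z v) <= Cv * ?W*dl u v" .
  have "norm (V Z (0, 0)) <= C*Z powr (d1 + \<sigma>)"
   using r_le[of 0 Z] Z eps by (simp add: V_def zt_def flip: zero_prod_def)
  also have "... <= Cv * ?W" using powr_om_le(2)[of Z] C Cr(1) M(1) Cv W by (intro mult_mono) (auto simp: Cv_def)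
  finally show "norm (V Z (0, 0)) <= Cv * ?W" .
 qed
 then show ?thesis using Cv by blast
qed


definition "W Z w = (X Z w, 0) + V Z w" for Z :: real and w :: "real \<times> real"

lemma E_zt: "0 < Z ==> Z < \<epsilon>/2 ==> w \<in> rect ==> E (zt Z w) = Psi (W Z w)"
 by (simp add: E_def W_def F_zt)

lemma dl_rect: "u \<in> rect ==> dl u (0, 0) <= 2"
 using y0 by (auto simp: rect_def abs_le_iff)

lemma W_estimates: "\<exists>Cw>0. \<exists>Z0>0. \<forall>Z u v. 0 < Z & Z < Z0 & u \<in> rect & v \<in> rect -->
 norm (W Z u) <= Cw*Z powr d1 & norm (W Z u - W Z v) <= Cw*Z powr d1*dl u v &
 norm (V Z u - V Z v) <= Cw*(Z powr d1 * om Z)*dl u v & norm (V Z (0, 0)) <= Cw*(Z powr d1 * om Z)"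
proof -
 obtain Cv where Cv: "0 < Cv" "!!Z u v. 0 < Z ==> Z < \<epsilon>/2 ==> Z < 1 ==> u \<in> rect ==> v \<in> rect ==>
  norm (V Z u - V Z v) <= Cv * (Z powr d1 * om Z)*dl u v & norm (V Z (0, 0)) <= Cv * (Z powr d1 * om Z)"
  using V_lip by blast
 obtain M where M: "0 < M" "!!Z u v. 0 < Z ==> u \<in> rect ==> v \<in> rect ==> abs (X Z u - X Z v) <= M*Z powr d1*abs (snd u - snd v)"
  using X_bilip by blast
 obtain Z1 where Z1: "0 < Z1" "!!Z. 0 < Z ==> Z < Z1 ==> om Z < 1" using om_small[of 1] by auto
 define Cw where "Cw = 2 powr (abs d1) + M + 3*Cv"
 have Cw: "0 < Cw" using Cv(1) M(1) by (simp add: Cw_def add_pos_pos)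
 have "norm (W Z u) <= Cw*Z powr d1 & norm (W Z u - W Z v) <= Cw*Z powr d1*dl u v &
  norm (V Z u - V Z v) <= Cw*(Z powr d1 * om Z)*dl u v & norm (V Z (0, 0)) <= Cw*(Z powr d1 * om Z)"
  if Z: "0 < Z" "Z < min Z1 (min (\<epsilon>/2) 1)" and uv: "u \<in> rect" "v \<in> rect" for Z u v
 proof -
  have z: "Z < \<epsilon>/2" "Z < 1" "Z < Z1" using Z by auto
  let ?p = "Z powr d1"
  have p: "0 <= ?p" by simp
  have o: "0 <= om Z" "om Z <= 1" using Z1(2)[OF Z(1) z(3)] by (auto simp: om_def)
  then have po: "0 <= ?p * om Z" "?p * om Z <= ?p" using mult_left_mono[OF o(2) p] by auto
  note V = Cv(2)[OF Z(1) z(1,2)]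
  have dl0: "0 <= dl u v" by simp
  have a: "norm (V Z u - V Z v) <= Cw*(?p * om Z)*dl u v" "norm (V Z (0, 0)) <= Cw*(?p * om Z)"
  proof -
   have "Cv <= Cw" using M(1) Cv(1) by (simp add: Cw_def add_nonneg_nonneg)
   then have "Cv * (?p * om Z) <= Cw*(?p * om Z)" using po(1) by (rule mult_right_mono)
   then show "norm (V Z u - V Z v) <= Cw*(?p * om Z)*dl u v" "norm (V Z (0, 0)) <= Cw*(?p * om Z)"
    using V[OF uv] mult_right_mono[of "Cv * (?p * om Z)" "Cw*(?p * om Z)" "dl u v"] by auto
  qed
  have V0: "norm (V Z (0, 0)) <= Cv * ?p"
   using V[OF uv, THEN conjunct2] mult_left_mono[OF po(2), of Cv] Cv(1) by linarith
  have "norm (V Z u - V Z (0, 0)) <= Cv * (?p * om Z)*dl u (0, 0)" using V[OF uv(1) zero_rect] by simp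
  also have "... <= Cv * ?p*2"
   using Cv(1) po dl_rect[OF uv(1)] by (intro mult_mono mult_left_mono) auto
  finally have "norm (V Z u) <= 3*Cv * ?p"
   using V0 norm_triangle_ineq2[of "V Z u" "V Z (0, 0)"] by linarith
  moreover have "abs (X Z u) <= 2 powr (abs d1) * ?p" unfolding X_def using zpow[OF Z(1) uv(1), of d1] by simp
  ultimately have "norm (W Z u) <= 2 powr (abs d1) * ?p + 3*Cv * ?p"
   unfolding W_def using norm_triangle_ineq[of "(X Z u, 0)" "V Z u"] by simp
  also have "... <= Cw * ?p" unfolding Cw_def distrib_right using M(1) by simp
  finally have b: "norm (W Z u) <= Cw * ?p" .
  have "W Z u - W Z v = (X Z u - X Z v, 0) + (V Z u - V Z v)" by (simp add: W_def)
  then have "norm (W Z u - W Z v) <= abs (X Z u - X Z v) + norm (V Z u - V Z v)"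
   using norm_triangle_ineq[of "(X Z u - X Z v, 0)" "V Z u - V Z v"] by simp
  also have "... <= M * ?p*dl u v + Cv * ?p*dl u v"
  proof (intro add_mono)
   show "abs (X Z u - X Z v) <= M * ?p*dl u v"
    using M(1) by (intro order_trans[OF M(2)[OF Z(1) uv] mult_left_mono]) auto
   show "norm (V Z u - V Z v) <= Cv * ?p*dl u v"
    using V[OF uv] mult_right_mono[OF mult_left_mono[OF po(2), of Cv] dl0] Cv(1) by linarith
  qed
  also have "... = (M + Cv)*(?p*dl u v)" by (simp add: algebra_simps)
  also have "... <= Cw*(?p*dl u v)" unfolding Cw_def using Cv(1) by (intro mult_right_mono) (auto simp: add_nonneg_nonneg)
  finally have c: "norm (W Z u - W Z v) <= Cw * ?p*dl u v" by (simp add: mult.assoc)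
  show ?thesis using a b c by blast
 qed
 then show ?thesis using Cw Z1(1) eps by (intro exI[of _ Cw] conjI exI[of _ "min Z1 (min (\<epsilon>/2) 1)"]) auto
qed

lemma powr_d1_small: "0 < e ==> \<exists>Z0>0. \<forall>Z. 0 < Z & Z < Z0 --> Z powr d1 < e"
 using small_powers[OF d(1)] by blast

text \<open>The linear part of \<open>Psi\<close> maps the leading term to
  \<open>X *\<^sub>R (A1, A2)\<close>. Two errors remain, each allotted half of
  \<open>\<eta>\<close>: the strict differentiability error of \<open>Psi\<close> at 0, and the
  image of \<open>V\<close>, which is smaller than \<open>Z powr d1\<close> by the factor
  \<open>om Z\<close>.\<close>

lemma rest_estimate:
 assumes eta: "0 < \<eta>"
 shows "\<exists>Z0>0. \<forall>Z. 0 < Z & Z < Z0 -->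
  (\<forall>u\<in>rect. \<forall>v\<in>rect. norm ((E (zt Z u) - X Z u *\<^sub>R (A1, A2)) - (E (zt Z v) - X Z v *\<^sub>R (A1, A2))) <= \<eta>*Z powr d1*dl u v) &
  norm (E (zt Z (0, 0)) - X Z (0, 0) *\<^sub>R (A1, A2)) <= \<eta>*Z powr d1"
proof -
 obtain Cw Z1 where Cw: "0 < Cw" "0 < Z1" "!!Z u v. 0 < Z ==> Z < Z1 ==> u \<in> rect ==> v \<in> rect ==>
  norm (W Z u) <= Cw*Z powr d1 & norm (W Z u - W Z v) <= Cw*Z powr d1*dl u v &
  norm (V Z u - V Z v) <= Cw*(Z powr d1 * om Z)*dl u v & norm (V Z (0, 0)) <= Cw*(Z powr d1 * om Z)"
  using W_estimates by blast
 let ?CL = "abs A1 + abs A2 + abs A3 + abs A4 + 1"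
 define e where "e = \<eta>/(2*Cw)"
 have e: "0 < e" using eta Cw(1) by (simp add: e_def)
 obtain \<delta> where de: "0 < \<delta>" "!!u v. norm u < \<delta> ==> norm v < \<delta> ==> norm (Psi u - Psi v - L (u - v)) <= e*norm (u - v)"
  using Psi_strict[OF e] by blast
 obtain Z2 where Z2: "0 < Z2" "!!Z. 0 < Z ==> Z < Z2 ==> Z powr d1 < \<delta>/Cw"
  using powr_d1_small[of "\<delta>/Cw"] de(1) Cw(1) by auto
 have oe: "0 < \<eta>/(2 * ?CL*Cw)" using eta Cw(1) by (intro divide_pos_pos mult_pos_pos) auto
 obtain Z3 where Z3: "0 < Z3" "!!Z. 0 < Z ==> Z < Z3 ==> om Z < \<eta>/(2 * ?CL*Cw)"
  using om_small[OF oe] by auto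
 define Z0 where "Z0 = min (min Z1 Z2) (min Z3 (\<epsilon>/2))"
 have Z0: "0 < Z0" using Cw(2) Z2(1) Z3(1) eps by (simp add: Z0_def)
 have lin: "L (x - y) = L x - L y" "L (x + y) = L x + L y" for x y
  by (auto simp: L_def algebra_simps)
 have Lx: "L (x, 0) = x *\<^sub>R (A1, A2)" for x by (simp add: L_def mult.commute)
 have main: "(\<forall>u\<in>rect. \<forall>v\<in>rect. norm ((E (zt Z u) - X Z u *\<^sub>R (A1, A2)) - (E (zt Z v) - X Z v *\<^sub>R (A1, A2))) <= \<eta>*Z powr d1*dl u v) &
  norm (E (zt Z (0, 0)) - X Z (0, 0) *\<^sub>R (A1, A2)) <= \<eta>*Z powr d1" if Z: "0 < Z" "Z < Z0" for Z
 proof -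
  have z: "Z < Z1" "Z < Z2" "Z < Z3" "Z < \<epsilon>/2" using Z by (auto simp: Z0_def)
  let ?p = "Z powr d1"
  have p0: "0 <= ?p" by simp
  have Wd: "norm (W Z u) < \<delta>" if "u \<in> rect" for u
  proof -
   have "Cw * ?p < Cw*(\<delta>/Cw)" using Z2(2)[OF Z(1) z(2)] Cw(1) by (intro mult_strict_left_mono)
   then show ?thesis using Cw(3)[OF Z(1) z(1) that that] Cw(1) by simp
  qed
  have om: "?CL*(Cw*(?p * om Z)) <= \<eta>/2 * ?p"
  proof -
   have CL: "0 < ?CL" by (simp add: add_nonneg_pos)
   have cancel: "(a*Cw)*(\<eta>/(2*a*Cw)) = \<eta>/2" if "0 < a" for a
    using Cw(1) that by (simp add: field_simps)
   have "(?CL*Cw) * om Z <= (?CL*Cw)*(\<eta>/(2 * ?CL*Cw))"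
    using Z3(2)[OF Z(1) z(3)] Cw(1) CL by (intro mult_left_mono) auto
   also have "... = \<eta>/2" by (rule cancel[OF CL])
   finally have "?p*((?CL*Cw) * om Z) <= ?p*(\<eta>/2)" by (rule mult_left_mono) simp
   then show ?thesis by (simp only: mult_ac)
  qed
  have LV: "norm (L x) <= ?CL*norm x" for x
   using L_le[of x] norm_ge_zero[of x] unfolding distrib_right mult_1 by linarith
  have rest: "norm (Psi (W Z u) - X Z u *\<^sub>R (A1, A2) - (Psi (W Z v) - X Z v *\<^sub>R (A1, A2))) <= \<eta> * ?p*dl u v"
   if uv: "u \<in> rect" "v \<in> rect" for u v
  proof -
   note w = Cw(3)[OF Z(1) z(1) uv]
   have LW: "L (W Z u) = X Z u *\<^sub>R (A1, A2) + L (V Z u)" for u unfolding W_def lin(2) Lx ..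
   have eq: "Psi (W Z u) - X Z u *\<^sub>R (A1, A2) - (Psi (W Z v) - X Z v *\<^sub>R (A1, A2))
     = (Psi (W Z u) - Psi (W Z v) - L (W Z u - W Z v)) + L (V Z u - V Z v)"
    unfolding lin(1) LW by (simp add: algebra_simps)
   have "norm (Psi (W Z u) - Psi (W Z v) - L (W Z u - W Z v)) <= e*norm (W Z u - W Z v)"
    by (rule de(2)[OF Wd[OF uv(1)] Wd[OF uv(2)]])
   also have "... <= e*(Cw * ?p*dl u v)" using w e by (intro mult_left_mono) auto
   also have "... = \<eta>/2 * ?p*dl u v" using Cw(1) by (simp add: e_def)
   finally have 1: "norm (Psi (W Z u) - Psi (W Z v) - L (W Z u - W Z v)) <= \<eta>/2 * ?p*dl u v" .
   have "norm (L (V Z u - V Z v)) <= ?CL*(Cw*(?p * om Z)*dl u v)"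
    using LV w by (intro order_trans[OF LV] mult_left_mono) auto
   also have "... <= \<eta>/2 * ?p*dl u v" using mult_right_mono[OF om, of "dl u v"] by (simp only: mult.assoc)
   finally have 2: "norm (L (V Z u - V Z v)) <= \<eta>/2 * ?p*dl u v" .
   show ?thesis unfolding eq
    using order_trans[OF norm_triangle_ineq add_mono[OF 1 2]] by simp
  qed
  have "norm (Psi (W Z (0, 0)) - X Z (0, 0) *\<^sub>R (A1, A2)) <= \<eta> * ?p"
  proof -
   note w = Cw(3)[OF Z(1) z(1) zero_rect zero_rect]
   have eq: "Psi (W Z (0, 0)) - X Z (0, 0) *\<^sub>R (A1, A2) = (Psi (W Z (0, 0)) - Psi 0 - L (W Z (0, 0) - 0)) + L (V Z (0, 0))"
    unfolding Psi(3) by (simp add: W_def lin(2) Lx)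
   have "norm (Psi (W Z (0, 0)) - Psi 0 - L (W Z (0, 0) - 0)) <= e*norm (W Z (0, 0) - 0)"
    by (rule de(2)[OF Wd[OF zero_rect]]) (use de(1) in simp)
   also have "... <= e*(Cw * ?p)" using w e by (intro mult_left_mono) auto
   also have "... = \<eta>/2 * ?p" using Cw(1) by (simp add: e_def)
   finally have 1: "norm (Psi (W Z (0, 0)) - Psi 0 - L (W Z (0, 0) - 0)) <= \<eta>/2 * ?p" .
   have 2: "norm (L (V Z (0, 0))) <= \<eta>/2 * ?p"
    using w by (intro order_trans[OF LV order_trans[OF mult_left_mono om]]) auto
   show ?thesis unfolding eq
    using order_trans[OF norm_triangle_ineq add_mono[OF 1 2]] by simp
  qed
  then show ?thesis using rest zero_rect by (simp add: E_zt[OF Z(1) z(4)])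
 qed
 then show ?thesis using Z0 by blast
qed


lemma zt_in: "0 < Z ==> Z < \<epsilon>/2 ==> w \<in> rect ==> abs (fst (zt Z w)) < \<epsilon> & 0 < snd (zt Z w) & snd (zt Z w) < \<epsilon>"
 using Zx[of Z w] by (simp add: zt_def)

text \<open>The matrix of the passage is nearly triangular with diagonal entries of orders \<open>Z\<^sup>d\<^sup>1\<close> and \<open>Z\<^sup>d\<^sup>2\<close>,
 in the order \<open>(z, y)\<close>; the off-diagonal terms are absorbed since \<open>Z\<^sup>d\<^sup>2\<close> is small relative to \<open>Z\<^sup>d\<^sup>1\<close>.\<close>

lemma W_lower:
 "\<exists>Z0>0. \<forall>Z. 0 < Z & Z < Z0 --> (\<exists>M>0. \<forall>u\<in>rect. \<forall>v\<in>rect. dl u v <= M*norm (W Z u - W Z v))"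
proof -
 obtain Cr where Cr: "0 <= Cr" "!!Z u v. 0 < Z ==> Z < \<epsilon>/2 ==> u \<in> rect ==> v \<in> rect ==>
  norm (r (zt Z u) - r (zt Z v)) <= Cr*Z powr (d2 + \<sigma>)*abs (fst u - fst v) + Cr*Z powr (d1 + \<sigma>)*abs (snd u - snd v)"
  using r_lip by blast
 obtain c where c: "0 < c" "!!Z u v. 0 < Z ==> u \<in> rect ==> v \<in> rect ==> c*Z powr d1*abs (snd u - snd v) <= abs (X Z u - X Z v)"
  using X_bilip by blast
 obtain M where M: "0 < M" "!!Z u v. 0 < Z ==> u \<in> rect ==> v \<in> rect ==>
  inverse M*Z powr d2*abs (fst u - fst v) <= abs (fst u*(Z*(1 + snd u)) powr d2 - fst v * (Z*(1 + snd v)) powr d2) + M*Z powr d2*abs (snd u - snd v)"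
  using Y_lip by blast
 define m where "m = inverse M"
 have m: "0 < m" using M(1) by (simp add: m_def)
 \<comment> \<open>The second and third bound allow the remainder on the diagonal to be absorbed by
   half of the diagonal entries; the last one makes the product of the off-diagonal entries small
   enough for \<open>two_by_two\<close>.\<close>
 define e where "e = min (min 1 (c/(2*(Cr + 1)))) (min (m/(2*(Cr + 1))) (c*m/(8*((Cr + 1)*(Cr + M)))))"
 have q: "0 < 2*(Cr + 1)" "0 < 8*((Cr + 1)*(Cr + M))" using Cr(1) M(1) by simp_all
 have e: "0 < e" "e <= 1" "e*(2*(Cr + 1)) <= c" "e*(2*(Cr + 1)) <= m" "e*(8*((Cr + 1)*(Cr + M))) <= c*m"
 proof -
  show "0 < e" unfolding e_def by (intro min_less_iff_conj[THEN iffD2] conjI divide_pos_pos q mult_pos_pos c m) simp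
  have "e <= c/(2*(Cr + 1))" "e <= m/(2*(Cr + 1))" "e <= c*m/(8*((Cr + 1)*(Cr + M)))" "e <= 1"
   unfolding e_def by (simp_all only: min.coboundedI1 min.coboundedI2 order_refl min.cobounded1 min.cobounded2)
  then show "e <= 1" "e*(2*(Cr + 1)) <= c" "e*(2*(Cr + 1)) <= m" "e*(8*((Cr + 1)*(Cr + M))) <= c*m"
   by (simp_all only: pos_le_divide_eq q)
 qed
 obtain Z1 where Z1: "0 < Z1" "!!Z. 0 < Z ==> Z < Z1 ==> om Z < e" using om_small[OF e(1)] by auto
 have "\<exists>N>0. \<forall>u\<in>rect. \<forall>v\<in>rect. dl u v <= N*norm (W Z u - W Z v)" if Z: "0 < Z" "Z < min Z1 (\<epsilon>/2)" for Z
 proof -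
  have z: "Z < Z1" "Z < \<epsilon>/2" using Z by auto
  let ?X = "Z powr d1" and ?Y = "Z powr d2" and ?s = "Z powr \<sigma>"
  have XY: "0 < ?X" "0 < ?Y" "0 < ?s" using Z(1) by auto
  have o: "?s <= e" "Z powr (d2 - d1) <= e"
   using Z1(2)[OF Z(1) z(1)] powr_ge_zero[of Z \<sigma>] powr_ge_zero[of Z "d2 - d1"] unfolding om_def by linarith+
  have Yx: "?Y = ?X*Z powr (d2 - d1)" by (simp add: powr_add[symmetric])
  have pw: "Z powr (d2 + \<sigma>) = ?Y * ?s" "Z powr (d1 + \<sigma>) = ?X * ?s" by (simp_all add: powr_add)
  define \<gamma> where "\<gamma> = 2*(Cr*(?Y * ?s))"
  define \<delta> where "\<delta> = 2*(Cr*(?X * ?s) + M * ?Y)"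
  have gd: "2*(\<gamma>*\<delta>) <= (c * ?X)*(m * ?Y)"
  proof -
   have "Cr * ?s + M*Z powr (d2 - d1) <= Cr*1 + M*1"
    using o e(2) Cr(1) M(1) by (intro add_mono mult_left_mono) auto
   then have "(Cr * ?s)*(Cr * ?s + M*Z powr (d2 - d1)) <= ((Cr + 1)*e)*(Cr + M)"
    using o(1) Cr(1) M(1) XY(3) e(1) by (intro mult_mono) auto
   then have "8*((Cr * ?s)*(Cr * ?s + M*Z powr (d2 - d1))) <= c*m" using e(5) by (simp only: mult_ac)
   then have "(?X * ?Y)*(8*((Cr * ?s)*(Cr * ?s + M*Z powr (d2 - d1)))) <= (?X * ?Y)*(c*m)"
    using XY by (intro mult_left_mono) auto
   moreover have "2*(\<gamma>*\<delta>) = (?X * ?Y)*(8*((Cr * ?s)*(Cr * ?s + M*Z powr (d2 - d1))))"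
   proof -
    have "\<delta> = 2 * ?X*(Cr * ?s + M*Z powr (d2 - d1))" unfolding \<delta>_def Yx by (simp add: algebra_simps)
    then show ?thesis unfolding \<gamma>_def by simp
   qed
   ultimately show ?thesis by (simp only: mult_ac)
  qed
  define N where "N = 4*(c * ?X + m * ?Y + \<gamma> + \<delta>)/((c * ?X)*(m * ?Y))"
  have gd0: "0 <= \<gamma>" "0 <= \<delta>" using Cr(1) M(1) XY by (auto simp: \<gamma>_def \<delta>_def)
  have al: "0 < c * ?X" "0 < m * ?Y" using c(1) m XY by auto
  have N: "0 < N" unfolding N_def using al gd0 c(1) m by (intro divide_pos_pos mult_pos_pos) auto
  have "dl u v <= N*norm (W Z u - W Z v)" if uv: "u \<in> rect" "v \<in> rect" for u v
  proof -
   define a where "a = abs (fst u - fst v)"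
   define b where "b = abs (snd u - snd v)"
   define p where "p = norm (W Z u - W Z v)"
   have ab: "0 <= a" "0 <= b" "0 <= p" by (auto simp: a_def b_def p_def)
   let ?dr = "r (zt Z u) - r (zt Z v)"
   let ?dy = "fst u*(Z*(1 + snd u)) powr d2 - fst v * (Z*(1 + snd v)) powr d2"
   have r: "norm ?dr <= Cr*(?Y * ?s)*a + Cr*(?X * ?s)*b"
    using Cr(2)[OF Z(1) z(2) uv] unfolding pw a_def b_def .
   have dW: "W Z u - W Z v = (X Z u - X Z v, ?dy) + ?dr" by (simp add: W_def V_def)
   have fW: "X Z u - X Z v = fst (W Z u - W Z v) - fst ?dr" "?dy = snd (W Z u - W Z v) - snd ?dr" unfolding dW by simp_all
   have fs: "abs (X Z u - X Z v) <= p + norm ?dr" "abs (?dy) <= p + norm ?dr"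
    unfolding fW p_def
    using norm_fst_le[of "fst (W Z u - W Z v)" "snd (W Z u - W Z v)"] norm_snd_le[of "snd (W Z u - W Z v)" "fst (W Z u - W Z v)"]
     norm_fst_le[of "fst ?dr" "snd ?dr"] norm_snd_le[of "snd ?dr" "fst ?dr"] unfolding prod.collapse real_norm_def by linarith+
   have 1: "c * ?X*b <= p + (Cr*(?Y * ?s)*a + Cr*(?X * ?s)*b)"
    using c(2)[OF Z(1) uv] fs(1) r unfolding b_def by linarith
   have 2: "m * ?Y*a <= p + (Cr*(?Y * ?s)*a + Cr*(?X * ?s)*b) + M * ?Y*b"
    using M(2)[OF Z(1) uv] fs(2) r unfolding a_def b_def m_def by linarith
   have Crs: "2*(Cr * ?s) <= c" "2*(Cr * ?s) <= m"
   proof -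
    have "2*(Cr * ?s) <= 2*((Cr + 1)*e)" using o(1) Cr(1) XY(3) by (intro mult_left_mono mult_mono) auto
    moreover have "2*((Cr + 1)*e) = e*(2*(Cr + 1))" by simp
    ultimately show "2*(Cr * ?s) <= c" "2*(Cr * ?s) <= m" using e(3,4) by linarith+
   qed
   have "2*(Cr*(?X * ?s)*b) <= c * ?X*b"
    using mult_right_mono[OF Crs(1), of "?X*b"] ab XY(1) by (simp add: mult_ac)
   then have b1: "(c * ?X)*b <= 2*p + \<gamma>*a" using 1 unfolding \<gamma>_def by (simp only: mult.assoc, linarith?)
   have "2*(Cr*(?Y * ?s)*a) <= m * ?Y*a"
    using mult_right_mono[OF Crs(2), of "?Y*a"] ab XY(2) by (simp add: mult_ac)
   then have a1: "(m * ?Y)*a <= 2*p + \<delta>*b" using 2 unfolding \<delta>_def by (simp only: mult.assoc distrib_right distrib_left, linarith?)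
   show ?thesis unfolding N_def a_def[symmetric] b_def[symmetric] p_def[symmetric]
    by (rule two_by_two[OF al gd0 ab b1 a1 gd])
  qed
  then show ?thesis using N by blast
 qed
 then show ?thesis using Z1(1) eps by (intro exI[of _ "min Z1 (\<epsilon>/2)"]) auto
qed


text \<open>The constant \<open>M\<close> depends on \<open>Z\<close>. It serves injectivity of the
  map and of its derivative within one strip, whereas the rates come from
  \<open>rest_estimate\<close>.\<close>

lemma E_lower:
 "\<exists>Z0>0. \<forall>Z. 0 < Z & Z < Z0 --> (\<exists>M. \<forall>u\<in>rect. \<forall>v\<in>rect. norm (zt Z u - zt Z v) <= M*norm (E (zt Z u) - E (zt Z v))) &
  (\<forall>u\<in>rect. E differentiable (at (zt Z u)))"
proof -
 obtain Z1 where Z1: "0 < Z1" "!!Z. 0 < Z ==> Z < Z1 ==> \<exists>M>0. \<forall>u\<in>rect. \<forall>v\<in>rect. dl u v <= M*norm (W Z u - W Z v)"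
  using W_lower by blast
 obtain Cw Z2 where Cw: "0 < Cw" "0 < Z2" "!!Z u. 0 < Z ==> Z < Z2 ==> u \<in> rect ==> norm (W Z u) <= Cw*Z powr d1"
  using W_estimates by blast
 obtain \<delta> N where de: "0 < \<delta>" "0 < N" "!!u v. norm u < \<delta> ==> norm v < \<delta> ==> norm (u - v) <= N*norm (Psi u - Psi v)"
  "!!u. norm u < \<delta> ==> Psi differentiable (at u)"
  using Psi_lower by blast
 obtain Z3 where Z3: "0 < Z3" "!!Z. 0 < Z ==> Z < Z3 ==> Z powr d1 < \<delta>/Cw"
  using powr_d1_small[of "\<delta>/Cw"] de(1) Cw(1) by auto
 define Z0 where "Z0 = min (min Z1 Z2) (min Z3 (min 1 (\<epsilon>/2)))"
 have "(\<exists>M. \<forall>u\<in>rect. \<forall>v\<in>rect. norm (zt Z u - zt Z v) <= M*norm (E (zt Z u) - E (zt Z v))) &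
  (\<forall>u\<in>rect. E differentiable (at (zt Z u)))" if Z: "0 < Z" "Z < Z0" for Z
 proof
  have z: "Z < Z1" "Z < Z2" "Z < Z3" "Z < 1" "Z < \<epsilon>/2" using Z by (auto simp: Z0_def)
  have Wd: "norm (W Z u) < \<delta>" if "u \<in> rect" for u
  proof -
   have "Cw*Z powr d1 < Cw*(\<delta>/Cw)" using Z3(2)[OF Z(1) z(3)] Cw(1) by (intro mult_strict_left_mono)
   then show ?thesis using Cw(3)[OF Z(1) z(2) that] Cw(1) by simp
  qed
  obtain M where M: "0 < M" "!!u v. u \<in> rect ==> v \<in> rect ==> dl u v <= M*norm (W Z u - W Z v)"
   using Z1(2)[OF Z(1) z(1)] by blast
  have "norm (zt Z u - zt Z v) <= M*N*norm (E (zt Z u) - E (zt Z v))" if uv: "u \<in> rect" "v \<in> rect" for u v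
  proof -
   have "zt Z u - zt Z v = (fst u - fst v, Z*(snd u - snd v))" by (simp add: zt_def algebra_simps)
   then have "norm (zt Z u - zt Z v) <= abs (fst u - fst v) + abs (Z*(snd u - snd v))"
    using norm_Pair_le[of "fst u - fst v" "Z*(snd u - snd v)"] by simp
   also have "abs (Z*(snd u - snd v)) <= 1*abs (snd u - snd v)" unfolding abs_mult using Z(1) z(4) by (intro mult_right_mono) auto
   finally have "norm (zt Z u - zt Z v) <= dl u v" by simp
   also have "... <= M*norm (W Z u - W Z v)" by (rule M(2)[OF uv])
   also have "... <= M*(N*norm (Psi (W Z u) - Psi (W Z v)))"
    using de(3)[OF Wd[OF uv(1)] Wd[OF uv(2)]] M(1) by (intro mult_left_mono) auto
   finally show ?thesis unfolding E_zt[OF Z(1) z(5) uv(1)] E_zt[OF Z(1) z(5) uv(2)] by (simp add: mult.assoc)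
  qed
  then show "\<exists>M. \<forall>u\<in>rect. \<forall>v\<in>rect. norm (zt Z u - zt Z v) <= M*norm (E (zt Z u) - E (zt Z v))" by blast
  show "\<forall>u\<in>rect. E differentiable (at (zt Z u))"
  proof
   fix u assume u: "u \<in> rect"
   let ?q = "zt Z u"
   have q: "abs (fst ?q) < \<epsilon>" "0 < snd ?q" "snd ?q < \<epsilon>" using zt_in[OF Z(1) z(5) u] by auto
   have "(%w. (snd w powr d1, fst w * snd w powr d2) + r w) differentiable (at ?q)"
   proof -
    have s: "(%w :: real \<times> real. snd w) differentiable (at ?q)" "(%w :: real \<times> real. fst w) differentiable (at ?q)"
     by (auto intro!: bounded_linear_imp_differentiable bounded_linear_snd bounded_linear_fst)
    have p: "(%w :: real \<times> real. snd w powr d) differentiable (at ?q)" for d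
     unfolding differentiable_def
     by (rule exI, rule has_derivative_compose[OF has_derivative_snd[OF has_derivative_ident]
       has_real_derivative_powr[OF q(2), THEN has_field_derivative_imp_has_derivative]])
    have r: "r differentiable (at ?q)" using r_diff[OF q(1-3)] by simp
    show ?thesis
     by (intro differentiable_add r differentiable_Pair p differentiable_mult s)
   qed
   then obtain D where D: "((%w. (snd w powr d1, fst w * snd w powr d2) + r w) has_derivative D) (at ?q)"
    by (auto simp: differentiable_def)
   let ?S = "{-\<epsilon><..<\<epsilon>} \<times> {0<..<\<epsilon>}"
   have "(F has_derivative D) (at ?q)"
    by (rule has_derivative_transform_within_open[OF D, of ?S])
     (use q in \<open>auto simp: open_Times F abs_less_iff mem_Times_iff\<close>)
   moreover have "F ?q = W Z u" using F_zt[OF Z(1) z(5) u] by (simp add: W_def)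
   then have "Psi differentiable (at (F ?q))" using de(4)[OF Wd[OF u]] by simp
   ultimately show "E differentiable (at ?q)"
    unfolding E_def[abs_def] differentiable_def using has_derivative_compose by blast
  qed
 qed
 moreover have "0 < Z0" using Z1(1) Cw(2) Z3(1) eps by (simp add: Z0_def)
 ultimately show ?thesis by blast
qed

end

section \<open>Horseshoes in all late strips\<close>

text \<open>The derivative \<open>1 - (1 + x) powr (d - 1)\<close> vanishes at 0 and is continuous
  there.\<close>

lemma powr_linearization:
 fixes d :: real
 assumes d: "0 < d"
 shows "\<exists>kp. 0 < kp & kp <= 1/16 & (\<forall>x y. abs x <= kp & abs y <= kp -->
  abs ((x - (1 + x) powr d/d) - (y - (1 + y) powr d/d)) <= (1/16)*abs (x - y))"
proof -
 have "isCont (%x::real. 1 - (1 + x) powr (d - 1)) 0" by (intro continuous_intros) auto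
 then obtain e where e: "0 < e" "!!x. abs x < e ==> abs (1 - (1 + x) powr (d - 1)) < 1/16"
  unfolding continuous_at_eps_delta by (metis abs_0 dist_real_def diff_zero diff_0_right cancel_comm_monoid_add_class.diff_cancel one_add_one powr_one_eq_one add.right_neutral less_divide_eq_1_pos zero_less_numeral divide_pos_pos zero_less_one)
 define kp where "kp = min (e/2) (1/16)"
 have k: "0 < kp" "kp <= 1/16" "kp < e" using e(1) by (auto simp: kp_def)
 have "abs ((x - (1 + x) powr d/d) - (y - (1 + y) powr d/d)) <= (1/16)*abs (x - y)" if "abs x <= kp" "abs y <= kp" for x y
 proof -
  have "norm ((x - (1 + x) powr d/d) - (y - (1 + y) powr d/d)) <= (1/16)*norm (x - y)"
  proof (rule field_differentiable_bound[of "{-kp..kp}" "%x. x - (1 + x) powr d/d" "%x. 1 - (1 + x) powr (d - 1)"])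
   fix z assume z: "z \<in> {-kp..kp}"
   then have z1: "0 < 1 + z" using k by auto
   have "((%x. 1 + x) has_real_derivative 0 + 1) (at z)" by (intro DERIV_add DERIV_const DERIV_ident)
   then have "((%x. (1 + x) powr d) has_real_derivative d*(1 + z) powr (d - 1)*1) (at z)"
    using DERIV_chain2[where f = "%x. x powr d" and g = "%x. 1 + x" and x = z and Db = 1 and s = UNIV,
      OF has_real_derivative_powr[OF z1, of d]] by simp
   then have "((%x. x - (1 + x) powr d/d) has_real_derivative 1 - d*(1 + z) powr (d - 1)*1/d) (at z)"
    by (intro DERIV_diff DERIV_ident DERIV_cdivide)
   then show "((%x. x - (1 + x) powr d/d) has_real_derivative 1 - (1 + z) powr (d - 1)) (at z within {-kp..kp})"
    using d by (simp add: has_field_derivative_at_within)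
   show "norm (1 - (1 + z) powr (d - 1)) <= 1/16"
   proof -
    have "abs z < e" using z k by (auto simp: abs_less_iff)
    from e(2)[OF this] show ?thesis by simp
   qed
  qed (use that in auto)
  then show ?thesis by simp
 qed
 then show ?thesis using k by blast
qed

lemma exp_nat_tendsto_0: "0 < a ==> (%n. exp (- (a*(2*pi*real n)))) \<longlonglongrightarrow> 0"
proof -
 assume a: "0 < a"
 have "exp (- (a*(2*pi*real n))) = exp (- (a*(2*pi))) ^ n" for n
  by (simp add: exp_of_nat_mult[symmetric] algebra_simps)
 then show ?thesis using a by (simp add: LIMSEQ_power_zero)
qed

text \<open>With \<open>q\<close> in the role of \<open>b22\<close>: in the first case the two terms
  cannot cancel, in the second \<open>q*\<rho>\<close> outweighs \<open>Z\<close>, in the third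
  \<open>Z\<close> outweighs \<open>q*\<rho>\<close>. The quotient by \<open>k\<close> is the square
  of the exit angle, hence the positivity.\<close>

lemma scale_balance:
 fixes k q :: real and Z \<rho> :: "nat => real"
 assumes pos: "!!n. 0 < Z n" "!!n. 0 < \<rho> n"
  and cases: "(0 < k & q < 0) \<or> (k < 0 & 0 < q & (%n. Z n/\<rho> n) \<longlonglongrightarrow> 0) \<or> (0 < k & 0 < q & (%n. \<rho> n/Z n) \<longlonglongrightarrow> 0)"
 shows "\<exists>B\<ge>0. \<forall>\<^sub>F n in sequentially. 0 < (Z n - q*\<rho> n)/k & Z n <= (11/10)*abs (Z n - q*\<rho> n) & \<rho> n <= B*((Z n - q*\<rho> n)/k)"
 using cases
proof (elim disjE conjE)
 assume kq: "0 < k" "q < 0"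
 have "0 < (Z n - q*\<rho> n)/k & Z n <= (11/10)*abs (Z n - q*\<rho> n) & \<rho> n <= (k / - q)*((Z n - q*\<rho> n)/k)" for n
 proof -
  have "0 < (- q)*\<rho> n" using kq pos(2)[of n] by (intro mult_pos_pos) auto
  then have "Z n - q*\<rho> n > 0" "Z n <= Z n - q*\<rho> n" "(- q)*\<rho> n <= Z n - q*\<rho> n" using pos(1)[of n] by auto
  moreover from this have "\<rho> n <= (Z n - q*\<rho> n)/(- q)" using kq by (subst pos_le_divide_eq) (simp_all add: mult.commute)
  moreover have "(Z n - q*\<rho> n)/(- q) = (k / - q)*((Z n - q*\<rho> n)/k)" using kq by simp
  ultimately show ?thesis using kq pos(1)[of n] by (simp only:) auto
 qed
 moreover have "0 <= k / - q" using kq by (intro divide_nonneg_pos) auto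
 ultimately show ?thesis by (intro exI[of _ "k / - q"] conjI always_eventually allI) blast+
next
 assume kq: "k < 0" "0 < q" and lim: "(%n. Z n/\<rho> n) \<longlonglongrightarrow> 0"
 have "\<forall>\<^sub>F n in sequentially. Z n/\<rho> n < q/2" using order_tendstoD(2)[OF lim, of "q/2"] kq by simp
 then have "\<forall>\<^sub>F n in sequentially. 0 < (Z n - q*\<rho> n)/k & Z n <= (11/10)*abs (Z n - q*\<rho> n) & \<rho> n <= (2*(- k)/q)*((Z n - q*\<rho> n)/k)"
 proof eventually_elim
  case (elim n)
  then have z: "Z n < q/2*\<rho> n" using pos(2)[of n] by (simp add: pos_divide_less_eq)
  have p: "0 < q/2*\<rho> n" using kq pos(2)[of n] by simp
  have 1: "Z n - q*\<rho> n < - (q/2*\<rho> n)" using z by (simp add: field_simps)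
  have "0 < (Z n - q*\<rho> n)/k" using 1 p kq by (intro divide_neg_neg) auto
  moreover have "Z n <= (11/10)*abs (Z n - q*\<rho> n)"
  proof -
   have "b < - a" if "a < - p" "b < p" for a b p :: real using that by linarith
   from this[OF 1 z] have "Z n < - (Z n - q*\<rho> n)" .
   then have "Z n <= abs (Z n - q*\<rho> n)" by simp
   then show ?thesis by (rule order_trans) simp
  qed
  moreover have "\<rho> n <= (2*(- k)/q)*((Z n - q*\<rho> n)/k)"
  proof -
   have "(2*(- k)/q)*(X/k) = (- 2*X)/q" for X using kq by simp
   moreover have "\<rho> n <= (- 2*(Z n - q*\<rho> n))/q"
    using 1 kq(2) by (subst pos_le_divide_eq) (simp_all add: field_simps)
   ultimately show ?thesis by (simp only:)
  qed
  ultimately show ?case by blast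
 qed
 moreover have "0 <= 2*(- k)/q" using kq by (intro divide_nonneg_pos) auto
 ultimately show ?thesis by blast
next
 assume kq: "0 < k" "0 < q" and lim: "(%n. \<rho> n/Z n) \<longlonglongrightarrow> 0"
 have "\<forall>\<^sub>F n in sequentially. \<rho> n/Z n < 1/(11*q)" using order_tendstoD(2)[OF lim, of "1/(11*q)"] kq by simp
 then have "\<forall>\<^sub>F n in sequentially. 0 < (Z n - q*\<rho> n)/k & Z n <= (11/10)*abs (Z n - q*\<rho> n) & \<rho> n <= (k/(10*q))*((Z n - q*\<rho> n)/k)"
 proof eventually_elim
  case (elim n)
  \<comment> \<open>At least \<open>10/11\<close> of \<open>Z\<close> survives in the difference;
    this is the factor \<open>11/10\<close>.\<close>
  then have z: "11*(q*\<rho> n) < Z n" using pos(1)[of n] kq by (simp add: field_simps)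
  have p: "0 < q*\<rho> n" using kq pos(2)[of n] by simp
  have "0 < (Z n - q*\<rho> n)/k" using z p kq by (intro divide_pos_pos) linarith+
  moreover have "abs (Z n - q*\<rho> n) = Z n - q*\<rho> n" using z p by simp
  then have "Z n <= (11/10)*abs (Z n - q*\<rho> n)" using z by simp
  moreover have "\<rho> n <= (k/(10*q))*((Z n - q*\<rho> n)/k)"
   using z kq by (simp add: field_simps)
  ultimately show ?case by blast
 qed
 then show ?thesis using kq by (intro exI[of _ "k/(10*q)"]) auto
qed

text \<open>The last clause records the itinerary of a point, from its entry at \<open>P\<close> to
  its arrival at \<open>E\<close>, with a common bound \<open>e\<close>. Membership in the strip and
  closeness to the cycle are both read off from it.\<close>

definition strip_horseshoe ::
 "(real \<times> real => real \<times> real) => (real \<times> real => real \<times> real) => (real \<times> real => real \<times> real) => real => real => nat => (real \<times> real) set => bool" where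
 "strip_horseshoe R P g ete e n K \<longleftrightarrow> compact K & R ` K = K & uniformly_hyperbolic R K & conjugate_to_full_shift R K &
   (\<forall>\<psi> z. (\<psi>, z) \<in> K --> (\<exists>s \<rho> y \<zeta>. abs \<psi> < e & z = exp (ete*(\<psi> - s - 2*pi*real n)) & abs s < e &
    P (\<psi>, z) = (s, \<rho>) & 0 < \<rho> & \<rho> < e & g (s, \<rho>) = (y, \<zeta>) & abs y < e & 0 < \<zeta> & \<zeta> < e))"

lemma (in transit) horseshoes_exist:
 fixes g P :: "real \<times> real => real \<times> real" and etc ete k c11 c12 c22 rg :: real
 assumes A2: "0 < A2" and g: "Ck 2 (ball 0 rg) g" "0 < rg" "g 0 = 0"
  and dg: "(g has_derivative (%(\<psi>, \<rho>). (c11*\<psi> + c12*\<rho>, c22*\<rho>))) (at 0)"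
  and k: "dird [(1, 0), (1, 0)] (%w. snd (g w)) 0 = 2*k" "k ~= 0" and c: "c22 ~= 0" "c11 ~= 0"
  and eta: "0 < etc" "0 < ete"
  and P: "!!n \<psi> z. 0 < z ==> abs (\<psi> - ln z/ete - 2*pi*real n) < 2 ==> P (\<psi>, z) = (\<psi> - ln z/ete - 2*pi*real n, z powr (etc/ete))"
  and cases: "(0 < k & c22 < 0) \<or> (k < 0 & 0 < c22 & d1*(etc/ete) < 1) \<or> (0 < k & 0 < c22 & 1 < d1*(etc/ete))"
  and e: "0 < e"
 shows "\<forall>\<^sub>F n in sequentially. \<exists>K. strip_horseshoe (%q. E (g (P q))) P g ete e n K"
proof -
 define \<tau> where "\<tau> n = 2*pi*real n" for n
 define ep where "ep n = exp (- (ete*\<tau> n))" for n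
 define \<rho> where "\<rho> n = exp (- (etc*\<tau> n))" for n
 \<comment> \<open>The height at \<open>E\<close> whose leading-order return height is
   \<open>ep n\<close>, the typical height of the strip.\<close>
 define Z where "Z n = (ep n/A2) powr (1/d1)" for n
 define ss where "ss n = sqrt ((Z n - c22*\<rho> n)/k)" for n
 have pos: "0 < ep n" "0 < \<rho> n" "0 < Z n" for n using A2 by (auto simp: ep_def \<rho>_def Z_def)
 have lim_ep: "ep \<longlonglongrightarrow> 0" "\<rho> \<longlonglongrightarrow> 0"
  unfolding ep_def[abs_def] \<rho>_def[abs_def] \<tau>_def using exp_nat_tendsto_0 eta by blast+
 have lim_Z: "Z \<longlonglongrightarrow> 0"
 proof -
  have "(%n. ep n/A2) \<longlonglongrightarrow> 0/A2" using A2 by (intro tendsto_intros lim_ep) auto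
  then have "(%n. (ep n/A2) powr (1/d1)) \<longlonglongrightarrow> 0 powr (1/d1)"
   using d(1) pos A2 by (intro tendsto_powr') (auto intro!: always_eventually less_imp_le divide_pos_pos)
  then show ?thesis by (simp add: Z_def[abs_def])
 qed
 have aZ: "A2*Z n powr d1 = ep n" for n using pos(1)[of n] A2 d(1) by (simp add: Z_def powr_powr)
 have lim_Zd: "(%n. Z n powr d1) \<longlonglongrightarrow> 0"
 proof -
  have "Z n powr d1 = ep n/A2" for n using aZ[of n] A2 by (simp add: field_simps)
  then show ?thesis using tendsto_divide[OF lim_ep(1) tendsto_const[of A2]] A2 by simp
 qed
 have Zexp: "Z n = A2 powr (- 1/d1)*exp (- (ete/d1*\<tau> n))" for n
 proof -
  have l: "ln (ep n/A2) = - (ete*\<tau> n) - ln A2" using A2 by (simp add: ep_def ln_div)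
  have "Z n = exp (1/d1*ln (ep n/A2))" using pos(1)[of n] A2 by (simp add: Z_def powr_def)
  also have "... = exp (- 1/d1*ln A2)*exp (- (ete/d1*\<tau> n))"
   unfolding l exp_add[symmetric] by (simp add: diff_divide_distrib)
  finally show ?thesis using A2 by (simp add: powr_def)
 qed
 have "\<exists>B\<ge>0. \<forall>\<^sub>F n in sequentially. 0 < (Z n - c22*\<rho> n)/k & Z n <= (11/10)*abs (Z n - c22*\<rho> n) & \<rho> n <= B*((Z n - c22*\<rho> n)/k)"
 proof (rule scale_balance)
  let ?a = "A2 powr (- 1/d1)"
  have a: "0 < ?a" using A2 by simp
  have l1: "(%n. Z n/\<rho> n) \<longlonglongrightarrow> 0" if "d1*(etc/ete) < 1"
  proof -
   have "0 < ete/d1 - etc" using that eta d(1) by (simp add: field_simps)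
   then have "(%n. ?a*exp (- ((ete/d1 - etc)*(2*pi*real n)))) \<longlonglongrightarrow> ?a*0"
    by (intro tendsto_intros exp_nat_tendsto_0)
   moreover have "Z n/\<rho> n = ?a*exp (- ((ete/d1 - etc)*(2*pi*real n)))" for n
    unfolding Zexp \<rho>_def \<tau>_def by (simp add: exp_minus exp_diff field_simps exp_add[symmetric])
   ultimately show ?thesis by simp
  qed
  have l2: "(%n. \<rho> n/Z n) \<longlonglongrightarrow> 0" if "1 < d1*(etc/ete)"
  proof -
   have "0 < etc - ete/d1" using that eta d(1) by (simp add: field_simps)
   then have "(%n. exp (- ((etc - ete/d1)*(2*pi*real n))) / ?a) \<longlonglongrightarrow> 0 / ?a"
    using a by (intro tendsto_intros exp_nat_tendsto_0) auto
   moreover have "\<rho> n/Z n = exp (- ((etc - ete/d1)*(2*pi*real n))) / ?a" for n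
    unfolding Zexp \<rho>_def \<tau>_def by (simp add: exp_minus exp_diff field_simps exp_add[symmetric])
   ultimately show ?thesis by simp
  qed
  show "(0 < k & c22 < 0) \<or> (k < 0 & 0 < c22 & (%n. Z n/\<rho> n) \<longlonglongrightarrow> 0) \<or> (0 < k & 0 < c22 & (%n. \<rho> n/Z n) \<longlonglongrightarrow> 0)"
   using cases l1 l2 by blast
 qed (rule pos)+
 then obtain B where B: "0 <= B" "\<forall>\<^sub>F n in sequentially. 0 < (Z n - c22*\<rho> n)/k & Z n <= (11/10)*abs (Z n - c22*\<rho> n) & \<rho> n <= B*((Z n - c22*\<rho> n)/k)"
  by blast
 have lim_ss: "ss \<longlonglongrightarrow> 0"
 proof -
  have "(%n. sqrt ((Z n - c22*\<rho> n)/k)) \<longlonglongrightarrow> sqrt ((0 - c22*0)/k)"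
   using k(2) by (intro tendsto_intros lim_Z lim_ep) auto
  then show ?thesis by (simp add: ss_def[abs_def])
 qed
 obtain kp where kap: "0 < kp" "kp <= 1/16" "!!x y. abs x <= kp ==> abs y <= kp ==>
  abs ((x - (1 + x) powr d1/d1) - (y - (1 + y) powr d1/d1)) <= (1/16)*abs (x - y)"
  using powr_linearization[OF d(1)] by blast
 \<comment> \<open>The weights 96, 24, 4, 4 are the denominators wanted in \<open>cc1\<close>; so
   the scale of the entry angle depends on \<open>B\<close> but not on the strip.\<close>
 define cc where "cc = inverse (96*(abs c22*etc*B/(2*abs k)) + 24*(ete/d1) + 4*etc + 4*ete)"
 have cden: "0 < 96*(abs c22*etc*B/(2*abs k)) + 24*(ete/d1) + 4*etc + 4*ete"
  using eta d(1) B(1) by (intro add_nonneg_pos add_nonneg_nonneg) auto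
 have cc: "0 < cc" unfolding cc_def using cden by simp
 have cc4: "a*cc <= 1/m" if "m*a <= 96*(abs c22*etc*B/(2*abs k)) + 24*(ete/d1) + 4*etc + 4*ete" "0 < m" for a m
 proof -
  have "(m*a)*cc <= 1" unfolding cc_def using that cden by (simp add: divide_inverse[symmetric])
  then show ?thesis using that(2) by (simp add: field_simps)
 qed
 have nn: "0 <= abs c22*etc*B/(2*abs k)" "0 <= ete/d1" using eta d(1) B(1) by auto
 have cc1: "(abs c22*etc*B/(2*abs k))*cc <= 1/96" "(ete/d1)*cc <= 1/24" "etc*cc <= 1/4" "ete*cc <= 1/4"
  using nn eta by (intro cc4; linarith)+
 \<comment> \<open>Sixty-four times each coefficient with which \<open>\<eta>\<close> survives in
   the numerical conditions as \<open>ss\<close> tends to 0 is at most \<open>den\<close>; hence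
   each of these products is at most \<open>kp/64\<close>.\<close>
 define den where "den = (2 + 3*etc*cc*B + 3*B)/(2*abs k)*64 + (2/(A2*d1))*64 + 1"
 have den: "1 <= den" unfolding den_def using eta cc B(1) A2 d(1) by (intro add_nonneg_nonneg[THEN add_increasing] order_refl) auto
 define \<eta> where "\<eta> = kp/den"
 have eta0: "0 < \<eta>" using kap(1) den by (simp add: \<eta>_def)
 have eta4: "\<eta>*a <= kp/64" if "a*64 <= den" for a
 proof -
  have "kp*(a*64) <= kp*den" using that kap(1) by (intro mult_left_mono) auto
  then show ?thesis using den by (simp add: \<eta>_def field_simps)
 qed
 have dgen: "(x + y)*64 <= (x + y + u)*64 + w*64 + 1 & (x + u)*64 <= (x + y + u)*64 + w*64 + 1 & w*64 <= (x + y + u)*64 + w*64 + 1"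
  if "0 <= x" "0 <= y" "0 <= u" "0 <= w" for x y u w :: real using that by auto
 have dd: "(2 + 3*etc*cc*B)/(2*abs k)*64 <= den" "(2 + 3*B)/(2*abs k)*64 <= den" "2/(A2*d1)*64 <= den"
 proof -
  have q: "0 <= 3*etc*cc*B/(2*abs k)" "0 <= 3*B/(2*abs k)" "0 <= 2/(2*abs k)" "0 <= 2/(A2*d1)"
   using eta cc B(1) A2 d(1) by auto
  then show "(2 + 3*etc*cc*B)/(2*abs k)*64 <= den" "(2 + 3*B)/(2*abs k)*64 <= den" "2/(A2*d1)*64 <= den"
   using dgen[OF q(3,1,2,4)] unfolding den_def add_divide_distrib by blast+
 qed
 have eta1: "\<eta>*((2 + 3*etc*cc*B)/(2*abs k)) <= kp/64" "\<eta>*((2 + 3*B)/(2*abs k)) <= kp/64" "\<eta>*(2/(A2*d1)) <= kp/64"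
  by (intro eta4 dd)+
 obtain Cg where Cg: "0 <= Cg" "\<exists>r'>0. \<forall>S \<rho>m s s' \<rho> \<rho>'. S <= r' & \<rho>m <= r' & abs s <= S & abs s' <= S & 0 <= \<rho> & \<rho> <= \<rho>m & 0 <= \<rho>' & \<rho>' <= \<rho>m -->
   abs ((snd (g (s, \<rho>)) - k * s\<^sup>2 - c22*\<rho>) - (snd (g (s', \<rho>')) - k * s'\<^sup>2 - c22*\<rho>')) <= (\<eta>*S + Cg*\<rho>m)*abs (s - s') + \<eta>*abs (\<rho> - \<rho>')"
  using tangency_map_estimate[OF g(1,2) dg k(1)] eta0 by blast
 then obtain r1 where r1: "0 < r1" "!!S \<rho>m s s' \<rho> \<rho>'. S <= r1 ==> \<rho>m <= r1 ==> abs s <= S ==> abs s' <= S ==> 0 <= \<rho> ==> \<rho> <= \<rho>m ==> 0 <= \<rho>' ==> \<rho>' <= \<rho>m ==>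
   abs ((snd (g (s, \<rho>)) - k * s\<^sup>2 - c22*\<rho>) - (snd (g (s', \<rho>')) - k * s'\<^sup>2 - c22*\<rho>')) <= (\<eta>*S + Cg*\<rho>m)*abs (s - s') + \<eta>*abs (\<rho> - \<rho>')"
  by blast
 have g1: "Ck (Suc 0) (ball 0 rg) g" using Ck_le[OF _ g(1), of "Suc 0"] by simp
 have g0: "0 \<in> ball (0 :: real \<times> real) rg" using g(2) by simp
 have ginj: "inj (frechet_derivative g (at 0))"
 proof -
  have fr: "frechet_derivative g (at 0) = (%(\<psi>, \<rho>). (c11*\<psi> + c12*\<rho>, c22*\<rho>))" using frechet_derivative_at[OF dg] by simp
  show ?thesis unfolding fr inj_def using c by auto
 qed
 obtain r2 Cl where r2: "0 < r2" "0 < Cl" "ball (0::real \<times> real) r2 \<subseteq> ball 0 rg"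
  "!!u v. u \<in> ball 0 r2 ==> v \<in> ball 0 r2 ==> norm (u - v) <= Cl*norm (g u - g v)"
  "!!u v. u \<in> ball 0 r2 ==> v \<in> ball 0 r2 ==> norm (g u - g v) <= Cl*norm (u - v)"
  using Ck_lower_bound[OF g1 open_ball g0 ginj] by metis
 obtain Z1 where Z1: "0 < Z1" "!!z u v. 0 < z ==> z < Z1 ==> u \<in> rect ==> v \<in> rect ==>
   norm ((E (zt z u) - X z u *\<^sub>R (A1, A2)) - (E (zt z v) - X z v *\<^sub>R (A1, A2))) <= \<eta>*z powr d1*dl u v"
  "!!z. 0 < z ==> z < Z1 ==> norm (E (zt z (0, 0)) - X z (0, 0) *\<^sub>R (A1, A2)) <= \<eta>*z powr d1"
  using rest_estimate[OF eta0] by blast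
 obtain Z2 where Z2: "0 < Z2" "!!z. 0 < z ==> z < Z2 ==> (\<exists>M. \<forall>u\<in>rect. \<forall>v\<in>rect. norm (zt z u - zt z v) <= M*norm (E (zt z u) - E (zt z v))) &
  (\<forall>u\<in>rect. E differentiable (at (zt z u)))"
  using E_lower by blast
 define ysum where "ysum n = Cl*(2* ss n + 3*etc*(cc+ss n)*\<rho> n + 3*\<rho> n)" for n
 have lim_y: "ysum \<longlonglongrightarrow> 0"
 proof -
  have "ysum \<longlonglongrightarrow> Cl*(2*0 + 3*etc*(cc+0)*0 + 3*0)"
   unfolding ysum_def[abs_def] by (intro tendsto_intros lim_ss lim_ep)
  then show ?thesis by simp
 qed
 have ev: "\<forall>\<^sub>F n in sequentially. f n < b" if "f \<longlonglongrightarrow> l" "l < b" for f :: "nat => real" and l b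
  using order_tendstoD(2)[OF that] .
 \<comment> \<open>Every numerical condition holds strictly with \<open>ss\<close> replaced by its
   limit 0, and therefore in all late strips.\<close>
 let ?N1 = "%x. 3*abs c22*etc*(cc+x)*B/(2*abs k) + (2*\<eta> + 3*Cg*B* x + 3*\<eta>*etc*(cc+x)*B)/(2*abs k)"
 have 1: "\<forall>\<^sub>F n in sequentially. ?N1 (ss n) < 1/8"
 proof (rule ev)
  show "(%n. ?N1 (ss n)) \<longlonglongrightarrow>
   ?N1 0"
   using k(2) by (intro tendsto_intros lim_ss) auto
  have "3*abs c22*etc*(cc+0)*B/(2*abs k) = 3*((abs c22*etc*B/(2*abs k))*cc)" by simp
  moreover have "(2*\<eta> + 3*Cg*B* 0 + 3*\<eta>*etc*(cc+0)*B)/(2*abs k) = \<eta>*((2 + 3*etc*cc*B)/(2*abs k))" by (simp add: algebra_simps)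
  ultimately show "?N1 0 < 1/8"
   using cc1(1) eta1(1) kap(2) by linarith
 qed
 let ?N2 = "%x. 3*abs c22*etc* x *B/(2*abs k) + (2*\<eta> + 3*Cg*B* x + 3*\<eta>*B)/(2*abs k)"
 have 2: "\<forall>\<^sub>F n in sequentially. ?N2 (ss n) < kp/8"
 proof (rule ev)
  show "(%n. ?N2 (ss n)) \<longlonglongrightarrow>
   ?N2 0"
   using k(2) by (intro tendsto_intros lim_ss) auto
  have "?N2 0 = \<eta>*((2 + 3*B)/(2*abs k))" by (simp add: algebra_simps)
  then show "?N2 0 < kp/8"
   using eta1(2) kap(1) by linarith
 qed
 let ?N3 = "%x. 2*\<eta>/(A2*d1) + 3*ete*(cc+x)/d1"
 have 3: "\<forall>\<^sub>F n in sequentially. ?N3 (ss n) < 1/2"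
 proof (rule ev)
  show "(%n. ?N3 (ss n)) \<longlonglongrightarrow> ?N3 0"
   using d(1) by (intro tendsto_intros lim_ss) auto
  have "?N3 0 = \<eta>*(2/(A2*d1)) + 3*((ete/d1)*cc)" by (simp add: ac_simps)
  then show "?N3 0 < 1/2" using eta1(3) cc1(2) kap(2) by linarith
 qed
 let ?N4 = "%x. 2*\<eta>/(A2*d1) + 3*ete* x/d1"
 have 4: "\<forall>\<^sub>F n in sequentially. ?N4 (ss n) < kp/8"
 proof (rule ev)
  show "(%n. ?N4 (ss n)) \<longlonglongrightarrow> ?N4 0"
   using d(1) by (intro tendsto_intros lim_ss) auto
  have "?N4 0 = \<eta>*(2/(A2*d1))" by simp
  then show "?N4 0 < kp/8" using eta1(3) kap(1) by linarith
 qed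
 have lim0: "(%n. a*Z n powr d1/cc) \<longlonglongrightarrow> 0" "(%n. a*Z n powr d1) \<longlonglongrightarrow> 0" for a
  using tendsto_divide[OF tendsto_mult[OF tendsto_const[of a] lim_Zd] tendsto_const[of cc]] tendsto_mult[OF tendsto_const[of a] lim_Zd] cc by auto
 have limt: "(%n. a*(cc + 2 * ss n)) \<longlonglongrightarrow> a*cc" for a
  using tendsto_mult[OF tendsto_const[of a] tendsto_add[OF tendsto_const[of cc] tendsto_mult[OF tendsto_const[of 2] lim_ss]]] by simp
 have limr: "(%n. 2 * ss n + 3*\<rho> n) \<longlonglongrightarrow> 0" "(%n. 2 * ss n) \<longlonglongrightarrow> 0" "(%n. 3*\<rho> n) \<longlonglongrightarrow> 0" "(%n. 2*Z n) \<longlonglongrightarrow> 0"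
  using tendsto_add[OF tendsto_mult[OF tendsto_const[of 2] lim_ss] tendsto_mult[OF tendsto_const[of 3] lim_ep(2)]]
   tendsto_mult[OF tendsto_const[of 2] lim_ss] tendsto_mult[OF tendsto_const[of 3] lim_ep(2)] tendsto_mult[OF tendsto_const[of 2] lim_Z] by auto
 have half: "etc*cc < 1" "ete*cc < 1" using cc1(3,4) by linarith+
 have kk8: "0 < kp/8" "0 < min 1 y0" "0 < min Z1 Z2" "0 < min r1 (min r2 e)" "0 < min 1 (min r1 e)" "0 < min y0 e" using kap(1) y0 Z1(1) Z2(1) r1(1) r2(1) e by auto
 have "\<forall>\<^sub>F n in sequentially. (2*abs A1*d1 + 2*\<eta>)*Z n powr d1/cc < 3/4"
  "\<forall>\<^sub>F n in sequentially. (abs A1 + 2*\<eta>)*Z n powr d1/cc < kp/8"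
  "\<forall>\<^sub>F n in sequentially. (abs A1*(1 + 2*d1) + 4*\<eta>)*Z n powr d1 < e"
  "\<forall>\<^sub>F n in sequentially. etc*(cc + 2 * ss n) < 1" "\<forall>\<^sub>F n in sequentially. ete*(cc + 2 * ss n) < 1"
  "\<forall>\<^sub>F n in sequentially. ysum n < min 1 y0" "\<forall>\<^sub>F n in sequentially. ysum n < min y0 e"
  "\<forall>\<^sub>F n in sequentially. Z n < min Z1 Z2" "\<forall>\<^sub>F n in sequentially. 2*Z n < e"
  "\<forall>\<^sub>F n in sequentially. 2 * ss n + 3*\<rho> n < min r1 (min r2 e)" "\<forall>\<^sub>F n in sequentially. 2 * ss n < min 1 (min r1 e)"
  "\<forall>\<^sub>F n in sequentially. 3*\<rho> n < min r1 (min r2 e)"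
  by (rule ev[OF lim0(1)] ev[OF lim0(2)] ev[OF limt] ev[OF lim_y] ev[OF lim_Z] ev[OF limr(1)] ev[OF limr(2)] ev[OF limr(3)] ev[OF limr(4)]; (rule kk8 half e)?; simp?)+
 then show ?thesis using 1 2 3 4 B(2)
 proof eventually_elim
  case (elim n)
  have kss: "k*(ss n)\<^sup>2 = Z n - c22*\<rho> n" and kssa: "abs k*(ss n)\<^sup>2 = abs (Z n - c22*\<rho> n)" and ssp: "0 < ss n" and ss2: "(ss n)\<^sup>2 = (Z n - c22*\<rho> n)/k"
  proof -
   have q: "0 < (Z n - c22*\<rho> n)/k" using elim(17) by blast
   show s2: "(ss n)\<^sup>2 = (Z n - c22*\<rho> n)/k" unfolding ss_def using q by simp
   show "0 < ss n" unfolding ss_def using q by simp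
   show a: "k*(ss n)\<^sup>2 = Z n - c22*\<rho> n" unfolding s2 using k(2) by simp
   show "abs k*(ss n)\<^sup>2 = abs (Z n - c22*\<rho> n)" unfolding a[symmetric] by (simp add: abs_mult)
  qed
  have zz: "Z n < Z1" "Z n < Z2" using elim(8) by auto
  obtain M where M: "!!u v. u \<in> rect ==> v \<in> rect ==> norm (zt (Z n) u - zt (Z n) v) <= M*norm (E (zt (Z n) u) - E (zt (Z n) v))"
   using Z2(2)[OF pos(3) zz(2)] by blast
  have Ed: "E differentiable (at (zt (Z n) u))" if "u \<in> rect" for u using Z2(2)[OF pos(3) zz(2)] that by blast
  have rin: "(y, z) \<in> rect" if "abs y <= y0" "abs z <= 1/2" for y z using that by (auto simp: rect_def abs_le_iff)
  have gin: "(s, r) \<in> ball 0 r2" if "abs s <= 2 * ss n" "0 <= r" "r <= 3*\<rho> n" for s r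
   using that elim(10) norm_Pair_le[of s r] by auto
  have zte: "zt (Z n) (y, z) = (y, Z n*(1 + z))" "X (Z n) (y, z) = (Z n*(1 + z)) powr d1" for y z by (simp_all add: zt_def X_def)
  interpret S: strip_map g E etc ete d1 A1 A2 k c22 y0 kp cc "ep n" "Z n" "\<rho> n" "ss n" \<eta> B Cg Cl P "%q. E (g (P q))" "\<tau> n" "max M Cl" r2
  proof (intro strip_map.intro strip.intro strip_map_axioms.intro)
   show "0 < etc" "0 < ete" "0 < d1" "0 < A2" "k ~= 0" "0 < y0" "0 < kp" "kp <= 1/16" "0 < cc" "0 < ep n" "0 < Z n" "0 < \<rho> n" "0 < ss n" "0 <= \<eta>" "0 <= B" "0 <= Cg" "0 <= Cl"
    using eta d(1) A2 k(2) y0(1) kap cc pos ssp eta0 B(1) Cg(1) r2(2) by auto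
   show "k*(ss n)\<^sup>2 = Z n - c22*\<rho> n" by (rule kss)
   show "A2*Z n powr d1 = ep n" by (rule aZ)
   show "Z n <= (11/10)*(abs k*(ss n)\<^sup>2)" unfolding kssa using elim(17) by blast
   show "\<rho> n <= B*(ss n)\<^sup>2" unfolding ss2 using elim(17) by blast
   show "g (0, 0) = (0, 0)" using g(3) by (simp add: zero_prod_def)
   show "norm (E (0, Z n) - Z n powr d1 *\<^sub>R (A1, A2)) <= \<eta>*Z n powr d1"
    using Z1(3)[OF pos(3) zz(1)] unfolding zte by simp
   show "abs ((x - (1 + x) powr d1/d1) - (y - (1 + y) powr d1/d1)) <= (1/16)*abs (x - y)" if "abs x <= kp" "abs y <= kp" for x y
    by (rule kap(3)[OF that])
   show "ss n < 1" using elim(11) ssp by auto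
   show "ep n = exp (- (ete*\<tau> n))" "\<rho> n = exp (- (etc*\<tau> n))" by (simp_all add: ep_def \<rho>_def)
   show "2* ss n + 3*\<rho> n < r2" using elim(10) by auto
   show "Cl*(2* ss n + 3*etc*(cc+ss n)*\<rho> n + 3*\<rho> n) <= min 1 y0" "Cl*(2* ss n + 3*etc*(cc+ss n)*\<rho> n + 3*\<rho> n) < y0"
    using elim(6,7) unfolding ysum_def by auto
   show "norm (w - w') <= max M Cl*norm (g w - g w')" if "w \<in> ball 0 r2" "w' \<in> ball 0 r2" for w w'
    using r2(4)[OF that] by (rule order_trans) (intro mult_right_mono, auto)
   show "g differentiable (at w)" if "w \<in> ball 0 r2" for w using g1 r2(3) that by auto
   fix s s' r r' assume sr: "abs s <= 2 * ss n" "abs s' <= 2 * ss n" "0 <= r" "r <= 3*\<rho> n" "0 <= r'" "r' <= 3*\<rho> n"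
   have "abs ((snd (g (s, r)) - k * s\<^sup>2 - c22*r) - (snd (g (s', r')) - k * s'\<^sup>2 - c22*r'))
    <= (\<eta>*(2 * ss n) + Cg*(3*\<rho> n))*abs (s - s') + \<eta>*abs (r - r')"
    by (rule r1(2)) (use sr elim(11,12) in auto)
   then show "abs ((snd (g (s, r)) - k * s\<^sup>2 - c22*r) - (snd (g (s', r')) - k * s'\<^sup>2 - c22*r'))
    <= (2*\<eta>* ss n + 3*Cg*\<rho> n)*abs (s - s') + \<eta>*abs (r - r')" by (simp only: mult_ac)
   have "abs (fst (g (s, r)) - fst (g (s', r'))) <= norm (g (s, r) - g (s', r'))"
    using norm_fst_le[of "fst (g (s, r) - g (s', r'))" "snd (g (s, r) - g (s', r'))"] unfolding prod.collapse by simp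
   also have "... <= Cl*norm ((s, r) - (s', r'))" by (rule r2(5)[OF gin gin]) (rule sr)+
   also have "... <= Cl*(abs (s - s') + abs (r - r'))"
    using norm_Pair_le[of "s - s'" "r - r'"] r2(2) by (intro mult_left_mono) auto
   finally show "abs (fst (g (s, r)) - fst (g (s', r'))) <= Cl*(abs (s - s') + abs (r - r'))" .
  next
   fix y z y' z' :: real assume a: "abs y <= y0" "abs y' <= y0" "abs z <= 1/2" "abs z' <= 1/2"
   show "norm ((E (y, Z n*(1 + z)) - (Z n*(1 + z)) powr d1 *\<^sub>R (A1, A2)) - (E (y', Z n*(1 + z')) - (Z n*(1 + z')) powr d1 *\<^sub>R (A1, A2)))
    <= \<eta>*Z n powr d1*(abs (y - y') + abs (z - z'))"
    using Z1(2)[OF pos(3) zz(1) rin[OF a(1,3)] rin[OF a(2,4)]] unfolding zte by simp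
  next
   fix y z y' z' :: real assume a: "abs y < y0" "abs y' < y0" "abs z < 1/2" "abs z' < 1/2"
   have "norm (zt (Z n) (y, z) - zt (Z n) (y', z')) <= M*norm (E (zt (Z n) (y, z)) - E (zt (Z n) (y', z')))"
    by (intro M rin) (use a in auto)
   also have "... <= max M Cl*norm (E (zt (Z n) (y, z)) - E (zt (Z n) (y', z')))" by (intro mult_right_mono) auto
   finally show "norm ((y, Z n*(1 + z)) - (y', Z n*(1 + z'))) <= max M Cl*norm (E (y, Z n*(1 + z)) - E (y', Z n*(1 + z')))"
    unfolding zte .
  next
   fix y z :: real assume "abs y < y0" "abs z < 1/2"
   then show "E differentiable (at (y, Z n*(1 + z)))" using Ed[OF rin[of y z]] unfolding zte by simp
  next
   fix \<psi> z assume "0 < z" "abs (\<psi> - ln z/ete - \<tau> n) < 2"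
   then show "P (\<psi>, z) = (\<psi> - ln z/ete - \<tau> n, z powr (etc/ete))" unfolding \<tau>_def by (rule P)
  qed (use elim in \<open>auto intro: less_imp_le\<close>)
  show ?case unfolding strip_horseshoe_def
  proof (intro exI[of _ S.K] conjI allI impI)
   fix \<psi> z assume "(\<psi>, z) \<in> S.K"
   from S.K_bounds[OF this] obtain s \<rho>' y \<zeta> where b: "abs \<psi> <= (abs A1*(1 + 2*d1) + 4*\<eta>)*Z n powr d1" "z = exp (ete*(\<psi> - s - \<tau> n))" "abs s <= 2 * ss n"
    "P (\<psi>, z) = (s, \<rho>')" "0 < \<rho>'" "\<rho>' <= 3*\<rho> n" "g (s, \<rho>') = (y, \<zeta>)"
    "abs y <= Cl*(2* ss n + 3*etc*(cc+ss n)*\<rho> n + 3*\<rho> n)" "0 < \<zeta>" "\<zeta> <= 2*Z n" by blast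
   have "abs \<psi> < e" using b(1) elim(3) by linarith
   moreover have "abs s < e" using b(3) elim(11) by linarith
   moreover have "\<rho>' < e" using b(6) elim(12) by linarith
   moreover have "abs y < e" using b(8) elim(7) unfolding ysum_def by linarith
   moreover have "\<zeta> < e" using b(10) elim(9) by linarith
   ultimately show "\<exists>s \<rho> y \<zeta>. abs \<psi> < e & z = exp (ete*(\<psi> - s - 2*pi*real n)) & abs s < e &
    P (\<psi>, z) = (s, \<rho>) & 0 < \<rho> & \<rho> < e & g (s, \<rho>) = (y, \<zeta>) & abs y < e & 0 < \<zeta> & \<zeta> < e"
    using b(2,4,5,7,9) unfolding \<tau>_def by blast
  qed (rule S.K_horseshoe S.K_hyperbolic)+
 qed
qed

section \<open>The flow of a smooth vector field\<close>

text \<open>Halving: on a time interval of length at most \<open>1/(2L)\<close> each bound \<open>S\<close> of \<open>d\<close> improves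
 to \<open>norm (d t0) + S/2\<close>.\<close>

lemma gronwall_short:
 fixes d :: "real => 'a::real_normed_vector"
 assumes J: "convex J" "t0 \<in> J" and h: "!!s. s \<in> J ==> abs (s - t0) <= h" and L: "0 <= L" "L*h <= 1/2"
  and d: "!!s. s \<in> J ==> (d has_vector_derivative d' s) (at s within J)" "!!s. s \<in> J ==> norm (d' s) <= L*norm (d s)"
  and bnd: "!!s. s \<in> J ==> norm (d s) <= S" and s: "s \<in> J"
 shows "norm (d s) <= 2*norm (d t0)"
proof -
 have half: "norm (d s) <= norm (d t0) + T/2" if T: "!!s. s \<in> J ==> norm (d s) <= T" and s: "s \<in> J" for T s
 proof -
  have T0: "0 <= T" using T[OF J(2)] norm_ge_zero order_trans by blast
  have "norm (d s - d t0) <= (L*T)*norm (s - t0)"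
  proof (rule differentiable_bound[OF J(1)])
   fix x assume x: "x \<in> J"
   show "(d has_derivative (%h. h *\<^sub>R d' x)) (at x within J)"
    using d(1)[OF x] by (simp add: has_vector_derivative_def)
   have "norm (d' x) <= L*T" using d(2)[OF x] mult_left_mono[OF T[OF x] L(1)] by linarith
   then show "onorm (%h. h *\<^sub>R d' x) <= L*T"
    by (intro onorm_le) (simp add: mult.commute[of "L*T"] mult_left_mono)
  qed (use s J in auto)
  also have "... <= (L*T)*h" using h[OF s] L(1) T0 by (intro mult_left_mono) auto
  also have "... = (L*h)*T" by simp
  also have "... <= 1/2*T" using L(2) T0 by (rule mult_right_mono)
  finally show ?thesis using norm_triangle_ineq2[of "d s" "d t0"] by linarith
 qed
 have S0: "0 <= S" using bnd[OF J(2)] norm_ge_zero order_trans by blast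
 have it: "\<forall>s\<in>J. norm (d s) <= 2*norm (d t0) + S/2 ^ n" for n
 proof (induction n)
  case 0 show ?case using bnd norm_ge_zero[of "d t0"] by (auto intro: add_increasing)
 next
  case (Suc n)
  show ?case
  proof
   fix s assume "s \<in> J"
   from half[OF _ this, of "2*norm (d t0) + S/2 ^ n"] Suc
   show "norm (d s) <= 2*norm (d t0) + S/2 ^ Suc n" by (simp add: field_simps)
  qed
 qed
 have "(%n. 2*norm (d t0) + S/2 ^ n) \<longlonglongrightarrow> 2*norm (d t0) + 0"
  by (intro tendsto_intros LIMSEQ_divide_realpow_zero) auto
 then show ?thesis using it s by (intro LIMSEQ_le_const[of _ "2*norm (d t0)"]) auto
qed

text \<open>The fixed point is sought among bounded continuous functions of all real times, a
  complete space; clamping the time by \<open>cl\<close> makes the integral operator act there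
  without changing the equation on the interval.\<close>

lemma picard:
 fixes G :: "'a::euclidean_space => 'a"
 assumes K: "0 < K" "!!x y. norm (G x - G y) <= K*norm (x - y)" and h: "0 < h" "8*K*h <= 1"
 shows "\<exists>u. u 0 = x0 & (\<forall>t\<in>{-h..h}. (u has_vector_derivative G (u t)) (at t within {-h..h}))"
proof -
 have contG: "continuous_on UNIV G"
  by (rule lipschitz_on_continuous_on[of K])
   (use K in \<open>auto simp: lipschitz_on_def dist_norm\<close>)
 define I where "I u t = integral {-h..t} (%s. G (u s))" for u :: "real => 'a" and t
 define cl where "cl t = max (-h) (min h t)" for t :: real
 have cl: "cl t \<in> {-h..h}" "t \<in> {-h..h} ==> cl t = t" for t using h by (auto simp: cl_def)
 have intg: "(%s. G (u s)) integrable_on {-h..t}" if "continuous_on {-h..h} u" "t \<in> {-h..h}" for u t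
  by (rule integrable_continuous_real) (use that contG in \<open>auto intro!: continuous_on_compose2[OF contG] elim!: continuous_on_subset\<close>)
 have I_cont: "continuous_on {-h..h} (I u)" if "continuous_on {-h..h} u" for u
  unfolding I_def using indefinite_integral_continuous_1[OF intg[OF that]] h(1) by auto
 \<comment> \<open>The integrals start at \<open>-h\<close>; subtracting the value at 0 yields the
   integral from 0 for both signs of the time. Two integrals over length at most \<open>2*h\<close>
   give the factor \<open>4*K*h\<close>, which is at most \<open>1/2\<close>.\<close>
 define T where "T u t = x0 + I u (cl t) - I u 0" for u :: "real => 'a" and t
 have T_cont: "continuous_on UNIV (T u)" if "continuous_on {-h..h} u" for u
  unfolding T_def cl_def[abs_def]
  by (intro continuous_intros continuous_on_compose2[OF I_cont[OF that]]) (use h in auto)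
 have T_bdd: "bounded (range (T u))" if "continuous_on {-h..h} u" for u
 proof -
  have "compact (I u ` {-h..h})" by (rule compact_continuous_image[OF I_cont[OF that]]) simp
  then have "bounded ((%v. v + (x0 - I u 0)) ` I u ` {-h..h})"
   using bounded_translation[OF compact_imp_bounded, of "I u ` {-h..h}" "x0 - I u 0"] by (simp add: add.commute)
  moreover have "range (T u) \<subseteq> (%v. v + (x0 - I u 0)) ` I u ` {-h..h}"
   using cl(1) by (auto simp: T_def algebra_simps)
  ultimately show ?thesis by (rule bounded_subset)
 qed
 define TT where "TT u = Bcontfun (T (apply_bcontfun u))" for u :: "real \<Rightarrow>\<^sub>C 'a"
 have ac: "continuous_on A (apply_bcontfun u)" for u :: "real \<Rightarrow>\<^sub>C 'a" and A
  using apply_bcontfun[of u] by (auto simp: bcontfun_def intro: continuous_on_subset)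
 have TT: "apply_bcontfun (TT u) = T (apply_bcontfun u)" for u
  unfolding TT_def using T_cont[OF ac] T_bdd[OF ac] by (intro Bcontfun_inverse) (auto simp: bcontfun_def)
 have contr: "dist (TT u) (TT v) <= 1/2*dist u v" for u v
 proof (rule dist_bound)
  fix t
  have Id: "norm (I (apply_bcontfun u) s - I (apply_bcontfun v) s) <= K*dist u v * (2*h)" if s: "s \<in> {-h..h}" for s
  proof -
   have e: "I (apply_bcontfun u) s - I (apply_bcontfun v) s = integral {-h..s} (%r. G (apply_bcontfun u r) - G (apply_bcontfun v r))"
    unfolding I_def using intg[OF ac s] by (intro integral_diff[symmetric])
   have "norm (integral {-h..s} (%r. G (apply_bcontfun u r) - G (apply_bcontfun v r))) <= (K*dist u v)*(s - - h)"
   proof (rule integral_bound)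
    show "- h <= s" using s by simp
    show "continuous_on {-h..s} (%r. G (apply_bcontfun u r) - G (apply_bcontfun v r))"
     by (intro continuous_intros continuous_on_compose2[OF contG] ac) auto
    fix r
    have "norm (G (apply_bcontfun u r) - G (apply_bcontfun v r)) <= K*norm (apply_bcontfun u r - apply_bcontfun v r)" by (rule K(2))
    also have "... <= K*dist u v" using dist_bounded[of u r v] K(1) by (intro mult_left_mono) (auto simp: dist_norm)
    finally show "norm (G (apply_bcontfun u r) - G (apply_bcontfun v r)) <= K*dist u v" .
   qed
   also have "... <= K*dist u v * (2*h)" using s K(1) by (intro mult_left_mono) auto
   finally show ?thesis unfolding e .
  qed
  have "dist (apply_bcontfun (TT u) t) (apply_bcontfun (TT v) t)
   = norm ((I (apply_bcontfun u) (cl t) - I (apply_bcontfun v) (cl t)) - (I (apply_bcontfun u) 0 - I (apply_bcontfun v) 0))"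
   unfolding TT T_def dist_norm by (simp add: algebra_simps)
  also have "... <= K*dist u v * (2*h) + K*dist u v * (2*h)"
   using Id[OF cl(1)] Id[of 0] h by (rule_tac order_trans[OF norm_triangle_ineq4]) (rule add_mono, auto)
  also have "... = (8*K*h)*(1/2*dist u v)" by simp
  also have "... <= 1*(1/2*dist u v)" using h(2) by (intro mult_right_mono) auto
  finally show "dist (apply_bcontfun (TT u) t) (apply_bcontfun (TT v) t) <= 1/2*dist u v" by simp
 qed
 obtain u where u: "TT u = u"
  using banach_fix_type[of "1/2" TT] contr by auto
 define w where "w = apply_bcontfun u"
 have w: "w t = x0 + I w (cl t) - I w 0" for t using TT[of u] u by (simp add: w_def T_def fun_eq_iff)
 show ?thesis
 proof (intro exI[of _ w] conjI ballI)
  show "w 0 = x0" using w[of 0] cl(2)[of 0] h by simp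
  fix t assume t: "t \<in> {-h..h}"
  have cw: "continuous_on {-h..h} w" unfolding w_def by (rule ac)
  have "(I w has_vector_derivative G (w t)) (at t within {-h..h})"
   unfolding I_def by (rule integral_has_vector_derivative[OF continuous_on_compose2[OF contG cw] t]) auto
  then have "((%t. x0 + I w t - I w 0) has_vector_derivative G (w t)) (at t within {-h..h})"
   by (auto intro!: derivative_eq_intros)
  then show "(w has_vector_derivative G (w t)) (at t within {-h..h})"
   by (rule has_vector_derivative_transform[OF t, rotated]) (use w cl(2) in auto)
 qed
qed

text \<open>Composition with the nearest-point projection makes the field globally Lipschitz. The
  speed bound and \<open>B*h <= r\<close> then keep the solution in the larger ball, where the
  projection is the identity.\<close>

lemma local_solution:
 fixes F :: "'a::euclidean_space => 'a"
 assumes r: "0 < r" and K: "0 < K" "!!x y. x \<in> cball x0 (2*r) ==> y \<in> cball x0 (2*r) ==> norm (F x - F y) <= K*norm (x - y)"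
  and B: "0 < B" "!!x. x \<in> cball x0 (2*r) ==> norm (F x) <= B" and h: "0 < h" "8*K*h <= 1" "B*h <= r" and x: "x \<in> cball x0 r"
 shows "\<exists>u. u 0 = x & (\<forall>t\<in>{-h..h}. u t \<in> cball x0 (2*r) & (u has_vector_derivative F (u t)) (at t within {-h..h}))"
proof -
 let ?C = "cball x0 (2*r)"
 have C: "closed ?C" "convex ?C" "?C ~= {}" using r by auto
 define G where "G y = F (closest_point ?C y)" for y
 have cin: "closest_point ?C y \<in> ?C" for y by (rule closest_point_in_set[OF C(1,3)])
 have GK: "norm (G y - G z) <= K*norm (y - z)" for y z
 proof -
  have "norm (G y - G z) <= K*norm (closest_point ?C y - closest_point ?C z)" unfolding G_def by (rule K(2)[OF cin cin])
  also have "... <= K*norm (y - z)"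
   using closest_point_lipschitz[OF C(2,1,3), of y z] K(1) by (intro mult_left_mono) (auto simp: dist_norm)
  finally show ?thesis .
 qed
 obtain u where u: "u 0 = x" "!!t. t \<in> {-h..h} ==> (u has_vector_derivative G (u t)) (at t within {-h..h})"
  using picard[OF K(1) GK h(1,2)] by blast
 have inC: "u t \<in> ?C" if t: "t \<in> {-h..h}" for t
 proof -
  have "norm (u t - u 0) <= B*norm (t - 0)"
  proof (rule differentiable_bound[of "{-h..h}"])
   fix s assume s: "s \<in> {-h..h}"
   show "(u has_derivative (%v. v *\<^sub>R G (u s))) (at s within {-h..h})"
    using u(2)[OF s] by (simp add: has_vector_derivative_def)
   have "norm (G (u s)) <= B" unfolding G_def by (rule B(2)[OF cin])
   then show "onorm (%v. v *\<^sub>R G (u s)) <= B"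
    by (intro onorm_le) (simp add: mult.commute[of B] mult_left_mono)
  qed (use t h in auto)
  also have "... <= B*h" using t B(1) by (intro mult_left_mono) auto
  finally have "norm (u t - x) <= r" using h(3) u(1) by simp
  then show ?thesis using x dist_triangle[of x0 "u t" x] by (simp add: dist_norm norm_minus_commute)
 qed
 have "(u has_vector_derivative F (u t)) (at t within {-h..h})" if "t \<in> {-h..h}" for t
  using u(2)[OF that] closest_point_self[OF inC[OF that]] by (simp add: G_def)
 then show ?thesis using u(1) inC by blast
qed

section \<open>Integral curves and the global flow on the manifold\<close>

locale vector_field =
 fixes A :: "'m::t2_space chart set" and f :: "'m vfield"
 assumes M: "compact_3manifold A" and f: "f \<in> smooth_vfields A"
begin

lemma covered: "\<exists>c\<in>A. p \<in> fst c"
 using M unfolding compact_3manifold_def by blast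

lemma chart:
 assumes "c \<in> A"
 shows "open (fst c)" "open (snd c ` fst c)" "continuous_on (fst c) (snd c)" "continuous_on (snd c ` fst c) (chart_inv c)"
  "!!p. p \<in> fst c ==> chart_inv c (snd c p) = p" "!!x. x \<in> snd c ` fst c ==> snd c (chart_inv c x) = x"
  "!!x. x \<in> snd c ` fst c ==> chart_inv c x \<in> fst c"
proof -
 have h: "open (fst c) & open (snd c ` fst c) & homeomorphism (fst c) (snd c ` fst c) (snd c) (chart_inv c)"
  using M assms unfolding compact_3manifold_def by blast
 then show "open (fst c)" "open (snd c ` fst c)" "continuous_on (fst c) (snd c)" "continuous_on (snd c ` fst c) (chart_inv c)"
  "!!p. p \<in> fst c ==> chart_inv c (snd c p) = p" "!!x. x \<in> snd c ` fst c ==> snd c (chart_inv c x) = x"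
  unfolding homeomorphism_def by blast+
 show "chart_inv c x \<in> fst c" if "x \<in> snd c ` fst c" for x
  using h that unfolding homeomorphism_def by blast
qed

lemma isCont_chart: "c \<in> A ==> p \<in> fst c ==> isCont (snd c) p"
 using chart(1,3) continuous_on_eq_continuous_at by blast

lemma isCont_chart_inv: "c \<in> A ==> x \<in> snd c ` fst c ==> isCont (chart_inv c) x"
 using chart(2,4) continuous_on_eq_continuous_at by blast

abbreviation "F c \<equiv> vfield_in f c"

lemma F_chart: "c \<in> A ==> p \<in> fst c ==> F c (snd c p) = f c p"
 by (simp add: vfield_in_def chart(5))

lemma F_C1: "c \<in> A ==> Ck (Suc 0) (snd c ` fst c) (F c)"
 using f unfolding smooth_vfields_def smooth_def by blast

lemma transition_smooth: "c \<in> A ==> c' \<in> A ==> Ck k (snd c ` (fst c \<inter> fst c')) (snd c' \<circ> chart_inv c)"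
 using M unfolding compact_3manifold_def smooth_def by blast

lemma f_change: "c \<in> A ==> c' \<in> A ==> p \<in> fst c ==> p \<in> fst c' ==>
  f c' p = frechet_derivative (snd c' \<circ> chart_inv c) (at (snd c p)) (f c p)"
 using f unfolding smooth_vfields_def by blast

lemma transition_derivative:
 assumes "c \<in> A" "c' \<in> A" "p \<in> fst c" "p \<in> fst c'"
 shows "((snd c' \<circ> chart_inv c) has_derivative frechet_derivative (snd c' \<circ> chart_inv c) (at (snd c p))) (at (snd c p))"
 using transition_smooth[OF assms(1,2), of "Suc 0"] assms(3,4) frechet_derivative_works by auto

text \<open>The factor \<open>m\<close> allows for reparametrized solutions: in the coordinates near
  \<open>P\<close> the field is known only up to a positive factor.\<close>

definition icurve :: "(real => real) => real set => (real => 'm) => bool" where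
 "icurve m I \<gamma> \<longleftrightarrow> open I & continuous_on I \<gamma> &
   (\<forall>t\<in>I. \<forall>c\<in>A. \<gamma> t \<in> fst c --> ((%s. snd c (\<gamma> s)) has_vector_derivative m t *\<^sub>R f c (\<gamma> t)) (at t))"

lemma icurveD: "icurve m I \<gamma> ==> t \<in> I ==> isCont \<gamma> t"
 unfolding icurve_def using continuous_on_eq_continuous_at by blast

lemma icurve_deriv: "icurve m I \<gamma> ==> t \<in> I ==> c \<in> A ==> \<gamma> t \<in> fst c ==>
  ((%s. snd c (\<gamma> s)) has_vector_derivative m t *\<^sub>R f c (\<gamma> t)) (at t)"
 unfolding icurve_def by simp

lemma chart_change:
 assumes c: "c \<in> A" "c' \<in> A" "\<gamma> t \<in> fst c" "\<gamma> t \<in> fst c'" and cont: "isCont \<gamma> t"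
  and d: "((%s. snd c (\<gamma> s)) has_vector_derivative v) (at t)"
 shows "((%s. snd c' (\<gamma> s)) has_vector_derivative frechet_derivative (snd c' \<circ> chart_inv c) (at (snd c (\<gamma> t))) v) (at t)"
proof -
 let ?D = "frechet_derivative (snd c' \<circ> chart_inv c) (at (snd c (\<gamma> t)))"
 note tr = transition_derivative[OF c]
 have "((%s. (snd c' \<circ> chart_inv c) (snd c (\<gamma> s))) has_derivative (%h. ?D (h *\<^sub>R v))) (at t)"
  by (rule has_derivative_compose[where f = "%s. snd c (\<gamma> s)" and f' = "%h. h *\<^sub>R v" and g = "snd c' \<circ> chart_inv c"])
   (use d in \<open>simp add: has_vector_derivative_def\<close>, rule tr)
 then have 1: "((%s. (snd c' \<circ> chart_inv c) (snd c (\<gamma> s))) has_derivative (%h. h *\<^sub>R ?D v)) (at t)"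
  by (simp add: linear_scale[OF has_derivative_linear[OF tr]])
 have "(\<gamma> \<longlongrightarrow> \<gamma> t) (nhds t)" using cont by (simp add: isCont_def tendsto_nhds_iff)
 then have "\<forall>\<^sub>F s in nhds t. \<gamma> s \<in> fst c" by (rule topological_tendstoD[OF _ chart(1)[OF c(1)] c(3)])
 then have 2: "\<forall>\<^sub>F s in nhds t. (snd c' \<circ> chart_inv c) (snd c (\<gamma> s)) = snd c' (\<gamma> s)"
  by eventually_elim (simp add: chart(5)[OF c(1)])
 show ?thesis unfolding has_vector_derivative_def
  by (rule has_derivative_transform_eventually[OF 1])
   (use 2 eventually_nhds_x_imp_x[OF 2] in \<open>auto simp: eventually_at_filter elim: eventually_mono\<close>)
qed

text \<open>By the transformation rule of the components it is enough to check the differential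
  equation in one chart.\<close>

lemma icurve_point_chart:
 assumes c: "c \<in> A" "\<gamma> t \<in> fst c" and cont: "isCont \<gamma> t"
  and d: "((%s. snd c (\<gamma> s)) has_vector_derivative k *\<^sub>R f c (\<gamma> t)) (at t)"
  and c': "c' \<in> A" "\<gamma> t \<in> fst c'"
 shows "((%s. snd c' (\<gamma> s)) has_vector_derivative k *\<^sub>R f c' (\<gamma> t)) (at t)"
 using chart_change[OF c(1) c'(1) c(2) c'(2) cont d] f_change[OF c(1) c'(1) c(2) c'(2)]
  linear_scale[OF has_derivative_linear[OF transition_derivative[OF c(1) c'(1) c(2) c'(2)]]]
 by simp

lemma icurve_chartI:
 assumes I: "open I" and c: "c \<in> A" and u: "!!t. t \<in> I ==> u t \<in> snd c ` fst c"
  "!!t. t \<in> I ==> (u has_vector_derivative m t *\<^sub>R F c (u t)) (at t)"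
 shows "icurve m I (%t. chart_inv c (u t))"
 unfolding icurve_def
proof (intro conjI ballI impI)
 have cu: "isCont u t" if "t \<in> I" for t using has_vector_derivative_continuous[OF u(2)[OF that]] .
 have ci: "isCont (%t. chart_inv c (u t)) t" if "t \<in> I" for t
  by (rule isCont_o2[OF cu[OF that] isCont_chart_inv[OF c u(1)[OF that]]])
 then show "continuous_on I (%t. chart_inv c (u t))" by (simp add: continuous_at_imp_continuous_on)
 fix t c' assume t: "t \<in> I" and c': "c' \<in> A" "chart_inv c (u t) \<in> fst c'"
 note V = u(1)[OF t]
 have in_c: "chart_inv c (u t) \<in> fst c" by (rule chart(7)[OF c V])
 have e: "f c (chart_inv c (u t)) = F c (u t)" by (simp add: vfield_in_def)
 have "((%s. snd c (chart_inv c (u s))) has_vector_derivative m t *\<^sub>R f c (chart_inv c (u t))) (at t)"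
  unfolding e by (rule has_vector_derivative_transform_within_open[OF u(2)[OF t] I t]) (use chart(6)[OF c] u(1) in auto)
 then show "((%s. snd c' (chart_inv c (u s))) has_vector_derivative m t *\<^sub>R f c' (chart_inv c (u t))) (at t)"
  by (rule icurve_point_chart[where \<gamma> = "%s. chart_inv c (u s)", OF c in_c ci[OF t] _ c'])
qed (rule I)

lemma local_data:
 assumes c: "c \<in> A" "p \<in> fst c"
 obtains r K B h where "0 < r" "0 < K" "0 < B" "0 < h" "8*K*h <= 1" "B*h <= r" "cball (snd c p) (2*r) \<subseteq> snd c ` fst c"
  "!!x y. x \<in> cball (snd c p) (2*r) ==> y \<in> cball (snd c p) (2*r) ==> norm (F c x - F c y) <= K*norm (x - y)"
  "!!x. x \<in> cball (snd c p) (2*r) ==> norm (F c x) <= B"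
proof -
 let ?x = "snd c p"
 have xV: "?x \<in> snd c ` fst c" using c by blast
 obtain d where d: "0 < d" "ball ?x d \<subseteq> snd c ` fst c"
  "!!u v. u \<in> ball ?x d ==> v \<in> ball ?x d ==> norm (F c u - F c v - frechet_derivative (F c) (at ?x) (u - v)) <= 1*norm (u - v)"
  using Ck_strict[OF F_C1[OF c(1)] chart(2)[OF c(1)] xV zero_less_one] by metis
 let ?D = "frechet_derivative (F c) (at ?x)"
 have "(F c has_derivative ?D) (at ?x)"
  using F_C1[OF c(1)] xV unfolding Ck.simps by (intro frechet_derivative_works[THEN iffD1]) blast
 then obtain L where L: "0 < L" "!!v. norm (?D v) <= norm v * L"
  using bounded_linear.pos_bounded[OF has_derivative_bounded_linear] by blast
 define K where "K = 1 + L"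
 have K: "0 < K" using L(1) by (simp add: K_def)
 have lip: "norm (F c u - F c v) <= K*norm (u - v)" if uv: "u \<in> ball ?x d" "v \<in> ball ?x d" for u v
  using d(3)[OF uv] L(2)[of "u - v"] norm_triangle_ineq2[of "F c u - F c v" "?D (u - v)"]
  by (simp add: K_def algebra_simps)
 define r where "r = d/4"
 have r: "0 < r" "cball ?x (2*r) \<subseteq> ball ?x d" using d(1) by (auto simp: r_def)
 define B where "B = norm (F c ?x) + K*d + 1"
 have B: "0 < B" using K d(1) by (simp add: B_def add_nonneg_pos)
 have bnd: "norm (F c u) <= B" if "u \<in> cball ?x (2*r)" for u
 proof -
  have u: "u \<in> ball ?x d" using that r by blast
  have "norm (F c u - F c ?x) <= K*norm (u - ?x)" by (rule lip[OF u]) (use d(1) in simp)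
  also have "... <= K*d" using u K by (intro mult_left_mono) (auto simp: dist_norm norm_minus_commute)
  finally show ?thesis using norm_triangle_ineq2[of "F c u" "F c ?x"] by (simp add: B_def)
 qed
 define h where "h = min (1/(8*K)) (r/B)"
 have h: "0 < h" "h <= 1/(8*K)" "h <= r/B" using K B r(1) by (auto simp: h_def)
 show ?thesis
 proof (rule that[OF r(1) K B h(1)])
  show "8*K*h <= 1" using h(2) K by (simp add: field_simps)
  show "B*h <= r" using h(3) B by (simp add: field_simps)
  show "cball ?x (2*r) \<subseteq> snd c ` fst c" using r(2) d(2) by blast
  show "norm (F c x - F c y) <= K*norm (x - y)" if "x \<in> cball ?x (2*r)" "y \<in> cball ?x (2*r)" for x y
   using lip that r(2) by blast
 qed (rule bnd)
qed

text \<open>Gronwall in a chart: for a short time the difference is at most twice its value at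
  \<open>t1\<close>, which is 0.\<close>

lemma icurve_unique_local:
 assumes g: "icurve m I \<gamma>" "icurve m I \<gamma>'" and m: "continuous_on I m" and t: "t1 \<in> I" "\<gamma> t1 = \<gamma>' t1"
 shows "\<forall>\<^sub>F t in nhds t1. t \<in> I & \<gamma> t = \<gamma>' t"
proof -
 obtain c where c: "c \<in> A" "\<gamma> t1 \<in> fst c" using covered by blast
 obtain r K where r: "0 < r" "0 < K" "cball (snd c (\<gamma> t1)) (2*r) \<subseteq> snd c ` fst c"
  "!!x y. x \<in> cball (snd c (\<gamma> t1)) (2*r) ==> y \<in> cball (snd c (\<gamma> t1)) (2*r) ==> norm (F c x - F c y) <= K*norm (x - y)"
  using local_data[OF c] by metis
 let ?x0 = "snd c (\<gamma> t1)"
 have I: "open I" using g(1) by (simp add: icurve_def)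
 have near: "\<forall>\<^sub>F t in nhds t1. \<alpha> t \<in> fst c & snd c (\<alpha> t) \<in> cball ?x0 (2*r)" if "isCont \<alpha> t1" "\<alpha> t1 = \<gamma> t1" for \<alpha>
 proof -
  have 1: "(\<alpha> \<longlongrightarrow> \<gamma> t1) (nhds t1)" using that by (simp add: isCont_def tendsto_nhds_iff)
  have 2: "((%t. snd c (\<alpha> t)) \<longlongrightarrow> ?x0) (nhds t1)"
   by (rule isCont_tendsto_compose[OF isCont_chart[OF c] 1])
  have "\<forall>\<^sub>F t in nhds t1. \<alpha> t \<in> fst c" by (rule topological_tendstoD[OF 1 chart(1)[OF c(1)] c(2)])
  moreover have "\<forall>\<^sub>F t in nhds t1. snd c (\<alpha> t) \<in> ball ?x0 (2*r)"
   by (rule topological_tendstoD[OF 2 open_ball]) (use r(1) in simp)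
  ultimately show ?thesis by eventually_elim auto
 qed
 have "isCont m t1" using m I t(1) continuous_on_eq_continuous_at by blast
 then have "((%t. abs (m t)) \<longlongrightarrow> (abs (m t1))) (nhds t1)" by (intro tendsto_rabs) (simp add: isCont_def tendsto_nhds_iff)
 then have "\<forall>\<^sub>F t in nhds t1. abs (m t) < abs (m t1) + 1" by (rule order_tendstoD) simp
 moreover have "\<forall>\<^sub>F t in nhds t1. t \<in> I" by (rule eventually_nhds_in_open[OF I t(1)])
 ultimately have "\<forall>\<^sub>F t in nhds t1. t \<in> I & abs (m t) < abs (m t1) + 1 & (\<gamma> t \<in> fst c & snd c (\<gamma> t) \<in> cball ?x0 (2*r)) &
   (\<gamma>' t \<in> fst c & snd c (\<gamma>' t) \<in> cball ?x0 (2*r))"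
  using near[OF icurveD[OF g(1) t(1)] refl] near[OF icurveD[OF g(2) t(1)] t(2)[symmetric]]
  by eventually_elim blast
 then obtain e where e: "0 < e" "!!t. abs (t - t1) < e ==> t \<in> I & abs (m t) < abs (m t1) + 1 & (\<gamma> t \<in> fst c & snd c (\<gamma> t) \<in> cball ?x0 (2*r)) &
   (\<gamma>' t \<in> fst c & snd c (\<gamma>' t) \<in> cball ?x0 (2*r))"
  unfolding eventually_nhds_metric dist_real_def by blast
 define L where "L = (abs (m t1) + 1)*K"
 have L: "0 < L" using r(2) by (simp add: L_def)
 define h where "h = min (e/2) (1/(2*L))"
 have h: "0 < h" "h < e" "L*h <= 1/2"
 proof -
  have "h <= 1/(2*L)" by (simp add: h_def)
  then show "L*h <= 1/2" using L by (simp add: field_simps)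
 qed (use e(1) L in \<open>auto simp: h_def\<close>)
 have "\<gamma> t = \<gamma>' t" if t': "t \<in> {t1 - h..t1 + h}" for t
 proof -
  have in_e: "abs (s - t1) < e" if "s \<in> {t1 - h..t1 + h}" for s using that h(2) by auto
  have "norm (snd c (\<gamma> t) - snd c (\<gamma>' t)) <= 2*norm (snd c (\<gamma> t1) - snd c (\<gamma>' t1))"
  proof (rule gronwall_short[where J = "{t1 - h..t1 + h}" and h = h and L = L and S = "4*r"
     and d = "%t. snd c (\<gamma> t) - snd c (\<gamma>' t)" and d' = "%t. m t *\<^sub>R f c (\<gamma> t) - m t *\<^sub>R f c (\<gamma>' t)"])
   fix s assume s: "s \<in> {t1 - h..t1 + h}"
   have es: "s \<in> I" "abs (m s) <= abs (m t1) + 1" "\<gamma> s \<in> fst c" "\<gamma>' s \<in> fst c"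
     "snd c (\<gamma> s) \<in> cball ?x0 (2*r)" "snd c (\<gamma>' s) \<in> cball ?x0 (2*r)"
    using e(2)[OF in_e[OF s]] by simp_all
   have 1: "((%t. snd c (\<gamma> t)) has_vector_derivative m s *\<^sub>R f c (\<gamma> s)) (at s)"
     "((%t. snd c (\<gamma>' t)) has_vector_derivative m s *\<^sub>R f c (\<gamma>' s)) (at s)"
    by (rule icurve_deriv[OF g(1) es(1) c(1) es(3)] icurve_deriv[OF g(2) es(1) c(1) es(4)])+
   show "((%t. snd c (\<gamma> t) - snd c (\<gamma>' t)) has_vector_derivative m s *\<^sub>R f c (\<gamma> s) - m s *\<^sub>R f c (\<gamma>' s)) (at s within {t1 - h..t1 + h})"
    by (rule has_vector_derivative_at_within[OF has_vector_derivative_diff[OF 1]])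
   have "m s *\<^sub>R f c (\<gamma> s) - m s *\<^sub>R f c (\<gamma>' s) = m s *\<^sub>R (F c (snd c (\<gamma> s)) - F c (snd c (\<gamma>' s)))"
    by (simp add: F_chart[OF c(1) es(3)] F_chart[OF c(1) es(4)] scaleR_diff_right)
   then have "norm (m s *\<^sub>R f c (\<gamma> s) - m s *\<^sub>R f c (\<gamma>' s)) = abs (m s)*norm (F c (snd c (\<gamma> s)) - F c (snd c (\<gamma>' s)))" by simp
   also have "... <= (abs (m t1) + 1)*(K*norm (snd c (\<gamma> s) - snd c (\<gamma>' s)))"
    using es(2) r(2) by (intro mult_mono r(4) es(5,6)) simp_all
   finally show "norm (m s *\<^sub>R f c (\<gamma> s) - m s *\<^sub>R f c (\<gamma>' s)) <= L*norm (snd c (\<gamma> s) - snd c (\<gamma>' s))" by (simp add: L_def mult.assoc)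
   have "dist (snd c (\<gamma> s)) (snd c (\<gamma>' s)) <= 2*r + 2*r"
    using es(5,6) by (intro order_trans[OF dist_triangle2[of _ _ ?x0]] add_mono) (simp_all add: dist_commute)
   then show "norm (snd c (\<gamma> s) - snd c (\<gamma>' s)) <= 4*r" by (simp add: dist_norm)
   show "abs (s - t1) <= h" using s by auto
  qed (use h L t' in auto)
  then have "snd c (\<gamma> t) = snd c (\<gamma>' t)" using t(2) by simp
  then show ?thesis using chart(5)[OF c(1)] e(2)[OF in_e[OF t']] by metis
 qed
 moreover have "\<forall>\<^sub>F t in nhds t1. t \<in> {t1 - h<..<t1 + h}" using h(1) by (intro eventually_nhds_in_open) auto
 then have "\<forall>\<^sub>F t in nhds t1. t \<in> {t1 - h..t1 + h}" by eventually_elim auto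
 moreover have "\<forall>\<^sub>F t in nhds t1. t \<in> I" by (rule eventually_nhds_in_open[OF I t(1)])
 ultimately show ?thesis by (auto elim: eventually_elim2)
qed

text \<open>The set of coincidence is open by the local statement and closed because the manifold is
  Hausdorff.\<close>

lemma icurve_unique:
 assumes g: "icurve m I \<gamma>" "icurve m I \<gamma>'" and m: "continuous_on I m" and I: "connected I"
  and t1: "b \<in> I" "\<gamma> b = \<gamma>' b" and t: "t \<in> I"
 shows "\<gamma> t = \<gamma>' t"
proof -
 define S where "S = {t \<in> I. \<gamma> t = \<gamma>' t}"
 have oI: "open I" using g(1) by (simp add: icurve_def)
 have "open S"
 proof (rule topological_space_class.openI)
  fix x assume "x \<in> S"
  then have "\<forall>\<^sub>F t in nhds x. t \<in> S" using icurve_unique_local[OF g m, of x] by (simp add: S_def)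
  then show "\<exists>T. open T & x \<in> T & T \<subseteq> S" unfolding eventually_nhds by blast
 qed
 moreover have "open (I - S)"
 proof (rule topological_space_class.openI)
  fix x assume x: "x \<in> I - S"
  then obtain U V where UV: "open U" "open V" "\<gamma> x \<in> U" "\<gamma>' x \<in> V" "U \<inter> V = {}"
   using hausdorff[of "\<gamma> x" "\<gamma>' x"] by (auto simp: S_def)
  have "open (I \<inter> \<gamma> -` U)" "open (I \<inter> \<gamma>' -` V)"
   using g UV(1,2) unfolding icurve_def by (auto intro: continuous_open_preimage)
  then have "open ((I \<inter> \<gamma> -` U) \<inter> (I \<inter> \<gamma>' -` V))" by (rule open_Int)
  moreover have "(I \<inter> \<gamma> -` U) \<inter> (I \<inter> \<gamma>' -` V) \<subseteq> I - S" using UV(5) by (auto simp: S_def)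
  ultimately show "\<exists>T. open T & x \<in> T & T \<subseteq> I - S" using x UV(3,4) by (intro exI conjI) auto
 qed
 ultimately have "S \<inter> I = {} \<or> (I - S) \<inter> I = {}"
  by (intro connectedD[OF I]) (auto simp: S_def)
 then show ?thesis using t1 t by (auto simp: S_def)
qed

lemma icurve_cong: "icurve m I \<gamma> ==> (!!t. t \<in> J ==> \<gamma>' t = \<gamma> t) ==> open J ==> J \<subseteq> I ==> icurve m J \<gamma>'"
proof -
 assume g: "icurve m I \<gamma>" and e: "!!t. t \<in> J ==> \<gamma>' t = \<gamma> t" and J: "open J" "J \<subseteq> I"
 show ?thesis unfolding icurve_def
 proof (intro conjI ballI impI)
  have "continuous_on J \<gamma>" using g J(2) unfolding icurve_def by (auto intro: continuous_on_subset)
  then show "continuous_on J \<gamma>'" using e by (simp cong: continuous_on_cong)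
  fix t c assume t: "t \<in> J" "c \<in> A" "\<gamma>' t \<in> fst c"
  then have "((%s. snd c (\<gamma> s)) has_vector_derivative m t *\<^sub>R f c (\<gamma> t)) (at t)"
   using g J(2) e[OF t(1)] unfolding icurve_def by auto
  then have "((%s. snd c (\<gamma>' s)) has_vector_derivative m t *\<^sub>R f c (\<gamma> t)) (at t)"
   by (rule has_vector_derivative_transform_within_open[OF _ J(1) t(1)]) (use e in auto)
  then show "((%s. snd c (\<gamma>' s)) has_vector_derivative m t *\<^sub>R f c (\<gamma>' t)) (at t)" using e[OF t(1)] by simp
 qed (rule J(1))
qed

lemma icurve_Union: "(!!i. i \<in> N ==> icurve m (I i) \<gamma>) ==> icurve m (\<Union>i\<in>N. I i) \<gamma>"
 unfolding icurve_def by (auto intro!: continuous_on_open_UN)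

lemma icurve_shift:
 assumes "icurve m I \<gamma>"
 shows "icurve (%t. m (t + a)) ((%t. t - a) ` I) (%t. \<gamma> (t + a))"
proof -
 have I: "open I" using assms by (simp add: icurve_def)
 have e: "(%t. t - a) ` I = {t. t + a \<in> I}" by (auto simp: image_iff) (metis add_diff_cancel_right')
 have "open ((%t. t + a) -` I)" by (rule open_vimage[OF I]) (intro continuous_intros)
 then have o: "open {t. t + a \<in> I}" by (simp add: vimage_def)
 show ?thesis unfolding e icurve_def
 proof (intro conjI ballI impI)
  have "continuous_on I \<gamma>" using assms by (simp add: icurve_def)
  then show "continuous_on {t. t + a \<in> I} (%t. \<gamma> (t + a))"
   by (rule continuous_on_compose2) (auto intro!: continuous_intros)
  fix t c assume t: "t \<in> {t. t + a \<in> I}" "c \<in> A" "\<gamma> (t + a) \<in> fst c"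
  then have d: "((%s. snd c (\<gamma> s)) has_vector_derivative m (t + a) *\<^sub>R f c (\<gamma> (t + a))) (at (t + a))"
   using assms unfolding icurve_def by auto
  have "((%s. s + a) has_vector_derivative 1) (at t)" by (auto intro!: derivative_eq_intros)
  then show "((%s. snd c (\<gamma> (s + a))) has_vector_derivative m (t + a) *\<^sub>R f c (\<gamma> (t + a))) (at t)"
   using vector_diff_chain_at[of "%s. s + a" 1 t "%s. snd c (\<gamma> s)"] d by (simp add: o_def)
 qed (rule o)
qed

definition sol :: "real => 'm => (real => 'm) => bool" where
 "sol a p \<gamma> \<longleftrightarrow> icurve (%_. 1) {-a<..<a} \<gamma> & \<gamma> 0 = p"

lemma sol_restrict: "sol a p \<gamma> ==> b <= a ==> sol b p \<gamma>"
 unfolding sol_def by (auto elim!: icurve_cong)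

lemma sol_unique: "sol a p \<gamma> ==> sol b p \<gamma>' ==> abs t < a ==> abs t < b ==> \<gamma> t = \<gamma>' t"
proof -
 assume s: "sol a p \<gamma>" "sol b p \<gamma>'" and t: "abs t < a" "abs t < b"
 let ?e = "min a b"
 have i: "icurve (%_. 1) {-?e<..<?e} \<gamma>" "icurve (%_. 1) {-?e<..<?e} \<gamma>'"
  using sol_restrict[OF s(1), of ?e] sol_restrict[OF s(2), of ?e] by (auto simp: sol_def)
 show ?thesis
  by (rule icurve_unique[OF i, where b = 0]) (use s t in \<open>auto simp: sol_def\<close>)
qed

lemma local_sol_chart:
 assumes c: "c \<in> A" and r: "0 < r" "0 < K" "0 < B" "0 < h" "8*K*h <= 1" "B*h <= r" "cball x0 (2*r) \<subseteq> snd c ` fst c"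
  "!!x y. x \<in> cball x0 (2*r) ==> y \<in> cball x0 (2*r) ==> norm (F c x - F c y) <= K*norm (x - y)"
  "!!x. x \<in> cball x0 (2*r) ==> norm (F c x) <= B"
  and x: "snd c p \<in> cball x0 r" "p \<in> fst c"
 shows "\<exists>\<gamma>. sol h p \<gamma> & (\<forall>t\<in>{-h<..<h}. \<gamma> t \<in> fst c & snd c (\<gamma> t) \<in> cball x0 (2*r))"
proof -
 obtain u where u: "u 0 = snd c p" "!!t. t \<in> {-h..h} ==> u t \<in> cball x0 (2*r) & (u has_vector_derivative F c (u t)) (at t within {-h..h})"
  using local_solution[OF r(1,2,8,3,9,4,5,6) x(1)] by blast
 have V: "u t \<in> snd c ` fst c" if "t \<in> {-h<..<h}" for t using u(2)[of t] r(7) that by auto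
 have "icurve (%_. 1) {-h<..<h} (%t. chart_inv c (u t))"
 proof (rule icurve_chartI[OF open_greaterThanLessThan c V])
  fix t assume t: "t \<in> {-h<..<h}"
  have "at t within {-h..h} = at t" using t by (intro at_within_interior) simp
  then show "(u has_vector_derivative 1 *\<^sub>R F c (u t)) (at t)" using u(2)[of t] t by simp
 qed
 then have "sol h p (%t. chart_inv c (u t))" unfolding sol_def using u(1) chart(5)[OF c x(2)] by simp
 then show ?thesis
  using chart(7)[OF c V] chart(6)[OF c V] u(2)
  by (intro exI[of _ "%t. chart_inv c (u t)"]) simp
qed

text \<open>Finitely many neighbourhoods cover the compact manifold, and the smallest of their times
  works everywhere. Both existence and regularity of the flow use it.\<close>

lemma uniform_time:
 assumes "!!p0. \<exists>U h. open U & p0 \<in> U & 0 < h & (\<forall>p\<in>U. \<forall>t. abs t < h --> Q t p)"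
 shows "\<exists>h>0. \<forall>p. \<forall>t::real. abs t < h --> Q t (p :: 'm)"
proof -
 have "\<forall>p. \<exists>Uh. open (fst Uh) & p \<in> fst Uh & 0 < snd Uh & (\<forall>q\<in>fst Uh. \<forall>t. abs t < snd Uh --> Q t q)"
  using assms by (metis fst_conv snd_conv)
 then obtain G where G: "!!p. open (fst (G p))" "!!p. p \<in> fst (G p)" "!!p. 0 < snd (G p)"
   "!!p q t. q \<in> fst (G p) ==> abs t < snd (G p) ==> Q t q"
  by metis
 have comp: "compact (UNIV :: 'm set)" using M by (simp add: compact_3manifold_def)
 obtain P where P: "finite P" "UNIV \<subseteq> (\<Union>p\<in>P. fst (G p))"
 proof (rule compactE_image[OF comp, of UNIV "%p. fst (G p)"])
  show "UNIV \<subseteq> (\<Union>p\<in>UNIV. fst (G p))" using G(2) by auto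
 qed (use G(1) in auto)
 define h where "h = Min (insert 1 ((%p. snd (G p)) ` P))"
 have h: "0 < h" "!!p. p \<in> P ==> h <= snd (G p)" using P(1) G(3) by (auto simp: h_def)
 have "Q t q" if "abs t < h" for q t
 proof -
  obtain p where "p \<in> P" "q \<in> fst (G p)" using P(2) by blast
  then show ?thesis using G(4)[of q p t] h(2)[of p] that by simp
 qed
 then show ?thesis using h(1) by blast
qed

lemma uniform_sol: "\<exists>h>0. \<forall>p. \<exists>\<gamma>. sol h p \<gamma>"
proof -
 \<comment> \<open>The half length of the interval of existence takes the place of the time in
   \<open>uniform_time\<close>; for a negative value the interval is empty.\<close>
 have "\<exists>h>0. \<forall>p t. abs t < h --> (\<exists>\<gamma>. sol t p \<gamma>)"
 proof (rule uniform_time)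
  fix p0
  obtain c where c: "c \<in> A" "p0 \<in> fst c" using covered by blast
  obtain r K B h where r: "0 < r" "0 < K" "0 < B" "0 < h" "8*K*h <= 1" "B*h <= r" "cball (snd c p0) (2*r) \<subseteq> snd c ` fst c"
   "!!x y. x \<in> cball (snd c p0) (2*r) ==> y \<in> cball (snd c p0) (2*r) ==> norm (F c x - F c y) <= K*norm (x - y)"
   "!!x. x \<in> cball (snd c p0) (2*r) ==> norm (F c x) <= B" using local_data[OF c] by metis
  define U where "U = fst c \<inter> snd c -` ball (snd c p0) r"
  have "\<exists>\<gamma>. sol t p \<gamma>" if p: "p \<in> U" "abs t < h" for p t
  proof -
   have "snd c p \<in> cball (snd c p0) r" "p \<in> fst c" using p(1) by (auto simp: U_def)
   then obtain \<gamma> where "sol h p \<gamma>" using local_sol_chart[OF c(1) r] by blast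
   then show ?thesis using sol_restrict[of h p \<gamma> t] p(2) abs_le_D1[of t h] by (intro exI[of _ \<gamma>]) simp
  qed
  moreover have "open U" unfolding U_def by (rule continuous_open_preimage[OF chart(3,1)[OF c(1)] open_ball])
  moreover have "p0 \<in> U" using c r(1) by (simp add: U_def)
  ultimately show "\<exists>U h. open U & p0 \<in> U & 0 < h & (\<forall>p\<in>U. \<forall>t. abs t < h --> (\<exists>\<gamma>. sol t p \<gamma>))" using r(4) by blast
 qed
 then obtain h where "0 < h" "!!p t. abs t < h ==> \<exists>\<gamma>. sol t p \<gamma>" by blast
 then show ?thesis by (intro exI[of _ "h/2"]) simp
qed

text \<open>Two further solutions, started from the points at times \<open>2/3*a\<close> and
  \<open>- (2/3*a)\<close>, reach beyond the given one. All three are glued on overlapping open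
  intervals, where uniqueness makes them agree.\<close>

lemma sol_extend:
 assumes a: "0 < a" and ex: "!!p. \<exists>\<gamma>. sol a p \<gamma>"
 shows "\<exists>\<gamma>. sol (3/2*a) p \<gamma>"
proof -
 obtain \<gamma> where g: "sol a p \<gamma>" using ex by blast
 let ?b = "2/3*a"
 obtain \<alpha> where al: "sol a (\<gamma> ?b) \<alpha>" using ex by blast
 obtain \<beta> where be: "sol a (\<gamma> (- ?b)) \<beta>" using ex by blast
 have sh: "icurve (%_. 1) {a' - a<..<a' + a} (%t. \<delta> (t - a'))" if "sol a q \<delta>" for q \<delta> a'
 proof -
  have "(%t. t - - a') ` {-a<..<a} = {a' - a<..<a' + a}"
   by (auto simp: image_iff) (metis add.commute add_diff_cancel_left' diff_add_cancel greaterThanLessThan_iff less_diff_eq diff_less_eq minus_less_iff uminus_add_conv_diff)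
  then show ?thesis using icurve_shift[of "%_. 1" "{-a<..<a}" \<delta> "- a'"] that by (simp add: sol_def)
 qed
 have e1: "\<gamma> t = \<alpha> (t - ?b)" if "t \<in> {- (a/3)<..<a}" for t
 proof (rule icurve_unique[where m = "%_. 1" and I = "{- (a/3)<..<a}" and b = ?b and \<gamma> = \<gamma> and \<gamma>' = "%t. \<alpha> (t - ?b)"])
  show "icurve (%_. 1) {- (a/3)<..<a} \<gamma>" using g a unfolding sol_def by (auto elim!: icurve_cong)
  show "icurve (%_. 1) {- (a/3)<..<a} (%t. \<alpha> (t - ?b))" by (rule icurve_cong[where \<gamma> = "%t. \<alpha> (t - ?b)", OF sh[OF al, of ?b]]) (use a in auto)
 qed (use a al that in \<open>auto simp: sol_def\<close>)
 have e2: "\<gamma> t = \<beta> (t - - ?b)" if "t \<in> {-a<..<a/3}" for t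
 proof (rule icurve_unique[where m = "%_. 1" and I = "{-a<..<a/3}" and b = "- ?b" and \<gamma> = \<gamma> and \<gamma>' = "%t. \<beta> (t - - ?b)"])
  show "icurve (%_. 1) {-a<..<a/3} \<gamma>" using g a unfolding sol_def by (auto elim!: icurve_cong)
  show "icurve (%_. 1) {-a<..<a/3} (%t. \<beta> (t - - ?b))" by (rule icurve_cong[where \<gamma> = "%t. \<beta> (t - - ?b)", OF sh[OF be, of "- ?b"]]) (use a in auto)
 qed (use a be that in \<open>auto simp: sol_def\<close>)
 define \<zeta> where "\<zeta> t = (if t > a/2 then \<alpha> (t - ?b) else if t < - (a/2) then \<beta> (t - - ?b) else \<gamma> t)" for t
 have z0: "\<zeta> t = \<gamma> t" if "t \<in> {-a<..<a}" for t using e1[of t] e2[of t] that a by (auto simp: \<zeta>_def)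
 have z1: "\<zeta> t = \<alpha> (t - ?b)" if "t \<in> {- (a/3)<..<3/2*a}" for t using e1[of t] that a by (auto simp: \<zeta>_def)
 have z2: "\<zeta> t = \<beta> (t - - ?b)" if "t \<in> {-(3/2*a)<..<a/3}" for t using e2[of t] that a by (auto simp: \<zeta>_def)
 have c0: "icurve (%_. 1) {-a<..<a} \<zeta>" by (rule icurve_cong[where \<gamma> = \<gamma> and I = "{-a<..<a}"]) (use g z0 in \<open>auto simp: sol_def\<close>)
 have c1: "icurve (%_. 1) {- (a/3)<..<3/2*a} \<zeta>" by (rule icurve_cong[where \<gamma> = "%t. \<alpha> (t - ?b)", OF sh[OF al, of ?b] z1]) (use a in auto)
 have c2: "icurve (%_. 1) {-(3/2*a)<..<a/3} \<zeta>" by (rule icurve_cong[where \<gamma> = "%t. \<beta> (t - - ?b)", OF sh[OF be, of "- ?b"] z2]) (use a in auto)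
 have "icurve (%_. 1) (\<Union>i\<in>{{-a<..<a}, {- (a/3)<..<3/2*a}, {-(3/2*a)<..<a/3}}. i) \<zeta>"
  by (rule icurve_Union) (use c0 c1 c2 in auto)
 then have "icurve (%_. 1) {- (3/2*a)<..<3/2*a} \<zeta>" by (rule icurve_cong[where \<gamma> = \<zeta>]) (use a in auto)
 then show ?thesis using z0[of 0] a g unfolding sol_def by (intro exI[of _ \<zeta>]) auto
qed

lemma global_sol: "\<exists>\<gamma>. icurve (%_. 1) UNIV \<gamma> & \<gamma> 0 = p"
proof -
 obtain h where h: "0 < h" "!!p. \<exists>\<gamma>. sol h p \<gamma>" using uniform_sol by blast
 define a where "a n = (3/2) ^ n*h" for n
 have a: "0 < a n" for n using h(1) by (simp add: a_def)
 have ex: "\<exists>\<gamma>. sol (a n) p \<gamma>" for n p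
 proof (induction n arbitrary: p)
  case 0 then show ?case using h(2) by (simp add: a_def)
 next
  case (Suc n)
  have "3/2*a n = a (Suc n)" by (simp add: a_def)
  then show ?case using sol_extend[OF a[of n] Suc, of p] by simp
 qed
 define \<gamma> where "\<gamma> n = (SOME \<gamma>. sol (a n) p \<gamma>)" for n
 have g: "sol (a n) p (\<gamma> n)" for n unfolding \<gamma>_def by (rule someI_ex[OF ex])
 have unb: "\<exists>n. abs t < a n" for t
 proof -
  obtain n where "abs t/h < (3/2) ^ n" using real_arch_pow[of "3/2" "abs t/h"] by auto
  then show ?thesis using h(1) by (auto simp: a_def field_simps)
 qed
 define N where "N t = (LEAST n. abs t < a n)" for t
 have N: "abs t < a (N t)" for t unfolding N_def by (rule LeastI_ex[OF unb])
 define \<zeta> where "\<zeta> t = \<gamma> (N t) t" for t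
 have z: "\<zeta> t = \<gamma> n t" if "abs t < a n" for n t
  unfolding \<zeta>_def by (rule sol_unique[OF g g N that])
 have "icurve (%_. 1) {- a n<..<a n} \<zeta>" for n
  by (rule icurve_cong[where I = "{- a n<..<a n}" and \<gamma> = "\<gamma> n"]) (use g[of n] z[of _ n] in \<open>auto simp: sol_def abs_less_iff\<close>)
 then have "icurve (%_. 1) (\<Union>n\<in>UNIV. {- a n<..<a n}) \<zeta>" by (intro icurve_Union)
 moreover have "(\<Union>n\<in>UNIV. {- a n<..<a n}) = UNIV" using unb by (auto simp: abs_less_iff) (metis minus_less_iff)
 moreover have "\<zeta> 0 = p" using z[of 0 0] a[of 0] g[of 0] by (simp add: sol_def)
 ultimately show ?thesis by auto
qed

abbreviation "\<phi> \<equiv> flow A f"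

text \<open>\<open>flow\<close> is a definite description, so it means something only once existence
  and uniqueness are both known.\<close>

lemma is_flow_flow: "is_flow A f \<phi>"
proof -
 have ic: "is_flow A f \<psi> \<longleftrightarrow> (\<forall>p. icurve (%_. 1) UNIV (%t. \<psi> t p) & \<psi> 0 p = p)" for \<psi>
  unfolding is_flow_def icurve_def by auto
 define G where "G p = (SOME \<gamma>. icurve (%_. 1) UNIV \<gamma> & \<gamma> 0 = p)" for p
 have G: "icurve (%_. 1) UNIV (G p) & G p 0 = p" for p unfolding G_def by (rule someI_ex[OF global_sol])
 have "is_flow A f (%t p. G p t)" unfolding ic using G by simp
 moreover have "\<psi> = (%t p. G p t)" if "is_flow A f \<psi>" for \<psi>
 proof (intro ext)
  fix t p
  show "\<psi> t p = G p t"
   by (rule icurve_unique[where I = UNIV and m = "%_. 1" and b = 0 and \<gamma> = "%t. \<psi> t p" and \<gamma>' = "G p"])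
    (use that G[of p] in \<open>simp_all add: ic\<close>)
 qed
 ultimately show ?thesis unfolding flow_def by (rule theI)
qed

lemma flow_0 [simp]: "\<phi> 0 p = p" and flow_curve: "icurve (%_. 1) UNIV (%t. \<phi> t p)"
 using is_flow_flow unfolding is_flow_def icurve_def by auto

text \<open>Both sides are integral curves with factor \<open>m\<close> and the same value at
  \<open>t0\<close>; uniqueness identifies them.\<close>

lemma flow_reparam:
 assumes g: "icurve m I \<gamma>" and I: "connected I" "t0 \<in> I" and m: "continuous_on I m"
  and T: "!!t. t \<in> I ==> (T has_real_derivative m t) (at t)" "T t0 = 0" and t: "t \<in> I"
 shows "\<phi> (T t) (\<gamma> t0) = \<gamma> t"
proof (rule icurve_unique[where \<gamma> = "%t. \<phi> (T t) (\<gamma> t0)", OF _ g m I(1,2) _ t])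
 show "icurve m I (%t. \<phi> (T t) (\<gamma> t0))" unfolding icurve_def
 proof (intro conjI ballI impI)
  show "open I" using g by (simp add: icurve_def)
  have cT: "continuous_on I T"
   using T(1) DERIV_isCont by (blast intro: continuous_at_imp_continuous_on)
  have cf: "continuous_on UNIV (%t. \<phi> t (\<gamma> t0))" using flow_curve by (simp add: icurve_def)
  show "continuous_on I (%t. \<phi> (T t) (\<gamma> t0))" by (rule continuous_on_compose2[OF cf cT]) auto
  fix t c assume t: "t \<in> I" "c \<in> A" "\<phi> (T t) (\<gamma> t0) \<in> fst c"
  then have "((%s. snd c (\<phi> s (\<gamma> t0))) has_vector_derivative f c (\<phi> (T t) (\<gamma> t0))) (at (T t))"
   using flow_curve[of "\<gamma> t0"] unfolding icurve_def by auto
  moreover have "(T has_vector_derivative m t) (at t)" using T(1)[OF t(1)] by (simp add: has_real_derivative_iff_has_vector_derivative)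
  ultimately show "((%s. snd c (\<phi> (T s) (\<gamma> t0))) has_vector_derivative m t *\<^sub>R f c (\<phi> (T t) (\<gamma> t0))) (at t)"
   using vector_diff_chain_at[of T "m t" t "%s. snd c (\<phi> s (\<gamma> t0))"] by (simp add: o_def)
 qed
 show "\<phi> (T t0) (\<gamma> t0) = \<gamma> t0" using T(2) by simp
qed

lemma flow_add: "\<phi> (s + t) p = \<phi> s (\<phi> t p)"
proof (rule icurve_unique[where I = UNIV and m = "%_. 1" and b = 0 and \<gamma> = "%s. \<phi> (s + t) p" and \<gamma>' = "%s. \<phi> s (\<phi> t p)"])
 show "icurve (%_. 1) UNIV (%s. \<phi> (s + t) p)" using icurve_shift[OF flow_curve, of t p] by simp
 show "icurve (%_. 1) UNIV (%s. \<phi> s (\<phi> t p))" by (rule flow_curve)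
qed auto

lemma flow_minus [simp]: "\<phi> (- t) (\<phi> t p) = p" "\<phi> t (\<phi> (- t) p) = p"
 using flow_add[of "- t" t p] flow_add[of t "- t" p] by auto

end

section \<open>Regularity of the flow in the initial point\<close>

context vector_field
begin

lemma flow_deriv: "c \<in> A ==> \<phi> t p \<in> fst c ==> ((%s. snd c (\<phi> s p)) has_vector_derivative f c (\<phi> t p)) (at t)"
 using icurve_deriv[OF flow_curve[of p], of t c] by simp

lemma isCont_flow_time: "isCont (%s. \<phi> s p) t"
 using icurveD[OF flow_curve] by simp

lemma flow_equilibrium:
 assumes "!!c. c \<in> A ==> p \<in> fst c ==> f c p = 0"
 shows "\<phi> t p = p"
proof (rule icurve_unique[where I = UNIV and m = "%_. 1" and b = 0 and \<gamma> = "%t. \<phi> t p" and \<gamma>' = "%_. p"])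
 show "icurve (%_. 1) UNIV (%_. p)" using assms by (auto simp: icurve_def)
qed (simp_all add: flow_curve)

text \<open>For a short time orbits near \<open>p0\<close> stay in one chart, where Gronwall
  applies; long times are reached later by composition.\<close>

lemma flow_box:
 obtains c U h B where "c \<in> A" "open U" "p0 \<in> U" "(0::real) < h" "(0::real) < B"
  "!!p t. p \<in> U ==> abs t < h ==> \<phi> t p \<in> fst c"
  "!!p q t. p \<in> U ==> q \<in> U ==> abs t < h ==> norm (snd c (\<phi> t p) - snd c (\<phi> t q)) <= 2*norm (snd c p - snd c q)"
  "!!p t. p \<in> U ==> abs t < h ==> norm (snd c (\<phi> t p) - snd c p) <= B*abs t"
proof -
 obtain c where c: "c \<in> A" "p0 \<in> fst c" using covered by blast
 let ?x0 = "snd c p0"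
 obtain r K B h where r: "0 < r" "0 < K" "0 < B" "0 < h" "8*K*h <= 1" "B*h <= r" "cball ?x0 (2*r) \<subseteq> snd c ` fst c"
  "!!x y. x \<in> cball ?x0 (2*r) ==> y \<in> cball ?x0 (2*r) ==> norm (F c x - F c y) <= K*norm (x - y)"
  "!!x. x \<in> cball ?x0 (2*r) ==> norm (F c x) <= B" using local_data[OF c] by metis
 define U where "U = fst c \<inter> snd c -` ball ?x0 r"
 let ?J = "{-h<..<h}"
 have inC: "\<phi> t p \<in> fst c" "snd c (\<phi> t p) \<in> cball ?x0 (2*r)" if p: "p \<in> U" and t: "t \<in> ?J" for p t
 proof -
  have "snd c p \<in> cball ?x0 r" "p \<in> fst c" using p by (auto simp: U_def)
  then obtain \<gamma> where g: "sol h p \<gamma>" "\<forall>t\<in>?J. \<gamma> t \<in> fst c & snd c (\<gamma> t) \<in> cball ?x0 (2*r)"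
   using local_sol_chart[OF c(1) r] by blast
  have "sol h p (%t. \<phi> t p)" unfolding sol_def using icurve_cong[OF flow_curve, of ?J "%t. \<phi> t p" p] by simp
  then have "\<gamma> t = \<phi> t p" using t by (intro sol_unique[OF g(1), where \<gamma>' = "%t. \<phi> t p"]) auto
  then show "\<phi> t p \<in> fst c" "snd c (\<phi> t p) \<in> cball ?x0 (2*r)" using bspec[OF g(2) t] by simp_all
 qed
 have der: "((%s. snd c (\<phi> s p)) has_vector_derivative F c (snd c (\<phi> t p))) (at t)" if "p \<in> U" "t \<in> ?J" for p t
  using flow_deriv[OF c(1) inC(1)[OF that]] F_chart[OF c(1) inC(1)[OF that]] by simp
 show ?thesis
 proof (rule that[OF c(1) _ _ r(4,3)])
  show "open U" unfolding U_def by (rule continuous_open_preimage[OF chart(3,1)[OF c(1)] open_ball])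
  show "p0 \<in> U" using c r(1) by (simp add: U_def)
  fix p t assume p: "p \<in> U" and t: "abs t < h"
  show "\<phi> t p \<in> fst c" by (rule inC[OF p]) (use t in auto)
  have "norm (snd c (\<phi> t p) - snd c (\<phi> 0 p)) <= B*norm (t - 0)"
  proof (rule differentiable_bound[of ?J])
   fix s assume s: "s \<in> ?J"
   show "((%s. snd c (\<phi> s p)) has_derivative (%v. v *\<^sub>R F c (snd c (\<phi> s p)))) (at s within ?J)"
    using has_vector_derivative_at_within[OF der[OF p s]] by (simp add: has_vector_derivative_def)
   show "onorm (%v. v *\<^sub>R F c (snd c (\<phi> s p))) <= B"
    using r(9)[OF inC(2)[OF p s]] by (intro onorm_le) (simp add: mult.commute[of B] mult_left_mono)
  qed (use t r(4) in auto)
  then show "norm (snd c (\<phi> t p) - snd c p) <= B*abs t" by simp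
 next
  fix p q t assume p: "p \<in> U" and q: "q \<in> U" and t: "abs t < h"
  have "norm (snd c (\<phi> t p) - snd c (\<phi> t q)) <= 2*norm (snd c (\<phi> 0 p) - snd c (\<phi> 0 q))"
  proof (rule gronwall_short[where J = ?J and h = h and L = K and S = "4*r"
     and d = "%t. snd c (\<phi> t p) - snd c (\<phi> t q)" and d' = "%t. F c (snd c (\<phi> t p)) - F c (snd c (\<phi> t q))"])
   show "K*h <= 1/2" using r(5) by simp
   fix s assume s: "s \<in> ?J"
   show "((%t. snd c (\<phi> t p) - snd c (\<phi> t q)) has_vector_derivative F c (snd c (\<phi> s p)) - F c (snd c (\<phi> s q))) (at s within ?J)"
    by (rule has_vector_derivative_at_within[OF has_vector_derivative_diff[OF der[OF p s] der[OF q s]]])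
   show "norm (F c (snd c (\<phi> s p)) - F c (snd c (\<phi> s q))) <= K*norm (snd c (\<phi> s p) - snd c (\<phi> s q))"
    by (rule r(8)[OF inC(2)[OF p s] inC(2)[OF q s]])
   have "dist (snd c (\<phi> s p)) (snd c (\<phi> s q)) <= 2*r + 2*r"
    using inC(2)[OF p s] inC(2)[OF q s] by (intro order_trans[OF dist_triangle2[of _ _ ?x0]] add_mono) (simp_all add: dist_commute)
   then show "norm (snd c (\<phi> s p) - snd c (\<phi> s q)) <= 4*r" by (simp add: dist_norm)
  qed (use t r in auto)
  then show "norm (snd c (\<phi> t p) - snd c (\<phi> t q)) <= 2*norm (snd c p - snd c q)" by simp
 qed
qed

lemma tendsto_chart:
 assumes c: "c \<in> A" "p \<in> fst c" and "\<forall>\<^sub>F x in G. g x \<in> fst c" and "((%x. snd c (g x)) \<longlongrightarrow> snd c p) G"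
 shows "(g \<longlongrightarrow> p) G"
proof -
 have "((%x. chart_inv c (snd c (g x))) \<longlongrightarrow> chart_inv c (snd c p)) G"
  by (rule isCont_tendsto_compose[OF isCont_chart_inv[OF c(1)] assms(4)]) (use c(2) in blast)
 then have "((%x. chart_inv c (snd c (g x))) \<longlongrightarrow> p) G" by (simp add: chart(5)[OF c])
 moreover have "\<forall>\<^sub>F x in G. chart_inv c (snd c (g x)) = g x"
  using assms(3) by eventually_elim (rule chart(5)[OF c(1)])
 ultimately show ?thesis by (rule Lim_transform_eventually)
qed

lemma chart_lipschitz:
 assumes c: "c \<in> A" "c' \<in> A" "p \<in> fst c" "p \<in> fst c'"
 shows "\<exists>K\<ge>0. \<forall>\<^sub>F q in nhds p. norm (snd c' q - snd c' p) <= K*norm (snd c q - snd c p)"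
proof -
 let ?t = "snd c' \<circ> chart_inv c" and ?D = "frechet_derivative (snd c' \<circ> chart_inv c) (at (snd c p))"
 note tr = transition_derivative[OF c]
 obtain d where d: "0 < d" "!!y. norm (y - snd c p) < d ==> norm (?t y - ?t (snd c p) - ?D (y - snd c p)) <= 1*norm (y - snd c p)"
  using tr unfolding has_derivative_at_alt by (meson zero_less_one)
 obtain L where L: "0 < L" "!!v. norm (?D v) <= norm v * L"
  using bounded_linear.pos_bounded[OF has_derivative_bounded_linear[OF tr]] by blast
 have 1: "(snd c \<longlongrightarrow> snd c p) (nhds p)" using isCont_chart[OF c(1,3)] by (simp add: isCont_def tendsto_nhds_iff)
 have "\<forall>\<^sub>F q in nhds p. dist (snd c q) (snd c p) < d" by (rule tendstoD[OF 1 d(1)])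
 moreover have "\<forall>\<^sub>F q in nhds p. q \<in> fst c" by (rule eventually_nhds_in_open[OF chart(1)[OF c(1)] c(3)])
 ultimately have "\<forall>\<^sub>F q in nhds p. norm (snd c' q - snd c' p) <= (1 + L)*norm (snd c q - snd c p)"
 proof eventually_elim
  case (elim q)
  have "norm (snd c' q - snd c' p - ?D (snd c q - snd c p)) <= 1*norm (snd c q - snd c p)"
   using d(2)[of "snd c q"] elim chart(5)[OF c(1)] c(3) by (simp add: dist_norm)
  then show ?case using L(2)[of "snd c q - snd c p"] norm_triangle_ineq2[of "snd c' q - snd c' p" "?D (snd c q - snd c p)"]
   by (simp add: algebra_simps)
 qed
 then show ?thesis using L(1) by (intro exI[of _ "1 + L"]) auto
qed

text \<open>A Lipschitz estimate at a single point. It composes, can be checked in one pair of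
  charts, and takes the place of differentiability of the flow in the proof that \<open>b11\<close>
  does not vanish.\<close>

definition plip :: "('m => 'm) => 'm => bool" where
 "plip g p \<longleftrightarrow> isCont g p & (\<forall>c\<in>A. \<forall>c'\<in>A. p \<in> fst c --> g p \<in> fst c' -->
   (\<exists>K\<ge>0. \<forall>\<^sub>F q in nhds p. norm (snd c' (g q) - snd c' (g p)) <= K*norm (snd c q - snd c p)))"

lemma plip_compose:
 assumes g: "plip g p" and k: "plip k (g p)"
 shows "plip (%q. k (g q)) p"
 unfolding plip_def
proof (intro conjI ballI impI)
 have "isCont g p" "isCont k (g p)" using g k by (simp_all add: plip_def)
 then show "isCont (%q. k (g q)) p" by (rule isCont_o2)
 fix c c' assume c: "c \<in> A" "c' \<in> A" "p \<in> fst c" "k (g p) \<in> fst c'"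
 obtain b where b: "b \<in> A" "g p \<in> fst b" using covered by blast
 obtain K where K: "0 <= K" "\<forall>\<^sub>F q in nhds p. norm (snd b (g q) - snd b (g p)) <= K*norm (snd c q - snd c p)"
  using g c(1,3) b unfolding plip_def by blast
 obtain L where L: "0 <= L" "\<forall>\<^sub>F q in nhds (g p). norm (snd c' (k q) - snd c' (k (g p))) <= L*norm (snd b q - snd b (g p))"
  using k c(2,4) b unfolding plip_def by blast
 have "(g \<longlongrightarrow> g p) (nhds p)" using g by (simp add: plip_def isCont_def tendsto_nhds_iff)
 then have "\<forall>\<^sub>F q in nhds p. norm (snd c' (k (g q)) - snd c' (k (g p))) <= L*norm (snd b (g q) - snd b (g p))"
  by (rule eventually_compose_filterlim[OF L(2)])
 with K(2) have "\<forall>\<^sub>F q in nhds p. norm (snd c' (k (g q)) - snd c' (k (g p))) <= L*K*norm (snd c q - snd c p)"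
 proof eventually_elim
  case (elim q)
  then show ?case using mult_left_mono[OF elim(1) L(1)] by (simp add: mult.assoc)
 qed
 then show "\<exists>K\<ge>0. \<forall>\<^sub>F q in nhds p. norm (snd c' (k (g q)) - snd c' (k (g p))) <= K*norm (snd c q - snd c p)"
  using K(1) L(1) by (intro exI[of _ "L*K"]) simp
qed

lemma plip_chartI:
 assumes b: "b \<in> A" "p \<in> fst b" "b' \<in> A" "g p \<in> fst b'" and cont: "isCont g p" and K: "0 <= K"
  and lip: "\<forall>\<^sub>F q in nhds p. norm (snd b' (g q) - snd b' (g p)) <= K*norm (snd b q - snd b p)"
 shows "plip g p"
 unfolding plip_def
proof (intro conjI ballI impI cont)
 fix c c' assume c: "c \<in> A" "c' \<in> A" "p \<in> fst c" "g p \<in> fst c'"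
 obtain L where L: "0 <= L" "\<forall>\<^sub>F q in nhds p. norm (snd b q - snd b p) <= L*norm (snd c q - snd c p)"
  using chart_lipschitz[OF c(1) b(1) c(3) b(2)] by blast
 obtain N where N: "0 <= N" "\<forall>\<^sub>F q in nhds (g p). norm (snd c' q - snd c' (g p)) <= N*norm (snd b' q - snd b' (g p))"
  using chart_lipschitz[OF b(3) c(2) b(4) c(4)] by blast
 have "(g \<longlongrightarrow> g p) (nhds p)" using cont by (simp add: isCont_def tendsto_nhds_iff)
 then have "\<forall>\<^sub>F q in nhds p. norm (snd c' (g q) - snd c' (g p)) <= N*norm (snd b' (g q) - snd b' (g p))"
  by (rule eventually_compose_filterlim[OF N(2)])
 with lip L(2) have "\<forall>\<^sub>F q in nhds p. norm (snd c' (g q) - snd c' (g p)) <= N*(K*L)*norm (snd c q - snd c p)"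
 proof eventually_elim
  case (elim q)
  have "N*norm (snd b' (g q) - snd b' (g p)) <= N*(K*(L*norm (snd c q - snd c p)))"
   using elim(1) mult_left_mono[OF elim(2) K] by (intro mult_left_mono[OF _ N(1)]) linarith
  then show ?case using elim(3) by (simp add: mult.assoc)
 qed
 then show "\<exists>K\<ge>0. \<forall>\<^sub>F q in nhds p. norm (snd c' (g q) - snd c' (g p)) <= K*norm (snd c q - snd c p)"
  using K L(1) N(1) by (intro exI[of _ "N*(K*L)"]) simp
qed

text \<open>Short times are covered by \<open>flow_box\<close>, uniformly on the manifold; a longer
  time is cut into equal short pieces.\<close>

lemma flow_plip: "plip (\<phi> t) p"
proof -
 have "\<exists>h>0. \<forall>p t. abs t < h --> plip (\<phi> t) p"
 proof (rule uniform_time)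
  fix p0
  obtain c U h where c: "c \<in> A" "open U" "p0 \<in> U" "0 < h"
   "!!p t. p \<in> U ==> abs t < h ==> \<phi> t p \<in> fst c"
   "!!p q t. p \<in> U ==> q \<in> U ==> abs t < h ==> norm (snd c (\<phi> t p) - snd c (\<phi> t q)) <= 2*norm (snd c p - snd c q)"
   using flow_box[of p0] by metis
  have "plip (\<phi> t) p" if p: "p \<in> U" and t: "abs t < h" for p t
  proof (rule plip_chartI[where b = c and b' = c and K = 2])
   show "c \<in> A" "c \<in> A" "\<phi> t p \<in> fst c" using c(1) c(5)[OF p t] by auto
   show pc: "p \<in> fst c" using c(5)[OF p, of 0] c(4) by simp
   have ev: "\<forall>\<^sub>F q in nhds p. q \<in> U" by (rule eventually_nhds_in_open[OF c(2) p])
   then show lip: "\<forall>\<^sub>F q in nhds p. norm (snd c (\<phi> t q) - snd c (\<phi> t p)) <= 2*norm (snd c q - snd c p)"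
    by eventually_elim (rule c(6)[OF _ p t])
   have "(snd c \<longlongrightarrow> snd c p) (nhds p)" using isCont_chart[OF c(1) pc] by (simp add: isCont_def tendsto_nhds_iff)
   then have "((%q. 2*norm (snd c q - snd c p)) \<longlongrightarrow> 2*norm (snd c p - snd c p)) (nhds p)" by (intro tendsto_intros)
   then have "((%q. snd c (\<phi> t q) - snd c (\<phi> t p)) \<longlongrightarrow> 0) (nhds p)"
    by (intro Lim_null_comparison[OF lip]) simp
   then have "((%q. snd c (\<phi> t q)) \<longlongrightarrow> snd c (\<phi> t p)) (nhds p)" by (rule LIM_zero_cancel)
   moreover have "\<forall>\<^sub>F q in nhds p. \<phi> t q \<in> fst c" using ev by eventually_elim (rule c(5)[OF _ t])
   ultimately have "(\<phi> t \<longlongrightarrow> \<phi> t p) (nhds p)" by (intro tendsto_chart[OF c(1) c(5)[OF p t]])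
   then show "isCont (\<phi> t) p" by (simp add: isCont_def tendsto_nhds_iff)
  qed simp
  then show "\<exists>U h. open U & p0 \<in> U & 0 < h & (\<forall>p\<in>U. \<forall>t. abs t < h --> plip (\<phi> t) p)" using c(2,3,4) by blast
 qed
 then obtain h where h: "0 < h" "!!p t. abs t < h ==> plip (\<phi> t) p" by blast
 obtain n :: nat where n: "abs t/h < real n" using reals_Archimedean2 by blast
 have n0: "0 < real n" using n h(1) by (meson abs_ge_zero divide_nonneg_pos le_less_trans)
 let ?s = "t/real n"
 have s: "abs (?s) < h" using n n0 h(1) by (simp add: field_simps)
 have "plip (\<phi> (real k * ?s)) p" for k
 proof (induction k)
  case 0 show ?case using h(2)[of 0 p] h(1) by (simp del: flow_0)
 next
  case (Suc k)
  have e: "real (Suc k) * ?s = ?s + real k * ?s" by (simp add: algebra_simps add_divide_distrib)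
  show ?case unfolding e flow_add[abs_def] by (rule plip_compose[OF Suc h(2)[OF s]])
 qed
 from this[of n] show ?thesis using n0 by simp
qed

lemma isCont_flow: "isCont (\<phi> t) p"
 using flow_plip by (simp add: plip_def)

text \<open>At time 0 the displacement is bounded by \<open>B*abs t\<close>, uniformly near the
  point; the group law and continuity for fixed time carry this to every pair.\<close>

lemma isCont_flow_joint: "isCont (%x. \<phi> (fst x) (snd x)) (t, p)"
proof -
 have 0: "((%x. \<phi> (fst x) (snd x)) \<longlongrightarrow> q) (nhds (0, q))" for q
 proof -
  obtain c U h B where c: "c \<in> A" "open U" "q \<in> U" "0 < h" "0 < B"
   "!!p t. p \<in> U ==> abs t < h ==> \<phi> t p \<in> fst c"
   "!!p t. p \<in> U ==> abs t < h ==> norm (snd c (\<phi> t p) - snd c p) <= B*abs t"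
   using flow_box[of q] by metis
  have qc: "q \<in> fst c" using c(6)[OF c(3), of 0] c(4) by simp
  have "open ({-h<..<h} \<times> U)" using c(2) by (intro open_Times) auto
  then have ev: "\<forall>\<^sub>F x in nhds (0, q). x \<in> {-h<..<h} \<times> U" by (rule eventually_nhds_in_open) (use c in auto)
  have cs: "((%x. snd c (snd x)) \<longlongrightarrow> snd c q) (nhds (0::real, q))"
   by (rule isCont_tendsto_compose[OF isCont_chart[OF c(1) qc]]) (use tendsto_snd[OF tendsto_ident_at] in \<open>auto simp: tendsto_nhds_iff intro!: tendsto_eq_intros filterlim_ident\<close>)
  have ft: "((%x. B*abs (fst x)) \<longlongrightarrow> B*abs 0) (nhds (0::real, q))"
   by (intro tendsto_intros) (auto intro!: tendsto_eq_intros filterlim_ident)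
  have "((%x. snd c (\<phi> (fst x) (snd x)) - snd c (snd x)) \<longlongrightarrow> 0) (nhds (0, q))"
  proof (rule Lim_null_comparison)
   show "\<forall>\<^sub>F x in nhds (0, q). norm (snd c (\<phi> (fst x) (snd x)) - snd c (snd x)) <= B*abs (fst x)"
    using ev by eventually_elim (auto intro!: c(7))
   show "((%x. B*abs (fst x)) \<longlongrightarrow> 0) (nhds (0, q))" using ft by simp
  qed
  from tendsto_add[OF this cs] have "((%x. snd c (\<phi> (fst x) (snd x))) \<longlongrightarrow> snd c q) (nhds (0, q))" by simp
  moreover have "\<forall>\<^sub>F x in nhds (0, q). \<phi> (fst x) (snd x) \<in> fst c" using ev by eventually_elim (auto intro!: c(6))
  ultimately show ?thesis by (intro tendsto_chart[OF c(1) qc])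
 qed
 have fs: "(fst \<longlongrightarrow> t) (nhds (t, p))" "(snd \<longlongrightarrow> p) (nhds (t, p))"
  by (auto intro!: tendsto_eq_intros filterlim_ident)
 have 1: "((%x. fst x - t) \<longlongrightarrow> 0) (nhds (t, p))" using tendsto_diff[OF fs(1) tendsto_const[of t]] by simp
 have 2: "((%x. \<phi> t (snd x)) \<longlongrightarrow> \<phi> t p) (nhds (t, p))" by (rule isCont_tendsto_compose[OF isCont_flow fs(2)])
 have "((%x. (fst x - t, \<phi> t (snd x))) \<longlongrightarrow> (0, \<phi> t p)) (nhds (t, p))" by (rule tendsto_Pair[OF 1 2])
 from filterlim_compose[OF 0 this] have "((%x. \<phi> (fst x - t) (\<phi> t (snd x))) \<longlongrightarrow> \<phi> t p) (nhds (t, p))" by simp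
 then show ?thesis by (simp add: flow_add[symmetric] isCont_def tendsto_nhds_iff)
qed

lemma tendsto_flow: "(g \<longlongrightarrow> t) G ==> (k \<longlongrightarrow> p) G ==> ((%x. \<phi> (g x) (k x)) \<longlongrightarrow> \<phi> t p) G"
 using isCont_tendsto_compose[OF isCont_flow_joint tendsto_Pair[of g t G k p]] by simp

text \<open>Joint continuity and the tube lemma: compactness of the set of times makes the
  neighbourhood of \<open>q\<close> independent of the time.\<close>

lemma flow_tube:
 assumes U: "open U" and I: "compact I" and s: "!!s. s \<in> I ==> \<phi> s q \<in> U"
 shows "\<forall>\<^sub>F p in nhds q. \<forall>s\<in>I. \<phi> s p \<in> U"
proof -
 have "((%x. \<phi> (snd x) (fst x)) \<longlongrightarrow> \<phi> (snd x) (fst x)) (at x)" for x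
  by (rule tendsto_flow[OF tendsto_snd[OF tendsto_ident_at] tendsto_fst[OF tendsto_ident_at]])
 then have "open ((%x. \<phi> (snd x) (fst x)) -` U)"
  by (intro open_vimage[OF U] continuous_at_imp_continuous_on) (auto simp: isCont_def)
 moreover have "{q} \<times> I \<subseteq> (%x. \<phi> (snd x) (fst x)) -` U" using s by auto
 ultimately obtain X V where "q \<in> X" "open X" "I \<subseteq> V" "X \<times> V \<subseteq> (%x. \<phi> (snd x) (fst x)) -` U"
  using tube_lemma_right[of euclidean euclidean "(%x. \<phi> (snd x) (fst x)) -` U" I q] I
  unfolding euclidean_product_topology open_openin[symmetric] by auto
 then have "\<phi> s p \<in> U" if "p \<in> X" "s \<in> I" for p s
 proof -
  have "(p, s) \<in> (%x. \<phi> (snd x) (fst x)) -` U" using that \<open>I \<subseteq> V\<close> \<open>X \<times> V \<subseteq> _\<close> by blast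
  then show ?thesis by simp
 qed
 then show ?thesis unfolding eventually_nhds using \<open>q \<in> X\<close> \<open>open X\<close> by blast
qed

end

section \<open>Parametrized coordinates\<close>

lemma vec3_eq: "vec3 x y z = x *\<^sub>R axis 1 1 + y *\<^sub>R axis 2 1 + z *\<^sub>R axis 3 1"
 by (simp add: vec_eq_iff forall_3 axis_def)

lemma vec3_has_vector_derivative:
 assumes "(a has_real_derivative a') (at t)" "(b has_real_derivative b') (at t)" "(c has_real_derivative c') (at t)"
 shows "((%s. vec3 (a s) (b s) (c s)) has_vector_derivative vec3 a' b' c') (at t)"
 using assms unfolding vec3_eq
 by (auto intro!: derivative_eq_intros)

lemma tendsto_vec3:
 "(a \<longlongrightarrow> x) G ==> (b \<longlongrightarrow> y) G ==> (c \<longlongrightarrow> z) G ==> ((%s. vec3 (a s) (b s) (c s)) \<longlongrightarrow> vec3 x y z) G"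
 unfolding vec3_eq by (intro tendsto_intros)

lemma vec3_diff: "vec3 x y z - vec3 x' y' z' = vec3 (x - x') (y - y') (z - z')"
 by (simp add: vec_eq_iff forall_3)

lemma norm_vec3_le: "norm (vec3 x y z) <= abs x + abs y + abs z"
 using norm_le_l1_cart[of "vec3 x y z"] by (simp add: sum_3)

context vector_field
begin

lemma param_chart:
 assumes k: "local_Ck_diffeo 2 A W \<kappa>" and w: "w \<in> W" "c \<in> A" "\<kappa> w \<in> fst c"
 shows "open (W \<inter> \<kappa> -` fst c)" "w \<in> W \<inter> \<kappa> -` fst c" "Ck (Suc 0) (W \<inter> \<kappa> -` fst c) (snd c \<circ> \<kappa>)"
  "inj (frechet_derivative (snd c \<circ> \<kappa>) (at w))"
  "((snd c \<circ> \<kappa>) has_derivative frechet_derivative (snd c \<circ> \<kappa>) (at w)) (at w)"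
proof -
 have 1: "open (W \<inter> \<kappa> -` fst c) & Ck 2 (W \<inter> \<kappa> -` fst c) (snd c \<circ> \<kappa>) &
   (\<forall>w\<in>W \<inter> \<kappa> -` fst c. inj (frechet_derivative (snd c \<circ> \<kappa>) (at w)))"
  using k w(2) unfolding local_Ck_diffeo_def by blast
 show m: "w \<in> W \<inter> \<kappa> -` fst c" using w by simp
 show "open (W \<inter> \<kappa> -` fst c)" "inj (frechet_derivative (snd c \<circ> \<kappa>) (at w))" using 1 m by blast+
 show C: "Ck (Suc 0) (W \<inter> \<kappa> -` fst c) (snd c \<circ> \<kappa>)" using 1 by (intro Ck_le[of "Suc 0" 2]) simp_all
 show "((snd c \<circ> \<kappa>) has_derivative frechet_derivative (snd c \<circ> \<kappa>) (at w)) (at w)"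
  using C m unfolding Ck.simps frechet_derivative_works[symmetric] by blast
qed

lemma param_isCont:
 assumes k: "local_Ck_diffeo 2 A W \<kappa>" and w: "w \<in> W"
 shows "isCont \<kappa> w"
proof -
 obtain c where c: "c \<in> A" "\<kappa> w \<in> fst c" using covered by blast
 note p = param_chart[OF k w c]
 have "isCont (snd c \<circ> \<kappa>) w" by (rule has_derivative_continuous[OF p(5)])
 then have "((%x. snd c (\<kappa> x)) \<longlongrightarrow> snd c (\<kappa> w)) (nhds w)" by (simp add: isCont_def tendsto_nhds_iff o_def)
 moreover have "\<forall>\<^sub>F x in nhds w. \<kappa> x \<in> fst c" using eventually_nhds_in_open[OF p(1,2)] by eventually_elim simp
 ultimately have "(\<kappa> \<longlongrightarrow> \<kappa> w) (nhds w)" by (intro tendsto_chart[OF c])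
 then show ?thesis by (simp add: isCont_def tendsto_nhds_iff)
qed

lemma param_continuous_on: "local_Ck_diffeo 2 A W \<kappa> ==> S \<subseteq> W ==> continuous_on S \<kappa>"
 using param_isCont by (blast intro: continuous_at_imp_continuous_on)

lemma param_icurve:
 assumes k: "local_Ck_diffeo 2 A W \<kappa>" and I: "open I" and w: "!!t. t \<in> I ==> w t \<in> W"
  "!!t. t \<in> I ==> (w has_vector_derivative m t *\<^sub>R v t) (at t)" "!!t. t \<in> I ==> represents A f \<kappa> (w t) (v t)"
 shows "icurve m I (%t. \<kappa> (w t))"
 unfolding icurve_def
proof (intro conjI ballI impI I)
 have "isCont (%t. \<kappa> (w t)) t" if "t \<in> I" for t
  by (rule isCont_o2[OF has_vector_derivative_continuous[OF w(2)[OF that]] param_isCont[OF k w(1)[OF that]]])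
 then show "continuous_on I (%t. \<kappa> (w t))" by (simp add: continuous_at_imp_continuous_on)
 fix t c assume t: "t \<in> I" and c: "c \<in> A" "\<kappa> (w t) \<in> fst c"
 let ?D = "frechet_derivative (snd c \<circ> \<kappa>) (at (w t))"
 note p = param_chart[OF k w(1)[OF t] c]
 have "((%s. (snd c \<circ> \<kappa>) (w s)) has_derivative (%h. ?D (h *\<^sub>R (m t *\<^sub>R v t)))) (at t)"
  by (rule has_derivative_compose[where f = w and f' = "%h. h *\<^sub>R (m t *\<^sub>R v t)" and g = "snd c \<circ> \<kappa>"])
   (use w(2)[OF t] in \<open>simp add: has_vector_derivative_def\<close>, rule p(5))
 moreover have "f c (\<kappa> (w t)) = ?D (v t)" using w(3)[OF t] c unfolding represents_def by blast
 moreover have "?D (h *\<^sub>R (m t *\<^sub>R v t)) = h *\<^sub>R (m t *\<^sub>R ?D (v t))" for h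
  by (simp only: linear_scale[OF has_derivative_linear[OF p(5)]])
 ultimately show "((%s. snd c (\<kappa> (w s))) has_vector_derivative m t *\<^sub>R f c (\<kappa> (w t))) (at t)"
  by (simp only: has_vector_derivative_def comp_apply)
qed

text \<open>The factor \<open>h\<close> comes without any regularity. But the field and the
  direction \<open>u\<close>, transported to a chart, are continuous and proportional with factor
  \<open>h\<close>, so \<open>1/h\<close> is a quotient of continuous inner products.\<close>

lemma param_speed_continuous:
 fixes I :: "real set"
 assumes k: "local_Ck_diffeo 2 A W \<kappa>" and I: "open I" and w: "continuous_on I w" "!!t. t \<in> I ==> w t \<in> W"
  and u: "continuous_on I u" "!!t. t \<in> I ==> u t ~= 0"
  and h: "!!t. t \<in> I ==> 0 < h t" "!!t. t \<in> I ==> represents A f \<kappa> (w t) (h t *\<^sub>R u t)"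
 shows "continuous_on I (%t. 1/h t)"
proof (rule continuous_at_imp_continuous_on, rule ballI)
 fix t0 assume t0: "t0 \<in> I"
 obtain c where c: "c \<in> A" "\<kappa> (w t0) \<in> fst c" using covered by blast
 let ?S = "W \<inter> \<kappa> -` fst c"
 let ?D = "%x. frechet_derivative (snd c \<circ> \<kappa>) (at x)"
 note p0 = param_chart[OF k w(2)[OF t0] c]
 have cw: "(w \<longlongrightarrow> w t0) (nhds t0)" and cu: "(u \<longlongrightarrow> u t0) (nhds t0)"
  using w(1) u(1) I t0 continuous_on_eq_continuous_at by (auto simp: isCont_def tendsto_nhds_iff)
 define X where "X t = ?D (w t) (u t)" for t
 define Y where "Y t = f c (\<kappa> (w t))" for t
 have ev: "\<forall>\<^sub>F t in nhds t0. t \<in> I & w t \<in> ?S"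
  using eventually_nhds_in_open[OF I t0] topological_tendstoD[OF cw p0(1,2)] by eventually_elim simp
 have lin: "linear (?D (w t))" if "t \<in> I" "w t \<in> ?S" for t
  using has_derivative_linear[OF param_chart(5)[OF k w(2)[OF that(1)] c(1)]] that(2) by simp
 have XS: "X t = (\<Sum>i\<in>Basis. (u t \<bullet> i) *\<^sub>R ?D (w t) i)" if "t \<in> I" "w t \<in> ?S" for t
  using linear_sum[OF lin[OF that], of "%i. (u t \<bullet> i) *\<^sub>R i" Basis] linear_scale[OF lin[OF that]]
  by (simp add: X_def euclidean_representation)
 have "((%t. \<Sum>i\<in>Basis. (u t \<bullet> i) *\<^sub>R ?D (w t) i) \<longlongrightarrow> (\<Sum>i\<in>Basis. (u t0 \<bullet> i) *\<^sub>R ?D (w t0) i)) (nhds t0)"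
 proof (intro tendsto_sum tendsto_scaleR tendsto_inner cu tendsto_const)
  fix i :: "real^3"
  have "continuous_on ?S (%x. ?D x i)" using p0(3) by simp
  then have "isCont (%x. ?D x i) (w t0)" using p0(1,2) continuous_on_eq_continuous_at by blast
  then show "((%t. ?D (w t) i) \<longlongrightarrow> ?D (w t0) i) (nhds t0)" by (rule isCont_tendsto_compose[OF _ cw])
 qed
 then have X: "(X \<longlongrightarrow> X t0) (nhds t0)"
  using ev XS p0(2) t0 by (subst tendsto_cong[of _ "%t. \<Sum>i\<in>Basis. (u t \<bullet> i) *\<^sub>R ?D (w t) i"]) (auto elim: eventually_mono)
 have "isCont (F c) (snd c (\<kappa> (w t0)))"
  using Ck_continuous[OF F_C1[OF c(1)]] chart(2)[OF c(1)] c(2) continuous_on_eq_continuous_at by blast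
 moreover have "((%t. snd c (\<kappa> (w t))) \<longlongrightarrow> snd c (\<kappa> (w t0))) (nhds t0)"
  by (rule isCont_tendsto_compose[OF isCont_chart[OF c] isCont_tendsto_compose[OF param_isCont[OF k w(2)[OF t0]] cw]])
 ultimately have "((%t. F c (snd c (\<kappa> (w t)))) \<longlongrightarrow> F c (snd c (\<kappa> (w t0)))) (nhds t0)"
  by (rule isCont_tendsto_compose)
 then have Y: "(Y \<longlongrightarrow> Y t0) (nhds t0)"
  using ev F_chart[OF c] by (subst tendsto_cong[of _ "%t. F c (snd c (\<kappa> (w t)))"]) (auto simp: Y_def F_chart[OF c(1)] elim: eventually_mono)
 have YX: "Y t = h t *\<^sub>R X t" "0 < X t \<bullet> X t" if "t \<in> I" "w t \<in> ?S" for t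
 proof -
  have "Y t = ?D (w t) (h t *\<^sub>R u t)" using h(2)[OF that(1)] c(1) that(2) unfolding represents_def Y_def by blast
  then show "Y t = h t *\<^sub>R X t" by (simp add: X_def linear_scale[OF lin[OF that]])
  have "inj (?D (w t))" using param_chart(4)[OF k w(2)[OF that(1)] c(1)] that(2) by simp
  then have "X t ~= 0" unfolding X_def using u(2)[OF that(1)] linear_injective_0[OF lin[OF that]] by blast
  then show "0 < X t \<bullet> X t" by simp
 qed
 have "((%t. (X t \<bullet> X t)/(Y t \<bullet> X t)) \<longlongrightarrow> (X t0 \<bullet> X t0)/(Y t0 \<bullet> X t0)) (nhds t0)"
  using YX[OF t0 p0(2)] h(1)[OF t0] by (intro tendsto_intros X Y) auto
 moreover have "(X t \<bullet> X t)/(Y t \<bullet> X t) = 1/h t" if "t \<in> I" "w t \<in> ?S" for t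
  using YX[OF that] h(1)[OF that(1)] by (simp add: field_simps)
 ultimately have "((%t. 1/h t) \<longlongrightarrow> 1/h t0) (nhds t0)"
  using ev t0 p0(2) by (subst tendsto_cong[of _ "%t. (X t \<bullet> X t)/(Y t \<bullet> X t)"]) (auto elim: eventually_mono)
 then show "isCont (%t. 1/h t) t0" by (simp add: isCont_def tendsto_nhds_iff)
qed

text \<open>\<open>w\<close> solves the equation without the factor \<open>h\<close>; the true time
  spent along it is the integral of \<open>1/h\<close>.\<close>

lemma flow_along:
 assumes k: "local_Ck_diffeo 2 A W \<kappa>" and L: "0 <= L" and w: "!!t. (w has_vector_derivative u (w t)) (at t)"
   "!!t. t \<in> {0..L} ==> w t \<in> W"
  and u: "continuous_on UNIV u" "!!x. u x ~= 0" and h: "!!x. x \<in> W ==> 0 < h x & represents A f \<kappa> x (h x *\<^sub>R u x)"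
 shows "\<exists>T. T 0 = 0 & continuous_on {0..L} T & (\<forall>t\<in>{0..L}. 0 <= T t & \<phi> (T t) (\<kappa> (w 0)) = \<kappa> (w t))"
proof -
 have cw: "continuous_on S w" for S
  using has_vector_derivative_continuous[OF w(1)] by (auto intro: continuous_at_imp_continuous_on)
 have W: "open W" using k by (simp add: local_Ck_diffeo_def)
 have "open (w -` W)" by (rule open_vimage[OF W cw])
 then obtain e where e: "0 < e" "(\<Union>x\<in>{0..L}. ball x e) \<subseteq> w -` W"
  using compact_subset_open_imp_ball_epsilon_subset[of "{0..L}" "w -` W"] w(2) by (metis compact_Icc vimageI2 subsetI)
 let ?I = "{-e<..<L+e}"
 have IW: "w t \<in> W" if "t \<in> ?I" for t
 proof -
  have "\<exists>x\<in>{0..L}. t \<in> ball x e"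
   by (rule bexI[of _ "max 0 (min L t)"]) (use that e(1) L in \<open>auto simp: dist_real_def\<close>)
  then show ?thesis using e(2) by blast
 qed
 define m where "m t = 1/h (w t)" for t
 have cm: "continuous_on ?I m" unfolding m_def[abs_def]
  by (rule param_speed_continuous[OF k, where w = w and u = "%t. u (w t)"])
   (use IW h u cw in \<open>auto intro: continuous_on_compose2[OF u(1) cw]\<close>)
 have m0: "0 < m t" if "t \<in> ?I" for t using h[OF IW[OF that]] by (simp add: m_def)
 \<comment> \<open>A larger interval is used so that \<open>T\<close> has two-sided derivatives also
   at 0 and \<open>L\<close>.\<close>
 have "continuous_on {-e/2..L+e/2} m" using e(1) by (intro continuous_on_subset[OF cm]) auto
 then obtain G where G: "!!t. t \<in> {-e/2..L+e/2} ==> (G has_vector_derivative m t) (at t within {-e/2..L+e/2})"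
  using antiderivative_continuous[of "-e/2" "L+e/2" m] by blast
 let ?J = "{-e/2<..<L+e/2}"
 have J: "?J \<subseteq> ?I" "0 \<in> ?J" "{0..L} \<subseteq> ?J" using e(1) L by auto
 define T where "T t = G t - G 0" for t
 have T: "(T has_real_derivative m t) (at t)" if "t \<in> ?J" for t
 proof -
  have "at t within {-e/2..L+e/2} = at t" using that by (intro at_within_interior) simp
  then have "(G has_real_derivative m t) (at t)"
   using G[of t] that by (simp add: has_real_derivative_iff_has_vector_derivative)
  then show ?thesis unfolding T_def[abs_def] by (auto intro!: derivative_eq_intros)
 qed
 have ic: "icurve m ?J (%t. \<kappa> (w t))"
 proof (rule param_icurve[OF k, where v = "%t. h (w t) *\<^sub>R u (w t)"])
  fix t assume t: "t \<in> ?J"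
  then show "w t \<in> W" using IW J(1) by blast
  then show "represents A f \<kappa> (w t) (h (w t) *\<^sub>R u (w t))" "(w has_vector_derivative m t *\<^sub>R (h (w t) *\<^sub>R u (w t))) (at t)"
   using h[of "w t"] w(1)[of t] by (auto simp: m_def)
 qed simp
 have fl: "\<phi> (T t) (\<kappa> (w 0)) = \<kappa> (w t)" if "t \<in> ?J" for t
  by (rule flow_reparam[OF ic _ J(2) continuous_on_subset[OF cm J(1)] T _ that]) (auto simp: T_def)
 have "0 <= T t" if t: "t \<in> {0..L}" for t
 proof -
  have "T 0 <= T t"
  proof (rule DERIV_nonneg_imp_nondecreasing[of 0 t T])
   fix x assume "0 <= x" "x <= t"
   then have "x \<in> {0..L}" using t by simp
   then have "x \<in> ?J" using J(3) by blast
   then show "\<exists>y. (T has_real_derivative y) (at x) & 0 <= y" using T m0 J(1) by (meson less_imp_le subsetD)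
  qed (use t in simp)
  then show ?thesis by (simp add: T_def)
 qed
 moreover have "continuous_on {0..L} T"
  using T J(3) DERIV_isCont by (blast intro: continuous_at_imp_continuous_on)
 ultimately show ?thesis using fl J(3) by (intro exI[of _ T]) (auto simp: T_def)
qed

end

section \<open>The cycle\<close>

locale tangency = vector_field A f for A :: "'m::t2_space chart set" and f +
 fixes d :: "'m cycle"
 assumes tc: "tangency_cycle A f d"
begin

lemma P_data: obtains W h where "tube \<subseteq> W" "local_Ck_diffeo 2 A W (coordP d)"
  "!!w. w \<in> W ==> 0 < h w & represents A f (coordP d) w (h w *\<^sub>R vec3 1 (- etac d*w $ 2) (etae d*w $ 3))"
proof -
 have "adapted_P A f d" using tc by (simp add: tangency_cycle_def)
 from conjunct1[OF this[unfolded adapted_P_def]] show ?thesis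
  by (elim exE conjE, rule_tac W = W and h = h in that) blast+
qed

lemma E_data: obtains W g where "cube \<subseteq> W" "local_Ck_diffeo 2 A W (coordE d)" "inj_on (coordE d) W" "coordE d 0 = equil d"
  "!!w. w \<in> W ==> represents A f (coordE d) w (g w)"
  "(g has_derivative (%v. vec3 (- lam1 d * v $ 1) (- lam2 d * v $ 2) (mu d * v $ 3))) (at 0)"
proof -
 have "adapted_E A f d" using tc by (simp add: tangency_cycle_def)
 from conjunct1[OF this[unfolded adapted_E_def]] show ?thesis
  by (elim exE conjE, rule_tac W = W and g = g in that) blast+
qed

lemma rates: "0 < etac d" "0 < etae d" "0 < lam1 d" "lam1 d < lam2 d" "0 < mu d"
 using tc unfolding tangency_cycle_def H1_def H2_def hyperbolic_saddle_def hyperbolic_periodic_def by auto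

lemma PE_data: obtains r T where "0 < r" "continuous_on (ball 0 r) T" "T 0 > 0" "Ck 2 (ball 0 r) (PsiPE d)" "PsiPE d 0 = 0"
  "!!w. w \<in> ball 0 r ==> \<phi> (T w) (secPout d w) = secEin d (PsiPE d w)"
proof -
 have "transition_map \<phi> (secPout d) (secEin d) (PsiPE d)" using tc by (simp add: tangency_cycle_def transitions_def)
 then show ?thesis unfolding transition_map_def
  by (elim exE conjE, rule_tac r = r and T = T in that) blast+
qed

lemma EP_data: obtains r T where "0 < r" "continuous_on (ball 0 r) T" "T 0 > 0" "Ck 2 (ball 0 r) (PsiEP d)" "PsiEP d 0 = 0"
  "!!w. w \<in> ball 0 r ==> \<phi> (T w) (secEout d w) = secPin d (PsiEP d w)"
proof -
 have "transition_map \<phi> (secEout d) (secPin d) (PsiEP d)" using tc by (simp add: tangency_cycle_def transitions_def)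
 then show ?thesis unfolding transition_map_def
  by (elim exE conjE, rule_tac r = r and T = T in that) blast+
qed

lemma vec3_tube: "abs y <= 1 ==> abs z <= 1 ==> vec3 x y z \<in> tube"
 by (simp add: tube_def)

lemma vec3_cube: "abs x <= 1 ==> abs y <= 1 ==> abs z <= 1 ==> vec3 x y z \<in> cube"
 by (simp add: cube_def forall_3)

lemma isCont_coordP: "w \<in> tube ==> isCont (coordP d) w"
 by (rule P_data) (rule param_isCont, assumption, erule (1) subsetD)

lemma isCont_coordE: "w \<in> cube ==> isCont (coordE d) w"
 by (rule E_data) (rule param_isCont, assumption, erule (1) subsetD)

lemma norm_le_vec3: "abs x <= norm (vec3 x y z)" "abs y <= norm (vec3 x y z)" "abs z <= norm (vec3 x y z)"
 using component_le_norm_cart[of "vec3 x y z" 1] component_le_norm_cart[of "vec3 x y z" 2] component_le_norm_cart[of "vec3 x y z" 3]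
 by simp_all

text \<open>If \<open>b11\<close> vanished, the points \<open>(s,0)\<close> of the outgoing section would be mapped into an \<open>o(s)\<close>-neighbourhood
 of a single point; flowing back, they would be \<open>o(s)\<close>-close to one orbit, which is transverse to the section.\<close>

lemma b11_nonzero: "b11 d ~= 0"
proof
 assume b: "b11 d = 0"
 obtain r T where tr: "0 < r" "continuous_on (ball 0 r) T" "T 0 > 0" "Ck 2 (ball 0 r) (PsiPE d)" "PsiPE d 0 = 0"
  "!!w. w \<in> ball 0 r ==> \<phi> (T w) (secPout d w) = secEin d (PsiPE d w)" by (rule PE_data) blast
 obtain WP h where P: "tube \<subseteq> WP" "local_Ck_diffeo 2 A WP (coordP d)"
  "!!w. w \<in> WP ==> 0 < h w & represents A f (coordP d) w (h w *\<^sub>R vec3 1 (- etac d*w $ 2) (etae d*w $ 3))" by (rule P_data) blast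
 obtain WE where E: "cube \<subseteq> WE" "local_Ck_diffeo 2 A WE (coordE d)" by (rule E_data) blast
 define P0 where "P0 = secPout d (0, 0)"
 define Q0 where "Q0 = secEin d (0, 0)"
 define T0 where "T0 = T 0"
 have PQ: "\<phi> T0 P0 = Q0" using tr(6)[of 0] tr(1,5) by (simp add: T0_def P0_def Q0_def zero_prod_def)
 then have QP: "\<phi> (- T0) Q0 = P0" using flow_minus(1)[of T0 P0] by simp
 obtain c U k where c: "c \<in> A" "open U" "P0 \<in> U" "0 < k" "!!p t. p \<in> U ==> abs t < k ==> \<phi> t p \<in> fst c"
  "!!p q t. p \<in> U ==> q \<in> U ==> abs t < k ==> norm (snd c (\<phi> t p) - snd c (\<phi> t q)) <= 2*norm (snd c p - snd c q)"
  using flow_box[of P0] by metis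
 have Pc: "P0 \<in> fst c" using c(5)[OF c(3), of 0] c(4) by simp
 obtain b where bA: "b \<in> A" "Q0 \<in> fst b" using covered by blast
 have v1: "vec3 0 0 1 \<in> WP" "vec3 1 0 0 \<in> WE" using P(1) E(1) vec3_tube vec3_cube by (auto simp: subset_iff)
 note pP = param_chart[OF P(2) v1(1) c(1)] and pE = param_chart[OF E(2) v1(2) bA(1)]
 have Pc': "coordP d (vec3 0 0 1) \<in> fst c" and Qb': "coordE d (vec3 1 0 0) \<in> fst b"
  using Pc bA(2) by (simp_all add: P0_def Q0_def)
 define psi where "psi s = PsiPE d (s, 0)" for s
 have deriv: "(PsiPE d has_derivative (%(x, y). (b11 d*x + b12 d*y, b22 d*y))) (at 0)"
  using tc unfolding tangency_cycle_def transitions_def by blast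
 have small: "\<forall>\<^sub>F s in nhds 0. norm (psi s) <= e*abs s" if e: "0 < e" for e
 proof -
  obtain \<delta> where \<delta>: "0 < \<delta>" "!!y. norm (y - 0) < \<delta> ==>
    norm (PsiPE d y - PsiPE d 0 - (%(x, y). (b11 d*x + b12 d*y, b22 d*y)) (y - 0)) <= e*norm (y - 0)"
   using conjunct2[OF deriv[unfolded has_derivative_at_alt], rule_format, OF e] by blast
  have "norm (psi s) <= e*abs s" if "abs s < \<delta>" for s
   using \<delta>(2)[of "(s, 0)"] that b tr(5) by (simp add: psi_def zero_prod_def[symmetric])
  then show ?thesis using \<delta>(1) unfolding eventually_nhds_metric by (auto simp: dist_real_def)
 qed
 have psi0: "(psi \<longlongrightarrow> 0) (nhds 0)"
 proof (rule Lim_null_comparison[OF small[OF zero_less_one]])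
  show "((%s. 1*abs s) \<longlongrightarrow> 0) (nhds (0::real))"
   using tendsto_rabs[OF filterlim_ident[of "nhds (0::real)"]] by simp
 qed
 obtain dE ME where dE: "0 < dE" "0 < ME"
  "!!u v. u \<in> ball (vec3 1 0 0) dE ==> v \<in> ball (vec3 1 0 0) dE ==>
    norm ((snd b \<circ> coordE d) u - (snd b \<circ> coordE d) v) <= ME*norm (u - v)"
  using Ck_lower_bound[OF pE(3,1,2,4)[OF Qb']] by metis
 have norm2: "norm (vec3 1 (fst w) (snd w) - vec3 1 0 0) <= 2*norm w" for w :: "real \<times> real"
  using norm_vec3_le[of 0 "fst w" "snd w"] norm_fst_le[of "fst w" "snd w"] norm_snd_le[of "snd w" "fst w"]
  by (simp add: vec3_diff)
 have "\<forall>\<^sub>F s in nhds 0. norm (psi s) < dE/2"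
  using tendstoD[OF psi0, of "dE/2"] dE(1) by (simp add: dist_norm)
 then have Q1: "\<forall>\<^sub>F s in nhds 0. norm (snd b (secEin d (psi s)) - snd b Q0) <= ME*2*norm (psi s)"
 proof eventually_elim
  case (elim s)
  have "vec3 1 (fst (psi s)) (snd (psi s)) \<in> ball (vec3 1 0 0) dE"
   using norm2[of "psi s"] elim by (simp add: dist_norm norm_minus_commute)
  then have "norm (snd b (secEin d (psi s)) - snd b Q0) <= ME*norm (vec3 1 (fst (psi s)) (snd (psi s)) - vec3 1 0 0)"
   using dE(3)[of "vec3 1 (fst (psi s)) (snd (psi s))" "vec3 1 0 0"] dE(1) secEin.simps[of d "fst (psi s)" "snd (psi s)"]
   by (simp add: Q0_def)
  also have "... <= ME*(2*norm (psi s))" using norm2 dE(2) by (intro mult_left_mono) auto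
  finally show ?case by simp
 qed
 have secE: "((%s. secEin d (psi s)) \<longlongrightarrow> Q0) (nhds 0)"
 proof -
  have "((%s. vec3 1 (fst (psi s)) (snd (psi s))) \<longlongrightarrow> vec3 1 0 0) (nhds 0)"
   using tendsto_fst[OF psi0] tendsto_snd[OF psi0] by (intro tendsto_vec3 tendsto_const) simp_all
  then have "((%s. coordE d (vec3 1 (fst (psi s)) (snd (psi s)))) \<longlongrightarrow> coordE d (vec3 1 0 0)) (nhds 0)"
   by (rule isCont_tendsto_compose[OF param_isCont[OF E(2) v1(2)]])
  moreover have "secEin d (psi s) = coordE d (vec3 1 (fst (psi s)) (snd (psi s)))" for s
   using secEin.simps[of d "fst (psi s)" "snd (psi s)"] by simp
  ultimately show ?thesis by (simp add: Q0_def)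
 qed
 define x where "x s = \<phi> (- T0) (secEin d (psi s))" for s
 have x0: "(x \<longlongrightarrow> P0) (nhds 0)" unfolding x_def[abs_def]
  using isCont_tendsto_compose[OF isCont_flow[where t = "- T0"] secE] by (simp add: QP)
 obtain K where K: "0 <= K" "\<forall>\<^sub>F q in nhds Q0. norm (snd c (\<phi> (- T0) q) - snd c (\<phi> (- T0) Q0)) <= K*norm (snd b q - snd b Q0)"
  using flow_plip[where t = "- T0" and p = Q0] bA c(1) Pc unfolding plip_def QP by blast
 have Q2: "\<forall>\<^sub>F s in nhds 0. norm (snd c (x s) - snd c P0) <= K*norm (snd b (secEin d (psi s)) - snd b Q0)"
  using eventually_compose_filterlim[OF K(2) secE] by (simp add: x_def QP)
 define N where "N = 2*K*(ME*2)"
 have N0: "0 <= N" using K(1) dE(2) by (simp add: N_def)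
 \<comment> \<open>The difference of travel times: flowing back for the fixed time \<open>T0\<close>
   misses the section by this amount along the orbit.\<close>
 define \<tau> where "\<tau> s = T0 - T (s, 0)" for s
 have \<tau>0: "(\<tau> \<longlongrightarrow> 0) (nhds 0)"
 proof -
  have "isCont T 0" using tr(1,2) continuous_on_eq_continuous_at[of "ball 0 r" T] by auto
  moreover have "((%s. (s, 0)) \<longlongrightarrow> (0 :: real \<times> real)) (nhds 0)"
   using tendsto_Pair[OF filterlim_ident[of "nhds (0::real)"] tendsto_const[of "0::real"]] by (simp add: zero_prod_def)
  ultimately have "((%s. T (s, 0)) \<longlongrightarrow> T 0) (nhds 0)" by (rule isCont_tendsto_compose)
  from tendsto_diff[OF tendsto_const[of T0] this] show ?thesis by (simp add: \<tau>_def[abs_def] T0_def)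
 qed
 have ball: "\<forall>\<^sub>F s in nhds (0::real). abs s < r" "\<forall>\<^sub>F s in nhds 0. abs (\<tau> s) < k"
  using tendstoD[OF filterlim_ident[of "nhds (0::real)"] tr(1)] tendstoD[OF \<tau>0 c(4)] by (simp_all add: dist_real_def)
 have main: "\<forall>\<^sub>F s in nhds 0. norm (snd c (coordP d (vec3 s 0 1)) - snd c (\<phi> (\<tau> s) P0)) <= N*norm (psi s)"
  using ball topological_tendstoD[OF x0 c(2,3)] Q1 Q2
 proof eventually_elim
  case (elim s)
  have "(s, 0) \<in> ball 0 r" using elim(1) by (simp add: zero_prod_def dist_Pair_Pair)
  from tr(6)[OF this] have "\<phi> (T (s, 0)) (coordP d (vec3 s 0 1)) = secEin d (psi s)" by (simp add: psi_def)
  then have "coordP d (vec3 s 0 1) = \<phi> (- T (s, 0)) (secEin d (psi s))" by (metis flow_minus(1))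
  also have "... = \<phi> (\<tau> s) (x s)" by (simp add: x_def \<tau>_def flow_add[symmetric])
  finally have "norm (snd c (coordP d (vec3 s 0 1)) - snd c (\<phi> (\<tau> s) P0)) <= 2*norm (snd c (x s) - snd c P0)"
   using c(6)[OF elim(3) c(3) elim(2)] by simp
  also have "... <= 2*(K*(ME*2*norm (psi s)))"
   using elim(5) mult_left_mono[OF elim(4) K(1)] by linarith
  finally show ?case by (simp add: N_def mult.assoc)
 qed
 let ?D = "frechet_derivative (snd c \<circ> coordP d) (at (vec3 0 0 1))"
 note lin = has_derivative_linear[OF pP(5)[OF Pc']]
 define h0 where "h0 = h (vec3 0 0 1)"
 have h0: "0 < h0" using P(3)[OF v1(1)] by (simp add: h0_def)
 let ?v = "vec3 1 0 (etae d)"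
 have fc: "f c P0 = h0 *\<^sub>R ?D ?v"
  using P(3)[OF v1(1)] c(1) Pc' linear_scale[OF lin] by (simp add: represents_def P0_def h0_def)
 define u where "u s = snd c (coordP d (vec3 s 0 1))" for s
 define y where "y t = snd c (\<phi> t P0)" for t
 have u': "(u has_vector_derivative ?D (vec3 1 0 0)) (at 0)"
 proof -
  have w: "((%s. vec3 s 0 1) has_vector_derivative vec3 1 0 0) (at 0)"
   by (rule vec3_has_vector_derivative) (auto intro!: derivative_eq_intros)
  have "((%s. (snd c \<circ> coordP d) (vec3 s 0 1)) has_derivative (%h. ?D (h *\<^sub>R vec3 1 0 0))) (at 0)"
   by (rule has_derivative_compose[where f = "%s. vec3 s 0 1" and f' = "%h. h *\<^sub>R vec3 1 0 0" and g = "snd c \<circ> coordP d"])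
    (use w in \<open>simp add: has_vector_derivative_def\<close>, rule pP(5)[OF Pc'])
  moreover have "?D (h *\<^sub>R vec3 1 0 0) = h *\<^sub>R ?D (vec3 1 0 0)" for h by (rule linear_scale[OF lin])
  ultimately show ?thesis by (simp only: has_vector_derivative_def comp_apply u_def[abs_def])
 qed
 have y': "(y has_vector_derivative f c P0) (at 0)"
  using flow_deriv[OF c(1), of 0 P0] Pc by (simp add: y_def[abs_def])
 have uy: "u 0 = y 0" by (simp add: u_def y_def P0_def)
 obtain B where B: "0 < B" "!!x. B*norm x <= norm (?D x)"
  using linear_inj_bounded_below_pos[OF lin pP(4)[OF Pc']] by blast
 define M where "M = 1 + 1/etae d + 1/(h0*etae d)"
 have M0: "0 < M" using rates h0 by (simp add: M_def add_pos_pos)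
 \<comment> \<open>Transversality in quantitative form: \<open>vec3 1 0 0\<close> is tangent to the
   section, while the flow direction has the nonzero last component \<open>etae d\<close>.\<close>
 have lower: "B*(abs s + abs t) <= M*norm (s *\<^sub>R ?D (vec3 1 0 0) - t *\<^sub>R f c P0)" for s t
 proof -
  have e: "s *\<^sub>R ?D (vec3 1 0 0) - t *\<^sub>R f c P0 = ?D (vec3 (s - t*h0) 0 (- (t*h0*etae d)))"
  proof -
   have "?D (s *\<^sub>R vec3 1 0 0 - (t*h0) *\<^sub>R ?v) = s *\<^sub>R ?D (vec3 1 0 0) - (t*h0) *\<^sub>R ?D ?v"
    by (simp only: linear_diff[OF lin] linear_scale[OF lin])
   moreover have "s *\<^sub>R vec3 1 0 0 - (t*h0) *\<^sub>R ?v = vec3 (s - t*h0) 0 (- (t*h0*etae d))"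
    by (simp add: vec_eq_iff forall_3)
   ultimately show ?thesis by (simp add: fc)
  qed
  let ?n = "norm (vec3 (s - t*h0) 0 (- (t*h0*etae d)))"
  have "abs (t*h0*etae d) <= ?n" using norm_le_vec3(3)[of "- (t*h0*etae d)" "s - t*h0" 0] by simp
  then have 1: "abs t*(h0*etae d) <= ?n" using h0 rates by (simp add: abs_mult mult.assoc)
  then have 2: "abs t <= ?n*(1/(h0*etae d))" "abs (t*h0) <= ?n*(1/etae d)"
   using h0 rates by (simp_all add: field_simps abs_mult)
  have "abs (s - t*h0) <= ?n" by (rule norm_le_vec3(1))
  then have "abs s + abs t <= ?n + ?n*(1/etae d) + ?n*(1/(h0*etae d))" using 2 by linarith
  also have "... = M * ?n" by (simp add: M_def algebra_simps)
  finally have "B*(abs s + abs t) <= B*(M * ?n)" using B(1) by (intro mult_left_mono) auto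
  also have "... <= M*norm (?D (vec3 (s - t*h0) 0 (- (t*h0*etae d))))"
   using mult_left_mono[OF B(2), of M] M0 by (simp add: mult.left_commute)
  finally show ?thesis unfolding e by simp
 qed
 \<comment> \<open>With this \<open>e\<close> the accumulated errors are at most \<open>B/4\<close>
   times \<open>abs s + abs (\<tau> s)\<close>, against the lower bound with
   \<open>B\<close>.\<close>
 define e where "e = B/(4*M*(N + 2))"
 have e0: "0 < e" using B M0 N0 by (simp add: e_def add_nonneg_pos)
 have du: "\<forall>\<^sub>F s in nhds 0. norm (u s - u 0 - s *\<^sub>R ?D (vec3 1 0 0)) <= e*abs s"
  using u' e0 unfolding has_vector_derivative_def has_derivative_at_alt eventually_nhds_metric
  by (auto simp: dist_real_def)
 have "\<forall>\<^sub>F t in nhds 0. norm (y t - y 0 - t *\<^sub>R f c P0) <= e*abs t"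
  using y' e0 unfolding has_vector_derivative_def has_derivative_at_alt eventually_nhds_metric
  by (auto simp: dist_real_def)
 then have dy: "\<forall>\<^sub>F s in nhds 0. norm (y (\<tau> s) - y 0 - \<tau> s *\<^sub>R f c P0) <= e*abs (\<tau> s)"
  by (rule eventually_compose_filterlim[OF _ \<tau>0])
 have "\<forall>\<^sub>F s in nhds 0. s = (0::real)" using du dy main small[OF e0]
 proof eventually_elim
  case (elim s)
  let ?v1 = "u s - u 0 - s *\<^sub>R ?D (vec3 1 0 0)" and ?v2 = "y (\<tau> s) - y 0 - \<tau> s *\<^sub>R f c P0"
  have eq: "s *\<^sub>R ?D (vec3 1 0 0) - \<tau> s *\<^sub>R f c P0 = (u s - y (\<tau> s)) - ?v1 + ?v2" by (simp add: uy)
  have "norm (u s - y (\<tau> s)) <= N*(e*abs s)"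
   using elim(3) mult_left_mono[OF elim(4) N0] by (simp add: u_def y_def)
  then have "norm (s *\<^sub>R ?D (vec3 1 0 0) - \<tau> s *\<^sub>R f c P0) <= N*(e*abs s) + e*abs s + e*abs (\<tau> s)"
   unfolding eq using elim(1,2) norm_triangle_ineq[of "(u s - y (\<tau> s)) - ?v1" ?v2] norm_triangle_ineq4[of "u s - y (\<tau> s)" ?v1]
   by linarith
  also have "... <= (N + 2)*e*(abs s + abs (\<tau> s))"
  proof -
   have "0 <= N*(e*abs (\<tau> s))" "0 <= e*abs s" "0 <= e*abs (\<tau> s)" using N0 e0 by simp_all
   then show ?thesis by (simp add: algebra_simps)
  qed
  finally have "M*norm (s *\<^sub>R ?D (vec3 1 0 0) - \<tau> s *\<^sub>R f c P0) <= M*((N + 2)*e*(abs s + abs (\<tau> s)))"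
   using M0 by (intro mult_left_mono) auto
  also have "... = B/4*(abs s + abs (\<tau> s))" using M0 N0 by (simp add: e_def)
  finally have "B*(abs s + abs (\<tau> s)) <= B/4*(abs s + abs (\<tau> s))" using lower[of s "\<tau> s"] by simp
  then have "(B*3/4)*(abs s + abs (\<tau> s)) <= 0" by (simp add: algebra_simps)
  then have "abs s + abs (\<tau> s) <= 0" using B(1) by (simp add: mult_le_0_iff)
  then show ?case by simp
 qed
 then obtain \<epsilon> where "0 < \<epsilon>" "!!s::real. abs s < \<epsilon> ==> s = 0"
  unfolding eventually_nhds_metric by (auto simp: dist_real_def)
 from this(1) this(2)[of "\<epsilon>/2"] show False by simp
qed

end

section \<open>Passage near the periodic orbit\<close>

context vector_field
begin

lemma orbit_flow: "q \<in> orbit \<phi> p ==> \<phi> t q \<in> orbit \<phi> p"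
 unfolding orbit_def by (auto simp: flow_add[symmetric])

text \<open>Orbit segments with a guaranteed minimal duration, so that infinitely many of them
  exhaust the time axis.\<close>

definition seg :: "'m set => 'm => 'm => real => bool" where
 "seg U p q c \<longleftrightarrow> (\<exists>t\<ge>c. \<phi> t p = q & (\<forall>s\<in>{0..t}. \<phi> s p \<in> U))"

lemma seg_trans:
 assumes "seg U p q a" "seg U q r b" "0 <= a" "0 <= b"
 shows "seg U p r (a + b)"
proof -
 obtain t where t: "a <= t" "\<phi> t p = q" "\<forall>s\<in>{0..t}. \<phi> s p \<in> U" using assms(1) unfolding seg_def by blast
 obtain t' where t': "b <= t'" "\<phi> t' q = r" "\<forall>s\<in>{0..t'}. \<phi> s q \<in> U" using assms(2) unfolding seg_def by blast
 have "\<phi> s p \<in> U" if s: "s \<in> {0..t + t'}" for s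
 proof (cases "s <= t")
  case True then show ?thesis using t(3) s by simp
 next
  case False
  have "\<phi> s p = \<phi> (s - t) q" using flow_add[of "s - t" t p] t(2) by simp
  then show ?thesis using t'(3) s False by simp
 qed
 moreover have "\<phi> (t + t') p = r" using flow_add[of t' t p] t(2) t'(2) by (simp add: add.commute)
 ultimately show ?thesis unfolding seg_def using t(1) t'(1) by (intro exI[of _ "t + t'"]) simp
qed

text \<open>Positive times are reached by concatenation. For negative times the point is written as
  an iterate of some point of \<open>K\<close> far enough in the past, which exists because
  \<open>R\<close> maps \<open>K\<close> onto itself.\<close>

lemma seg_saturation:
 assumes c: "0 < c" and seg: "!!x. x \<in> K ==> seg U (s x) (s (R x)) c" and R: "R ` K = K" and x: "x \<in> K"
 shows "\<phi> t (s x) \<in> U"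
proof -
 have RK: "(R ^^ n) y \<in> K" if "y \<in> K" for n y using that R by (induction n) auto
 have it: "seg U (s y) (s ((R ^^ n) y)) (real n*c)" if y: "y \<in> K" for n y
 proof (induction n)
  case 0
  obtain t where "c <= t" "\<forall>r\<in>{0..t}. \<phi> r (s y) \<in> U" using seg[OF y] unfolding seg_def by blast
  then have "\<phi> 0 (s y) \<in> U" using c by (auto simp del: flow_0)
  then show ?case unfolding seg_def by (intro exI[of _ 0]) auto
 next
  case (Suc n)
  have "seg U (s y) (s ((R ^^ Suc n) y)) (real n*c + c)"
   using seg_trans[OF Suc seg[OF RK[OF y, of n]]] c by simp
  then show ?case by (simp add: algebra_simps)
 qed
 have fw: "\<phi> t (s y) \<in> U" if y: "y \<in> K" and t: "0 <= t" for y t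
 proof -
  obtain n :: nat where n: "t/c <= real n" using real_arch_simple by blast
  then have "t <= real n*c" using c by (simp add: field_simps)
  moreover obtain t' where "real n*c <= t'" "\<forall>r\<in>{0..t'}. \<phi> r (s y) \<in> U" using it[OF y, of n] unfolding seg_def by blast
  ultimately show ?thesis using t by simp
 qed
 have pre: "\<exists>y\<in>K. (R ^^ n) y = x" for n
 proof (induction n)
  case 0 then show ?case using x by simp
 next
  case (Suc n)
  then obtain y where y: "y \<in> K" "(R ^^ n) y = x" by blast
  then have "y \<in> R ` K" using R by simp
  then obtain z where "z \<in> K" "R z = y" by blast
  moreover from this have "(R ^^ Suc n) z = x" using y(2) by (simp only: funpow_Suc_right comp_apply)
  ultimately show ?case by blast
 qed
 obtain n :: nat where n: "- t/c <= real n" using real_arch_simple by blast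
 then have n': "- t <= real n*c" using c by (simp add: field_simps)
 obtain y where y: "y \<in> K" "(R ^^ n) y = x" using pre by blast
 obtain t' where t': "real n*c <= t'" "\<phi> t' (s y) = s x" using it[OF y(1), of n] y(2) unfolding seg_def by blast
 have "\<phi> t (s x) = \<phi> (t + t') (s y)" by (simp add: flow_add t'(2))
 then show ?thesis using fw[OF y(1), of "t + t'"] t'(1) n' by simp
qed

text \<open>The travel time is continuous and positive at 0, so nearby it lies between half its
  value there and that value plus 1; \<open>flow_tube\<close> over this range keeps the segment in
  \<open>U\<close>.\<close>

lemma transition_seg:
 fixes T :: "real \<times> real => real"
 assumes r: "0 < r" and T: "continuous_on (ball 0 r) T" "0 < T 0" and tr: "!!w. w \<in> ball 0 r ==> \<phi> (T w) (s w) = s' (\<Psi> w)"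
  and s: "isCont s 0" and U: "open U" "orbit \<phi> (s 0) \<subseteq> U"
 shows "\<exists>e>0. \<forall>w. norm w < e --> seg U (s w) (s' (\<Psi> w)) (T 0/2)"
proof -
 have Tl: "(T \<longlongrightarrow> T 0) (nhds 0)"
  using T(1) r continuous_on_eq_continuous_at[of "ball 0 r" T] by (auto simp: isCont_def tendsto_nhds_iff)
 have sl: "(s \<longlongrightarrow> s 0) (nhds 0)" using s by (simp add: isCont_def tendsto_nhds_iff)
 have 1: "\<forall>\<^sub>F p in nhds (s 0). \<forall>t\<in>{0..T 0 + 1}. \<phi> t p \<in> U"
  by (rule flow_tube[OF U(1)]) (use U(2) in \<open>auto simp: orbit_def\<close>)
 have "\<forall>\<^sub>F w in nhds 0. w \<in> ball 0 r" by (rule eventually_nhds_in_open) (use r in auto)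
 moreover have "\<forall>\<^sub>F w in nhds 0. T 0/2 < T w" by (rule order_tendstoD[OF Tl]) (use T(2) in simp)
 moreover have "\<forall>\<^sub>F w in nhds 0. T w < T 0 + 1" by (rule order_tendstoD[OF Tl]) simp
 moreover have "\<forall>\<^sub>F w in nhds 0. \<forall>t\<in>{0..T 0 + 1}. \<phi> t (s w) \<in> U" by (rule eventually_compose_filterlim[OF 1 sl])
 ultimately have "\<forall>\<^sub>F w in nhds 0. seg U (s w) (s' (\<Psi> w)) (T 0/2)"
 proof eventually_elim
  case (elim w)
  then show ?case unfolding seg_def using tr[OF elim(1)] by (intro exI[of _ "T w"]) simp
 qed
 then show ?thesis unfolding eventually_nhds_metric by (simp add: dist_norm)
qed

end

lemma path_nbhd:
 fixes w :: "real => 'a::metric_space"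
 assumes "open S" "continuous_on {a..b} w" "!!t. t \<in> {a..b} ==> w t \<in> S"
 shows "\<exists>e>0. \<forall>t\<in>{a..b}. \<forall>x. dist x (w t) < e --> x \<in> S"
proof -
 have "compact (w ` {a..b})" by (rule compact_continuous_image[OF assms(2) compact_Icc])
 moreover have "w ` {a..b} \<subseteq> S" using assms(3) by blast
 ultimately obtain e where e: "0 < e" "(\<Union>x\<in>w ` {a..b}. ball x e) \<subseteq> S"
  using compact_subset_open_imp_ball_epsilon_subset[OF _ assms(1)] by metis
 have "x \<in> S" if "t \<in> {a..b}" "dist x (w t) < e" for t x
 proof -
  have "x \<in> (\<Union>y\<in>w ` {a..b}. ball y e)" using that by (auto simp: dist_commute)
  then show ?thesis using e(2) by blast
 qed
 then show ?thesis using e(1) by blast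
qed

section \<open>Explicit orbits near the periodic orbit\<close>

context tangency
begin

lemma coordP_periodic: "w \<in> tube ==> coordP d (w + vec3 (2*pi * of_int j) 0 0) = coordP d w"
proof -
 assume w: "w \<in> tube"
 then have "w + vec3 (2*pi * of_int j) 0 0 \<in> tube" by (simp add: tube_def)
 moreover have "adapted_P A f d" using tc by (simp add: tangency_cycle_def)
 ultimately show ?thesis using w unfolding adapted_P_def by metis
qed

lemma coordP_shift: "abs y <= 1 ==> abs z <= 1 ==> coordP d (vec3 (x + 2*pi * of_int j) y z) = coordP d (vec3 x y z)"
proof -
 assume "abs y <= 1" "abs z <= 1"
 moreover have "vec3 (x + 2*pi * of_int j) y z = vec3 x y z + vec3 (2*pi * of_int j) 0 0" by (simp add: vec_eq_iff forall_3)
 ultimately show ?thesis using coordP_periodic[OF vec3_tube[of y z x], of j] by simp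
qed

lemma perP_eq: "perP A f d = range (%\<psi>. coordP d (vec3 \<psi> 0 0))"
 and secPin_orbit: "secPin d (0, 0) \<in> orbit \<phi> (pt_EP d)" and secPout_orbit: "secPout d (0, 0) \<in> orbit \<phi> (pt_PE d)"
proof -
 have "adapted_P A f d" using tc by (simp add: tangency_cycle_def)
 then show "perP A f d = range (%\<psi>. coordP d (vec3 \<psi> 0 0))" "secPin d (0, 0) \<in> orbit \<phi> (pt_EP d)"
  "secPout d (0, 0) \<in> orbit \<phi> (pt_PE d)"
  unfolding adapted_P_def by blast+
qed

text \<open>Orbits in these coordinates are those of the linear flow at a different speed;
  \<open>T\<close> converts linear time into true time.\<close>

lemma P_flow:
 assumes L: "0 <= L" and y: "abs y <= 1" and z: "abs z*exp (etae d*L) <= 1"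
 shows "\<exists>T. T 0 = 0 & continuous_on {0..L} T &
  (\<forall>t\<in>{0..L}. 0 <= T t & \<phi> (T t) (coordP d (vec3 x y z)) = coordP d (vec3 (x + t) (y*exp (- (etac d*t))) (z*exp (etae d*t))))"
proof -
 obtain W h where P: "tube \<subseteq> W" "local_Ck_diffeo 2 A W (coordP d)"
  "!!w. w \<in> W ==> 0 < h w & represents A f (coordP d) w (h w *\<^sub>R vec3 1 (- etac d*w $ 2) (etae d*w $ 3))" by (rule P_data) blast
 let ?w = "%t. vec3 (x + t) (y*exp (- (etac d*t))) (z*exp (etae d*t))"
 let ?u = "%w::real^3. vec3 1 (- etac d*w $ 2) (etae d*w $ 3)"
 have "(?w has_vector_derivative ?u (?w t)) (at t)" for t
  by (rule vec3_has_vector_derivative) (auto intro!: derivative_eq_intros)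
 moreover have "?w t \<in> W" if t: "t \<in> {0..L}" for t
 proof -
  have "abs y*exp (- (etac d*t)) <= 1*1" using y t rates by (intro mult_mono) auto
  moreover have "abs z*exp (etae d*t) <= abs z*exp (etae d*L)" using t rates by (intro mult_left_mono) auto
  ultimately have "?w t \<in> tube" using z by (intro vec3_tube) (auto simp: abs_mult)
  then show ?thesis using P(1) by blast
 qed
 moreover have "continuous_on UNIV ?u" unfolding vec3_eq by (intro continuous_intros)
 moreover have "?u w ~= 0" for w
 proof
  assume "?u w = 0"
  then have "?u w $ 1 = 0" by simp
  then show False by simp
 qed
 ultimately have "\<exists>T. T 0 = 0 & continuous_on {0..L} T & (\<forall>t\<in>{0..L}. 0 <= T t & \<phi> (T t) (coordP d (?w 0)) = coordP d (?w t))"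
  by (intro flow_along[OF P(2) L _ _ _ _ P(3), of ?w]) auto
 then show ?thesis by simp
qed

lemma EP_leg: "0 <= t ==> coordP d (vec3 t (exp (- (etac d*t))) 0) \<in> orbit \<phi> (pt_EP d)"
proof -
 assume t: "0 <= t"
 obtain T where "\<forall>s\<in>{0..t}. 0 <= T s & \<phi> (T s) (coordP d (vec3 0 1 0))
   = coordP d (vec3 (0 + s) (1*exp (- (etac d * s))) (0*exp (etae d * s)))"
  using P_flow[of t 1 0 0] t by auto
 then have "\<phi> (T t) (secPin d (0, 0)) = coordP d (vec3 t (exp (- (etac d*t))) 0)" using t by simp
 then show ?thesis using orbit_flow[OF secPin_orbit, of "T t"] by simp
qed

lemma PE_leg: "0 <= t ==> coordP d (vec3 (- t) 0 (exp (- (etae d*t)))) \<in> orbit \<phi> (pt_PE d)"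
proof -
 assume t: "0 <= t"
 obtain T where "\<forall>s\<in>{0..t}. 0 <= T s & \<phi> (T s) (coordP d (vec3 (- t) 0 (exp (- (etae d*t)))))
   = coordP d (vec3 (- t + s) (0*exp (- (etac d * s))) (exp (- (etae d*t))*exp (etae d * s)))"
  using P_flow[of t 0 "exp (- (etae d*t))" "- t"] t by (auto simp: exp_add[symmetric])
 then have "\<phi> (T t) (coordP d (vec3 (- t) 0 (exp (- (etae d*t))))) = secPout d (0, 0)"
  using t by (simp add: exp_add[symmetric])
 then have "coordP d (vec3 (- t) 0 (exp (- (etae d*t)))) = \<phi> (- T t) (secPout d (0, 0))" by (metis flow_minus(1))
 then show ?thesis using orbit_flow[OF secPout_orbit] by simp
qed

text \<open>For linear time \<open>ts\<close> after the entry the orbit is close to the incoming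
  connection, for \<open>ts\<close> before the exit close to the outgoing one. In between both
  transverse coordinates are below \<open>\<eta>\<close>, which puts it close to the periodic
  orbit.\<close>

lemma P_passage:
 assumes U: "open U" "Gamma A f d \<subseteq> U"
 shows "\<exists>e>0. \<forall>\<psi> z s \<rho>. abs \<psi> < e & 0 < z & z < e & PiP d (\<psi>, z) = (s, \<rho>) & abs s < e & abs \<rho> < e -->
  seg U (secPin d (\<psi>, z)) (secPout d (s, \<rho>)) 0"
proof -
 obtain W where P: "tube \<subseteq> W" "local_Ck_diffeo 2 A W (coordP d)" by (rule P_data) blast
 have W: "open W" using P(2) by (simp add: local_Ck_diffeo_def)
 define S where "S = W \<inter> coordP d -` U"
 have S: "open S" unfolding S_def by (rule continuous_open_preimage[OF param_continuous_on[OF P(2) order_refl] W U(1)])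
 have S_U: "coordP d x \<in> U" if "x \<in> S" for x using that by (simp add: S_def)
 have mem: "vec3 x y z \<in> S" if "abs y <= 1" "abs z <= 1" "coordP d (vec3 x y z) \<in> Gamma A f d" for x y z
  using vec3_tube[OF that(1,2), of x] that(3) P(1) U(2) unfolding S_def by blast
 have "\<exists>e>0. \<forall>t\<in>{0..2*pi}. \<forall>x. dist x (vec3 t 0 0) < e --> x \<in> S"
 proof (rule path_nbhd[OF S])
  show "continuous_on {0..2*pi} (%t. vec3 t 0 0)" unfolding vec3_eq by (intro continuous_intros)
  show "vec3 t 0 0 \<in> S" for t by (rule mem) (auto simp: Gamma_def perP_eq)
 qed
 then obtain e3 where e3: "0 < e3" "!!t x. t \<in> {0..2*pi} ==> dist x (vec3 t 0 0) < e3 ==> x \<in> S" by blast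
 define \<eta> where "\<eta> = min 1 (e3/2)"
 have \<eta>: "0 < \<eta>" "\<eta> <= 1" "2*\<eta> <= e3" using e3(1) by (auto simp: \<eta>_def)
 have mid: "coordP d (vec3 x y z) \<in> U" if yz: "abs y < \<eta>" "abs z < \<eta>" for x y z
 proof -
  define j where "j = - \<lfloor>x/(2*pi)\<rfloor>"
  have j: "x + 2*pi * of_int j \<in> {0..2*pi}"
   using floor_divide_lower[of "2*pi" x] floor_divide_upper[of "2*pi" x] by (simp add: j_def algebra_simps)
  have "dist (vec3 (x + 2*pi * of_int j) y z) (vec3 (x + 2*pi * of_int j) 0 0) < e3"
   using norm_vec3_le[of 0 y z] yz \<eta>(3) by (simp add: dist_norm vec3_diff)
  then have "coordP d (vec3 (x + 2*pi * of_int j) y z) \<in> U" by (intro S_U e3(2)[OF j])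
  then show ?thesis using coordP_shift[of y z x j] yz \<eta>(2) by simp
 qed
 \<comment> \<open>From this time on both exponentials, in the contracting and in the expanding
   rate, are below \<open>\<eta>\<close>.\<close>
 define ts where "ts = max 0 (max (1 - ln \<eta>/etac d) (1 - ln \<eta>/etae d))"
 have ts0: "0 <= ts" by (simp add: ts_def)
 have decay: "exp (- (c*t)) < \<eta>" if "c \<in> {etac d, etae d}" "ts <= t" for c t
 proof -
  have c: "0 < c" using that(1) rates by auto
  have "1 - ln \<eta>/c <= t" using that by (auto simp: ts_def)
  then have "c*(1 - ln \<eta>/c) <= c*t" using c by (intro mult_left_mono) auto
  then have "c - ln \<eta> <= c*t" using c by (simp add: algebra_simps)
  then have "- (c*t) < ln \<eta>" using c by linarith
  then show ?thesis using \<eta>(1) by (metis exp_less_mono exp_ln)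
 qed
 have "\<exists>e>0. \<forall>t\<in>{0..ts}. \<forall>x. dist x (vec3 t (exp (- (etac d*t))) 0) < e --> x \<in> S"
 proof (rule path_nbhd[OF S])
  show "continuous_on {0..ts} (%t. vec3 t (exp (- (etac d*t))) 0)" unfolding vec3_eq by (intro continuous_intros)
  show "vec3 t (exp (- (etac d*t))) 0 \<in> S" if "t \<in> {0..ts}" for t
   by (rule mem) (use that rates EP_leg[of t] in \<open>auto simp: Gamma_def\<close>)
 qed
 then obtain e1 where e1: "0 < e1" "!!t x. t \<in> {0..ts} ==> dist x (vec3 t (exp (- (etac d*t))) 0) < e1 ==> x \<in> S" by blast
 have "\<exists>e>0. \<forall>t\<in>{0..ts}. \<forall>x. dist x (vec3 (- t) 0 (exp (- (etae d*t)))) < e --> x \<in> S"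
 proof (rule path_nbhd[OF S])
  show "continuous_on {0..ts} (%t. vec3 (- t) 0 (exp (- (etae d*t))))" unfolding vec3_eq by (intro continuous_intros)
  show "vec3 (- t) 0 (exp (- (etae d*t))) \<in> S" if "t \<in> {0..ts}" for t
   by (rule mem) (use that rates PE_leg[of t] in \<open>auto simp: Gamma_def\<close>)
 qed
 then obtain e2 where e2: "0 < e2" "!!t x. t \<in> {0..ts} ==> dist x (vec3 (- t) 0 (exp (- (etae d*t)))) < e2 ==> x \<in> S" by blast
 \<comment> \<open>The largest factor by which an initial error in \<open>z\<close>, or a final one
   in \<open>\<rho>\<close> followed backwards, can grow within the time \<open>ts\<close>.\<close>
 define Q where "Q = 1 + exp (etae d*ts) + exp (etac d*ts)"
 have Q: "1 <= Q" "exp (etae d*ts) <= Q" "exp (etac d*ts) <= Q" by (simp_all add: Q_def add_nonneg_nonneg)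
 define e where "e = min 1 (min e1 e2/(2*Q))"
 have e: "0 < e" "e <= 1" using e1(1) e2(1) Q(1) by (auto simp: e_def)
 have "e <= min e1 e2/(2*Q)" by (simp add: e_def)
 then have "e*(2*Q) <= min e1 e2" using Q(1) by (simp add: pos_le_divide_eq)
 then have eQ: "2*(e*Q) <= e1" "2*(e*Q) <= e2" by linarith+
 have eQ': "e*1 <= e*Q" using e(1) Q(1) by (intro mult_left_mono) auto
 have "seg U (secPin d (\<psi>, z)) (secPout d (s, \<rho>)) 0"
  if \<psi>: "abs \<psi> < e" and z: "0 < z" "z < e" and s: "PiP d (\<psi>, z) = (s, \<rho>)" "abs s < e" "abs \<rho> < e" for \<psi> z s \<rho>
 proof -
  \<comment> \<open>The linear time needed to rise from height \<open>z\<close> to the section at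
    height 1.\<close>
  define L where "L = - ln z/etae d"
  have "ln z <= 0" using z e by simp
  then have L: "0 <= L" using divide_nonpos_pos[of "ln z" "etae d"] rates by (simp add: L_def)
  have lz: "ln z = - (etae d*L)" using rates by (simp add: L_def)
  have zL: "z*exp (etae d*L) = 1" using z(1) lz by (metis exp_ln exp_minus_inverse mult.commute minus_minus exp_minus)
  define k where "k = round ((\<psi> - ln z/etae d)/(2*pi))"
  have sk: "\<psi> + L = s + 2*pi * of_int k" using s(1) by (simp add: k_def L_def Let_def)
  have \<rho>L: "\<rho> = exp (- (etac d*L))"
  proof -
   have "\<rho> = z powr deltaP d" using s(1) by (simp add: Let_def)
   also have "... = exp (deltaP d*ln z)" using z(1) by (simp add: powr_def)
   finally show ?thesis using rates by (simp add: deltaP_def L_def)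
  qed
  define w where "w t = vec3 (\<psi> + t) (exp (- (etac d*t))) (z*exp (etae d*t))" for t
  obtain T where T: "T 0 = 0" "continuous_on {0..L} T" "!!t. t \<in> {0..L} ==> 0 <= T t & \<phi> (T t) (secPin d (\<psi>, z)) = coordP d (w t)"
   using P_flow[OF L, of 1 z \<psi>] zL z(1) by (auto simp: w_def)
  have wL: "coordP d (w L) = secPout d (s, \<rho>)"
   using coordP_shift[of \<rho> 1 s k] L rates by (simp add: w_def sk zL \<rho>L)
  have wU: "coordP d (w t) \<in> U" if t: "t \<in> {0..L}" for t
  proof -
   consider "t <= ts" | "L - ts <= t" | "ts <= t" "t <= L - ts" by linarith
   then show ?thesis
   proof cases
    case 1
    have "z*exp (etae d*t) <= e*Q"
     using z 1 rates Q(2) e by (intro mult_mono) (auto intro: order_trans[rotated])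
    then have "dist (w t) (vec3 t (exp (- (etac d*t))) 0) < e1"
     using norm_vec3_le[of \<psi> 0 "z*exp (etae d*t)"] \<psi> eQ(1) eQ' z(1) by (simp add: dist_norm vec3_diff w_def)
    then show ?thesis using e1(2)[of t] t 1 by (intro S_U) auto
   next
    case 2
    \<comment> \<open>Time counted backwards from the exit; in it \<open>\<rho>\<close> grows and
      the height decays.\<close>
    define r where "r = L - t"
    have r: "r \<in> {0..ts}" using t 2 by (auto simp: r_def)
    have ye: "exp (- (etac d*t)) = \<rho>*exp (etac d*r)" by (simp add: \<rho>L r_def algebra_simps exp_add[symmetric])
    have ze: "z*exp (etae d*t) = exp (- (etae d*r))"
    proof -
     have "z*exp (etae d*t) = exp (- (etae d*L))*exp (etae d*t)" using lz z(1) by (metis exp_ln)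
     then show ?thesis by (simp add: r_def algebra_simps exp_add[symmetric])
    qed
    have "abs \<rho>*exp (etac d*r) <= e*Q"
     using s(3) r rates Q(3) e by (intro mult_mono) (auto intro: order_trans[rotated])
    then have y1: "exp (- (etac d*t)) <= e*Q" unfolding ye using \<rho>L by simp
    have "dist (vec3 (s - r) (exp (- (etac d*t))) (exp (- (etae d*r)))) (vec3 (- r) 0 (exp (- (etae d*r)))) < e2"
     using norm_vec3_le[of s "exp (- (etac d*t))" 0] s(2) eQ(2) eQ' y1 by (simp add: dist_norm vec3_diff)
    then have "coordP d (vec3 (s - r) (exp (- (etac d*t))) (exp (- (etae d*r)))) \<in> U" using e2(2)[OF r] by (intro S_U) auto
    moreover have "w t = vec3 ((s - r) + 2*pi * of_int k) (exp (- (etac d*t))) (exp (- (etae d*r)))"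
    proof -
     have "\<psi> + t = (s - r) + 2*pi * of_int k" using sk by (simp add: r_def)
     then show ?thesis by (simp add: w_def ze)
    qed
    ultimately show ?thesis using coordP_shift[of "exp (- (etac d*t))" "exp (- (etae d*r))" "s - r" k] t r rates by simp
   next
    case 3
    have "z*exp (etae d*t) = exp (- (etae d*L))*exp (etae d*t)" using lz z(1) by (metis exp_ln)
    then have "z*exp (etae d*t) = exp (- (etae d*(L - t)))" by (simp add: algebra_simps exp_add[symmetric])
    then show ?thesis unfolding w_def using decay[of "etac d" t] decay[of "etae d" "L - t"] 3 by (intro mid) auto
   qed
  qed
  have "\<phi> r (secPin d (\<psi>, z)) \<in> U" if r: "r \<in> {0..T L}" for r
  proof -
   \<comment> \<open>By the intermediate value theorem every true time up to the exit is a value of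
     \<open>T\<close>.\<close>
   obtain t where t: "t \<in> {0..L}" "T t = r"
    using IVT'[of T 0 r L] T(1,2) r L by auto
   then show ?thesis using T(3)[OF t(1)] wU[OF t(1)] by simp
  qed
  then show ?thesis unfolding seg_def using T(3)[of L] L wL by (intro exI[of _ "T L"]) simp
 qed
 then show ?thesis using e(1) by blast
qed

end

section \<open>Passage near the equilibrium\<close>

text \<open>The hypothesis says that \<open>g t*exp (- (c*t))\<close> is nondecreasing.\<close>

lemma exp_growth:
 fixes g :: "real => real"
 assumes d: "!!t. 0 <= t ==> (g has_real_derivative g' t) (at t)" "!!t. 0 <= t ==> c*g t <= g' t" and t: "0 <= t"
 shows "g 0*exp (c*t) <= g t"
proof -
 have "g 0*exp (- (c*0)) <= g t*exp (- (c*t))"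
 proof (rule DERIV_nonneg_imp_nondecreasing[OF t])
  fix x :: real assume x: "0 <= x"
  have "((%t. g t*exp (- (c*t))) has_real_derivative (g' x - c*g x)*exp (- (c*x))) (at x)"
   by (rule derivative_eq_intros d(1)[OF x] refl | simp add: algebra_simps)+
  then show "\<exists>y. ((%t. g t*exp (- (c*t))) has_real_derivative y) (at x) & 0 <= y"
   using d(2)[OF x] by (intro exI conjI) auto
 qed
 then have "g 0*exp (c*t) <= g t*exp (- (c*t))*exp (c*t)" by (simp add: mult_right_mono)
 then show ?thesis by (simp add: mult.assoc exp_add[symmetric])
qed

text \<open>A vector field that is, up to a small Lipschitz error, linear with a one-dimensional unstable direction;
 \<open>bsol\<close> are its solutions that stay in the ball for all negative times, run backwards.\<close>

locale saddle_field =
 fixes G :: "real^3 => real^3" and l1 l2 mu m \<epsilon> r :: real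
 assumes m: "0 < m" "m <= l1" "m <= l2" "m <= mu" and eps: "0 <= \<epsilon>" "4*\<epsilon> <= m" and r: "0 < r" and G0: "G 0 = 0"
  and est: "!!x y. norm x <= r ==> norm y <= r ==>
   norm (G x - G y - vec3 (- l1*(x - y) $ 1) (- l2*(x - y) $ 2) (mu*(x - y) $ 3)) <= \<epsilon>*norm (x - y)"
begin

definition bsol :: "(real => real^3) => bool" where
 "bsol X \<longleftrightarrow> (\<forall>t\<ge>0. norm (X t) <= r & (X has_vector_derivative - G (X t)) (at t))"

lemma bsol_shift: "bsol X ==> 0 <= s ==> bsol (%t. X (t + s))"
 unfolding bsol_def
proof (intro allI impI conjI)
 fix t :: real assume X: "\<forall>t\<ge>0. norm (X t) <= r & (X has_vector_derivative - G (X t)) (at t)" and s: "0 <= s" "0 <= t"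
 then show "norm (X (t + s)) <= r" by simp
 have "((%t. t + s) has_vector_derivative 1) (at t)" by (auto intro!: derivative_eq_intros)
 moreover have "(X has_vector_derivative - G (X (t + s))) (at (t + s))" using X s by simp
 ultimately show "((%t. X (t + s)) has_vector_derivative - G (X (t + s))) (at t)"
  using vector_diff_chain_at[of "%t. t + s" 1 t X] by (simp add: o_def)
qed

lemma bsol_0: "bsol (%_. 0)"
 using r by (simp add: bsol_def G0)

lemma bsol_component: "bsol X ==> 0 <= t ==> ((%t. X t $ i) has_real_derivative - (G (X t) $ i)) (at t)"
proof -
 assume "bsol X" "0 <= t"
 then have "(X has_vector_derivative - G (X t)) (at t)" by (simp add: bsol_def)
 from bounded_linear.has_vector_derivative[OF bounded_linear_vec_nth this, of i]
 show ?thesis by (simp add: has_real_derivative_iff_has_vector_derivative)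
qed

lemma norm_sq3: "(norm x)\<^sup>2 = (x $ 1)\<^sup>2 + (x $ 2)\<^sup>2 + (x $ 3)\<^sup>2" for x :: "real^3"
 by (simp add: norm_eq_sqrt_inner inner_vec_def sum_3 power2_eq_square)

text \<open>For the difference of two solutions let \<open>V\<close> be the squared stable part
  minus the squared unstable part. In backward time its derivative is at least \<open>m*V\<close>,
  so a positive \<open>V\<close> would grow beyond all bounds, while both solutions stay in the
  ball.\<close>

lemma cone:
 assumes X: "bsol X" and Y: "bsol Y"
 shows "((X 0 - Y 0) $ 1)\<^sup>2 + ((X 0 - Y 0) $ 2)\<^sup>2 <= ((X 0 - Y 0) $ 3)\<^sup>2"
proof -
 define D where "D t = X t - Y t" for t
 define V where "V t = (D t $ 1)\<^sup>2 + (D t $ 2)\<^sup>2 - (D t $ 3)\<^sup>2" for t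
 define D' where "D' t = G (Y t) - G (X t)" for t
 have dD: "((%t. D t $ i) has_real_derivative D' t $ i) (at t)" if "0 <= t" for t i
  using DERIV_diff[OF bsol_component[OF X that, of i] bsol_component[OF Y that, of i]] by (simp add: D_def D'_def)
 have dV: "(V has_real_derivative 2*(D t $ 1*D' t $ 1 + D t $ 2*D' t $ 2 - D t $ 3*D' t $ 3)) (at t)" if "0 <= t" for t
  unfolding V_def[abs_def]
  by (rule derivative_eq_intros dD[OF that] refl | simp add: algebra_simps)+
 have VD: "V t <= (norm (D t))\<^sup>2" for t by (simp add: V_def norm_sq3)
 have grow: "m*V t <= 2*(D t $ 1*D' t $ 1 + D t $ 2*D' t $ 2 - D t $ 3*D' t $ 3)" if t: "0 <= t" for t
 proof -
  define R where "R = G (X t) - G (Y t) - vec3 (- l1*D t $ 1) (- l2*D t $ 2) (mu*D t $ 3)"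
  have R: "norm R <= \<epsilon>*norm (D t)" unfolding R_def D_def by (rule est) (use X Y t in \<open>auto simp: bsol_def\<close>)
  have "D' t = - R - vec3 (- l1*D t $ 1) (- l2*D t $ 2) (mu*D t $ 3)" by (simp add: R_def D'_def)
  then have D': "D' t $ 1 = l1*D t $ 1 - R $ 1" "D' t $ 2 = l2*D t $ 2 - R $ 2" "D' t $ 3 = - mu*D t $ 3 - R $ 3"
   by simp_all
  have "D t $ 1*R $ 1 + D t $ 2*R $ 2 - D t $ 3*R $ 3 = vec3 (D t $ 1) (D t $ 2) (- D t $ 3) \<bullet> R"
   by (simp add: inner_vec_def sum_3)
  also have "... <= norm (vec3 (D t $ 1) (D t $ 2) (- D t $ 3))*norm R" by (rule norm_cauchy_schwarz)
  also have "norm (vec3 (D t $ 1) (D t $ 2) (- D t $ 3)) = norm (D t)"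
   by (simp add: norm_eq_sqrt_inner inner_vec_def sum_3)
  also have "norm (D t)*norm R <= norm (D t)*(\<epsilon>*norm (D t))" using R by (intro mult_left_mono) auto
  finally have cs: "D t $ 1*R $ 1 + D t $ 2*R $ 2 - D t $ 3*R $ 3 <= \<epsilon>*(norm (D t))\<^sup>2"
   by (simp add: power2_eq_square mult.left_commute)
  have "m*(norm (D t))\<^sup>2 <= l1*(D t $ 1)\<^sup>2 + l2*(D t $ 2)\<^sup>2 + mu*(D t $ 3)\<^sup>2"
   using m unfolding norm_sq3 distrib_left by (intro add_mono mult_right_mono) auto
  moreover have "4*(\<epsilon>*(norm (D t))\<^sup>2) <= m*(norm (D t))\<^sup>2" using mult_right_mono[OF eps(2), of "(norm (D t))\<^sup>2"] by simp
  moreover have "m*V t <= m*(norm (D t))\<^sup>2" using VD m(1) by (intro mult_left_mono) auto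
  moreover have P: "D t $ 1*D' t $ 1 + D t $ 2*D' t $ 2 - D t $ 3*D' t $ 3
    = (l1*(D t $ 1)\<^sup>2 + l2*(D t $ 2)\<^sup>2 + mu*(D t $ 3)\<^sup>2) - (D t $ 1*R $ 1 + D t $ 2*R $ 2 - D t $ 3*R $ 3)"
   unfolding D' by (simp add: power2_eq_square algebra_simps)
  moreover have "0 <= m*(norm (D t))\<^sup>2" using m(1) by simp
  moreover have "v <= 2*(a - b)" if "k <= a" "4*e <= k" "v <= k" "0 <= k" "b <= e" for k a e v b :: real
   using that by (simp add: algebra_simps)
  ultimately show ?thesis using cs unfolding P by blast
 qed
 have bound: "V t <= (2*r)\<^sup>2" if "0 <= t" for t
 proof -
  have "norm (X t) <= r" "norm (Y t) <= r" using X Y that by (simp_all add: bsol_def)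
  then have "norm (D t) <= 2*r" using norm_triangle_ineq4[of "X t" "Y t"] unfolding D_def by linarith
  then have "(norm (D t))\<^sup>2 <= (2*r)\<^sup>2" by (intro power_mono) auto
  then show ?thesis using VD[of t] by linarith
 qed
 have "V 0 <= 0"
 proof (rule ccontr)
  assume "\<not> V 0 <= 0"
  then have V0: "0 < V 0" by simp
  \<comment> \<open>Chosen so that already the linear minorant \<open>1 + m*t\<close> of the
    exponential carries \<open>V\<close> above its bound \<open>(2*r)\<^sup>2\<close>.\<close>
  define t where "t = ((2*r)\<^sup>2/V 0)/m"
  have t: "0 <= t" using V0 m(1) by (simp add: t_def)
  have "V 0*exp (m*t) <= V t" by (rule exp_growth[OF dV grow t])
  moreover have "V 0*(1 + m*t) <= V 0*exp (m*t)" using V0 exp_ge_add_one_self[of "m*t"] by (intro mult_left_mono) auto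
  moreover have "V 0*(1 + m*t) = V 0 + (2*r)\<^sup>2" using V0 m(1) by (simp add: t_def field_simps)
  ultimately show False using bound[OF t] V0 by linarith
 qed
 then show ?thesis by (simp add: V_def D_def)
qed

text \<open>By \<open>cone\<close> against the zero solution the third coordinate dominates the
  others, so the perturbation in its equation is at most half of the linear rate.\<close>

lemma decay:
 assumes X: "bsol X" and t: "0 <= t"
 shows "(X t $ 3)\<^sup>2 <= (X 0 $ 3)\<^sup>2*exp (- (m*t))"
proof -
 have "(%t. - (X t $ 3)\<^sup>2) 0*exp (- m*t) <= (%t. - (X t $ 3)\<^sup>2) t"
 proof (rule exp_growth[OF _ _ t])
  fix t :: real assume t: "0 <= t"
  show "((%t. - (X t $ 3)\<^sup>2) has_real_derivative 2*(X t $ 3*G (X t) $ 3)) (at t)"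
   by (rule derivative_eq_intros bsol_component[OF X t] refl | simp)+
  have c: "(X t $ 1)\<^sup>2 + (X t $ 2)\<^sup>2 <= (X t $ 3)\<^sup>2" using cone[OF bsol_shift[OF X t] bsol_0] by simp
  then have "(norm (X t))\<^sup>2 <= 2*(X t $ 3)\<^sup>2" by (simp add: norm_sq3)
  also have "... <= (2*abs (X t $ 3))\<^sup>2" by (simp add: power_mult_distrib)
  finally have n: "norm (X t) <= 2*abs (X t $ 3)" by (rule power2_le_imp_le) simp
  define R where "R = G (X t) - vec3 (- l1*X t $ 1) (- l2*X t $ 2) (mu*X t $ 3)"
  have "norm (X t) <= r" using X t by (simp add: bsol_def)
  then have "norm R <= \<epsilon>*norm (X t)" using est[of "X t" 0] r by (simp add: R_def G0)
  also have "... <= \<epsilon>*(2*abs (X t $ 3))" using n eps by (intro mult_left_mono) auto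
  also have "... <= m/2*abs (X t $ 3)" using mult_right_mono[OF eps(2), of "abs (X t $ 3)"] by simp
  finally have R3: "abs (R $ 3) <= m/2*abs (X t $ 3)" using component_le_norm_cart[of R 3] by linarith
  have "- (X t $ 3*R $ 3) <= abs (X t $ 3)*abs (R $ 3)" using abs_ge_minus_self[of "X t $ 3*R $ 3"] by (simp add: abs_mult)
  also have "... <= abs (X t $ 3)*(m/2*abs (X t $ 3))" using R3 by (intro mult_left_mono) auto
  also have "... = m/2*(X t $ 3)\<^sup>2" by (simp add: power2_eq_square)
  finally have "- (X t $ 3*R $ 3) <= m/2*(X t $ 3)\<^sup>2" .
  moreover have "X t $ 3*G (X t) $ 3 = mu*(X t $ 3)\<^sup>2 + X t $ 3*R $ 3" by (simp add: R_def power2_eq_square algebra_simps)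
  moreover have "m*(X t $ 3)\<^sup>2 <= mu*(X t $ 3)\<^sup>2" using m by (intro mult_right_mono) auto
  moreover have "0 <= m*(X t $ 3)\<^sup>2" using m by simp
  ultimately show "- m * - (X t $ 3)\<^sup>2 <= 2*(X t $ 3*G (X t) $ 3)" by simp
 qed
 then show ?thesis by simp
qed

text \<open>By \<open>decay\<close> the height of the upper solution falls to that of the lower one;
  at equal height \<open>cone\<close> forces the two points to coincide.\<close>

lemma meet:
 assumes X: "bsol X" and Y: "bsol Y" and le: "0 < X 0 $ 3" "X 0 $ 3 <= Y 0 $ 3"
 shows "\<exists>s\<ge>0. Y s = X 0"
proof -
 let ?x = "X 0 $ 3" and ?y = "Y 0 $ 3"
 define t where "t = (?y\<^sup>2 / ?x\<^sup>2)/m"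
 have t: "0 <= t" using m by (simp add: t_def)
 have mt: "?x\<^sup>2*(1 + m*t) = ?x\<^sup>2 + ?y\<^sup>2" using le m by (simp add: t_def field_simps)
 have "(Y t $ 3)\<^sup>2*exp (m*t) <= ?y\<^sup>2*exp (- (m*t))*exp (m*t)" by (intro mult_right_mono decay[OF Y t]) simp
 then have 1: "(Y t $ 3)\<^sup>2*exp (m*t) <= ?y\<^sup>2" by (simp add: mult.assoc exp_add[symmetric])
 have "Y t $ 3 <= ?x"
 proof (rule ccontr)
  assume "\<not> Y t $ 3 <= ?x"
  then have "?x\<^sup>2 <= (Y t $ 3)\<^sup>2" using le(1) by (intro power_mono) auto
  then have "?x\<^sup>2*(1 + m*t) <= (Y t $ 3)\<^sup>2*exp (m*t)"
   using exp_ge_add_one_self[of "m*t"] m t by (intro mult_mono) auto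
  moreover have "0 < ?x\<^sup>2" using le(1) by simp
  ultimately show False using 1 mt by linarith
 qed
 moreover have "\<forall>s. 0 <= s & s <= t --> isCont (%s. Y s $ 3) s"
  using DERIV_isCont[OF bsol_component[OF Y]] by blast
 ultimately obtain s where s: "0 <= s" "s <= t" "Y s $ 3 = ?x" using IVT2[of "%s. Y s $ 3" t ?x 0] le(2) t by auto
 have "((X 0 - Y (0 + s)) $ 1)\<^sup>2 + ((X 0 - Y (0 + s)) $ 2)\<^sup>2 <= ((X 0 - Y (0 + s)) $ 3)\<^sup>2"
  by (rule cone[OF X bsol_shift[OF Y s(1)]])
 then have "((X 0 - Y s) $ 1)\<^sup>2 + ((X 0 - Y s) $ 2)\<^sup>2 <= 0" using s(3) by simp
 then have "(norm (X 0 - Y s))\<^sup>2 <= 0" using s(3) by (simp add: norm_sq3)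
 then have "Y s = X 0" by simp
 then show ?thesis using s(1) by blast
qed

end

section \<open>The cube around the equilibrium and its local unstable curve\<close>

context tangency
begin

lemma E_fixed: "\<phi> t (equil d) = equil d"
proof (rule flow_equilibrium)
 fix c assume "c \<in> A" "equil d \<in> fst c"
 moreover have "hyperbolic_saddle A f (equil d) (lam1 d) (lam2 d) (mu d)" using tc by (simp add: tangency_cycle_def H1_def)
 ultimately show "f c (equil d) = 0" unfolding hyperbolic_saddle_def by blast
qed

lemma coordE_inj: "w \<in> cube ==> w' \<in> cube ==> coordE d w = coordE d w' ==> w = w'"
 by (rule E_data) (erule inj_onD, assumption, (erule (1) subsetD)+)

lemma coordE_0: "coordE d 0 = equil d"
 by (rule E_data)

lemma axis_orbit: "0 < s ==> s <= 1 ==> coordE d (vec3 0 0 s) \<in> orbit \<phi> (pt_EP d)"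
proof -
 have "adapted_E A f d" using tc by (simp add: tangency_cycle_def)
 then have "\<forall>s\<in>{0<..1}. coordE d (vec3 0 0 s) \<in> orbit \<phi> (pt_EP d)" unfolding adapted_E_def by blast
 then show "0 < s ==> s <= 1 ==> coordE d (vec3 0 0 s) \<in> orbit \<phi> (pt_EP d)" by simp
qed

lemma cube_stable: "(\<forall>t\<ge>0. \<phi> t p \<in> coordE d ` cube) \<longleftrightarrow> p \<in> coordE d ` {w \<in> cube. w $ 3 = 0}"
proof -
 have "adapted_E A f d" using tc by (simp add: tangency_cycle_def)
 then have "{p. \<forall>t\<ge>0. \<phi> t p \<in> coordE d ` cube} = coordE d ` {w \<in> cube. w $ 3 = 0}" unfolding adapted_E_def by blast
 then show ?thesis by blast
qed

text \<open>An orbit through \<open>E\<close> is stationary. For the connection this contradicts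
  injectivity of \<open>coordE\<close> on the axis; for \<open>P\<close> it would identify angles
  that differ by 1, which is no multiple of \<open>2*pi\<close>.\<close>

lemma E_not_in_orbits: "equil d \<notin> orbit \<phi> (pt_EP d)" "equil d \<notin> perP A f d"
proof -
 show "equil d \<notin> orbit \<phi> (pt_EP d)"
 proof
  assume "equil d \<in> orbit \<phi> (pt_EP d)"
  then obtain a where a: "equil d = \<phi> a (pt_EP d)" by (auto simp: orbit_def)
  then have "pt_EP d = equil d" using E_fixed[of "- a"] by (metis flow_minus(1))
  then have "coordE d (vec3 0 0 1) = coordE d 0" using axis_orbit[of 1] E_fixed by (auto simp: orbit_def coordE_0)
  moreover have "vec3 0 0 1 \<in> cube" "0 \<in> cube" by (simp_all add: cube_def forall_3)
  ultimately have "vec3 0 0 1 = (0 :: real^3)" by (intro coordE_inj)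
  then have "vec3 0 0 1 $ 3 = (0 :: real^3) $ 3" by simp
  then show False by simp
 qed
 show "equil d \<notin> perP A f d"
 proof
  assume "equil d \<in> perP A f d"
  then obtain a where a: "equil d = \<phi> a (per_pt d)" by (auto simp: orbit_def perP_def)
  then have "per_pt d = equil d" using E_fixed[of "- a"] by (metis flow_minus(1))
  then have "perP A f d = {equil d}" using E_fixed by (auto simp: perP_def orbit_def)
  then have e: "coordP d (vec3 0 0 0) = coordP d (vec3 1 0 0)" unfolding perP_eq by (metis rangeI singletonD)
  have "adapted_P A f d" using tc by (simp add: tangency_cycle_def)
  then have "\<forall>w\<in>tube. \<forall>w'\<in>tube. coordP d w = coordP d w' \<longleftrightarrow> (\<exists>j::int. w' = w + vec3 (2*pi * of_int j) 0 0)"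
   unfolding adapted_P_def by blast
  then obtain j :: int where "vec3 1 0 0 = vec3 0 0 0 + vec3 (2*pi * of_int j) 0 (0::real)"
   using e vec3_tube[of 0 0] by (metis abs_0 zero_le_one)
  then have "vec3 1 0 0 $ 1 = (vec3 0 0 0 + vec3 (2*pi * of_int j) 0 (0::real)) $ 1" by simp
  then have j: "2*pi * of_int j = 1" by simp
  then have "0 < (of_int j :: real)" by (metis mult_pos_pos pi_gt_zero zero_less_mult_pos zero_less_numeral zero_less_one)
  then have "1 <= (of_int j :: real)" by simp
  then have "2*pi*1 <= 2*pi * of_int j" by (intro mult_left_mono) auto
  then show False using j pi_gt3 by simp
 qed
qed

lemma perP_compact: "compact (perP A f d)"
proof -
 have "perP A f d = (%\<psi>. coordP d (vec3 \<psi> 0 0)) ` {0..2*pi}"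
 proof (intro subset_antisym subsetI)
  fix p assume "p \<in> perP A f d"
  then obtain x where x: "p = coordP d (vec3 x 0 0)" unfolding perP_eq by blast
  define j where "j = - \<lfloor>x/(2*pi)\<rfloor>"
  have "x + 2*pi * of_int j \<in> {0..2*pi}"
   using floor_divide_lower[of "2*pi" x] floor_divide_upper[of "2*pi" x] by (simp add: j_def algebra_simps)
  moreover have "p = coordP d (vec3 (x + 2*pi * of_int j) 0 0)" using coordP_shift[of 0 0 x j] x by simp
  ultimately show "p \<in> (%\<psi>. coordP d (vec3 \<psi> 0 0)) ` {0..2*pi}" by blast
 qed (auto simp: perP_eq)
 moreover have "continuous_on {0..2*pi} (%\<psi>. coordP d (vec3 \<psi> 0 0))"
 proof (rule continuous_at_imp_continuous_on, rule ballI)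
  fix x :: real
  have "isCont (%x. vec3 x 0 0) x" unfolding vec3_eq by (intro continuous_intros)
  moreover have "isCont (coordP d) (vec3 x 0 0)" by (rule isCont_coordP[OF vec3_tube]) simp_all
  ultimately show "isCont (%\<psi>. coordP d (vec3 \<psi> 0 0)) x" by (rule isCont_o2)
 qed
 ultimately show ?thesis using compact_continuous_image[OF _ compact_Icc] by metis
qed

lemma cube_compact: "compact cube"
proof -
 have e: "cube = cbox (vec3 (-1) (-1) (-1)) (vec3 1 1 1)"
  by (auto simp: cube_def mem_box_cart forall_3 abs_le_iff)
 show ?thesis unfolding e by (rule compact_cbox)
qed

lemma coordE_image_closed: "closed C ==> closed (coordE d ` (cube \<inter> C))" "closed C ==> compact (coordE d ` (cube \<inter> C))"
proof -
 assume C: "closed C"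
 have "continuous_on (cube \<inter> C) (coordE d)"
  using isCont_coordE by (blast intro: continuous_at_imp_continuous_on)
 then show "compact (coordE d ` (cube \<inter> C))" by (intro compact_continuous_image compact_Int_closed cube_compact C)
 then show "closed (coordE d ` (cube \<inter> C))" by (rule compact_imp_closed)
qed

text \<open>\<open>S\<close> is the inverse of the derivative \<open>Di\<close> of \<open>coordE\<close> at \<open>E\<close>; only \<open>Di\<close>, not \<open>coordE\<close> itself, is used to
 transport the vector field, which therefore remains \<open>C\<^sup>1\<close>.\<close>

definition saddle_chart :: "'m chart => (real^3 => real^3) => (real^3 => real^3) => bool" where
 "saddle_chart c Di S \<longleftrightarrow> c \<in> A & equil d \<in> fst c & linear Di & linear S & (\<forall>x. S (Di x) = x) & (\<forall>x. Di (S x) = x) &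
  F c (snd c (equil d)) = 0 &
  (\<forall>e>0. \<exists>r>0. (\<forall>x. norm x <= r --> snd c (equil d) + Di x \<in> snd c ` fst c) &
    (\<forall>x y. norm x <= r --> norm y <= r --> norm (S (F c (snd c (equil d) + Di x)) - S (F c (snd c (equil d) + Di y)) -
     vec3 (- lam1 d*(x - y) $ 1) (- lam2 d*(x - y) $ 2) (mu d*(x - y) $ 3)) <= e*norm (x - y))) &
  (\<forall>e>0. \<exists>r>0. \<forall>w. norm w < r --> norm (S (snd c (coordE d w) - snd c (equil d)) - w) <= e*norm w)"

text \<open>In the coordinates \<open>coordE\<close> the field \<open>g\<close> is given only as
  differentiable at 0. Computing the derivative of the chart field along
  \<open>t *\<^sub>R v\<close> in two ways shows that \<open>Di\<close> conjugates the prescribed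
  diagonal matrix to the derivative of that field; strict differentiability of the smooth chart
  field then gives the estimate.\<close>

lemma E_chart: "\<exists>c Di S. saddle_chart c Di S"
proof -
 obtain W g where E: "cube \<subseteq> W" "local_Ck_diffeo 2 A W (coordE d)" "inj_on (coordE d) W" "coordE d 0 = equil d"
  "!!w. w \<in> W ==> represents A f (coordE d) w (g w)"
  "(g has_derivative (%v. vec3 (- lam1 d * v $ 1) (- lam2 d * v $ 2) (mu d * v $ 3))) (at 0)" by (rule E_data) blast
 let ?L = "%v. vec3 (- lam1 d * v $ 1) (- lam2 d * v $ 2) (mu d * v $ 3)"
 obtain c where c: "c \<in> A" "equil d \<in> fst c" using covered by blast
 have W0: "0 \<in> W" using E(1) by (auto simp: cube_def)
 have c': "coordE d 0 \<in> fst c" using c E(4) by simp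
 let ?\<kappa> = "snd c \<circ> coordE d" and ?O = "W \<inter> coordE d -` fst c" and ?e = "snd c (equil d)"
 note p = param_chart[OF E(2) W0 c(1) c']
 define Di where "Di = frechet_derivative ?\<kappa> (at 0)"
 have lin: "linear Di" unfolding Di_def by (rule has_derivative_linear[OF p(5)])
 have inj: "inj Di" unfolding Di_def by (rule p(4))
 obtain S where S: "linear S" "!!x. S (Di x) = x" "!!x. Di (S x) = x"
  using linear_injective_isomorphism[OF lin inj] by blast
 have fc0: "f c (equil d) = 0"
 proof -
  have "hyperbolic_saddle A f (equil d) (lam1 d) (lam2 d) (mu d)" using tc by (simp add: tangency_cycle_def H1_def)
  then show ?thesis using c unfolding hyperbolic_saddle_def by blast
 qed
 then have F0: "F c ?e = 0" using F_chart[OF c] by simp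
 have lino: "linear (frechet_derivative ?\<kappa> (at w))" if "w \<in> ?O" for w
  using has_derivative_linear[OF param_chart(5)[OF E(2) _ c(1)]] that by simp
 have Fg: "F c (?\<kappa> w) = frechet_derivative ?\<kappa> (at w) (g w)" if w: "w \<in> ?O" for w
  using E(5)[of w] w F_chart[OF c(1), of "coordE d w"] c(1) unfolding represents_def by simp
 have g0: "g 0 = 0"
 proof -
  have "Di (g 0) = 0" using Fg[OF p(2)] F0 E(4) by (simp add: Di_def)
  then show ?thesis using linear_injective_0[OF lin] inj by blast
 qed
 have eV: "?e \<in> snd c ` fst c" using c(2) by blast
 have dF: "(F c has_derivative frechet_derivative (F c) (at ?e)) (at ?e)"
  using F_C1[OF c(1)] eV unfolding Ck.simps by (intro frechet_derivative_works[THEN iffD1]) blast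
 let ?DF = "frechet_derivative (F c) (at ?e)"
 have conj: "?DF (Di v) = Di (?L v)" for v
 proof -
  define h where "h t = F c (?\<kappa> (t *\<^sub>R v))" for t
  have tv: "((%t. t *\<^sub>R v) \<longlongrightarrow> 0) (at (0::real))"
   using tendsto_scaleR[OF tendsto_ident_at[of "0::real" UNIV] tendsto_const[of v]] by simp
  have "((%t. ?\<kappa> (t *\<^sub>R v)) has_derivative (%t. Di (t *\<^sub>R v))) (at 0)"
   by (rule has_derivative_compose[where f = "%t. t *\<^sub>R v" and f' = "%t. t *\<^sub>R v" and g = ?\<kappa>])
    (auto intro!: derivative_eq_intros simp: Di_def p(5))
  then have "(h has_derivative (%t. ?DF (Di (t *\<^sub>R v)))) (at 0)"
   unfolding h_def[abs_def]
   by (rule has_derivative_compose[where f = "%t. ?\<kappa> (t *\<^sub>R v)" and g = "F c"]) (use dF E(4) in simp)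
  then have "(h has_vector_derivative ?DF (Di v)) (at 0)"
   by (simp add: has_vector_derivative_def linear_scale[OF lin] linear_scale[OF has_derivative_linear[OF dF]])
  then have 1: "((%t. (h t - h 0) /\<^sub>R t) \<longlongrightarrow> ?DF (Di v)) (at 0)"
   by (rule has_vector_derivative_quotient)
  have "((%t. g (t *\<^sub>R v)) has_derivative (%t. ?L (t *\<^sub>R v))) (at 0)"
   by (rule has_derivative_compose[where f = "%t. t *\<^sub>R v" and f' = "%t. t *\<^sub>R v" and g = g])
    (auto intro!: derivative_eq_intros simp: E(6)[simplified])
  moreover have "?L (t *\<^sub>R v) = t *\<^sub>R ?L v" for t by (simp add: vec_eq_iff forall_3)
  ultimately have "((%t. g (t *\<^sub>R v)) has_vector_derivative ?L v) (at 0)" by (simp only: has_vector_derivative_def)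
  from has_vector_derivative_quotient[OF this] have 2: "((%t. g (t *\<^sub>R v) /\<^sub>R t) \<longlongrightarrow> ?L v) (at 0)" by (simp add: g0)
  have "((%t. \<Sum>i\<in>Basis. ((g (t *\<^sub>R v) /\<^sub>R t) \<bullet> i) *\<^sub>R frechet_derivative ?\<kappa> (at (t *\<^sub>R v)) i)
    \<longlongrightarrow> (\<Sum>i\<in>Basis. (?L v \<bullet> i) *\<^sub>R Di i)) (at 0)"
  proof (intro tendsto_sum tendsto_scaleR tendsto_inner 2 tendsto_const)
   fix i :: "real^3"
   have "continuous_on ?O (%x. frechet_derivative ?\<kappa> (at x) i)" using p(3) by simp
   then have "isCont (%x. frechet_derivative ?\<kappa> (at x) i) 0" using p(1,2) continuous_on_eq_continuous_at by blast
   from isCont_tendsto_compose[OF this tv]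
   show "((%t. frechet_derivative ?\<kappa> (at (t *\<^sub>R v)) i) \<longlongrightarrow> Di i) (at 0)" by (simp add: Di_def)
  qed
  moreover have "(\<Sum>i\<in>Basis. (?L v \<bullet> i) *\<^sub>R Di i) = Di (?L v)"
   using linear_sum[OF lin, of "%i. (?L v \<bullet> i) *\<^sub>R i" Basis] linear_scale[OF lin] by (simp add: euclidean_representation)
  moreover have "\<forall>\<^sub>F t in at 0. (\<Sum>i\<in>Basis. ((g (t *\<^sub>R v) /\<^sub>R t) \<bullet> i) *\<^sub>R frechet_derivative ?\<kappa> (at (t *\<^sub>R v)) i) = (h t - h 0) /\<^sub>R t"
   using topological_tendstoD[OF tv p(1,2)]
  proof eventually_elim
   case (elim t)
   let ?T = "frechet_derivative ?\<kappa> (at (t *\<^sub>R v))"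
   have "(\<Sum>i\<in>Basis. ((g (t *\<^sub>R v) /\<^sub>R t) \<bullet> i) *\<^sub>R ?T i) = ?T (g (t *\<^sub>R v) /\<^sub>R t)"
    using linear_sum[OF lino[OF elim], of "%i. ((g (t *\<^sub>R v) /\<^sub>R t) \<bullet> i) *\<^sub>R i" Basis] linear_scale[OF lino[OF elim]]
    by (simp add: euclidean_representation del: inner_scaleR_left)
   also have "... = ?T (g (t *\<^sub>R v)) /\<^sub>R t" by (rule linear_scale[OF lino[OF elim]])
   also have "... = (h t - h 0) /\<^sub>R t" using Fg[OF elim] F0 E(4) by (simp add: h_def)
   finally show ?case .
  qed
  ultimately have "((%t. (h t - h 0) /\<^sub>R t) \<longlongrightarrow> Di (?L v)) (at 0)"
   using Lim_transform_eventually by fastforce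
  then show ?thesis using 1 LIM_unique by blast
 qed
 obtain BS where BS: "0 < BS" "!!x. norm (S x) <= BS*norm x" using linear_bounded_pos[OF S(1)] by blast
 obtain BD where BD: "0 < BD" "!!x. norm (Di x) <= BD*norm x" using linear_bounded_pos[OF lin] by blast
 have "saddle_chart c Di S"
  unfolding saddle_chart_def
 proof (intro conjI allI c lin S F0; rule impI)
  fix e :: real assume e: "0 < e"
  have e': "0 < e/(BS*BD)" using e BS BD by simp
  obtain r where r: "0 < r" "ball ?e r \<subseteq> snd c ` fst c"
   "!!u v. u \<in> ball ?e r ==> v \<in> ball ?e r ==> norm (F c u - F c v - ?DF (u - v)) <= e/(BS*BD)*norm (u - v)"
   using Ck_strict[OF F_C1[OF c(1)] chart(2)[OF c(1)] eV e'] by metis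
  define q where "q = r/(2*BD)"
  have q: "0 < q" using r BD by (simp add: q_def)
  have inb: "?e + Di x \<in> ball ?e r" if "norm x <= q" for x
  proof -
   have "norm (Di x) <= BD*q" using mult_left_mono[OF that, of BD] BD(1) by (intro order_trans[OF BD(2)]) simp
   also have "... < r" using BD(1) r(1) by (simp add: q_def)
   finally show ?thesis by (simp add: dist_norm)
  qed
  have "norm (S (F c (?e + Di x)) - S (F c (?e + Di y)) - ?L (x - y)) <= e*norm (x - y)" if "norm x <= q" "norm y <= q" for x y
  proof -
   have d: "(?e + Di x) - (?e + Di y) = Di (x - y)" by (simp add: linear_diff[OF lin])
   have "S (F c (?e + Di x)) - S (F c (?e + Di y)) - ?L (x - y) = S (F c (?e + Di x) - F c (?e + Di y) - ?DF (Di (x - y)))"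
    unfolding conj by (simp only: linear_diff[OF S(1)] S(2))
   then have "norm (S (F c (?e + Di x)) - S (F c (?e + Di y)) - ?L (x - y)) <= BS*norm (F c (?e + Di x) - F c (?e + Di y) - ?DF (Di (x - y)))"
    using BS(2) by simp
   also have "... <= BS*(e/(BS*BD)*norm (Di (x - y)))"
    using r(3)[OF inb[OF that(1)] inb[OF that(2)]] BS(1) unfolding d by (intro mult_left_mono) auto
   also have "... <= BS*(e/(BS*BD)*(BD*norm (x - y)))"
    using BD(2)[of "x - y"] BS(1) e' by (intro mult_left_mono) auto
   also have "... = e*norm (x - y)" using BS(1) BD(1) by simp
   finally show ?thesis .
  qed
  then show "\<exists>r>0. (\<forall>x. norm x <= r --> ?e + Di x \<in> snd c ` fst c) &
    (\<forall>x y. norm x <= r --> norm y <= r --> norm (S (F c (?e + Di x)) - S (F c (?e + Di y)) - ?L (x - y)) <= e*norm (x - y))"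
   using q inb r(2) by (intro exI[of _ q]) blast
 next
  fix e :: real assume e: "0 < e"
  have e': "0 < e/BS" using e BS by simp
  obtain r where r: "0 < r" "!!y. norm (y - 0) < r ==> norm (?\<kappa> y - ?\<kappa> 0 - Di (y - 0)) <= e/BS*norm (y - 0)"
   using conjunct2[OF p(5)[unfolded has_derivative_at_alt], rule_format, OF e'] unfolding Di_def by blast
  have "norm (S (snd c (coordE d w) - ?e) - w) <= e*norm w" if "norm w < r" for w
  proof -
   have "S (snd c (coordE d w) - ?e) - w = S (?\<kappa> w - ?\<kappa> 0 - Di w)" using E(4) by (simp add: linear_diff[OF S(1)] S(2))
   then have "norm (S (snd c (coordE d w) - ?e) - w) <= BS*norm (?\<kappa> w - ?\<kappa> 0 - Di w)" using BS(2) by simp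
   also have "... <= BS*(e/BS*norm w)" using r(2)[of w] that BS(1) by (intro mult_left_mono) auto
   finally show ?thesis using BS(1) by simp
  qed
  then show "\<exists>r>0. \<forall>w. norm w < r --> norm (S (snd c (coordE d w) - ?e) - w) <= e*norm w" using r(1) by blast
 qed
 then show ?thesis by blast
qed

end

context tangency
begin

text \<open>Near \<open>E\<close>, points on the side of the cycle with a backward orbit staying near \<open>E\<close> lie on the outgoing connection:
 by \<open>cone\<close>, two such orbits cannot be different at equal height.\<close>

lemma unstable_local:
 assumes U: "open U" "equil d \<in> U"
 obtains N N0 where "compact N" "open N0" "equil d \<in> N0" "N0 \<subseteq> N" "N \<subseteq> U"
  "!!w. w \<in> cube ==> 0 <= w $ 3 ==> coordE d w ~= equil d ==> (!!t. 0 <= t ==> \<phi> (- t) (coordE d w) \<in> N) ==>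
   coordE d w \<in> orbit \<phi> (pt_EP d)"
proof -
 obtain c Di S where sc: "saddle_chart c Di S" using E_chart by blast
 then have c: "c \<in> A" "equil d \<in> fst c" and lin: "linear Di" "linear S" "!!x. S (Di x) = x" "!!x. Di (S x) = x"
  and F0: "F c (snd c (equil d)) = 0"
  unfolding saddle_chart_def by blast+
 let ?e = "snd c (equil d)"
 define m where "m = min (lam1 d) (min (lam2 d) (mu d))"
 have m: "0 < m" "m <= lam1 d" "m <= lam2 d" "m <= mu d" using rates by (auto simp: m_def)
 obtain r1 where r1: "0 < r1" "!!x. norm x <= r1 ==> ?e + Di x \<in> snd c ` fst c"
  "!!x y. norm x <= r1 ==> norm y <= r1 ==> norm (S (F c (?e + Di x)) - S (F c (?e + Di y)) -
     vec3 (- lam1 d*(x - y) $ 1) (- lam2 d*(x - y) $ 2) (mu d*(x - y) $ 3)) <= m/4*norm (x - y)"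
  using sc m(1) unfolding saddle_chart_def by (elim conjE allE[of _ "m/4"]) auto
 obtain \<rho> where \<rho>: "0 < \<rho>" "!!w. norm w < \<rho> ==> norm (S (snd c (coordE d w) - ?e) - w) <= 1/4*norm w"
  using sc unfolding saddle_chart_def by (elim conjE allE[of _ "1/4"]) auto
 \<comment> \<open>Deleting the periodic orbit forces the outgoing connection to leave
   \<open>N\<close>; deleting the images of all \<open>w\<close> with large norm ensures that points
   of the cube lying in \<open>N\<close> have small coordinates.\<close>
 define U' where "U' = U \<inter> - perP A f d \<inter> - coordE d ` (cube \<inter> {w. \<rho> <= norm w})"
 have "closed {w :: real^3. \<rho> <= norm w}" by (intro closed_Collect_le continuous_intros)
 then have U'o: "open U'" unfolding U'_def
  using U(1) coordE_image_closed(1) compact_imp_closed[OF perP_compact] by (intro open_Int open_Compl) auto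
 have EU': "equil d \<in> U'"
 proof -
  have False if w: "w \<in> cube" "\<rho> <= norm w" "equil d = coordE d w" for w
  proof -
   have "w = 0" by (rule coordE_inj) (use w coordE_0 in \<open>auto simp: cube_def\<close>)
   then show False using w(2) \<rho>(1) by simp
  qed
  then show ?thesis using U(2) E_not_in_orbits by (auto simp: U'_def)
 qed
 have smallw: "norm w < \<rho>" if "w \<in> cube" "coordE d w \<in> U'" for w
  using that by (force simp: U'_def)
 define V where "V = snd c ` fst c \<inter> chart_inv c -` U'"
 have "open V" unfolding V_def by (rule continuous_open_preimage[OF chart(4,2)[OF c(1)] U'o])
 moreover have "?e \<in> V" using c EU' chart(5)[OF c] by (auto simp: V_def)
 ultimately obtain \<eta> where \<eta>: "0 < \<eta>" "ball ?e \<eta> \<subseteq> V" using open_contains_ball_eq by blast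
 obtain BD where BD: "0 < BD" "!!x. norm (Di x) <= BD*norm x" using linear_bounded_pos[OF lin(1)] by blast
 define r where "r = min r1 (\<eta>/(2*BD))"
 have r: "0 < r" "r <= r1" "BD*r < \<eta>"
 proof -
  have "BD*r <= BD*(\<eta>/(2*BD))" using BD(1) by (intro mult_left_mono) (auto simp: r_def)
  then show "BD*r < \<eta>" using BD(1) \<eta>(1) by simp
 qed (use r1(1) \<eta>(1) BD(1) in \<open>auto simp: r_def\<close>)
 define \<delta> where "\<delta> p = S (snd c p - ?e)" for p
 have \<delta>: "snd c p = ?e + Di (\<delta> p)" for p by (simp add: \<delta>_def lin(4))
 define N where "N = {p \<in> fst c. norm (\<delta> p) <= r}"
 define N0 where "N0 = {p \<in> fst c. norm (\<delta> p) < r}"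
 have NU': "N \<subseteq> U'"
 proof
  fix p assume p: "p \<in> N"
  have "norm (Di (\<delta> p)) <= BD*r" using p BD(1) by (intro order_trans[OF BD(2)] mult_left_mono) (auto simp: N_def)
  then have "snd c p \<in> ball ?e \<eta>" using r(3) unfolding \<delta>[of p] by (simp add: dist_norm)
  then have "snd c p \<in> V" using \<eta>(2) by blast
  then show "p \<in> U'" using p chart(5)[OF c(1), of p] by (simp add: V_def N_def)
 qed
 have contS: "continuous_on UNIV S" using lin(2) linear_continuous_on linear_conv_bounded_linear by blast
 have contD: "continuous_on T Di" for T using lin(1) linear_continuous_on linear_conv_bounded_linear by blast
 have Neq: "N = chart_inv c ` (%x. ?e + Di x) ` cball 0 r"
 proof (intro subset_antisym subsetI)
  fix p assume p: "p \<in> N"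
  then have "p = chart_inv c (?e + Di (\<delta> p))" using chart(5)[OF c(1), of p] \<delta>[of p] by (simp add: N_def)
  then show "p \<in> chart_inv c ` (%x. ?e + Di x) ` cball 0 r" using p by (auto simp: N_def)
 next
  fix p assume "p \<in> chart_inv c ` (%x. ?e + Di x) ` cball 0 r"
  then obtain x where x: "p = chart_inv c (?e + Di x)" "norm x <= r" by auto
  then have V: "?e + Di x \<in> snd c ` fst c" using r1(2) r(2) by simp
  then have "snd c p = ?e + Di x" using chart(6)[OF c(1)] x(1) by simp
  then show "p \<in> N" using chart(7)[OF c(1) V] x lin(3) by (simp add: N_def \<delta>_def)
 qed
 have Nc: "compact N" unfolding Neq
 proof (intro compact_continuous_image)
  show "continuous_on ((%x. ?e + Di x) ` cball 0 r) (chart_inv c)"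
   by (rule continuous_on_subset[OF chart(4)[OF c(1)]]) (use r1(2) r(2) in auto)
  show "continuous_on (cball 0 r) (%x. ?e + Di x)" by (intro continuous_intros contD)
 qed simp
 have N0o: "open N0"
 proof -
  have "continuous_on UNIV (%x. norm (S (x - ?e)))" by (intro continuous_intros continuous_on_compose2[OF contS]) auto
  then have "open {x. norm (S (x - ?e)) < r}" by (intro open_Collect_less) auto
  from continuous_open_preimage[OF chart(3,1)[OF c(1)] this] show ?thesis
   by (simp add: N0_def \<delta>_def vimage_def Int_def)
 qed
 have EN0: "equil d \<in> N0" using c(2) r(1) linear_0[OF lin(2)] by (simp add: N0_def \<delta>_def)
 define G where "G x = S (F c (?e + Di x))" for x
 interpret saddle_field G "lam1 d" "lam2 d" "mu d" m "m/4" r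
 proof
  show "G 0 = 0" using F0 linear_0[OF lin(1)] linear_0[OF lin(2)] by (simp add: G_def)
  show "norm (G x - G y - vec3 (- lam1 d*(x - y) $ 1) (- lam2 d*(x - y) $ 2) (mu d*(x - y) $ 3)) <= m/4*norm (x - y)"
   if "norm x <= r" "norm y <= r" for x y
   unfolding G_def using that r(2) by (intro r1(3)) auto
 qed (use m r(1) in auto)
 have bs: "bsol (%t. \<delta> (\<phi> (- t) q))" if q: "!!t. 0 <= t ==> \<phi> (- t) q \<in> N" for q
  unfolding bsol_def
 proof (intro allI impI conjI)
  fix t :: real assume t: "0 <= t"
  have fc: "\<phi> (- t) q \<in> fst c" and n: "norm (\<delta> (\<phi> (- t) q)) <= r" using q[OF t] by (auto simp: N_def)
  show "norm (\<delta> (\<phi> (- t) q)) <= r" by (rule n)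
  have "((%s. snd c (\<phi> s q)) has_vector_derivative f c (\<phi> (- t) q)) (at (- t))" by (rule flow_deriv[OF c(1) fc])
  moreover have "((%t. - t) has_vector_derivative - 1) (at t)" by (auto intro!: derivative_eq_intros)
  ultimately have "((%t. snd c (\<phi> (- t) q)) has_vector_derivative - f c (\<phi> (- t) q)) (at t)"
   using vector_diff_chain_at[of "%t. - t" "- 1" t "%s. snd c (\<phi> s q)"] by (simp add: o_def)
  then have "((%t. snd c (\<phi> (- t) q) - ?e) has_vector_derivative - f c (\<phi> (- t) q)) (at t)"
   by (auto intro!: derivative_eq_intros)
  from bounded_linear.has_vector_derivative[OF lin(2)[unfolded linear_conv_bounded_linear] this]
  have "((%t. \<delta> (\<phi> (- t) q)) has_vector_derivative S (- f c (\<phi> (- t) q))) (at t)" by (simp add: \<delta>_def)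
  moreover have "S (- f c (\<phi> (- t) q)) = - G (\<delta> (\<phi> (- t) q))"
   using F_chart[OF c(1) fc] linear_neg[OF lin(2)] by (simp add: G_def \<delta>[symmetric])
  ultimately show "((%t. \<delta> (\<phi> (- t) q)) has_vector_derivative - G (\<delta> (\<phi> (- t) q))) (at t)" by simp
 qed
 have \<delta>_inj: "p = q" if "p \<in> N" "q \<in> N" "\<delta> p = \<delta> q" for p q
 proof -
  have "snd c p = snd c q" using \<delta>[of p] \<delta>[of q] that(3) by simp
  moreover have "p \<in> fst c" "q \<in> fst c" using that(1,2) by (simp_all add: N_def)
  ultimately show ?thesis using chart(5)[OF c(1)] by metis
 qed
 \<comment> \<open>The coordinates \<open>w\<close> and \<open>\<delta>\<close> agree up to a
   quarter of \<open>norm w\<close>. If the heights had opposite signs, the \<open>\<delta>\<close>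
   height would be at most a third of the norm, and the cone condition would leave only
   \<open>E\<close>.\<close>
 have pos: "0 < \<delta> (coordE d w) $ 3" if w: "w \<in> cube" "0 <= w $ 3" "coordE d w ~= equil d"
  and b: "!!t. 0 <= t ==> \<phi> (- t) (coordE d w) \<in> N" for w
 proof (rule ccontr)
  let ?x = "\<delta> (coordE d w)"
  assume "\<not> 0 < ?x $ 3"
  then have x3: "?x $ 3 <= 0" by simp
  have wN: "coordE d w \<in> N" using b[of 0] by simp
  have "norm (?x - w) <= 1/4*norm w" unfolding \<delta>_def by (rule \<rho>(2)[OF smallw[OF w(1)]]) (use wN NU' in blast)
  moreover have "norm w <= norm ?x + norm (?x - w)" by (metis add.commute diff_add_cancel norm_minus_commute norm_triangle_ineq)
  moreover have "abs ((?x - w) $ 3) <= norm (?x - w)" by (rule component_le_norm_cart)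
  ultimately have "3*abs (?x $ 3) <= norm ?x" using x3 w(2) by simp
  then have "(3*abs (?x $ 3))\<^sup>2 <= (norm ?x)\<^sup>2" by (intro power_mono) auto
  then have "9*(?x $ 3)\<^sup>2 <= (?x $ 1)\<^sup>2 + (?x $ 2)\<^sup>2 + (?x $ 3)\<^sup>2" by (simp add: norm_sq3 power_mult_distrib)
  moreover have "(?x $ 1)\<^sup>2 + (?x $ 2)\<^sup>2 <= (?x $ 3)\<^sup>2" using cone[OF bs[OF b] bsol_0] by simp
  ultimately have "(?x $ 3)\<^sup>2 <= 0" using zero_le_power2[of "?x $ 3"] by argo
  then have "?x $ 3 = 0" by simp
  then have "(norm ?x)\<^sup>2 <= 0" using \<open>(?x $ 1)\<^sup>2 + (?x $ 2)\<^sup>2 <= (?x $ 3)\<^sup>2\<close> by (simp add: norm_sq3)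
  then have "?x = \<delta> (equil d)" using linear_0[OF lin(2)] by (simp add: \<delta>_def)
  then have "coordE d w = equil d" using \<delta>_inj[OF wN] EN0 by (simp add: N_def N0_def)
  then show False using w(3) by blast
 qed
 have NP: "open (- N)" "perP A f d \<subseteq> - N" using compact_imp_closed[OF Nc] NU' by (auto simp: U'_def)
 have "pt_EP d \<in> stable_set \<phi> (perP A f d)" "pt_EP d \<in> unstable_set \<phi> {equil d}"
  using tc by (auto simp: tangency_cycle_def H4_def)
 then have "\<forall>\<^sub>F t in at_top. \<phi> t (pt_EP d) \<in> - N" "\<forall>\<^sub>F t in at_bot. \<phi> t (pt_EP d) \<in> N0"
  unfolding stable_set_def unstable_set_def using NP N0o EN0 by auto
 then obtain T1 T0 where T1: "!!t. T1 <= t ==> \<phi> t (pt_EP d) \<notin> N" and T0: "!!t. t <= T0 ==> \<phi> t (pt_EP d) \<in> N0"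
  unfolding eventually_at_top_linorder eventually_at_bot_linorder by auto
 have N0N: "N0 \<subseteq> N" by (auto simp: N_def N0_def)
 \<comment> \<open>The middle piece of the outgoing connection, compact and away from
   \<open>E\<close>. A point of the axis that avoids it and lies in \<open>N0\<close> belongs to the
   early piece, so its backward orbit stays in \<open>N0\<close>.\<close>
 define C where "C = (%t. \<phi> t (pt_EP d)) ` {T0..T1}"
 have "compact C" unfolding C_def
  by (rule compact_continuous_image[OF continuous_at_imp_continuous_on compact_Icc]) (use isCont_flow_time in blast)
 then have Co: "open (N0 \<inter> - C)" using N0o compact_imp_closed by (intro open_Int open_Compl) auto
 have EC: "equil d \<in> N0 \<inter> - C" using EN0 E_not_in_orbits(1) by (auto simp: C_def orbit_def)
 have "((%s. coordE d (vec3 0 0 s)) \<longlongrightarrow> coordE d (vec3 0 0 0)) (at_right 0)"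
  by (rule isCont_tendsto_compose[OF isCont_coordE tendsto_vec3]) (auto simp: cube_def forall_3 intro: tendsto_ident_at)
 moreover have "vec3 0 0 0 = (0 :: real^3)" by (simp add: vec_eq_iff forall_3)
 ultimately have "((%s. coordE d (vec3 0 0 s)) \<longlongrightarrow> equil d) (at_right 0)" using coordE_0 by simp
 then have "\<forall>\<^sub>F s in at_right 0. coordE d (vec3 0 0 s) \<in> N0 \<inter> - C" by (rule topological_tendstoD[OF _ Co EC])
 moreover have "\<forall>\<^sub>F s in at_right (0::real). s \<in> {0<..<1}" by (rule eventually_at_right_real) simp
 ultimately have "\<forall>\<^sub>F s in at_right 0. coordE d (vec3 0 0 s) \<in> N0 \<inter> - C & s < 1 & 0 < s" by eventually_elim auto
 then obtain s where s: "coordE d (vec3 0 0 s) \<in> N0 \<inter> - C" "0 < s" "s < 1"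
  using eventually_happens'[OF trivial_limit_at_right_real] by blast
 let ?b = "coordE d (vec3 0 0 s)"
 obtain a where a: "?b = \<phi> a (pt_EP d)" using axis_orbit[of s] s by (auto simp: orbit_def)
 have "a \<notin> {T0..T1}" "a < T1" using s(1) T1[of a] N0N unfolding a C_def by (blast, meson IntE not_le subsetD)
 then have aT: "a < T0" by simp
 have b: "\<phi> (- t) ?b \<in> N" if "0 <= t" for t
  using T0[of "a - t"] aT that N0N flow_add[of "- t" a "pt_EP d"] unfolding a by auto
 have sc: "vec3 0 0 s \<in> cube" using s by (simp add: cube_def forall_3)
 have borb: "?b \<in> orbit \<phi> (pt_EP d)" by (rule axis_orbit) (use s in auto)
 then have bE: "?b ~= equil d" using E_not_in_orbits(1) by metis
 have bpos: "0 < \<delta> ?b $ 3" by (rule pos[OF sc _ bE b]) (use s in auto)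
 show ?thesis
 proof (rule that[OF Nc N0o EN0 N0N])
  show "N \<subseteq> U" using NU' by (auto simp: U'_def)
  fix w assume w: "w \<in> cube" "0 <= w $ 3" "coordE d w ~= equil d" and q: "!!t. 0 <= t ==> \<phi> (- t) (coordE d w) \<in> N"
  let ?q = "coordE d w"
  have qpos: "0 < \<delta> ?q $ 3" by (rule pos[OF w q])
  show "?q \<in> orbit \<phi> (pt_EP d)"
  \<comment> \<open>Whichever of the two points is higher flows back through the other one.\<close>
  proof (cases "\<delta> ?q $ 3 <= \<delta> ?b $ 3")
   case True
   then obtain t where t: "0 <= t" "\<delta> (\<phi> (- t) ?b) = \<delta> ?q" using meet[OF bs[OF q] bs[OF b]] qpos by auto
   then have "\<phi> (- t) ?b = ?q" using \<delta>_inj[OF b[OF t(1)] q[of 0]] by simp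
   then show ?thesis using orbit_flow[OF borb, of "- t"] by simp
  next
   case False
   then obtain t where t: "0 <= t" "\<delta> (\<phi> (- t) ?q) = \<delta> ?b" using meet[OF bs[OF b] bs[OF q]] bpos by auto
   then have "\<phi> (- t) ?q = ?b" using \<delta>_inj[OF q[OF t(1)] b[of 0]] by simp
   then have "?q = \<phi> t ?b" by (metis flow_minus(2))
   then show ?thesis using orbit_flow[OF borb, of t] by simp
  qed
 qed
qed

end

section \<open>Orbits passing the equilibrium\<close>

context tangency
begin

lemma forward_flat: "p \<in> coordE d ` {w \<in> cube. w $ 3 = 0} ==> 0 <= t ==> \<phi> t p \<in> coordE d ` {w \<in> cube. w $ 3 = 0}"
proof -
 assume p: "p \<in> coordE d ` {w \<in> cube. w $ 3 = 0}" and t: "0 <= t"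
 have "\<phi> s (\<phi> t p) \<in> coordE d ` cube" if "0 <= s" for s
  using cube_stable[of p] p that t flow_add[of s t p] by (metis add_nonneg_nonneg)
 then show ?thesis using cube_stable[of "\<phi> t p"] by blast
qed

lemma secEout_top: "w \<in> sq1 ==> secEout d w \<in> coordE d ` (cube \<inter> {w. w $ 3 = 1})"
 by (cases w) (auto intro!: imageI simp: cube_def forall_3 abs_le_iff)

lemma flat_not_top: "p \<in> coordE d ` {w \<in> cube. w $ 3 = 0} ==> p \<notin> coordE d ` (cube \<inter> {w. w $ 3 = 1})"
proof
 assume "p \<in> coordE d ` {w \<in> cube. w $ 3 = 0}" "p \<in> coordE d ` (cube \<inter> {w. w $ 3 = 1})"
 then obtain v w where v: "p = coordE d v" "v \<in> cube" "v $ 3 = 0" and w: "p = coordE d w" "w \<in> cube" "w $ 3 = 1" by blast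
 then have "v = w" by (intro coordE_inj) auto
 then show False using v(3) w(3) by simp
qed

text \<open>An orbit that meets the plane \<open>w $ 3 = 0\<close> in the cube stays in it and never
  reaches the top. So the times above and below the plane form two disjoint closed sets covering a
  connected interval.\<close>

lemma passage_upper:
 assumes yz: "abs y <= 1" "0 < z" "z <= 1" and w': "w' \<in> sq1" and t: "0 < t" "\<phi> t (secEin d (y, z)) = secEout d w'"
  and cube: "!!s. s \<in> {0..t} ==> \<phi> s (secEin d (y, z)) \<in> coordE d ` cube" and s: "s \<in> {0..t}"
 shows "\<phi> s (secEin d (y, z)) \<in> coordE d ` (cube \<inter> {w. 0 <= w $ 3})"
proof -
 let ?p = "secEin d (y, z)"
 define X where "X C = {0..t} \<inter> (%s. \<phi> s ?p) -` (coordE d ` (cube \<inter> C))" for C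
 have X: "closed (X C)" if "closed C" for C unfolding X_def
  by (rule continuous_closed_preimage[OF continuous_at_imp_continuous_on closed_atLeastAtMost coordE_image_closed(1)[OF that]])
   (use isCont_flow_time in blast)
 have cl: "closed {w :: real^3. 0 <= w $ 3}" "closed {w :: real^3. w $ 3 <= 0}"
  by (intro closed_Collect_le continuous_intros)+
 have "X {w. 0 <= w $ 3} \<inter> {0..t} = {} \<or> X {w. w $ 3 <= 0} \<inter> {0..t} = {}"
 proof (rule connected_closedD[OF connected_Icc])
  show "X {w. 0 <= w $ 3} \<inter> X {w. w $ 3 <= 0} \<inter> {0..t} = {}"
  proof (rule ccontr)
   assume "X {w. 0 <= w $ 3} \<inter> X {w. w $ 3 <= 0} \<inter> {0..t} ~= {}"
   then obtain r where r: "r \<in> {0..t}" "r \<in> X {w. 0 <= w $ 3}" "r \<in> X {w. w $ 3 <= 0}" by blast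
   then obtain v w where v: "\<phi> r ?p = coordE d v" "v \<in> cube" "0 <= v $ 3" and w: "\<phi> r ?p = coordE d w" "w \<in> cube" "w $ 3 <= 0"
    unfolding X_def by blast
   have "v = w" by (rule coordE_inj) (use v w in auto)
   then have "v $ 3 = 0" using v w by simp
   then have "\<phi> r ?p \<in> coordE d ` {w \<in> cube. w $ 3 = 0}" using v by blast
   from forward_flat[OF this, of "t - r"] have "\<phi> (t - r) (\<phi> r ?p) \<in> coordE d ` {w \<in> cube. w $ 3 = 0}" using r(1) by simp
   then have "secEout d w' \<in> coordE d ` {w \<in> cube. w $ 3 = 0}" using flow_add[of "t - r" r ?p] t(2) by simp
   then show False using flat_not_top secEout_top[OF w'] by blast
  qed
  show "{0..t} \<subseteq> X {w. 0 <= w $ 3} \<union> X {w. w $ 3 <= 0}"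
  proof
   fix r assume r: "r \<in> {0..t}"
   then obtain w where "\<phi> r ?p = coordE d w" "w \<in> cube" using cube by blast
   then show "r \<in> X {w. 0 <= w $ 3} \<union> X {w. w $ 3 <= 0}"
    using r linear[of 0 "w $ 3"] unfolding X_def by blast
  qed
 qed (use X cl in auto)
 moreover have "0 \<in> X {w. 0 <= w $ 3}"
  using yz t(1) by (auto simp: X_def cube_def forall_3 intro!: imageI)
 ultimately have "s \<notin> X {w. w $ 3 <= 0}" using s t(1) by auto
 moreover obtain w where "\<phi> s ?p = coordE d w" "w \<in> cube" using cube[OF s] by blast
 ultimately show ?thesis using s linear[of 0 "w $ 3"] unfolding X_def by blast
qed

text \<open>A compactness argument replaces estimates of the flow in the cube. The points where a
  sequence of bad passages leaves the neighbourhood of \<open>E\<close> accumulate at a point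
  \<open>qq\<close> of the outgoing connection. From \<open>qq\<close> the cube is left within the
  bounded time \<open>T\<close>, inside \<open>U\<close>; a passage lies in the cube until it ends,
  so it ends before that and never leaves \<open>U\<close>.\<close>

lemma E_passage:
 assumes U: "open U" "Gamma A f d \<subseteq> U"
 shows "\<exists>e>0. \<forall>y z w'. abs y < e & 0 < z & z < e & passesE A f d (y, z) w' --> seg U (secEin d (y, z)) (secEout d w') 0"
proof (rule ccontr)
 assume neg: "\<not> ?thesis"
 \<comment> \<open>The target section is kept out of \<open>N\<close>, so that every passage leaves
   \<open>N\<close> before it ends.\<close>
 let ?top = "coordE d ` (cube \<inter> {w. w $ 3 = 1})"
 have top: "closed ?top" by (rule coordE_image_closed(1)) (intro closed_Collect_eq continuous_intros)
 have EU: "equil d \<in> U \<inter> - ?top"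
 proof -
  have "equil d \<in> coordE d ` {w \<in> cube. w $ 3 = 0}" using coordE_0 by (auto simp: cube_def intro!: image_eqI[of _ _ 0])
  then show ?thesis using flat_not_top U(2) by (auto simp: Gamma_def)
 qed
 obtain N N0 where N: "compact N" "open N0" "equil d \<in> N0" "N0 \<subseteq> N" "N \<subseteq> U \<inter> - ?top"
  "!!w. w \<in> cube ==> 0 <= w $ 3 ==> coordE d w ~= equil d ==> (!!t. 0 <= t ==> \<phi> (- t) (coordE d w) \<in> N) ==>
   coordE d w \<in> orbit \<phi> (pt_EP d)"
  using unstable_local[OF open_Int[OF U(1) open_Compl[OF top]] EU] by metis
 have Ncl: "closed N" by (rule compact_imp_closed[OF N(1)])
 define q0 where "q0 = secEin d (0, 0)"
 have q0: "q0 \<in> orbit \<phi> (pt_PE d)"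
 proof -
  have "adapted_E A f d" using tc by (simp add: tangency_cycle_def)
  then show ?thesis unfolding adapted_E_def q0_def by blast
 qed
 then have q0U: "\<phi> t q0 \<in> U" for t using orbit_flow[OF q0] U(2) by (auto simp: Gamma_def)
 obtain b where b: "q0 = \<phi> b (pt_PE d)" using q0 by (auto simp: orbit_def)
 have "pt_PE d \<in> stable_set \<phi> {equil d}" using tc by (auto simp: tangency_cycle_def H3_def)
 then have "\<forall>\<^sub>F t in at_top. \<phi> t (pt_PE d) \<in> N0" unfolding stable_set_def using N(2,3) by auto
 then obtain t0 where t0: "!!t. t0 <= t ==> \<phi> t (pt_PE d) \<in> N0" unfolding eventually_at_top_linorder by auto
 define t1 where "t1 = max 0 (t0 - b)"
 have t1: "0 <= t1" "!!t. t1 <= t ==> \<phi> t q0 \<in> N0"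
 proof -
  fix t assume "t1 <= t"
  then have "t0 <= t + b" by (simp add: t1_def)
  then show "\<phi> t q0 \<in> N0" using t0[of "t + b"] by (simp add: b flow_add)
 qed (simp add: t1_def)
 have q0flat: "\<phi> t q0 \<in> coordE d ` {w \<in> cube. w $ 3 = 0}" if "0 <= t" for t
  by (rule forward_flat[OF _ that]) (auto simp: q0_def cube_def forall_3 intro!: imageI)
 have "\<exists>y z w'. abs y < 1/real (Suc n) & 0 < z & z < 1/real (Suc n) & passesE A f d (y, z) w' &
   \<not> seg U (secEin d (y, z)) (secEout d w') 0" for n
  using neg by (auto simp del: of_nat_Suc dest!: spec[of _ "1/real (Suc n)"])
 then obtain y z w' where yz: "!!n. abs (y n) < 1/real (Suc n)" "!!n. 0 < z n" "!!n. z n < 1/real (Suc n)"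
   "!!n. passesE A f d (y n, z n) (w' n)" "!!n. \<not> seg U (secEin d (y n, z n)) (secEout d (w' n)) 0" by metis
 define p where "p n = secEin d (y n, z n)" for n
 have w': "w' n \<in> sq1" for n using yz(4)[of n] by (simp add: passesE_def)
 have "\<exists>t>0. \<phi> t (p n) = secEout d (w' n) & (\<forall>s\<in>{0..t}. \<phi> s (p n) \<in> coordE d ` cube)" for n
  using yz(4)[of n] by (simp add: passesE_def p_def)
 then obtain t where t: "!!n. 0 < t n" "!!n. \<phi> (t n) (p n) = secEout d (w' n)"
   "!!n s. s \<in> {0..t n} ==> \<phi> s (p n) \<in> coordE d ` cube" by metis
 have "\<exists>s\<in>{0..t n}. \<phi> s (p n) \<notin> U" for n
  using yz(5)[of n] t(1,2)[of n] unfolding seg_def p_def[symmetric] by (meson less_imp_le)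
 then obtain s where s: "!!n. s n \<in> {0..t n}" "!!n. \<phi> (s n) (p n) \<notin> U" by metis
 have p: "(p \<longlongrightarrow> q0) sequentially"
 proof -
  have inv: "(%n. 1/real (Suc n)) \<longlonglongrightarrow> 0" using LIMSEQ_inverse_real_of_nat by (simp add: inverse_eq_divide)
  have "norm (y n) <= 1/real (Suc n)" for n using yz(1)[of n] unfolding real_norm_def by (rule less_imp_le)
  then have "y \<longlonglongrightarrow> 0" by (intro Lim_null_comparison[OF always_eventually inv] allI)
  moreover have "norm (z n) <= 1/real (Suc n)" for n
   using yz(3)[of n] unfolding real_norm_def abs_of_pos[OF yz(2)] by (rule less_imp_le)
  then have "z \<longlonglongrightarrow> 0" by (intro Lim_null_comparison[OF always_eventually inv] allI)
  ultimately have v: "((%n. vec3 1 (y n) (z n)) \<longlongrightarrow> vec3 1 0 0) sequentially" by (intro tendsto_vec3 tendsto_const)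
  have "isCont (coordE d) (vec3 1 0 0)" by (rule isCont_coordE[OF vec3_cube]) simp_all
  from isCont_tendsto_compose[OF this v] have "((%n. coordE d (vec3 1 (y n) (z n))) \<longlongrightarrow> coordE d (vec3 1 0 0)) sequentially" .
  then show ?thesis by (simp add: p_def[abs_def] q0_def)
 qed
 have follow: "\<forall>\<^sub>F n in sequentially. \<forall>s\<in>{0..t1}. \<phi> s (p n) \<in> U \<inter> - ?top"
 proof (rule eventually_compose_filterlim[OF flow_tube p])
  show "\<phi> s q0 \<in> U \<inter> - ?top" if "s \<in> {0..t1}" for s using q0U[of s] flat_not_top[OF q0flat[of s]] that by auto
 qed (use U(1) top in auto)
 have stay: "\<forall>\<^sub>F n in sequentially. \<forall>s\<in>{t1..t1 + \<tau>}. \<phi> s (p n) \<in> N0" for \<tau>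
  by (rule eventually_compose_filterlim[OF flow_tube p]) (use N(2) t1(2) in auto)
 have "\<forall>\<^sub>F n in sequentially. \<exists>e. t1 <= e & e <= t n & \<phi> e (p n) \<in> N & \<phi> e (p n) \<notin> N0 & (\<forall>s\<in>{t1..<e}. \<phi> s (p n) \<in> N0)"
  using follow stay[of 0]
 proof eventually_elim
  case (elim n)
  have top': "\<phi> (t n) (p n) \<in> ?top" using t(2) secEout_top[OF w'] by simp
  then have tn: "t1 < t n" using elim(1) t(1)[of n] by (metis ComplD IntD2 atLeastAtMost_iff less_imp_le not_le)
  \<comment> \<open>The least element of \<open>J\<close> is the first time after \<open>t1\<close>
    at which the orbit is outside \<open>N0\<close>.\<close>
  define J where "J = {t1..t n} \<inter> (%s. \<phi> s (p n)) -` (- N0)"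
  have "closed J" unfolding J_def
   by (rule continuous_closed_preimage[OF continuous_at_imp_continuous_on]) (use N(2) isCont_flow_time in auto)
  moreover have "bounded J" unfolding J_def by (rule bounded_subset[of "{t1..t n}"]) auto
  ultimately have "compact J" by (simp add: compact_eq_bounded_closed)
  moreover have "t n \<in> J" using top' N(4,5) tn by (auto simp: J_def)
  ultimately obtain e where e: "e \<in> J" "!!s. s \<in> J ==> e <= s" using compact_attains_inf[of J] by blast
  have e': "t1 <= e" "e <= t n" "\<phi> e (p n) \<notin> N0" using e(1) by (auto simp: J_def)
  have b4: "\<phi> s (p n) \<in> N0" if "s \<in> {t1..<e}" for s
   using e(2)[of s] that e'(2) by (force simp: J_def)
  have et: "t1 < e" using elim(2) e' by (metis add.right_neutral atLeastAtMost_iff le_less order_refl)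
  have "\<phi> e (p n) \<in> N"
  proof (rule ccontr)
   assume "\<phi> e (p n) \<notin> N"
   moreover have "((%s. \<phi> s (p n)) \<longlongrightarrow> \<phi> e (p n)) (at_left e)"
    using isCont_flow_time[where p = "p n" and t = e] by (auto simp: isCont_def intro: tendsto_mono at_le)
   ultimately have "\<forall>\<^sub>F s in at_left e. \<phi> s (p n) \<in> - N" using Ncl by (intro topological_tendstoD) auto
   moreover have "\<forall>\<^sub>F s in at_left e. s \<in> {t1<..<e}" by (rule eventually_at_left_real[OF et])
   ultimately have "\<forall>\<^sub>F s in at_left e. False"
   proof eventually_elim
    case (elim s)
    then show ?case using b4[of s] N(4) by auto
   qed
   then show False by simp
  qed
  then show ?case using e' b4 by blast
 qed
 then obtain n0 where "!!n. n0 <= n ==> \<exists>e. t1 <= e & e <= t n & \<phi> e (p n) \<in> N & \<phi> e (p n) \<notin> N0 & (\<forall>s\<in>{t1..<e}. \<phi> s (p n) \<in> N0)"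
  unfolding eventually_sequentially by blast
 then obtain e where e: "!!n. n0 <= n ==> t1 <= e n" "!!n. n0 <= n ==> e n <= t n" "!!n. n0 <= n ==> \<phi> (e n) (p n) \<in> N"
   "!!n. n0 <= n ==> \<phi> (e n) (p n) \<notin> N0" "!!n s. n0 <= n ==> s \<in> {t1..<e n} ==> \<phi> s (p n) \<in> N0" by metis
 define q where "q n = \<phi> (e n) (p n)" for n
 \<comment> \<open>The exit times tend to infinity, since over every bounded time the orbits follow
   that of \<open>q0\<close> inside \<open>N0\<close>.\<close>
 have late: "\<forall>\<^sub>F n in sequentially. n0 <= n & t1 + \<tau> <= e n" for \<tau>
  using stay[of \<tau>] eventually_ge_at_top[of n0]
 proof eventually_elim
  case (elim n)
  then show ?case using e(1,4)[of n] by (metis atLeastAtMost_iff linear)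
 qed
 have "compact (N \<inter> - N0)" using N(1,2) by (intro compact_Int_closed) auto
 moreover have "\<forall>\<^sub>F x in filtermap q sequentially. x \<in> N \<inter> - N0"
  unfolding eventually_filtermap using late[of 0] by eventually_elim (use e q_def in auto)
 \<comment> \<open>The manifold is only given as a Hausdorff space, so \<open>qq\<close> is an
   accumulation point in the sense of filters; \<open>meet\<close> extracts suitable indices from
   it.\<close>
 ultimately obtain qq where qq: "qq \<in> N \<inter> - N0" "inf (nhds qq) (filtermap q sequentially) ~= bot"
  unfolding compact_filter by (metis filtermap_bot_iff sequentially_bot)
 have meet: "\<exists>n. P (q n) & Q n" if P: "\<forall>\<^sub>F x in nhds qq. P x" and Q: "\<forall>\<^sub>F n in sequentially. Q n" for P Q
 proof -
  have "\<forall>\<^sub>F x in filtermap q sequentially. \<exists>n. x = q n & Q n" unfolding eventually_filtermap using Q by eventually_elim blast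
  then have "\<forall>\<^sub>F x in inf (nhds qq) (filtermap q sequentially). P x & (\<exists>n. x = q n & Q n)"
   using P unfolding eventually_inf by blast
  from eventually_happens'[OF qq(2) this] show ?thesis by blast
 qed
 \<comment> \<open>At time \<open>\<tau>\<close> before the exit the approximating orbits are in
   \<open>N\<close>, by \<open>late\<close>, and \<open>N\<close> is closed.\<close>
 have "\<phi> (- \<tau>) qq \<in> N" if \<tau>: "0 <= \<tau>" for \<tau>
 proof (rule ccontr)
  assume "\<phi> (- \<tau>) qq \<notin> N"
  moreover have "(\<phi> (- \<tau>) \<longlongrightarrow> \<phi> (- \<tau>) qq) (nhds qq)" using isCont_flow by (simp add: isCont_def tendsto_nhds_iff)
  ultimately have "\<forall>\<^sub>F x in nhds qq. \<phi> (- \<tau>) x \<in> - N" using Ncl by (intro topological_tendstoD) auto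
  from meet[OF this late[of \<tau>]] obtain n where n: "\<phi> (- \<tau>) (q n) \<notin> N" "n0 <= n" "t1 + \<tau> <= e n" by blast
  have eq: "\<phi> (- \<tau>) (q n) = \<phi> (e n - \<tau>) (p n)" using flow_add[of "- \<tau>" "e n" "p n"] by (simp add: q_def)
  have "\<phi> (e n - \<tau>) (p n) \<in> N"
  proof (cases "\<tau> = 0")
   case False
   then show ?thesis using e(5)[OF n(2), of "e n - \<tau>"] n(3) \<tau> N(4) by auto
  qed (use e(3)[OF n(2)] in simp)
  then show False using n(1) eq by simp
 qed
 note bw = this
 have "qq \<in> coordE d ` (cube \<inter> {w. 0 <= w $ 3})"
 proof (rule ccontr)
  assume "qq \<notin> coordE d ` (cube \<inter> {w. 0 <= w $ 3})"
  moreover have "closed (coordE d ` (cube \<inter> {w. 0 <= w $ 3}))"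
   by (rule coordE_image_closed(1)) (intro closed_Collect_le continuous_intros)
  ultimately have "\<forall>\<^sub>F x in nhds qq. x \<in> - (coordE d ` (cube \<inter> {w. 0 <= w $ 3}))" by (intro eventually_nhds_in_open) auto
  from meet[OF this late[of 0]] obtain n where n: "q n \<notin> coordE d ` (cube \<inter> {w. 0 <= w $ 3})" "n0 <= n" by blast
  have "1/real (Suc n) <= 1" by simp
  then have "abs (y n) <= 1" "z n <= 1" using yz(1,3)[of n] by linarith+
  then have "q n \<in> coordE d ` (cube \<inter> {w. 0 <= w $ 3})" unfolding q_def p_def
   by (rule passage_upper[OF _ yz(2) _ w' t(1) _ _]) (use t(2,3)[of n] t(3) e(1,2)[OF n(2)] t1(1) in \<open>auto simp: p_def\<close>)
  then show False using n(1) by blast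
 qed
 then obtain w where w: "qq = coordE d w" "w \<in> cube" "0 <= w $ 3" by blast
 have "qq ~= equil d" using qq(1) N(3) by auto
 then have orb: "qq \<in> orbit \<phi> (pt_EP d)" using N(6)[OF w(2,3)] bw w(1) by simp
 then obtain a1 where a1: "qq = \<phi> a1 (pt_EP d)" by (auto simp: orbit_def)
 obtain a2 where a2: "coordE d (vec3 0 0 1) = \<phi> a2 (pt_EP d)" using axis_orbit[of 1] by (auto simp: orbit_def)
 define a where "a = a2 - a1"
 have a: "\<phi> a qq = coordE d (vec3 0 0 1)" unfolding a1 a2 a_def by (simp add: flow_add[symmetric])
 have axt: "coordE d (vec3 0 0 1) \<in> ?top" by (auto simp: cube_def forall_3 intro!: imageI)
 have a0: "0 <= a"
 proof (rule ccontr)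
  assume "\<not> 0 <= a"
  then have "\<phi> (- (- a)) qq \<in> N" by (intro bw) simp
  then show False using a axt N(5) by auto
 qed
 \<comment> \<open>Points that stay in the cube for all positive times have
   \<open>w $ 3 = 0\<close>, so a point of the top must leave.\<close>
 have "\<exists>t2\<ge>0. \<phi> t2 (coordE d (vec3 0 0 1)) \<notin> coordE d ` cube"
  using cube_stable[of "coordE d (vec3 0 0 1)"] flat_not_top[of "coordE d (vec3 0 0 1)"] axt by blast
 then obtain t2 where t2: "0 <= t2" "\<phi> t2 (coordE d (vec3 0 0 1)) \<notin> coordE d ` cube" by blast
 define T where "T = t2 + a"
 have T: "0 <= T" "\<phi> T qq \<notin> coordE d ` cube" using t2 a0 by (simp_all add: T_def flow_add a)
 have 1: "\<forall>\<^sub>F x in nhds qq. \<forall>s\<in>{0..T}. \<phi> s x \<in> U"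
  by (rule flow_tube[OF U(1)]) (use orbit_flow[OF orb] U(2) in \<open>auto simp: Gamma_def\<close>)
 have "closed (coordE d ` (cube \<inter> UNIV))" by (rule coordE_image_closed(1)) simp
 moreover have "(\<phi> T \<longlongrightarrow> \<phi> T qq) (nhds qq)" using isCont_flow by (simp add: isCont_def tendsto_nhds_iff)
 ultimately have 2: "\<forall>\<^sub>F x in nhds qq. \<phi> T x \<in> - coordE d ` cube" using T(2) by (intro topological_tendstoD) auto
 from meet[OF eventually_conj[OF 1 2] eventually_conj[OF follow late[of 0]]]
 obtain n where n: "!!s. s \<in> {0..T} ==> \<phi> s (q n) \<in> U" "\<phi> T (q n) \<notin> coordE d ` cube" "!!s. s \<in> {0..t1} ==> \<phi> s (p n) \<in> U" "n0 <= n"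
  by blast
 have qn: "\<phi> r (q n) = \<phi> (r + e n) (p n)" for r by (simp add: q_def flow_add)
 consider "s n <= t1" | "t1 < s n" "s n < e n" | "e n <= s n" by linarith
 then show False
 proof cases
  case 1 then show False using n(3)[of "s n"] s[of n] by simp
 next
  case 2 then show False using e(5)[OF n(4), of "s n"] s(2)[of n] N(4,5) by auto
 next
  case 3
  show False
  proof (cases "s n - e n <= T")
   case True
   then show False using n(1)[of "s n - e n"] qn[of "s n - e n"] 3 s(2)[of n] by simp
  next
   case False
   then have "T + e n \<in> {0..t n}" using s(1)[of n] T(1) e(1)[OF n(4)] t1(1) by auto
   then show False using t(3)[of "T + e n" n] n(2) qn[of T] by simp
  qed
 qed
qed

end

section \<open>Accumulation on the cycle\<close>

lemma (in vector_field) orbit_connect: "q \<in> orbit \<phi> p ==> x \<in> orbit \<phi> p ==> \<exists>t. \<phi> t q = x"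
proof -
 assume "q \<in> orbit \<phi> p" "x \<in> orbit \<phi> p"
 then obtain a b where "q = \<phi> a p" "x = \<phi> b p" by (auto simp: orbit_def)
 then have "\<phi> (b - a) q = x" by (simp add: flow_add[symmetric])
 then show ?thesis by blast
qed

context tangency
begin

lemma deltas: "0 < delta1 d" "delta1 d < delta2 d" "0 < deltaP d"
 using rates by (auto simp: delta1_def delta2_def deltaP_def divide_strict_right_mono)

lemma PiE_unique: "\<exists>\<epsilon>>0. \<forall>y z. abs y < \<epsilon> & 0 < z & z < \<epsilon> --> (\<exists>!w'. passesE A f d (y, z) w')"
proof -
 have "PiE_asymptotics A f d" using tc by (simp add: tangency_cycle_def adapted_E_def)
 then show ?thesis unfolding PiE_asymptotics_def by metis
qed

lemma PiE_transit:
 "\<exists>r re \<sigma> C \<epsilon>. transit (PsiEP d) (PiE A f d) r re (delta1 d) (delta2 d) \<sigma> C \<epsilon> (a11 d) (a21 d) (a12 d) (a22 d)"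
proof -
 have "PiE_asymptotics A f d" using tc by (simp add: tangency_cycle_def adapted_E_def)
 then obtain \<sigma> C \<epsilon> r where *: "0 < \<sigma>" "0 < \<epsilon>" "\<forall>y z. abs y < \<epsilon> & 0 < z & z < \<epsilon> -->
     (\<exists>!w'. passesE A f d (y, z) w') &
     PiE A f d (y, z) = (z powr delta1 d, y*z powr delta2 d) + r (y, z) &
     r differentiable (at (y, z)) &
     norm (r (y, z)) <= C*z powr (delta1 d + \<sigma>) &
     norm (frechet_derivative r (at (y, z)) (0, 1)) <= C*z powr (delta1 d - 1 + \<sigma>) &
     norm (frechet_derivative r (at (y, z)) (1, 0)) <= C*z powr (delta2 d + \<sigma>)"
  unfolding PiE_asymptotics_def by (elim exE conjE) rule
 obtain re where EP: "0 < re" "Ck 2 (ball 0 re) (PsiEP d)" "PsiEP d 0 = 0" by (rule EP_data) blast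
 have "transitions A f d" using tc by (simp add: tangency_cycle_def)
 then have tr: "(PsiEP d has_derivative (%(x, y). (a11 d*x + a12 d*y, a21 d*x + a22 d*y))) (at 0)"
   "a11 d*a22 d - a12 d*a21 d ~= 0"
  unfolding transitions_def by blast+
 \<comment> \<open>\<open>PiE_asymptotics\<close> leaves the sign of \<open>C\<close> open, whereas
   \<open>transit\<close> wants it nonnegative.\<close>
 have C: "x <= abs C*z powr a" if "x <= C*z powr a" for x z a
  using that mult_right_mono[OF abs_ge_self[of C] powr_ge_zero[of z a]] by linarith
 have "transit (PsiEP d) (PiE A f d) r re (delta1 d) (delta2 d) \<sigma> (abs C) \<epsilon> (a11 d) (a21 d) (a12 d) (a22 d)"
  by unfold_locales (fact EP tr deltas *(1,2) abs_ge_zero | (use *(3) in \<open>auto intro!: C\<close>))+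
 then show ?thesis by blast
qed

lemma PiE_tendsto:
 assumes e: "0 < e"
 shows "\<exists>\<delta>>0. \<forall>y z. abs y < \<delta> & 0 < z & z < \<delta> --> norm (PiE A f d (y, z)) < e"
proof -
 obtain r re \<sigma> C \<epsilon> where "transit (PsiEP d) (PiE A f d) r re (delta1 d) (delta2 d) \<sigma> C \<epsilon> (a11 d) (a21 d) (a12 d) (a22 d)"
  using PiE_transit by blast
 then interpret transit "PsiEP d" "PiE A f d" r re "delta1 d" "delta2 d" \<sigma> C \<epsilon> "a11 d" "a21 d" "a12 d" "a22 d" .
 have p: "((%z. z powr a) \<longlongrightarrow> 0) (at_right (0::real))" if "0 < a" for a
  by (rule tendsto_zero_powrI[OF tendsto_ident_at tendsto_const _ that])
   (use eventually_at_right_less[of "0::real"] in \<open>auto elim: eventually_mono\<close>)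
 have "((%z. z powr delta1 d + z powr delta2 d + C*z powr (delta1 d + \<sigma>)) \<longlongrightarrow> 0 + 0 + C*0) (at_right (0::real))"
  by (intro tendsto_intros p) (use deltas sg in auto)
 then have "\<forall>\<^sub>F z in at_right (0::real). z powr delta1 d + z powr delta2 d + C*z powr (delta1 d + \<sigma>) < e"
  by (rule order_tendstoD) (use e in simp)
 then obtain b where b: "0 < b" "!!z. 0 < z ==> z < b ==> z powr delta1 d + z powr delta2 d + C*z powr (delta1 d + \<sigma>) < e"
  unfolding eventually_at_right_field by auto
 have "norm (PiE A f d (y, z)) < e" if "abs y < min 1 (min \<epsilon> b)" "0 < z" "z < min 1 (min \<epsilon> b)" for y z
 proof -
  have yz: "abs y < \<epsilon>" "z < \<epsilon>" "abs y <= 1" "z < b" using that by auto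
  have "norm (PiE A f d (y, z)) <= norm (z powr delta1 d, y*z powr delta2 d) + norm (r (y, z))"
   unfolding F[OF yz(1) that(2) yz(2)] by (rule norm_triangle_ineq)
  moreover have "norm (z powr delta1 d, y*z powr delta2 d) <= z powr delta1 d + abs y*z powr delta2 d"
   using norm_Pair_le[of "z powr delta1 d" "y*z powr delta2 d"] by (simp add: abs_mult)
  moreover have "abs y*z powr delta2 d <= 1*z powr delta2 d" using yz(3) by (intro mult_right_mono) auto
  ultimately show ?thesis using b(2)[OF that(2) yz(4)] r_le[OF yz(1) that(2) yz(2)] by linarith
 qed
 then show ?thesis using b(1) eps by (intro exI[of _ "min 1 (min \<epsilon> b)"]) auto
qed

text \<open>As \<open>2 < pi\<close>, the quotient by \<open>2*pi\<close> lies within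
  \<open>1/2\<close> of \<open>n\<close>, and rounding returns \<open>n\<close>.\<close>

lemma PiP_eq:
 assumes "abs (\<psi> - ln z/etae d - 2*pi*real n) < 2"
 shows "PiP d (\<psi>, z) = (\<psi> - ln z/etae d - 2*pi*real n, z powr (etac d/etae d))"
proof -
 let ?\<theta> = "\<psi> - ln z/etae d"
 have "round (?\<theta>/(2*pi)) = int n"
 proof (rule round_unique')
  have "?\<theta>/(2*pi) - of_int (int n) = (?\<theta> - 2*pi*real n)/(2*pi)" by (simp add: field_simps)
  then have "abs (?\<theta>/(2*pi) - of_int (int n)) = abs (?\<theta> - 2*pi*real n)/(2*pi)" by (simp add: abs_divide)
  also have "... < 1/2" using assms pi_gt3 by (simp add: divide_less_eq)
  finally show "abs (?\<theta>/(2*pi) - of_int (int n)) < 1/2" .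
 qed
 then show ?thesis by (simp add: Let_def deltaP_def)
qed

lemma strip_horseshoes:
 assumes cs: "case3 d \<or> case4 d \<or> case5 d" and e: "0 < e"
 shows "\<forall>\<^sub>F n in sequentially. \<exists>K. strip_horseshoe (Rmap A f d) (PiP d) (PsiPE d) (etae d) e n K"
proof -
 obtain r re \<sigma> C \<epsilon> where "transit (PsiEP d) (PiE A f d) r re (delta1 d) (delta2 d) \<sigma> C \<epsilon> (a11 d) (a21 d) (a12 d) (a22 d)"
  using PiE_transit by blast
 then interpret transit "PsiEP d" "PiE A f d" r re "delta1 d" "delta2 d" \<sigma> C \<epsilon> "a11 d" "a21 d" "a12 d" "a22 d" .
 obtain rp where PE: "0 < rp" "Ck 2 (ball 0 rp) (PsiPE d)" "PsiPE d 0 = 0" by (rule PE_data) blast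
 have "transitions A f d" using tc by (simp add: tangency_cycle_def)
 then have tr: "(PsiPE d has_derivative (%(\<psi>, \<rho>). (b11 d*\<psi> + b12 d*\<rho>, b22 d*\<rho>))) (at 0)"
   "dird [(1, 0), (1, 0)] (%w. snd (PsiPE d w)) 0 = 2*kq d" "kq d ~= 0" "b22 d ~= 0"
  unfolding transitions_def by blast+
 have R: "(%q. E (PsiPE d (PiP d q))) = Rmap A f d" by (simp add: fun_eq_iff E_def Rmap_def)
 have "0 < a21 d" using cs by (auto simp: case3_def case4_def case5_def)
 moreover have "(0 < kq d & b22 d < 0) \<or> (kq d < 0 & 0 < b22 d & delta1 d*(etac d/etae d) < 1) \<or>
   (0 < kq d & 0 < b22 d & 1 < delta1 d*(etac d/etae d))"
  using cs by (auto simp: case3_def case4_def case5_def delta_def deltaP_def)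
 ultimately show ?thesis
  using horseshoes_exist[where g = "PsiPE d" and P = "PiP d", OF _ PE(2,1,3) tr b11_nonzero rates(1,2) PiP_eq _ e]
  unfolding R by blast
qed

text \<open>The connections are dense in the cycle: \<open>E\<close> is the backward limit of the
  one leaving it, and a point of the periodic orbit is the limit of the points at the same angle on
  the leg that winds towards \<open>P\<close>. So lower approximation of the cycle reduces to the
  two sections at \<open>P\<close>.\<close>

lemma Gamma_approx:
 assumes U: "open U" "Gamma A f d \<inter> U ~= {}"
 shows "(\<exists>t. \<phi> t (secPin d (0, 0)) \<in> U) \<or> (\<exists>t. \<phi> t (secPout d (0, 0)) \<in> U)"
proof -
 have EP: "\<exists>t. \<phi> t (secPin d (0, 0)) \<in> U" if "x \<in> orbit \<phi> (pt_EP d)" "x \<in> U" for x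
  using orbit_connect[OF secPin_orbit that(1)] that(2) by auto
 obtain x where x: "x \<in> Gamma A f d" "x \<in> U" using U(2) by blast
 then consider "x = equil d" | "x \<in> perP A f d" | "x \<in> orbit \<phi> (pt_EP d)" | "x \<in> orbit \<phi> (pt_PE d)"
  unfolding Gamma_def by blast
 then show ?thesis
 proof cases
  case 1
  have "pt_EP d \<in> unstable_set \<phi> {equil d}" using tc by (auto simp: tangency_cycle_def H4_def)
  then have "\<forall>\<^sub>F t in at_bot. \<phi> t (pt_EP d) \<in> U" unfolding unstable_set_def using U(1) x(2) 1 by auto
  then obtain t where "\<phi> t (pt_EP d) \<in> U" using eventually_happens'[OF trivial_limit_at_bot_linorder] by blast
  then show ?thesis using EP[of "\<phi> t (pt_EP d)"] by (auto simp: orbit_def)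
 next
  case 2
  then obtain \<psi> where \<psi>: "x = coordP d (vec3 \<psi> 0 0)" unfolding perP_eq by blast
  have top: "filterlim (%j. \<psi> + 2*pi*real j) at_top sequentially"
   by (intro filterlim_tendsto_add_at_top[OF tendsto_const] filterlim_tendsto_pos_mult_at_top[OF tendsto_const] filterlim_real_sequentially) simp
  have "((%t. exp (- (etac d*t))) \<longlongrightarrow> 0) at_top"
   by (rule filterlim_compose[OF exp_at_bot]) (use rates in \<open>auto simp: filterlim_uminus_at_bot intro!: filterlim_tendsto_pos_mult_at_top[OF tendsto_const] filterlim_ident\<close>)
  from filterlim_compose[OF this top]
  have "((%j. vec3 \<psi> (exp (- (etac d*(\<psi> + 2*pi*real j)))) 0) \<longlongrightarrow> vec3 \<psi> 0 0) sequentially"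
   by (intro tendsto_vec3 tendsto_const)
  from isCont_tendsto_compose[OF isCont_coordP[OF vec3_tube] this]
  have "((%j. coordP d (vec3 \<psi> (exp (- (etac d*(\<psi> + 2*pi*real j)))) 0)) \<longlongrightarrow> x) sequentially" by (simp add: \<psi>)
  then have "\<forall>\<^sub>F j in sequentially. coordP d (vec3 \<psi> (exp (- (etac d*(\<psi> + 2*pi*real j)))) 0) \<in> U"
   by (rule topological_tendstoD[OF _ U(1) x(2)])
  moreover have "\<forall>\<^sub>F j in sequentially. 0 <= \<psi> + 2*pi*real j" using top unfolding filterlim_at_top by blast
  ultimately have "\<forall>\<^sub>F j in sequentially. coordP d (vec3 \<psi> (exp (- (etac d*(\<psi> + 2*pi*real j)))) 0) \<in> U & 0 <= \<psi> + 2*pi*real j"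
   by eventually_elim blast
  then obtain j where j: "coordP d (vec3 \<psi> (exp (- (etac d*(\<psi> + 2*pi*real j)))) 0) \<in> U" "0 <= \<psi> + 2*pi*real j"
   using eventually_happens'[OF sequentially_bot] by blast
  have "coordP d (vec3 (\<psi> + 2*pi * of_int (int j)) (exp (- (etac d*(\<psi> + 2*pi*real j)))) 0)
    = coordP d (vec3 \<psi> (exp (- (etac d*(\<psi> + 2*pi*real j)))) 0)"
   by (rule coordP_shift) (use j(2) rates in auto)
  then show ?thesis using EP[OF EP_leg[OF j(2)]] j(1) by simp
 next
  case 3 then show ?thesis using EP x(2) by blast
 next
  case 4 then show ?thesis using orbit_connect[OF secPout_orbit 4] x(2) by auto
 qed
qed

lemma isCont_sections: "isCont (secPin d) 0" "isCont (secPout d) 0" "isCont (secEout d) 0"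
proof -
 have v: "isCont (%w :: real \<times> real. vec3 (fst w) 1 (snd w)) 0" "isCont (%w :: real \<times> real. vec3 (fst w) (snd w) 1) 0"
  unfolding vec3_eq by (intro continuous_intros)+
 have e: "secPin d = (%w. coordP d (vec3 (fst w) 1 (snd w)))" "secPout d = (%w. coordP d (vec3 (fst w) (snd w) 1))"
  "secEout d = (%w. coordE d (vec3 (fst w) (snd w) 1))"
  by (simp_all add: fun_eq_iff)
 show "isCont (secPin d) 0" unfolding e by (rule isCont_o2[OF v(1) isCont_coordP[OF vec3_tube]]) simp_all
 show "isCont (secPout d) 0" unfolding e by (rule isCont_o2[OF v(2) isCont_coordP[OF vec3_tube]]) simp_all
 show "isCont (secEout d) 0" unfolding e by (rule isCont_o2[OF v(2) isCont_coordE[OF vec3_cube]]) simp_all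
qed

text \<open>The itinerary clause of \<open>strip_horseshoe\<close> freed from the strip number, with
  a bound on the height instead.\<close>

definition near_cycle :: "real => real => real => bool" where
 "near_cycle e \<psi> z \<longleftrightarrow> (\<exists>s \<rho> y \<zeta>. abs \<psi> < e & 0 < z & z < e & PiP d (\<psi>, z) = (s, \<rho>) & abs s < e & abs \<rho> < e &
   PsiPE d (s, \<rho>) = (y, \<zeta>) & abs y < e & 0 < \<zeta> & \<zeta> < e)"

text \<open>One return consists of four segments: past \<open>P\<close>, transition, past
  \<open>E\<close>, transition. The transitions have durations bounded below, which provides
  \<open>c > 0\<close>.\<close>

lemma return_seg:
 assumes U: "open U" "Gamma A f d \<subseteq> U"
 shows "\<exists>e>0. \<exists>c>0. \<forall>\<psi> z. near_cycle e \<psi> z --> seg U (secPin d (\<psi>, z)) (secPin d (Rmap A f d (\<psi>, z))) c"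
proof -
 obtain e1 where e1: "0 < e1" "!!\<psi> z s \<rho>. abs \<psi> < e1 & 0 < z & z < e1 & PiP d (\<psi>, z) = (s, \<rho>) & abs s < e1 & abs \<rho> < e1 ==>
  seg U (secPin d (\<psi>, z)) (secPout d (s, \<rho>)) 0" using P_passage[OF U] by blast
 obtain rp Tp where PE: "0 < rp" "continuous_on (ball 0 rp) Tp" "0 < Tp 0"
  "!!w. w \<in> ball 0 rp ==> \<phi> (Tp w) (secPout d w) = secEin d (PsiPE d w)" by (rule PE_data) blast
 have o1: "orbit \<phi> (secPout d 0) \<subseteq> U"
 proof
  fix x assume "x \<in> orbit \<phi> (secPout d 0)"
  then obtain t where "x = \<phi> t (secPout d (0, 0))" by (auto simp: orbit_def zero_prod_def)
  then show "x \<in> U" using orbit_flow[OF secPout_orbit, of t] U(2) by (auto simp: Gamma_def)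
 qed
 obtain e2 where e2: "0 < e2" "!!w. norm w < e2 ==> seg U (secPout d w) (secEin d (PsiPE d w)) (Tp 0/2)"
  using transition_seg[where s = "secPout d" and s' = "secEin d" and \<Psi> = "PsiPE d", OF PE isCont_sections(2) U(1) o1] by blast
 obtain e3 where e3: "0 < e3" "!!y z w'. abs y < e3 & 0 < z & z < e3 & passesE A f d (y, z) w' ==> seg U (secEin d (y, z)) (secEout d w') 0"
  using E_passage[OF U] by blast
 obtain re Te where EP: "0 < re" "continuous_on (ball 0 re) Te" "0 < Te 0"
  "!!w. w \<in> ball 0 re ==> \<phi> (Te w) (secEout d w) = secPin d (PsiEP d w)" by (rule EP_data) blast
 have o2: "orbit \<phi> (secEout d 0) \<subseteq> U"
 proof
  fix x assume "x \<in> orbit \<phi> (secEout d 0)"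
  then obtain t where "x = \<phi> t (coordE d (vec3 0 0 1))" by (auto simp: orbit_def zero_prod_def)
  then show "x \<in> U" using orbit_flow[OF axis_orbit[of 1], of t] U(2) by (auto simp: Gamma_def)
 qed
 obtain e4 where e4: "0 < e4" "!!w. norm w < e4 ==> seg U (secEout d w) (secPin d (PsiEP d w)) (Te 0/2)"
  using transition_seg[where s = "secEout d" and s' = "secPin d" and \<Psi> = "PsiEP d", OF EP isCont_sections(3) U(1) o2] by blast
 obtain e5 where e5: "0 < e5" "!!y z. abs y < e5 & 0 < z & z < e5 ==> norm (PiE A f d (y, z)) < e4"
  using PiE_tendsto[OF e4(1)] by blast
 obtain \<epsilon> where \<epsilon>: "0 < \<epsilon>" "!!y z. abs y < \<epsilon> & 0 < z & z < \<epsilon> ==> \<exists>!w'. passesE A f d (y, z) w'" using PiE_unique by blast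
 define e where "e = min e1 (min (e2/2) (min e3 (min e5 \<epsilon>)))"
 have "e <= e2/2" by (simp add: e_def min_le_iff_disj)
 then have e: "0 < e" "e <= e1" "2*e <= e2" "e <= e3" "e <= e5" "e <= \<epsilon>"
  using e1(1) e2(1) e3(1) e5(1) \<epsilon>(1) unfolding e_def by linarith+
 have "seg U (secPin d (\<psi>, z)) (secPin d (Rmap A f d (\<psi>, z))) (Tp 0/2 + Te 0/2)"
  if \<psi>: "abs \<psi> < e" "0 < z" "z < e" and s: "PiP d (\<psi>, z) = (s, \<rho>)" "abs s < e" "abs \<rho> < e"
   and y: "PsiPE d (s, \<rho>) = (y, \<zeta>)" "abs y < e" "0 < \<zeta>" "\<zeta> < e" for \<psi> z s \<rho> y \<zeta>
 proof -
  have 1: "seg U (secPin d (\<psi>, z)) (secPout d (s, \<rho>)) 0" using \<psi> s e(2) by (intro e1(2)) auto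
  have "norm (s, \<rho>) <= abs s + abs \<rho>" using norm_Pair_le[of s \<rho>] by simp
  also have "... < e2" using s e(3) by linarith
  finally have 2: "seg U (secPout d (s, \<rho>)) (secEin d (y, \<zeta>)) (Tp 0/2)" using e2(2)[of "(s, \<rho>)"] y(1) by simp
  have "passesE A f d (y, \<zeta>) (PiE A f d (y, \<zeta>))"
   unfolding PiE_def by (rule theI') (rule \<epsilon>(2), use y e(6) in auto)
  then have 3: "seg U (secEin d (y, \<zeta>)) (secEout d (PiE A f d (y, \<zeta>))) 0" using y e(4) by (intro e3(2)) auto
  have "norm (PiE A f d (y, \<zeta>)) < e4" using y e(5) by (intro e5(2)) auto
  then have 4: "seg U (secEout d (PiE A f d (y, \<zeta>))) (secPin d (PsiEP d (PiE A f d (y, \<zeta>)))) (Te 0/2)" by (rule e4(2))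
  have "seg U (secPin d (\<psi>, z)) (secPin d (PsiEP d (PiE A f d (y, \<zeta>)))) (0 + Tp 0/2 + 0 + Te 0/2)"
   by (rule seg_trans[OF seg_trans[OF seg_trans[OF 1 2] 3] 4]) (use PE(3) EP(3) in auto)
  then show ?thesis using s(1) y(1) by (simp add: Rmap_def)
 qed
 then have "\<forall>\<psi> z. near_cycle e \<psi> z --> seg U (secPin d (\<psi>, z)) (secPin d (Rmap A f d (\<psi>, z))) (Tp 0/2 + Te 0/2)"
  unfolding near_cycle_def by blast
 moreover have "0 < Tp 0/2 + Te 0/2" using PE(3) EP(3) by simp
 ultimately show ?thesis using e(1) by blast
qed

lemma horseshoe_sequence:
 assumes cs: "case3 d \<or> case4 d \<or> case5 d"
 shows "horseshoe_sequence A f d"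
 unfolding horseshoe_sequence_def
\<comment> \<open>Any positive bound for \<open>\<tau>\<close> works, since horseshoes smaller than
  a given \<open>\<tau>\<close> are found in late strips.\<close>
proof (intro exI[of _ "1::real"] conjI allI impI)
 fix \<tau> :: real and n0 :: nat
 assume \<tau>: "0 < \<tau> & \<tau> < 1" and n0: "\<forall>n\<ge>n0. Hstrip d \<tau> n \<subseteq> RP \<tau>"
 obtain \<epsilon> where \<epsilon>: "0 < \<epsilon>" "!!y z. abs y < \<epsilon> & 0 < z & z < \<epsilon> ==> \<exists>!w'. passesE A f d (y, z) w'" using PiE_unique by blast
 \<comment> \<open>Below \<open>\<tau>\<close> for membership in the strips, below
   \<open>\<epsilon>\<close> for a unique passage of \<open>E\<close>, and tending to 0 for the
   accumulation.\<close>
 define e where "e m = min (min \<tau> \<epsilon>) (1/real (Suc m))" for m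
 have e: "0 < e m" "e m <= \<tau>" "e m <= \<epsilon>" "e m <= 1/real (Suc m)" for m using \<tau> \<epsilon>(1) by (auto simp: e_def)
 define good where "good m = strip_horseshoe (Rmap A f d) (PiP d) (PsiPE d) (etae d) (e m)" for m
 have "\<exists>n K. n0 <= n & good m n K" for m
 proof -
  have "\<forall>\<^sub>F n in sequentially. n0 <= n & (\<exists>K. good m n K)"
   unfolding good_def by (rule eventually_conj[OF eventually_ge_at_top strip_horseshoes[OF cs e(1)]])
  then show ?thesis using eventually_happens'[OF sequentially_bot] by blast
 qed
 then obtain n K where n: "!!m. n0 <= n m" and K: "!!m. good m (n m) (K m)" by metis
 have Kp: "\<exists>s \<rho> y \<zeta>. abs \<psi> < e m & z = exp (etae d*(\<psi> - s - 2*pi*real (n m))) & abs s < e m &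
    PiP d (\<psi>, z) = (s, \<rho>) & 0 < \<rho> & \<rho> < e m & PsiPE d (s, \<rho>) = (y, \<zeta>) & abs y < e m & 0 < \<zeta> & \<zeta> < e m"
  if "(\<psi>, z) \<in> K m" for m \<psi> z using K[of m] that unfolding good_def strip_horseshoe_def by blast
 have RK: "Rmap A f d ` K m = K m" for m using K[of m] by (simp add: good_def strip_horseshoe_def)
 have KH: "K m \<subseteq> Hstrip d \<tau> (n m)" for m
 proof
  fix p assume "p \<in> K m"
  moreover obtain \<psi> z where p: "p = (\<psi>, z)" by (cases p)
  ultimately obtain s where s: "abs \<psi> < e m" "z = exp (etae d*(\<psi> - s - 2*pi*real (n m)))" "abs s < e m" using Kp by blast
  have "etae d*(- \<tau> - 2*real (n m)*pi + \<psi>) <= etae d*(\<psi> - s - 2*pi*real (n m))"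
   "etae d*(\<psi> - s - 2*pi*real (n m)) <= etae d*(\<tau> - 2*real (n m)*pi + \<psi>)"
   using rates s(3) e(2)[of m] by (auto intro!: mult_left_mono)
  then show "p \<in> Hstrip d \<tau> (n m)" using s(1) e(2)[of m] by (auto simp: Hstrip_def p s(2))
 qed
 have Kdom: "K m \<subseteq> Rdom A f d \<tau> n0" for m
 proof
  fix p assume pK: "p \<in> K m"
  obtain \<psi> z where p: "p = (\<psi>, z)" by (cases p)
  obtain s \<rho> y \<zeta> where s: "abs s < e m" "PiP d p = (s, \<rho>)" "0 < \<rho>" "\<rho> < e m" "PsiPE d (s, \<rho>) = (y, \<zeta>)" "abs y < e m" "0 < \<zeta>" "\<zeta> < e m"
   using Kp pK p by blast
  have "p \<in> (\<Union>n\<in>{n0..}. Hstrip d \<tau> n)" using KH[of m] pK n[of m] by auto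
  moreover have "PiP d p \<in> RP \<tau>" using s e(2)[of m] by (auto simp: RP_def)
  moreover have "\<exists>!w'. passesE A f d (PsiPE d (PiP d p)) w'" using \<epsilon>(2)[of y \<zeta>] s e(3)[of m] by simp
  moreover have "Rmap A f d p \<in> RP \<tau>" using RK[of m] pK KH[of m] n0 n[of m] by blast
  ultimately show "p \<in> Rdom A f d \<tau> n0" using s by (simp add: Rdom_def)
 qed
 have e0: "\<forall>\<^sub>F m in sequentially. e m < b" if "0 < b" for b
 proof -
  have "\<forall>\<^sub>F m in sequentially. 1/real (Suc m) < b"
   using order_tendstoD(2)[OF LIMSEQ_inverse_real_of_nat that] by (simp add: inverse_eq_divide)
  then show ?thesis by eventually_elim (use e(4) in \<open>blast intro: le_less_trans\<close>)
 qed
 have Ksmall: "\<forall>\<^sub>F m in sequentially. \<forall>\<psi> z. (\<psi>, z) \<in> K m --> near_cycle b \<psi> z" if b: "0 < b" for b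
 proof -
  \<comment> \<open>The itinerary bounds \<open>\<rho>\<close>, which is
    \<open>z powr deltaP d\<close>; the second entry of the minimum turns this into a bound for
    \<open>z\<close>.\<close>
  have b': "0 < min b (b powr deltaP d)" using b by simp
  show ?thesis using e0[OF b']
  proof (eventually_elim, intro allI impI)
   fix m \<psi> z assume em: "e m < min b (b powr deltaP d)" and p: "(\<psi>, z) \<in> K m"
   obtain s \<rho> y \<zeta> where s: "abs \<psi> < e m" "z = exp (etae d*(\<psi> - s - 2*pi*real (n m)))" "abs s < e m"
    "PiP d (\<psi>, z) = (s, \<rho>)" "0 < \<rho>" "\<rho> < e m" "PsiPE d (s, \<rho>) = (y, \<zeta>)" "abs y < e m" "0 < \<zeta>" "\<zeta> < e m"
    using Kp[OF p] by blast
   have z0: "0 < z" by (simp add: s(2))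
   have "\<rho> = z powr deltaP d" using s(4) by (simp add: Let_def)
   then have "z powr deltaP d < b powr deltaP d" using s(6) em by simp
   then have "z < b" using powr_mono2[of "deltaP d" b z] deltas(3) b by (meson less_imp_le not_le)
   have "e m < b" using em by simp
   then have "abs \<psi> < b" "abs s < b" "abs \<rho> < b" "abs y < b" "\<zeta> < b" using s by simp_all
   then show "near_cycle b \<psi> z" unfolding near_cycle_def
    using s(4,7,9) z0 \<open>z < b\<close> by blast
  qed
 qed
 \<comment> \<open>The shift space over at least two symbols is nonempty, hence so is
   \<open>K m\<close>; open sets meeting the cycle could not be hit otherwise.\<close>
 have Kne: "K m ~= {}" for m
 proof
  assume "K m = {}"
  moreover have "conjugate_to_full_shift (Rmap A f d) (K m)" using K[of m] by (simp add: good_def strip_horseshoe_def)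
  ultimately obtain N h where "2 <= N" "homeomorphic_map (top_of_set {}) (full_shift_space N) (h :: real \<times> real => int => nat)"
   unfolding conjugate_to_full_shift_def by auto
  then have "topspace (full_shift_space N) = {}" "2 <= N" using homeomorphic_imp_surjective_map by fastforce+
  then show False by (auto simp: full_shift_space_def PiE_eq_empty_iff lessThan_empty_iff)
 qed
 have acc: "accumulates_on A f d K (Gamma A f d)"
  unfolding accumulates_on_def
 proof (intro conjI allI impI; elim conjE)
  fix U assume U: "open U" "Gamma A f d \<subseteq> U"
  obtain b c where b: "0 < b" "0 < c" "!!\<psi> z. near_cycle b \<psi> z ==> seg U (secPin d (\<psi>, z)) (secPin d (Rmap A f d (\<psi>, z))) c"
   using return_seg[OF U] by blast
  show "\<forall>\<^sub>F m in sequentially. saturation A f d (K m) \<subseteq> U" using Ksmall[OF b(1)]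
  proof eventually_elim
   case (elim m)
   have "seg U (secPin d p) (secPin d (Rmap A f d p)) c" if pK: "p \<in> K m" for p
   proof -
    obtain \<psi> z where p: "p = (\<psi>, z)" by (cases p)
    with pK have "near_cycle b \<psi> z" using elim by blast
    then show ?thesis unfolding p by (rule b(3))
   qed
   then have "\<phi> t (secPin d p) \<in> U" if "p \<in> K m" for t p by (rule seg_saturation[OF b(2) _ RK that])
   then show ?case by (auto simp: saturation_def orbit_def)
  qed
 next
  fix U assume U: "open U" "Gamma A f d \<inter> U ~= {}"
  from Gamma_approx[OF this] show "\<forall>\<^sub>F m in sequentially. saturation A f d (K m) \<inter> U ~= {}"
  proof (elim disjE exE)
   fix t assume t: "\<phi> t (secPin d (0, 0)) \<in> U"
   have "((%w. \<phi> t (secPin d w)) \<longlongrightarrow> \<phi> t (secPin d 0)) (nhds 0)"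
    by (rule isCont_tendsto_compose[OF isCont_flow]) (use isCont_sections(1) in \<open>simp add: isCont_def tendsto_nhds_iff\<close>)
   then have "\<forall>\<^sub>F w in nhds 0. \<phi> t (secPin d w) \<in> U" by (rule topological_tendstoD[OF _ U(1)]) (use t in \<open>simp add: zero_prod_def\<close>)
   then obtain b where b: "0 < b" "!!w. norm w < b ==> \<phi> t (secPin d w) \<in> U"
    unfolding eventually_nhds_metric by (auto simp: dist_norm)
   have b2: "0 < b/2" using b(1) by simp
   show ?thesis using Ksmall[OF b2]
   proof eventually_elim
    case (elim m)
    obtain \<psi> z where p: "(\<psi>, z) \<in> K m" using Kne[of m] by (metis ex_in_conv surj_pair)
    then have "abs \<psi> < b/2" "0 < z" "z < b/2" using elim unfolding near_cycle_def by blast+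
    then have "norm (\<psi>, z) < b" using norm_Pair_le[of \<psi> z] by simp
    then have "\<phi> t (secPin d (\<psi>, z)) \<in> U" by (rule b(2))
    moreover have "\<phi> t (secPin d (\<psi>, z)) \<in> saturation A f d (K m)" unfolding saturation_def orbit_def using p by blast
    ultimately show ?case by blast
   qed
  next
   fix t assume t: "\<phi> t (secPout d (0, 0)) \<in> U"
   have "((%w. \<phi> t (secPout d w)) \<longlongrightarrow> \<phi> t (secPout d 0)) (nhds 0)"
    by (rule isCont_tendsto_compose[OF isCont_flow]) (use isCont_sections(2) in \<open>simp add: isCont_def tendsto_nhds_iff\<close>)
   then have "\<forall>\<^sub>F w in nhds 0. \<phi> t (secPout d w) \<in> U" by (rule topological_tendstoD[OF _ U(1)]) (use t in \<open>simp add: zero_prod_def\<close>)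
   then obtain b where b: "0 < b" "!!w. norm w < b ==> \<phi> t (secPout d w) \<in> U"
    unfolding eventually_nhds_metric by (auto simp: dist_norm)
   obtain b' where b': "0 < b'" "!!\<psi> z s \<rho>. abs \<psi> < b' & 0 < z & z < b' & PiP d (\<psi>, z) = (s, \<rho>) & abs s < b' & abs \<rho> < b' ==>
     seg UNIV (secPin d (\<psi>, z)) (secPout d (s, \<rho>)) 0" using P_passage[OF open_UNIV subset_UNIV] by blast
   have b2: "0 < min (b/2) b'" using b(1) b'(1) by simp
   show ?thesis using Ksmall[OF b2]
   proof eventually_elim
    case (elim m)
    obtain \<psi> z where p: "(\<psi>, z) \<in> K m" using Kne[of m] by (metis ex_in_conv surj_pair)
    then obtain s \<rho> where s: "abs \<psi> < min (b/2) b'" "0 < z" "z < min (b/2) b'" "PiP d (\<psi>, z) = (s, \<rho>)"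
     "abs s < min (b/2) b'" "abs \<rho> < min (b/2) b'" using elim unfolding near_cycle_def by blast
    then have "norm (s, \<rho>) < b" using norm_Pair_le[of s \<rho>] by simp
    then have 1: "\<phi> t (secPout d (s, \<rho>)) \<in> U" by (rule b(2))
    have "seg UNIV (secPin d (\<psi>, z)) (secPout d (s, \<rho>)) 0" using s by (intro b'(2)) auto
    then obtain t' where "\<phi> t' (secPin d (\<psi>, z)) = secPout d (s, \<rho>)" by (auto simp: seg_def)
    then have "\<phi> (t + t') (secPin d (\<psi>, z)) \<in> U" using 1 by (simp add: flow_add)
    moreover have "\<phi> (t + t') (secPin d (\<psi>, z)) \<in> saturation A f d (K m)" unfolding saturation_def orbit_def using p by blast
    ultimately show ?case by blast
   qed
  qed
 qed
 show "\<exists>K. (\<forall>m. compact (K m) & K m \<subseteq> Rdom A f d \<tau> n0 & Rmap A f d ` K m = K m &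
       uniformly_hyperbolic (Rmap A f d) (K m) & conjugate_to_full_shift (Rmap A f d) (K m)) &
     accumulates_on A f d K (Gamma A f d)"
  using K Kdom acc unfolding good_def strip_horseshoe_def by (intro exI[of _ K]) blast
qed simp

end

theorem theorem6p5:
 fixes A :: "'m::t2_space chart set"
 assumes "compact_3manifold A"
 shows "\<exists>\<O>. \<O> \<subseteq> case_vfields A \<and>
      openin (subtopology (Cinf_topology A) (case_vfields A)) \<O> \<and>
      case_vfields A \<subseteq> (Cinf_topology A) closure_of \<O> \<and>
      (\<forall>f\<in>\<O>. \<forall>d. tangency_cycle A f d \<and> (case3 d \<or> case4 d \<or> case5 d) \<longrightarrow>
       horseshoe_sequence A f d)"
proof (intro exI[of _ "case_vfields A"] conjI ballI allI impI)
 have "A ~= {}"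
 proof
  assume "A = {}"
  then show False using assms UNIV_not_empty[where ?'a = 'm] by (simp add: compact_3manifold_def)
 qed
 then obtain c where c: "c \<in> A" by blast
 \<comment> \<open>Openness and density are relative to the class, so it remains to see that its
   members are points of the topological space.\<close>
 have sub: "case_vfields A \<subseteq> topspace (Cinf_topology A)"
 proof
  fix f assume "f \<in> case_vfields A"
  then have f: "f \<in> smooth_vfields A" by (simp add: case_vfields_def)
  \<comment> \<open>Over the empty compact set the conditions on derivatives are void, so any one
    chart yields a basic set containing \<open>f\<close>.\<close>
  then have "f \<in> Cinf_ball A f c {} 0 1" by (simp add: Cinf_ball_def)
  moreover have "Cinf_ball A f c {} 0 1 \<in> {Cinf_ball A f c K k \<epsilon> | f c K k \<epsilon>.
    f \<in> smooth_vfields A & c \<in> A & compact K & K \<subseteq> fst c & 0 < \<epsilon>}"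
   using f c by (intro CollectI exI[of _ f] exI[of _ c] exI[of _ "{}"] exI[of _ 0] exI[of _ 1]) auto
  ultimately show "f \<in> topspace (Cinf_topology A)"
   unfolding Cinf_topology_def topology_generated_by_topspace by blast
 qed
 then show "openin (subtopology (Cinf_topology A) (case_vfields A)) (case_vfields A)"
  by (simp only: openin_subtopology_refl)
 show "case_vfields A \<subseteq> (Cinf_topology A) closure_of (case_vfields A)" by (rule closure_of_subset[OF sub])
 fix f d assume f: "f \<in> case_vfields A" and d: "tangency_cycle A f d & (case3 d \<or> case4 d \<or> case5 d)"
 interpret tangency A f d
  by unfold_locales (use assms f d in \<open>auto simp: case_vfields_def\<close>)
 show "horseshoe_sequence A f d" by (rule horseshoe_sequence) (use d in blast)
qed simp

end
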